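(* **1.** Let $m$ be a positive integer. The module $J^{\mathbb Z}_{0,m}/J^{\mathbb Z}_{0,m}(q)$ is a free $\mathbb Z$-module of rank $m$. Moreover, it has a basis consisting of (the classes of) forms $\psi_{0,m}^{(1)},\dots,\psi_{0,m}^{(m)}\in J^{\mathbb Z}_{0,m}$ with the following $q^0$-terms (for those $n$ with $1\le n\le m$): $$[\psi_{0,m}^{(n)}]_{q^0}=y^n+\dots+y^{-n}\qquad(3\le n\le m),$$ $$[\psi_{0,m}^{(2)}]_{q^0}=y^2-4y+6-4y^{-1}+y^{-2},$$ $$[\psi_{0,m}^{(1)}]_{q^0}=\frac{1}{(12,m)}\bigl(my+(12-2m)+my^{-1}\bigr),$$ where $(12,m)$ is the greatest common divisor of $12$ and $m$, and $y^n+\dots+y^{-n}$ denotes a Laurent polynomial in $y$, symmetric under $y\mapsto y^{-1}$, whose highest-degree term is $y^n$ with coefficient $1$. **2.** The graded ring $J^{\mathbb Z}_{0,*}=\bigoplus_{m\ge 0}J^{\mathbb Z}_{0,m}$ of all weak Jacobi forms of weight $0$ and integral index with integral Fourier coefficients is finitely generated: $$J^{\mathbb Z}_{0,*}=\mathbb Z[\phi_{0,1},\phi_{0,2},\phi_{0,3},\phi_{0,4}].$$ The forms $\phi_{0,1},\phi_{0,2},\phi_{0,3}$ are algebraically independent, and $$4\phi_{0,4}=\phi_{0,1}\phi_{0,3}-\phi_{0,2}^2.$$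
   Context: Let $\mathbb H_1$ be the upper half-plane, $q=e^{2\pi i\tau}$, $y=e^{2\pi i z}$. A weak Jacobi form of weight $0$ and index $m\in\mathbb Z_{\ge 0}$ is a holomorphic function $\phi(\tau,z)$ on $\mathbb H_1\times\mathbb C$ satisfying $$\phi\Bigl(\frac{a\tau+b}{c\tau+d},\frac{z}{c\tau+d}\Bigr)=e^{2\pi i m c z^2/(c\tau+d)}\phi(\tau,z)\quad\text{for all }\begin{pmatrix}a&b\\c&d\end{pmatrix}\in SL_2(\mathbb Z),$$ $$\phi(\tau,z+\lambda\tau+\mu)=e^{-2\pi i m(\lambda^2\tau+2\lambda z)}\phi(\tau,z)\quad\text{for all }\lambda,\mu\in\mathbb Z,$$ and having a Fourier expansion $\phi(\tau,z)=\sum_{n\ge 0,\ l\in\mathbb Z}f(n,l)q^ny^l$. Its $q^0$-term is $[\phi]_{q^0}=\sum_l f(0,l)y^l$ (a Laurent polynomial). $J^{\mathbb Z}_{0,m}$ is the $\mathbb Z$-module of such forms with all $f(n,l)\in\mathbb Z$, and $J^{\mathbb Z}_{0,m}(q)\subset J^{\mathbb Z}_{0,m}$ is the submodule of forms with zero $q^0$-term. Let $$\vartheta(\tau,z)=\sum_{n\in\mathbb Z}\Bigl(\frac{-4}{n}\Bigr)q^{n^2/8}y^{n/2}=-q^{1/8}y^{-1/2}\prod_{n\ge1}(1-q^{n-1}y)(1-q^ny^{-1})(1-q^n)$$ (with the Kronecker symbol), and $\eta(\tau)=q^{1/24}\prod_{n\ge1}(1-q^n)$. The four forms in part 2 are: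 - $\phi_{0,1}$: the unique weak Jacobi form of weight $0$ and index $1$ with $q^0$-term $y+10+y^{-1}$ (the space of weak Jacobi forms of weight $0$ and index $1$ is one-dimensional over $\mathbb C$); - $\phi_{0,2}(\tau,z)=\frac12\eta(\tau)^{-4}\sum_{m,n\in\mathbb Z}(3m-n)\bigl(\frac{-4}{m}\bigr)\bigl(\frac{12}{n}\bigr)q^{\frac{3m^2+n^2}{24}}y^{\frac{m+n}{2}}$, of index $2$, with $q^0$-term $y+4+y^{-1}$; - $\phi_{0,3}(\tau,z)=\bigl(\vartheta(\tau,2z)/\vartheta(\tau,z)\bigr)^2$, of index $3$, with $q^0$-term $y+2+y^{-1}$; - $\phi_{0,4}(\tau,z)=\vartheta(\tau,3z)/\vartheta(\tau,z)$, of index $4$, with $q^0$-term $y+1+y^{-1}$. *)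

theory Defs
  imports
    "HOL-Complex_Analysis.Complex_Analysis"
    "HOL-Algebra.Algebra"
    "HOL-Number_Theory.Number_Theory"
    "HOL-Library.Poly_Mapping"
begin

definition e2pi :: "complex \<Rightarrow> complex" where
  "e2pi x = exp (2 * of_real pi * \<i> * x)"


section \<open>Weak Jacobi forms of weight 0\<close>

text \<open>
  A function on the product of the upper half-plane with the complex plane is represented by a
  total function that is 0 for \<open>Im \<tau> \<le> 0\<close>, so that equality of forms is equality in HOL.
\<close>

type_synonym jform = "complex \<Rightarrow> complex \<Rightarrow> complex"

text \<open>Holomorphic in two variables: the total derivative exists and is complex linear.\<close>

definition holomorphic_HC :: "jform \<Rightarrow> bool" where
  "holomorphic_HC \<phi> \<longleftrightarrow> (\<forall>\<tau> z. Im \<tau> > 0 \<longrightarrow>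
     (\<exists>A B. ((\<lambda>(t, w). \<phi> t w) has_derivative (\<lambda>(h, k). A * h + B * k)) (at (\<tau>, z))))"

definition has_fourier_expansion :: "jform \<Rightarrow> (nat \<Rightarrow> int \<Rightarrow> complex) \<Rightarrow> bool" where
  "has_fourier_expansion \<phi> f \<longleftrightarrow> (\<forall>\<tau> z. Im \<tau> > 0 \<longrightarrow>
     ((\<lambda>(n, l). f n l * e2pi (of_nat n * \<tau>) * e2pi (of_int l * z)) has_sum \<phi> \<tau> z) UNIV)"

definition weak_jacobi_form :: "nat \<Rightarrow> jform \<Rightarrow> bool" where
  "weak_jacobi_form m \<phi> \<longleftrightarrow>
     (\<forall>\<tau> z. Im \<tau> \<le> 0 \<longrightarrow> \<phi> \<tau> z = 0) \<and>
     holomorphic_HC \<phi> \<and>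
     (\<forall>a b c d :: int. a * d - b * c = 1 \<longrightarrow> (\<forall>\<tau> z. Im \<tau> > 0 \<longrightarrow>
        \<phi> ((of_int a * \<tau> + of_int b) / (of_int c * \<tau> + of_int d)) (z / (of_int c * \<tau> + of_int d)) =
        e2pi (of_nat m * of_int c * z\<^sup>2 / (of_int c * \<tau> + of_int d)) * \<phi> \<tau> z)) \<and>
     (\<forall>lam mu :: int. \<forall>\<tau> z. Im \<tau> > 0 \<longrightarrow>
        \<phi> \<tau> (z + of_int lam * \<tau> + of_int mu) =
        e2pi (- of_nat m * ((of_int lam)\<^sup>2 * \<tau> + 2 * of_int lam * z)) * \<phi> \<tau> z) \<and>
     (\<exists>f. has_fourier_expansion \<phi> f)"

text \<open>The Fourier coefficients, which a form determines uniquely.\<close>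

definition jcoeff :: "jform \<Rightarrow> nat \<Rightarrow> int \<Rightarrow> complex" where
  "jcoeff \<phi> = (THE f. has_fourier_expansion \<phi> f)"

text \<open>
  Laurent polynomials in \<open>y\<close> with complex coefficients are finitely supported functions on the
  exponents; \<open>Poly_Mapping.single l c\<close> is the monomial with exponent \<open>l\<close> and coefficient \<open>c\<close>.
\<close>

type_synonym laurent_poly = "int \<Rightarrow>\<^sub>0 complex"

definition has_q0_term :: "jform \<Rightarrow> laurent_poly \<Rightarrow> bool" where
  "has_q0_term \<phi> P \<longleftrightarrow> (\<forall>l. jcoeff \<phi> 0 l = Poly_Mapping.lookup P l)"

definition JZ :: "nat \<Rightarrow> jform set" where
  "JZ m = {\<phi>. weak_jacobi_form m \<phi> \<and> (\<forall>n l. jcoeff \<phi> n l \<in> \<int>)}"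

definition JZq :: "nat \<Rightarrow> jform set" where
  "JZq m = {\<phi> \<in> JZ m. has_q0_term \<phi> 0}"

text \<open>Modules over the integers are treated as abelian groups, written multiplicatively
  in HOL-Algebra.\<close>

definition JZ_group :: "nat \<Rightarrow> jform monoid" where
  "JZ_group m = \<lparr>carrier = JZ m, monoid.mult = (\<lambda>\<phi> \<psi> \<tau> z. \<phi> \<tau> z + \<psi> \<tau> z), one = (\<lambda>\<tau> z. 0)\<rparr>"

definition is_Z_basis :: "('a, 'c) monoid_scheme \<Rightarrow> 'i set \<Rightarrow> ('i \<Rightarrow> 'a) \<Rightarrow> bool" where
  "is_Z_basis G I b \<longleftrightarrow> comm_group G \<and> finite I \<and> b \<in> I \<rightarrow> carrier G \<and>
     (\<forall>x \<in> carrier G. \<exists>!c. c \<in> I \<rightarrow>\<^sub>E (UNIV :: int set) \<and>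
        x = finprod G (\<lambda>i. b i [^]\<^bsub>G\<^esub> c i) I)"


section \<open>The graded ring\<close>

text \<open>The external direct sum of the modules \<open>JZ m\<close>: an element is the sequence of its
  homogeneous components, and multiplication is convolution.\<close>

definition JZ_ring :: "(nat \<Rightarrow> jform) ring" where
  "JZ_ring = \<lparr>
     carrier = {F. (\<forall>m. F m \<in> JZ m) \<and> finite {m. F m \<noteq> (\<lambda>\<tau> z. 0)}},
     monoid.mult = (\<lambda>F G m \<tau> z. \<Sum>k\<le>m. F k \<tau> z * G (m - k) \<tau> z),
     monoid.one = (\<lambda>m \<tau> z. if m = 0 \<and> Im \<tau> > 0 then 1 else 0),
     ring.zero = (\<lambda>m \<tau> z. 0),
     ring.add = (\<lambda>F G m \<tau> z. F m \<tau> z + G m \<tau> z)\<rparr>"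

definition homog :: "nat \<Rightarrow> jform \<Rightarrow> nat \<Rightarrow> jform" where
  "homog m \<phi> k = (if k = m then \<phi> else (\<lambda>\<tau> z. 0))"

text \<open>
  Algebraic independence over the integers of a list of elements of a commutative ring.
  A polynomial over the integers in the variables \<open>0, 1, \<dots>\<close> is a finitely supported function on
  monomials, and a monomial is a finitely supported exponent function.
\<close>

definition eval_mpoly :: "('a, 'c) ring_scheme \<Rightarrow> 'a list \<Rightarrow> ((nat \<Rightarrow>\<^sub>0 nat) \<Rightarrow>\<^sub>0 int) \<Rightarrow> 'a" where
  "eval_mpoly R xs p =
     finsum R (\<lambda>t. [Poly_Mapping.lookup p t] \<cdot>\<^bsub>R\<^esub>
        finprod R (\<lambda>i. (xs ! i) [^]\<^bsub>R\<^esub> Poly_Mapping.lookup t i) {..<length xs})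
       (Poly_Mapping.keys p)"

definition alg_independent :: "('a, 'c) ring_scheme \<Rightarrow> 'a list \<Rightarrow> bool" where
  "alg_independent R xs \<longleftrightarrow>
     (\<forall>p. (\<forall>t \<in> Poly_Mapping.keys p. Poly_Mapping.keys t \<subseteq> {..<length xs}) \<and>
          eval_mpoly R xs p = \<zero>\<^bsub>R\<^esub> \<longrightarrow> p = 0)"


section \<open>The four generators\<close>

definition kronecker_prime :: "int \<Rightarrow> nat \<Rightarrow> int" where
  "kronecker_prime a p =
     (if p = 2 then (if even a then 0 else if a mod 8 \<in> {1, 7} then 1 else -1)
      else Legendre a (int p))"

definition kronecker_symbol :: "int \<Rightarrow> int \<Rightarrow> int" where
  "kronecker_symbol a n =
     (if n = 0 then (if \<bar>a\<bar> = 1 then 1 else 0)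
      else (if n < 0 \<and> a < 0 then -1 else 1) *
        (\<Prod>p \<in> prime_factors (nat \<bar>n\<bar>). kronecker_prime a p ^ multiplicity p (nat \<bar>n\<bar>)))"

definition jtheta :: "complex \<Rightarrow> complex \<Rightarrow> complex" where
  "jtheta \<tau> z = (\<Sum>\<^sub>\<infinity>n::int. of_int (kronecker_symbol (-4) n) *
     e2pi ((of_int n)\<^sup>2 / 8 * \<tau>) * e2pi (of_int n / 2 * z))"

definition dedekind_eta :: "complex \<Rightarrow> complex" where
  "dedekind_eta \<tau> = e2pi (\<tau> / 24) * prodinf (\<lambda>n. 1 - e2pi (of_nat (Suc n) * \<tau>))"

definition phi01 :: jform where
  "phi01 = (THE \<phi>. weak_jacobi_form 1 \<phi> \<and>
     has_q0_term \<phi> (Poly_Mapping.single 1 1 + Poly_Mapping.single 0 10 + Poly_Mapping.single (-1) 1))"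

definition phi02 :: jform where
  "phi02 \<tau> z = (if Im \<tau> > 0 then
     1 / 2 * inverse (dedekind_eta \<tau> ^ 4) *
     (\<Sum>\<^sub>\<infinity>(m, n) \<in> (UNIV :: (int \<times> int) set).
        of_int (3 * m - n) * of_int (kronecker_symbol (-4) m) * of_int (kronecker_symbol 12 n) *
        e2pi (of_int (3 * m\<^sup>2 + n\<^sup>2) / 24 * \<tau>) * e2pi (of_int (m + n) / 2 * z))
     else 0)"

text \<open>
  The theta quotients are holomorphic in \<open>z\<close> after removal of singularities:
  \<open>jtheta \<tau>\<close> vanishes at the points of the lattice generated by \<open>\<tau>\<close> and \<open>1\<close>,
  where HOL's division would return 0. Hence \<open>remove_sings\<close>.
\<close>

definition phi03 :: jform where
  "phi03 \<tau> z =
     (if Im \<tau> > 0 then remove_sings (\<lambda>w. (jtheta \<tau> (2 * w) / jtheta \<tau> w)\<^sup>2) z else 0)"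

definition phi04 :: jform where
  "phi04 \<tau> z =
     (if Im \<tau> > 0 then remove_sings (\<lambda>w. jtheta \<tau> (3 * w) / jtheta \<tau> w) z else 0)"

end

(*
  Every form of weight 0 is handled through the Taylor coefficients of \<phi>(\<tau>, z) at z = 0, which are
  holomorphic functions of q = e(\<tau>). With T = \<theta> / \<eta>^3, an even elliptic family vanishing at z = 0 is
  divisible by T^2; combined with the vanishing of modular forms of weight 2 and of cusp forms of
  weight below 12 this shows:
  (a) the q^0-term of a form of index m is an integral polynomial Q in u = y - 2 + 1/y of degree at most
      m with m Q(0) = 12 Q'(0);
  (b) a form with zero q^0-term is divisible by
      P = phi01^2 phi04 + 8 phi02^3 + 27 phi03^2 - 9 phi01 phi02 phi03 = - Delta T^12.
  The quotient in (b) is again integral, because the theta series has leading coefficient 1.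
  The generators have q^0-terms u + 12, u + 6, u + 4, u + 3, and monomials in them realise u^k
  for 2 \<le> k \<le> m and (m u + 12) / gcd(12, m), which is a basis of the lattice cut out by (a).
  Induction on m then gives generation. For the independence one restricts to z = 1/2.
*)
theory Submission
  imports Defs
begin

text \<open>The polynomial P has a geometric origin. Substituting X = x + wp(z) in y^2 = 4 X^3 - g2
  X - g3 gives a cubic 4 x^3 + b2 x^2 + 2 b4 x + b6, and up to powers of 2 pi i the four generators
  are b2 T^2, b4 T^4, b6 T^6 and b8 T^8. The relation among the generators is 4 b8 = b2 b6 - b4^2,
  and -P is the classical formula for the discriminant of the cubic, which is blind to the
  translation by wp(z). Two obstacles shape the development. A weak Jacobi form must possess a
  Fourier expansion in both variables, and division by T^2 does not visibly preserve this; hence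
  quotients are formed on Taylor coefficients, and \<open>EF_FE\<close> recovers the expansion
  afterwards. Secondly, the weight 12 law of Delta is at first available only in absolute value,
  from the values of T at the half-periods. The vanishing arguments for cusp forms use the maximum
  principle and accept this weak form; they yield P = - Delta T^12, and this identity in turn gives
  the exact law in \<open>del_modular\<close>.\<close>

abbreviation \<kappa> :: complex where "\<kappa> \<equiv> 2 * of_real pi * \<i>"

abbreviation is_entire :: "(complex \<Rightarrow> complex) \<Rightarrow> bool" ("_ is'_entire" [51] 50) where
  "F is_entire \<equiv> F holomorphic_on UNIV"

abbreviation aut :: "int \<Rightarrow> int \<Rightarrow> complex \<Rightarrow> complex" where "aut c d t \<equiv> of_int c * t + of_int d"

abbreviation mob :: "int \<Rightarrow> int \<Rightarrow> int \<Rightarrow> int \<Rightarrow> complex \<Rightarrow> complex" where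
  "mob a b c d t \<equiv> (of_int a * t + of_int b) / (of_int c * t + of_int d)"

section \<open>The exponential e(x) = exp(2 pi i x)\<close>

lemma e2pi_cong: "x = y \<Longrightarrow> e2pi x = e2pi y" by simp

lemma e2pi_add: "e2pi (x + y) = e2pi x * e2pi y"
  by (simp add: e2pi_def ring_distribs exp_add)

lemma e2pi_0 [simp]: "e2pi 0 = 1"
  by (simp add: e2pi_def)

lemma e2pi_nonzero [simp]: "e2pi x \<noteq> 0"
  by (simp add: e2pi_def)

lemma e2pi_minus: "e2pi (- x) = inverse (e2pi x)"
  by (simp add: e2pi_def exp_minus)

lemma e2pi_diff: "e2pi (x - y) = e2pi x / e2pi y"
  by (simp add: e2pi_def ring_distribs exp_diff)

lemma e2pi_of_nat_mult: "e2pi (of_nat n * x) = e2pi x ^ n"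
proof -
  have "\<kappa> * (of_nat n * x) = of_nat n * (\<kappa> * x)"
    by simp
  then show ?thesis unfolding e2pi_def by (metis exp_of_nat_mult)
qed

lemma e2pi_of_int [simp]: "e2pi (of_int n) = 1"
  unfolding e2pi_def by (simp add: exp_eq_1)

lemma e2pi_of_nat [simp]: "e2pi (of_nat n) = 1"
  using e2pi_of_int[of "int n"] by simp

lemma e2pi_1 [simp]: "e2pi 1 = 1"
  using e2pi_of_int[of 1] by simp

lemma e2pi_half: "e2pi (1/2) = -1"
  by (simp add: e2pi_def)

lemma e2pi_of_int_half: "e2pi (of_int n / 2) = (-1) powi n"
proof (cases "n \<ge> 0")
  case True
  then obtain m where "n = int m" using nonneg_int_cases by blast
  then show ?thesis using e2pi_of_nat_mult[of m "1/2"] by (simp add: e2pi_half)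
next
  case False
  then obtain m where "n = - int m" using nonneg_int_cases[of "-n"] by (metis add.inverse_inverse linorder_not_le neg_0_le_iff_le order_less_imp_le)
  then show ?thesis using e2pi_of_nat_mult[of m "1/2"] by (simp add: e2pi_half e2pi_minus power_int_minus)
qed

lemma norm_e2pi: "norm (e2pi x) = exp (- (2 * pi * Im x))"
  by (simp add: e2pi_def norm_exp_eq_Re)

lemma norm_e2pi_less_1: "Im t > 0 \<Longrightarrow> norm (e2pi t) < 1"
  by (simp add: norm_e2pi)

lemma e2pi_in_ball: "Im t > 0 \<Longrightarrow> e2pi t \<in> ball 0 1"
  by (simp add: norm_e2pi)

lemma e2pi_eq_1_iff: "e2pi x = 1 \<longleftrightarrow> (\<exists>n. x = of_int n)"
proof
  assume "e2pi x = 1"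
  then obtain n :: int where n: "Re (\<kappa> * x) = 0" "Im (\<kappa> * x) = of_int (2 * n) * pi"
    unfolding e2pi_def exp_eq_1 by blast
  then have "Im x = 0" "Re x = of_int n" by auto
  then show "\<exists>n. x = of_int n" by (metis complex_eq_iff Im_complex_of_real Re_complex_of_real of_real_of_int_eq)
qed auto

lemma e2pi_eq_iff: "e2pi x = e2pi y \<longleftrightarrow> (\<exists>n. x = y + of_int n)"
proof -
  have "e2pi x = e2pi y \<longleftrightarrow> e2pi (x - y) = 1"
    by (simp add: e2pi_diff)
  then show ?thesis unfolding e2pi_eq_1_iff by (simp add: algebra_simps)
qed

lemma e2pi_surj: assumes "w \<noteq> 0" obtains t where "e2pi t = w"
proof
  show "e2pi (Ln w / \<kappa>) = w"
    using assms by (simp add: e2pi_def)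
qed

lemma e2pi_surj_H:
  assumes "w \<noteq> 0" "norm w < 1" obtains t where "e2pi t = w" "Im t > 0"
proof -
  obtain t where t: "e2pi t = w" using e2pi_surj assms by metis
  have "exp (- (2 * pi * Im t)) < 1" using assms t norm_e2pi by metis
  then have "Im t > 0" by (simp add: zero_less_mult_iff)
  then show ?thesis using that t by blast
qed

lemma e2pi_holomorphic [holomorphic_intros]: "f holomorphic_on S \<Longrightarrow> (\<lambda>z. e2pi (f z)) holomorphic_on S"
  unfolding e2pi_def by (intro holomorphic_intros)

lemma e2pi_has_field_derivative [derivative_intros]:
  "(f has_field_derivative f') (at z within S) \<Longrightarrow>
   ((\<lambda>z. e2pi (f z)) has_field_derivative (\<kappa> * e2pi (f z) * f')) (at z within S)"
  unfolding e2pi_def by (auto intro!: derivative_eq_intros)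

subsection \<open>Exponential sums\<close>

text \<open>Exponents are real and the index type is free, so that the same facts serve Fourier
  expansions, with integral exponents, and theta series, with exponents such as n^2/24 and
  n/2.\<close>

definition eterm :: "('k \<Rightarrow> complex) \<Rightarrow> ('k \<Rightarrow> real) \<Rightarrow> ('k \<Rightarrow> real) \<Rightarrow> complex \<Rightarrow> complex \<Rightarrow> 'k \<Rightarrow> complex" where
  "eterm c N M t z k = c k * e2pi (of_real (N k) * t) * e2pi (of_real (M k) * z)"

definition esum :: "('k \<Rightarrow> complex) \<Rightarrow> ('k \<Rightarrow> real) \<Rightarrow> ('k \<Rightarrow> real) \<Rightarrow> complex \<Rightarrow> complex \<Rightarrow> complex" where
  "esum c N M t z = (\<Sum>\<^sub>\<infinity>k. eterm c N M t z k)"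

definition esummable :: "('k \<Rightarrow> complex) \<Rightarrow> ('k \<Rightarrow> real) \<Rightarrow> ('k \<Rightarrow> real) \<Rightarrow> bool" where
  "esummable c N M \<longleftrightarrow> (\<forall>t z. Im t > 0 \<longrightarrow> eterm c N M t z summable_on UNIV)"

lemma norm_eterm: "norm (eterm c N M t z k) = norm (c k) * exp (- (2 * pi * (N k * Im t + M k * Im z)))"
  by (simp add: eterm_def norm_mult norm_e2pi exp_add [symmetric] ring_distribs)

lemma esummable_norm:
  assumes "esummable c N M" "Im t > 0"
  shows "(\<lambda>k. norm (c k) * exp (- (2 * pi * (N k * Im t + M k * Im z)))) summable_on UNIV"
  using assms unfolding esummable_def
  by (simp add: norm_eterm [symmetric] summable_on_iff_abs_summable_on_complex)

text \<open>Convergence at the four points with \<open>Im t\<close> and \<open>Im z\<close> moved by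
  \<open>d\<close> in either direction leaves exponential slack in both exponents. The slack pays
  for every polynomial factor that differentiation produces.\<close>

lemma esummable_norm_shift:
  assumes "esummable c N M" "0 < d" "d < Im t"
  shows "(\<lambda>k. norm (c k) * exp (- (2 * pi * (N k * Im t + M k * Im z))) * exp (2 * pi * d * (\<bar>N k\<bar> + \<bar>M k\<bar>))) summable_on UNIV"
proof -
  define g where "g = (\<lambda>s r k. norm (c k) * exp (- (2 * pi * (N k * (Im t + s) + M k * (Im z + r)))))"
  have g: "g s r summable_on UNIV" if "\<bar>s\<bar> \<le> d" for s r
  proof -
    have "Im (t + of_real s * \<i>) > 0" using that assms by auto
    from esummable_norm[OF assms(1) this, of "z + of_real r * \<i>"] show ?thesis
      by (simp add: g_def)
  qed
  have "(\<lambda>k. g d d k + g d (-d) k + g (-d) d k + g (-d) (-d) k) summable_on UNIV"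
    using assms by (intro summable_on_add g) auto
  then show ?thesis
  proof (rule summable_on_comparison_test)
    fix k
    have nn: "g s r k \<ge> 0" for s r by (simp add: g_def)
    \<comment> \<open>The signs are chosen so that each shift enlarges the term: the exponents then
      contribute their absolute values.\<close>
    let ?s = "if N k \<ge> 0 then - d else d" and ?r = "if M k \<ge> 0 then - d else d"
    have "norm (c k) * exp (- (2 * pi * (N k * Im t + M k * Im z))) * exp (2 * pi * d * (\<bar>N k\<bar> + \<bar>M k\<bar>)) = g ?s ?r k"
      by (auto simp: g_def exp_add [symmetric] algebra_simps abs_if mult.assoc)
    also have "\<dots> \<le> g d d k + g d (-d) k + g (-d) d k + g (-d) (-d) k"
      using nn[of d d] nn[of d "-d"] nn[of "-d" d] nn[of "-d" "-d"] by auto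
    finally show "norm (c k) * exp (- (2 * pi * (N k * Im t + M k * Im z))) * exp (2 * pi * d * (\<bar>N k\<bar> + \<bar>M k\<bar>))
      \<le> g d d k + g d (-d) k + g (-d) d k + g (-d) (-d) k" .
  qed auto
qed

lemma esummable_comparison:
  assumes "esummable c N M" "\<And>k. norm (d k) \<le> K * norm (c k)"
  shows "esummable d N M"
  unfolding esummable_def
proof (intro allI impI)
  fix t z :: complex assume t: "Im t > 0"
  have "(\<lambda>k. K * (norm (c k) * exp (- (2 * pi * (N k * Im t + M k * Im z))))) summable_on UNIV"
    using esummable_norm[OF assms(1) t] by (intro summable_on_cmult_right)
  then have "(\<lambda>k. norm (eterm d N M t z k)) summable_on UNIV"
    by (rule summable_on_comparison_test) (auto simp: norm_eterm mult.assoc [symmetric] intro!: mult_right_mono assms)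
  then show "eterm d N M t z summable_on UNIV"
    by (simp add: summable_on_iff_abs_summable_on_complex)
qed

text \<open>From x <= exp x, with x proportional to the exponents, and the slack in
  \<open>esummable_norm_shift\<close>.\<close>

lemma esummable_mult_abs:
  assumes "esummable c N M"
  shows "esummable (\<lambda>k. c k * of_real (\<bar>N k\<bar> + \<bar>M k\<bar>)) N M"
  unfolding esummable_def
proof (intro allI impI)
  fix t z :: complex assume t: "Im t > 0"
  define d where "d = Im t / 2"
  have d: "0 < d" "d < Im t" using t by (auto simp: d_def)
  have "(\<lambda>k. (1 / (2 * pi * d)) * (norm (c k) * exp (- (2 * pi * (N k * Im t + M k * Im z))) * exp (2 * pi * d * (\<bar>N k\<bar> + \<bar>M k\<bar>)))) summable_on UNIV"
    using esummable_norm_shift[OF assms d] by (rule summable_on_cmult_right)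
  then have "(\<lambda>k. norm (eterm (\<lambda>k. c k * of_real (\<bar>N k\<bar> + \<bar>M k\<bar>)) N M t z k)) summable_on UNIV"
  proof (rule summable_on_comparison_test)
    fix k
    have "2 * pi * d * (\<bar>N k\<bar> + \<bar>M k\<bar>) \<le> exp (2 * pi * d * (\<bar>N k\<bar> + \<bar>M k\<bar>))"
      using exp_ge_add_one_self[of "2 * pi * d * (\<bar>N k\<bar> + \<bar>M k\<bar>)"] by linarith
    then have "\<bar>N k\<bar> + \<bar>M k\<bar> \<le> 1 / (2 * pi * d) * exp (2 * pi * d * (\<bar>N k\<bar> + \<bar>M k\<bar>))"
      using d by (simp add: field_simps)
    then have "norm (c k) * exp (- (2 * pi * (N k * Im t + M k * Im z))) * (\<bar>N k\<bar> + \<bar>M k\<bar>)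
      \<le> norm (c k) * exp (- (2 * pi * (N k * Im t + M k * Im z))) * (1 / (2 * pi * d) * exp (2 * pi * d * (\<bar>N k\<bar> + \<bar>M k\<bar>)))"
      by (intro mult_left_mono) auto
    then show "norm (eterm (\<lambda>k. c k * of_real (\<bar>N k\<bar> + \<bar>M k\<bar>)) N M t z k) \<le>
       (1 / (2 * pi * d)) * (norm (c k) * exp (- (2 * pi * (N k * Im t + M k * Im z))) * exp (2 * pi * d * (\<bar>N k\<bar> + \<bar>M k\<bar>)))"
      unfolding norm_eterm norm_mult norm_of_real by (simp add: mult_ac del: of_real_add)
  qed auto
  then show "eterm (\<lambda>k. c k * of_real (\<bar>N k\<bar> + \<bar>M k\<bar>)) N M t z summable_on UNIV"
    by (simp add: summable_on_iff_abs_summable_on_complex)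
qed

lemma esummable_deriv_z:
  assumes "esummable c N M" shows "esummable (\<lambda>k. c k * (\<kappa> * of_real (M k))) N M"
  by (rule esummable_comparison[OF esummable_mult_abs[OF assms], where K = "2 * pi"])
     (auto simp: norm_mult algebra_simps simp del: of_real_add)

lemma esummable_deriv_t:
  assumes "esummable c N M" shows "esummable (\<lambda>k. c k * (\<kappa> * of_real (N k))) N M"
  by (rule esummable_comparison[OF esummable_mult_abs[OF assms], where K = "2 * pi"])
     (auto simp: norm_mult algebra_simps simp del: of_real_add)

lemma norm_exp_remainder: "norm (exp w - 1 - w) \<le> (norm w)\<^sup>2 * exp (norm (w::complex))"
proof -
  have "norm (exp w - (\<Sum>k\<le>1. w ^ k / fact k)) \<le> exp \<bar>Re w\<bar> * norm w ^ Suc 1 / fact 1"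
    by (rule Taylor_exp)
  also have "exp \<bar>Re w\<bar> * norm w ^ Suc 1 / fact 1 \<le> (norm w)\<^sup>2 * exp (norm w)"
    using abs_Re_le_cmod[of w] by (simp add: power2_eq_square mult.commute[of _ "norm w * norm w"] mult_left_mono)
  finally show ?thesis by (simp add: diff_diff_eq)
qed

text \<open>Each term is multiplied by exp v with v linear in the increment, so
  \<open>norm_exp_remainder\<close> bounds the termwise error by |v|^2 exp |v|. Summation gives an
  error quadratic in the increment, hence a derivative in both variables jointly, as
  \<open>holomorphic_HC\<close> requires.\<close>

proposition esum_has_derivative:
  assumes c: "esummable c N M" and t: "Im t > 0"
  shows "((\<lambda>(t, z). esum c N M t z) has_derivative
     (\<lambda>(h, k). esum (\<lambda>k. c k * (\<kappa> * of_real (N k))) N M t z * h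
             + esum (\<lambda>k. c k * (\<kappa> * of_real (M k))) N M t z * k)) (at (t, z))"
proof -
  let ?cN = "\<lambda>k. c k * (\<kappa> * of_real (N k))"
  let ?cM = "\<lambda>k. c k * (\<kappa> * of_real (M k))"
  let ?A = "esum ?cN N M t z" and ?B = "esum ?cM N M t z"
  \<comment> \<open>Increments shorter than this keep \<open>t + h\<close> in the upper
    half-plane.\<close>
  define d where "d = Im t / 2"
  have d: "0 < d" "d < Im t" using t by (auto simp: d_def)
  \<comment> \<open>Two factors of the exponents, because the remainder is quadratic in v.\<close>
  define G where "G = (\<lambda>k. norm (c k * of_real (\<bar>N k\<bar> + \<bar>M k\<bar>) * of_real (\<bar>N k\<bar> + \<bar>M k\<bar>)) *
      exp (- (2 * pi * (N k * Im t + M k * Im z))) * exp (2 * pi * d * (\<bar>N k\<bar> + \<bar>M k\<bar>)))"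
  have G: "G summable_on UNIV"
    unfolding G_def by (rule esummable_norm_shift[OF _ d]) (intro esummable_mult_abs c)
  define S where "S = (2 * pi)\<^sup>2 * infsum G UNIV"
  have bound: "norm (esum c N M (t + h) (z + w) - esum c N M t z - (?A * h + ?B * w)) \<le> S * (norm (h, w))\<^sup>2"
    if "norm (h, w) < d" for h w
  proof -
    define r where "r = norm (h, w)"
    have hr: "norm h \<le> r" "norm w \<le> r" unfolding r_def by (auto intro: norm_fst_le norm_snd_le simp: norm_ge_zero)
    have rd: "r < d" "r \<ge> 0" using that by (auto simp: r_def)
    have "Im h \<ge> - d" using abs_Im_le_cmod[of h] hr rd by linarith
    then have th: "Im (t + h) > 0" using d by (simp add: d_def)
    have s1: "eterm c N M (t + h) (z + w) summable_on UNIV" "eterm c N M t z summable_on UNIV"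
        "eterm ?cN N M t z summable_on UNIV" "eterm ?cM N M t z summable_on UNIV"
      using c th t esummable_deriv_t[OF c] esummable_deriv_z[OF c] by (auto simp: esummable_def)
    define R where "R = (\<lambda>k. eterm c N M (t + h) (z + w) k - eterm c N M t z k - (eterm ?cN N M t z k * h + eterm ?cM N M t z k * w))"
    have hsR: "(R has_sum (esum c N M (t + h) (z + w) - esum c N M t z - (?A * h + ?B * w))) UNIV"
      unfolding R_def esum_def diff_conv_add_uminus
      by (intro has_sum_add has_sum_uminusI has_sum_cmult_left has_sum_infsum s1)
    have bR: "norm (R k) \<le> (2 * pi)\<^sup>2 * r\<^sup>2 * G k" for k
    proof -
      define v where "v = \<kappa> * (of_real (N k) * h + of_real (M k) * w)"
      have e: "eterm c N M (t + h) (z + w) k = eterm c N M t z k * exp v"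
        by (simp add: eterm_def v_def e2pi_def exp_add [symmetric] mult.assoc ring_distribs add_ac mult_ac)
      have "R k = eterm c N M t z k * (exp v - 1 - v)"
        unfolding R_def e by (simp add: eterm_def v_def algebra_simps)
      then have "norm (R k) \<le> norm (eterm c N M t z k) * ((norm v)\<^sup>2 * exp (norm v))"
        by (simp add: norm_mult mult_left_mono norm_exp_remainder)
      moreover have nv: "norm v \<le> 2 * pi * (\<bar>N k\<bar> + \<bar>M k\<bar>) * r"
      proof -
        have "norm v \<le> 2 * pi * (\<bar>N k\<bar> * norm h + \<bar>M k\<bar> * norm w)"
          unfolding v_def norm_mult by (simp, rule order.trans[OF norm_triangle_ineq]) (simp add: norm_mult)
        also have "\<dots> \<le> 2 * pi * (\<bar>N k\<bar> * r + \<bar>M k\<bar> * r)"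
          by (intro mult_left_mono add_mono hr) auto
        finally show ?thesis by (simp add: algebra_simps)
      qed
      moreover have "(norm v)\<^sup>2 * exp (norm v) \<le> (2 * pi * (\<bar>N k\<bar> + \<bar>M k\<bar>) * r)\<^sup>2 * exp (2 * pi * d * (\<bar>N k\<bar> + \<bar>M k\<bar>))"
      proof (intro mult_mono power_mono nv)
        have "norm v \<le> 2 * pi * (\<bar>N k\<bar> + \<bar>M k\<bar>) * d"
          by (rule order.trans[OF nv]) (intro mult_left_mono, use rd in auto)
        then show "exp (norm v) \<le> exp (2 * pi * d * (\<bar>N k\<bar> + \<bar>M k\<bar>))" by (simp add: mult_ac)
      qed auto
      ultimately have "norm (R k) \<le> norm (eterm c N M t z k) * ((2 * pi * (\<bar>N k\<bar> + \<bar>M k\<bar>) * r)\<^sup>2 * exp (2 * pi * d * (\<bar>N k\<bar> + \<bar>M k\<bar>)))"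
        by (meson mult_left_mono norm_ge_zero order.trans)
      also have "\<dots> = (2 * pi)\<^sup>2 * r\<^sup>2 * G k"
      proof -
        have ab: "norm (of_real (\<bar>N k\<bar> + \<bar>M k\<bar>) :: complex) = \<bar>N k\<bar> + \<bar>M k\<bar>"
          by (simp del: of_real_add)
        show ?thesis
          unfolding norm_eterm G_def norm_mult ab by (simp only: power_mult_distrib power2_eq_square mult_ac)
      qed
      finally show ?thesis .
    qed
    have "norm (esum c N M (t + h) (z + w) - esum c N M t z - (?A * h + ?B * w)) \<le> (2 * pi)\<^sup>2 * r\<^sup>2 * infsum G UNIV"
      using hsR has_sum_cmult_right[OF has_sum_infsum[OF G]] bR by (rule norm_infsum_le)
    then show ?thesis by (simp add: S_def r_def mult_ac)
  qed
  show ?thesis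
  proof (rule has_derivativeI_sandwich[where e = d and H = "\<lambda>y. S * norm (y - (t, z))"])
    show "bounded_linear (\<lambda>(h, k). ?A * h + ?B * k)"
      unfolding split_beta
      by (intro bounded_linear_add bounded_linear_const_mult bounded_linear_fst bounded_linear_snd)
    show "((\<lambda>y. S * norm (y - (t, z))) \<longlongrightarrow> 0) (at (t, z))"
      by (rule tendsto_eq_intros | simp)+
    fix y :: "complex \<times> complex" assume y: "y \<noteq> (t, z)" "dist y (t, z) < d"
    obtain h w where y': "y = (t + h, z + w)" by (metis add_diff_cancel_left' diff_add_cancel prod.collapse add.commute)
    then have nd: "y - (t, z) = (h, w)" by simp
    have "norm (h, w) < d" using y(2) nd by (metis dist_norm)
    note b = bound[OF this]
    have p: "norm (h, w) > 0" using y nd by (metis right_minus_eq zero_less_norm_iff)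
    show "norm ((case y of (t, z) \<Rightarrow> esum c N M t z) - (case (t, z) of (t, z) \<Rightarrow> esum c N M t z) -
        (case y - (t, z) of (h, k) \<Rightarrow> ?A * h + ?B * k)) / norm (y - (t, z)) \<le> S * norm (y - (t, z))"
      unfolding nd using b p by (simp add: y' divide_le_eq power2_eq_square mult_ac)
  qed (use d in auto)
qed

section \<open>Fourier expansions with coefficients in a closed ring\<close>

lemma has_sum_closed_set:
  fixes f :: "'k \<Rightarrow> complex"
  assumes "(f has_sum s) A" "\<And>k. k \<in> A \<Longrightarrow> f k \<in> S" "closed S" "0 \<in> S" "\<And>a b. a \<in> S \<Longrightarrow> b \<in> S \<Longrightarrow> a + b \<in> S"
  shows "s \<in> S"
proof -
  have fin: "sum f F \<in> S" if "finite F" "F \<subseteq> A" for F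
    using that assms by (induction F rule: finite_induct) auto
  have "(sum f \<longlongrightarrow> s) (finite_subsets_at_top A)"
    using assms(1) by (simp add: has_sum_def)
  then show ?thesis
    by (rule Lim_in_closed_set[OF \<open>closed S\<close>, rotated 2])
       (auto simp: fin intro!: eventually_finite_subsets_at_top_weakI)
qed

text \<open>Coefficients arise as infinite sums over all ways of reaching an exponent, hence the
  closedness. The two instances are the complex numbers, for the existence of expansions, and the
  integers, for integrality.\<close>

definition coeff_ring :: "complex set \<Rightarrow> bool" where
  "coeff_ring S \<longleftrightarrow> closed S \<and> 0 \<in> S \<and> 1 \<in> S \<and> (\<forall>a\<in>S. \<forall>b\<in>S. a + b \<in> S \<and> a * b \<in> S \<and> - a \<in> S)"

lemma coeff_ring_UNIV [simp]: "coeff_ring UNIV" by (simp add: coeff_ring_def)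
lemma coeff_ring_Ints [simp]: "coeff_ring \<int>" by (simp add: coeff_ring_def)

definition FE :: "complex set \<Rightarrow> jform \<Rightarrow> bool" where
  "FE S \<phi> \<longleftrightarrow> (\<exists>f. (\<forall>n l. f n l \<in> S) \<and> has_fourier_expansion \<phi> f)"

text \<open>Absolute convergence permits grouping by exponent. A fibre may be infinite, so the
  convergence of the collected coefficients is part of the conclusion.\<close>

lemma has_fourier_expansion_series:
  fixes N :: "'k \<Rightarrow> nat" and M :: "'k \<Rightarrow> int"
  assumes "\<And>t z. Im t > 0 \<Longrightarrow> ((\<lambda>k. c k * e2pi (of_nat (N k) * t) * e2pi (of_int (M k) * z)) has_sum \<phi> t z) UNIV"
  shows "has_fourier_expansion \<phi> (\<lambda>n l. \<Sum>\<^sub>\<infinity>k\<in>{k. N k = n \<and> M k = l}. c k)"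
    and "c summable_on {k. N k = n \<and> M k = l}"
proof -
  let ?F = "\<lambda>p. {k. N k = fst p \<and> M k = snd p}"
  let ?X = "\<lambda>t z k. c k * e2pi (of_nat (N k) * t) * e2pi (of_int (M k) * z)"
  have sumfib: "c summable_on ?F p" for p
  proof -
    \<comment> \<open>On a fibre the exponential factors are a nonzero constant, which is divided
      out.\<close>
    have "?X \<i> 0 summable_on UNIV" using assms[of \<i> 0] by (auto simp: summable_on_def)
    then have "?X \<i> 0 summable_on ?F p" by (rule summable_on_subset_banach) auto
    also have "?this \<longleftrightarrow> (\<lambda>k. c k * e2pi (of_nat (fst p) * \<i>)) summable_on ?F p"
      by (rule summable_on_cong) auto
    finally have "(\<lambda>k. c k * e2pi (of_nat (fst p) * \<i>) * inverse (e2pi (of_nat (fst p) * \<i>))) summable_on ?F p"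
      by (rule summable_on_cmult_left)
    then show ?thesis by (simp add: mult.assoc)
  qed
  from sumfib[of "(n, l)"] show "c summable_on {k. N k = n \<and> M k = l}" by simp
  show "has_fourier_expansion \<phi> (\<lambda>n l. \<Sum>\<^sub>\<infinity>k\<in>{k. N k = n \<and> M k = l}. c k)"
    unfolding has_fourier_expansion_def
  proof (intro allI impI)
    fix t z :: complex assume t: "Im t > 0"
    have bij: "bij_betw snd (Sigma UNIV ?F) UNIV"
      by (rule bij_betwI[where g = "\<lambda>k. ((N k, M k), k)"]) auto
    have "((\<lambda>x. ?X t z (snd x)) has_sum \<phi> t z) (Sigma UNIV ?F)"
      using assms[OF t, of z] has_sum_reindex_bij_betw[OF bij, of "?X t z"] by blast
    moreover have "((\<lambda>k. ?X t z (snd (p, k))) has_sum (case p of (n, l) \<Rightarrow> (\<Sum>\<^sub>\<infinity>k\<in>{k. N k = n \<and> M k = l}. c k) * e2pi (of_nat n * t) * e2pi (of_int l * z))) (?F p)" for p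
    proof -
      obtain n l where p: "p = (n, l)" by (cases p)
      have "((\<lambda>k. c k * e2pi (of_nat n * t) * e2pi (of_int l * z)) has_sum (\<Sum>\<^sub>\<infinity>k\<in>?F p. c k) * e2pi (of_nat n * t) * e2pi (of_int l * z)) (?F p)"
        by (intro has_sum_cmult_left has_sum_infsum sumfib)
      then show ?thesis unfolding p by (subst has_sum_cong[where g = "\<lambda>k. c k * e2pi (of_nat n * t) * e2pi (of_int l * z)"]) auto
    qed
    ultimately show "((\<lambda>(n, l). (\<Sum>\<^sub>\<infinity>k\<in>{k. N k = n \<and> M k = l}. c k) * e2pi (of_nat n * t) * e2pi (of_int l * z)) has_sum \<phi> t z) UNIV"
      by (rule has_sum_SigmaD)
  qed
qed

lemma FE_series:
  fixes N :: "'k \<Rightarrow> nat" and M :: "'k \<Rightarrow> int"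
  assumes S: "coeff_ring S" and c: "\<And>k. c k \<in> S"
    and hs: "\<And>t z. Im t > 0 \<Longrightarrow> ((\<lambda>k. c k * e2pi (of_nat (N k) * t) * e2pi (of_int (M k) * z)) has_sum \<phi> t z) UNIV"
  shows "FE S \<phi>"
  unfolding FE_def
proof (intro exI conjI allI)
  show "has_fourier_expansion \<phi> (\<lambda>n l. \<Sum>\<^sub>\<infinity>k\<in>{k. N k = n \<and> M k = l}. c k)"
    using hs by (rule has_fourier_expansion_series)
  fix n l
  have "c summable_on {k. N k = n \<and> M k = l}"
    using hs by (rule has_fourier_expansion_series)
  then show "(\<Sum>\<^sub>\<infinity>k\<in>{k. N k = n \<and> M k = l}. c k) \<in> S"
    using S c by (intro has_sum_closed_set[OF has_sum_infsum]) (auto simp: coeff_ring_def)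
qed

lemma has_sum_finite_sum:
  fixes f :: "'i \<Rightarrow> 'k \<Rightarrow> complex"
  assumes "finite I" "\<And>i. i \<in> I \<Longrightarrow> (f i has_sum s i) A"
  shows "((\<lambda>k. \<Sum>i\<in>I. f i k) has_sum (\<Sum>i\<in>I. s i)) A"
  using assms by (induction I rule: finite_induct) (auto intro!: has_sum_add)

lemma has_sum_mult_prod:
  fixes f g :: "_ \<Rightarrow> complex"
  assumes "(f has_sum a) A" "(g has_sum b) B"
  shows "((\<lambda>(x, y). f x * g y) has_sum a * b) (A \<times> B)"
proof (rule has_sum_SigmaI)
  show "((\<lambda>x. f x * b) has_sum a * b) A"
    using assms(1) by (rule has_sum_cmult_left)
  show "((\<lambda>y. case (x, y) of (x, y) \<Rightarrow> f x * g y) has_sum f x * b) B" for x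
    using has_sum_cmult_right[OF assms(2), of "f x"] by simp
  have sf: "(\<lambda>x. norm (f x)) summable_on A" and sg: "(\<lambda>x. norm (g x)) summable_on B"
    using assms[THEN has_sum_imp_summable] by (simp_all only: summable_on_iff_abs_summable_on_complex)
  have "(\<lambda>(x, y). norm (f x) * norm (g y)) summable_on A \<times> B"
  proof (rule summable_on_SigmaI)
    show "((\<lambda>y. case (x, y) of (x, y) \<Rightarrow> norm (f x) * norm (g y)) has_sum norm (f x) * infsum (\<lambda>x. norm (g x)) B) B" for x
      using has_sum_cmult_right[OF has_sum_infsum[OF sg], of "norm (f x)"] by simp
    show "(\<lambda>x. norm (f x) * infsum (\<lambda>x. norm (g x)) B) summable_on A"
      using sf by (rule summable_on_cmult_left)
  qed auto
  then have "(\<lambda>p. norm ((\<lambda>(x, y). f x * g y) p)) summable_on A \<times> B"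
    by (simp add: case_prod_unfold norm_mult)
  then show "(\<lambda>(x, y). f x * g y) summable_on A \<times> B"
    by (rule iffD2[OF summable_on_iff_abs_summable_on_complex])
qed

text \<open>The product is left indexed by pairs of exponents: \<open>FE_mult\<close> collects it,
  while \<open>FE_cancel_lead\<close> works with the individual products of coefficients.\<close>

lemma has_fourier_expansion_mult:
  assumes f: "has_fourier_expansion \<phi> f" and g: "has_fourier_expansion \<psi> g" and that: "Im t > 0"
  shows "((\<lambda>(p, r). f (fst p) (snd p) * g (fst r) (snd r) * e2pi (of_nat (fst p + fst r) * t) * e2pi (of_int (snd p + snd r) * z))
          has_sum \<phi> t z * \<psi> t z) UNIV"
proof -
  have "((\<lambda>(n, l). f n l * e2pi (of_nat n * t) * e2pi (of_int l * z)) has_sum \<phi> t z) UNIV"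
       "((\<lambda>(n, l). g n l * e2pi (of_nat n * t) * e2pi (of_int l * z)) has_sum \<psi> t z) UNIV"
    using f g that unfolding has_fourier_expansion_def by blast+
  from has_sum_mult_prod[OF this]
  show ?thesis by (simp add: case_prod_unfold e2pi_add ring_distribs mult_ac)
qed

lemma FE_mult:
  assumes S: "coeff_ring S" and "FE S \<phi>" "FE S \<psi>"
  shows "FE S (\<lambda>t z. \<phi> t z * \<psi> t z)"
proof -
  obtain f g where fS: "\<And>n l. f n l \<in> S" and gS: "\<And>n l. g n l \<in> S" and f: "has_fourier_expansion \<phi> f" and g: "has_fourier_expansion \<psi> g"
    using assms unfolding FE_def by blast
  show ?thesis
    by (rule FE_series[OF S, where c = "\<lambda>(p, r). f (fst p) (snd p) * g (fst r) (snd r)" and N = "\<lambda>(p, r). fst p + fst r" and M = "\<lambda>(p, r). snd p + snd r"])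
       (use has_fourier_expansion_mult[OF f g] fS gS S in \<open>auto simp: case_prod_unfold coeff_ring_def\<close>)
qed

lemma FE_add:
  assumes S: "coeff_ring S" and "FE S \<phi>" "FE S \<psi>"
  shows "FE S (\<lambda>t z. \<phi> t z + \<psi> t z)"
proof -
  obtain f g where fS: "\<And>n l. f n l \<in> S" and gS: "\<And>n l. g n l \<in> S" and f: "has_fourier_expansion \<phi> f" and g: "has_fourier_expansion \<psi> g"
    using assms unfolding FE_def by blast
  have "has_fourier_expansion (\<lambda>t z. \<phi> t z + \<psi> t z) (\<lambda>n l. f n l + g n l)"
    unfolding has_fourier_expansion_def
  proof (intro allI impI)
    fix t z :: complex assume "Im t > 0"
    then have "((\<lambda>(n, l). f n l * e2pi (of_nat n * t) * e2pi (of_int l * z)) has_sum \<phi> t z) UNIV"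
       "((\<lambda>(n, l). g n l * e2pi (of_nat n * t) * e2pi (of_int l * z)) has_sum \<psi> t z) UNIV"
      using f g unfolding has_fourier_expansion_def by blast+
    from has_sum_add[OF this] show "((\<lambda>(n, l). (f n l + g n l) * e2pi (of_nat n * t) * e2pi (of_int l * z)) has_sum \<phi> t z + \<psi> t z) UNIV"
      by (simp add: case_prod_unfold algebra_simps)
  qed
  then show ?thesis unfolding FE_def using fS gS S by (intro exI[of _ "\<lambda>n l. f n l + g n l"]) (auto simp: coeff_ring_def)
qed

lemma FE_const: assumes "coeff_ring S" "a \<in> S" shows "FE S (\<lambda>t z. a)"
  unfolding FE_def
proof (intro exI conjI allI)
  show "(if n = (0::nat) \<and> l = (0::int) then a else 0) \<in> S" for n l
    using assms by (auto simp: coeff_ring_def)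
  show "has_fourier_expansion (\<lambda>t z. a) (\<lambda>n l. if n = 0 \<and> l = 0 then a else 0)"
    unfolding has_fourier_expansion_def
    by (intro allI impI has_sum_finite_neutralI[where B = "{(0,0)}"]) (auto split: if_splits)
qed

lemma FE_cong: "(\<And>t z. Im t > 0 \<Longrightarrow> \<phi> t z = \<psi> t z) \<Longrightarrow> FE S \<phi> \<longleftrightarrow> FE S \<psi>"
  unfolding FE_def has_fourier_expansion_def by simp

lemma FE_minus: assumes "coeff_ring S" "FE S \<phi>" shows "FE S (\<lambda>t z. - \<phi> t z)"
  using FE_mult[OF assms(1) FE_const[OF assms(1), of "-1"] assms(2)] assms by (auto simp: coeff_ring_def)

lemma FE_diff: assumes "coeff_ring S" "FE S \<phi>" "FE S \<psi>" shows "FE S (\<lambda>t z. \<phi> t z - \<psi> t z)"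
  using FE_add[OF assms(1,2) FE_minus[OF assms(1,3)]] by simp

lemma FE_power: assumes "coeff_ring S" "FE S \<phi>" shows "FE S (\<lambda>t z. \<phi> t z ^ n)"
proof (induction n)
  case 0
  show ?case using FE_const[of S 1] assms by (simp add: coeff_ring_def)
qed (use assms in \<open>auto intro!: FE_mult\<close>)

subsection \<open>Uniqueness of expansions\<close>

text \<open>Averaging over the B-th roots of unity replaces the Fourier integral. It keeps the
  coefficients with index congruent to k modulo B, and for large B those other than k have total
  size less than the supposed nonzero coefficient.\<close>

lemma trig_sum_zero_imp_coeff_zero:
  fixes a :: "int \<Rightarrow> complex"
  assumes hs: "\<And>x::real. ((\<lambda>l. a l * e2pi (of_int l * of_real x)) has_sum 0) UNIV"
  shows "a k = 0"
proof (rule ccontr)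
  assume ak: "a k \<noteq> 0"
  have "a summable_on UNIV" using hs[of 0] by (auto simp: summable_on_def)
  then have abs: "(\<lambda>l. norm (a l)) summable_on UNIV" by (simp add: summable_on_iff_abs_summable_on_complex)
  then have "(sum (\<lambda>l. norm (a l)) \<longlongrightarrow> infsum (\<lambda>l. norm (a l)) UNIV) (finite_subsets_at_top UNIV)"
    by (rule infsum_tendsto)
  from tendstoD[OF this, of "norm (a k)"] ak
  \<comment> \<open>Outside F the norms sum to less than the norm of \<open>a k\<close>.\<close>
  obtain F where F: "finite F" "dist (sum (\<lambda>l. norm (a l)) F) (infsum (\<lambda>l. norm (a l)) UNIV) < norm (a k)"
      "\<And>G. finite G \<Longrightarrow> F \<subseteq> G \<Longrightarrow> dist (sum (\<lambda>l. norm (a l)) G) (infsum (\<lambda>l. norm (a l)) UNIV) < norm (a k)"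
    unfolding eventually_finite_subsets_at_top by (metis order_refl subset_UNIV zero_less_norm_iff)
  \<comment> \<open>B exceeds every distance from k to an element of F, so no element of F other
    than k lies in its residue class.\<close>
  define B where "B = nat (Max ((\<lambda>l. \<bar>l - k\<bar>) ` insert k F)) + 1"
  have B: "\<bar>l - k\<bar> < int B" if "l \<in> insert k F" for l
  proof -
    have "\<bar>l - k\<bar> \<le> Max ((\<lambda>l. \<bar>l - k\<bar>) ` insert k F)" using that F(1) by (intro Max_ge) auto
    then show ?thesis unfolding B_def by linarith
  qed
  have Bpos: "B > 0" by (simp add: B_def)
  define w where "w = (\<lambda>j::nat. e2pi (of_int (- k) * of_real (real j / real B)))"
  define R where "R = {l. int B dvd (l - k)}"
  have avg: "(\<Sum>j<B. w j * e2pi (of_int l * of_real (real j / real B))) = (if l \<in> R then of_nat B else 0)" for l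
  proof -
    define \<zeta> where "\<zeta> = e2pi (of_int (l - k) / of_nat B)"
    have t: "w j * e2pi (of_int l * of_real (real j / real B)) = \<zeta> ^ j" for j
      unfolding w_def \<zeta>_def e2pi_of_nat_mult [symmetric] e2pi_add [symmetric]
      using Bpos by (intro arg_cong[where f = e2pi]) (simp add: field_simps)
    have z1: "\<zeta> = 1 \<longleftrightarrow> l \<in> R"
    proof -
      have "\<zeta> = 1 \<longleftrightarrow> (\<exists>n. (of_int (l - k) :: complex) / of_nat B = of_int n)"
        unfolding \<zeta>_def by (rule e2pi_eq_1_iff)
      also have "\<dots> \<longleftrightarrow> (\<exists>n. (of_int (l - k) :: complex) = of_int (n * int B))"
        using Bpos by (simp add: field_simps)
      also have "\<dots> \<longleftrightarrow> (\<exists>n. l - k = n * int B)" unfolding of_int_eq_iff ..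
      finally show ?thesis unfolding R_def dvd_def by (auto simp: mult.commute)
    qed
    have zB: "\<zeta> ^ B = 1"
      unfolding \<zeta>_def e2pi_of_nat_mult [symmetric] using Bpos by (simp add: e2pi_of_int del: of_int_diff)
    show ?thesis unfolding t using z1 zB by (auto simp: sum_gp_strict)
  qed
  have "((\<lambda>l. \<Sum>j<B. w j * (a l * e2pi (of_int l * of_real (real j / real B)))) has_sum (\<Sum>j<B. w j * 0)) UNIV"
    by (intro has_sum_finite_sum has_sum_cmult_right hs) auto
  then have "((\<lambda>l. a l * (\<Sum>j<B. w j * e2pi (of_int l * of_real (real j / real B)))) has_sum 0) UNIV"
    by (simp add: sum_distrib_left mult_ac)
  then have "((\<lambda>l. a l * (if l \<in> R then of_nat B else 0)) has_sum 0) UNIV"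
    by (simp only: avg)
  then have "((\<lambda>l. inverse (of_nat B) * (a l * (if l \<in> R then of_nat B else 0))) has_sum inverse (of_nat B) * 0) UNIV"
    by (rule has_sum_cmult_right)
  then have "((\<lambda>l. inverse (of_nat B) * (a l * (if l \<in> R then of_nat B else 0))) has_sum 0) UNIV"
    by simp
  also have "?this \<longleftrightarrow> (a has_sum 0) R"
    by (rule has_sum_cong_neutral) (use Bpos in auto)
  finally have "(a has_sum 0) R" .
  have kR: "k \<in> R" by (simp add: R_def)
  have "(a has_sum (0 - a k)) (R - {k})"
    using kR by (intro has_sum_Diff \<open>(a has_sum 0) R\<close> has_sum_finiteI) auto
  then have "norm (0 - a k) \<le> infsum (\<lambda>l. norm (a l)) (R - {k})"
    by (rule norm_infsum_le[OF _ has_sum_infsum]) (auto intro: summable_on_subset_banach[OF abs])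
  also have "\<dots> \<le> infsum (\<lambda>l. norm (a l)) (UNIV - insert k F)"
  proof (rule infsum_mono2)
    show "R - {k} \<subseteq> UNIV - insert k F"
    proof
      fix l assume l: "l \<in> R - {k}"
      show "l \<in> UNIV - insert k F"
      proof (rule ccontr)
        assume "l \<notin> UNIV - insert k F"
        then have "\<bar>l - k\<bar> < int B" using B by blast
        moreover have "int B dvd l - k" "l - k \<noteq> 0" using l by (auto simp: R_def)
        ultimately show False using dvd_imp_le_int[of "l - k" "int B"] by linarith
      qed
    qed
  qed (auto intro: summable_on_subset_banach[OF abs])
  also have "\<dots> = infsum (\<lambda>l. norm (a l)) UNIV - sum (\<lambda>l. norm (a l)) (insert k F)"
    using F(1) by (subst infsum_Diff[OF abs]) auto
  also have "\<dots> < norm (a k)"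
  proof -
    have "dist (sum (\<lambda>l. norm (a l)) (insert k F)) (infsum (\<lambda>l. norm (a l)) UNIV) < norm (a k)"
      by (rule F(3)) (use F(1) in auto)
    then show ?thesis unfolding dist_real_def by linarith
  qed
  finally show False by simp
qed

text \<open>The inner sums are the Fourier coefficients in the first variable, so two applications
  of the one-variable case suffice.\<close>

lemma trig_double_sum_zero_imp_coeff_zero:
  fixes a :: "int \<times> int \<Rightarrow> complex"
  assumes hs: "\<And>x w::real. ((\<lambda>(n, l). a (n, l) * e2pi (of_int n * of_real x) * e2pi (of_int l * of_real w)) has_sum 0) UNIV"
  shows "a (n, l) = 0"
proof -
  have sa: "a summable_on UNIV" using hs[of 0 0] by (auto simp: summable_on_def case_prod_unfold)
  define b where "b = (\<lambda>w::real. \<lambda>n. \<Sum>\<^sub>\<infinity>l. a (n, l) * e2pi (of_int l * of_real w))"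
  have s1: "(\<lambda>l. a (n, l) * e2pi (of_int l * of_real w)) summable_on UNIV" for n and w :: real
  proof -
    have "(\<lambda>l. norm (a (n, l))) summable_on UNIV"
    proof -
      have "a summable_on range (Pair n)" by (rule summable_on_subset_banach[OF sa]) auto
      then have "(a \<circ> Pair n) summable_on UNIV" by (subst (asm) summable_on_reindex) (auto simp: inj_on_def)
      then show ?thesis by (simp add: summable_on_iff_abs_summable_on_complex o_def)
    qed
    then have "(\<lambda>l. norm (a (n, l) * e2pi (of_int l * of_real w))) summable_on UNIV"
      by (simp add: norm_mult norm_e2pi)
    then show ?thesis by (simp add: summable_on_iff_abs_summable_on_complex)
  qed
  have "((\<lambda>n. b w n * e2pi (of_int n * of_real x)) has_sum 0) UNIV" for x w :: real
  proof -
    have "((\<lambda>(n, l). a (n, l) * e2pi (of_int n * of_real x) * e2pi (of_int l * of_real w)) has_sum 0) (Sigma UNIV (\<lambda>_. UNIV))"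
      using hs by simp
    then show ?thesis
    proof (rule has_sum_SigmaD)
      fix n :: int
      have "((\<lambda>l. a (n, l) * e2pi (of_int l * of_real w)) has_sum b w n) UNIV"
        unfolding b_def using s1 by (rule has_sum_infsum)
      from has_sum_cmult_left[OF this, of "e2pi (of_int n * of_real x)"]
      show "((\<lambda>l. case (n, l) of (n, l) \<Rightarrow> a (n, l) * e2pi (of_int n * of_real x) * e2pi (of_int l * of_real w)) has_sum b w n * e2pi (of_int n * of_real x)) UNIV"
        by (simp add: mult_ac)
    qed
  qed
  then have "b w n = 0" for w n
    using trig_sum_zero_imp_coeff_zero[of "b w"] by blast
  then have "((\<lambda>l. a (n, l) * e2pi (of_int l * of_real w)) has_sum 0) UNIV" for w
    using has_sum_infsum[OF s1[of n w]] by (simp add: b_def)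
  then show ?thesis using trig_sum_zero_imp_coeff_zero[of "\<lambda>l. a (n, l)" l] by blast
qed

text \<open>On the line Im t = 1 the weight e(n i) is absorbed into the coefficients, and extending
  them by zero to negative n makes the sum a double trigonometric series.\<close>

lemma has_fourier_expansion_unique:
  assumes f: "has_fourier_expansion \<phi> f" and g: "has_fourier_expansion \<phi> g"
  shows "f = g"
proof (intro ext)
  fix n0 l0
  define a where "a = (\<lambda>p. if fst p \<ge> (0::int) then (f (nat (fst p)) (snd p) - g (nat (fst p)) (snd p)) * e2pi (of_int (fst p) * \<i>) else 0)"
  have a_neg: "a (n, l) = 0" if "\<not> n \<ge> 0" for n l
    using that by (simp add: a_def)
  have "a (int n0, l0) = 0"
  proof (rule trig_double_sum_zero_imp_coeff_zero)
    fix x w :: real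
    define t where "t = \<i> + of_real x"
    have t: "Im t > 0" by (simp add: t_def)
    have e2t: "e2pi (of_nat n * t) = e2pi (of_nat n * \<i>) * e2pi (of_nat n * of_real x)" for n
      by (simp add: t_def e2pi_add ring_distribs)
    have "((\<lambda>(n, l). f n l * e2pi (of_nat n * t) * e2pi (of_int l * of_real w)) has_sum \<phi> t w) UNIV"
       "((\<lambda>(n, l). g n l * e2pi (of_nat n * t) * e2pi (of_int l * of_real w)) has_sum \<phi> t w) UNIV"
      using f g t unfolding has_fourier_expansion_def by blast+
    from has_sum_add[OF this(1) has_sum_uminusI[OF this(2)]]
    have "((\<lambda>(n, l). (f n l - g n l) * e2pi (of_nat n * t) * e2pi (of_int l * of_real w)) has_sum 0) UNIV"
      by (simp add: case_prod_unfold left_diff_distrib)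
    also have "?this \<longleftrightarrow> ((\<lambda>(n, l). a (n, l) * e2pi (of_int n * of_real x) * e2pi (of_int l * of_real w)) has_sum 0) ({0..} \<times> UNIV)"
      by (rule has_sum_reindex_bij_witness[where i = "\<lambda>(n, l). (nat n, l)" and j = "\<lambda>(n, l). (int n, l)"])
         (auto simp: a_def e2t mult.assoc)
    also have "\<dots> \<longleftrightarrow> ((\<lambda>(n, l). a (n, l) * e2pi (of_int n * of_real x) * e2pi (of_int l * of_real w)) has_sum 0) UNIV"
    proof (rule has_sum_cong_neutral)
      fix p assume "p \<in> UNIV - {0::int..} \<times> (UNIV :: int set)"
      then have "\<not> fst p \<ge> 0" by (cases p) simp
      from a_neg[OF this, of "snd p"]
      show "(case p of (n, l) \<Rightarrow> a (n, l) * e2pi (of_int n * of_real x) * e2pi (of_int l * of_real w)) = 0"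
        by (simp add: case_prod_unfold)
    next
      fix p assume "p \<in> {0::int..} \<times> UNIV - (UNIV :: (int \<times> int) set)"
      then show "(case p of (n, l) \<Rightarrow> a (n, l) * e2pi (of_int n * of_real x) * e2pi (of_int l * of_real w)) = 0"
        by blast
    qed (rule refl)
    finally show "((\<lambda>(n, l). a (n, l) * e2pi (of_int n * of_real x) * e2pi (of_int l * of_real w)) has_sum 0) UNIV" .
  qed
  then show "f n0 l0 = g n0 l0" by (simp add: a_def)
qed

lemma jcoeff_eq: "has_fourier_expansion \<phi> f \<Longrightarrow> jcoeff \<phi> = f"
  unfolding jcoeff_def by (rule the_equality) (auto intro: has_fourier_expansion_unique)

subsection \<open>Functions of the nome\<close>

text \<open>\<open>h\<close> is a holomorphic function of the nome q = e(t) on the whole unit disc,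
  and \<open>c\<close> is its value at q = 0. Periodicity and regularity at the cusp are thus one
  property, closed under sums and products.\<close>

definition qval :: "(complex \<Rightarrow> complex) \<Rightarrow> complex \<Rightarrow> bool" where
  "qval h c \<longleftrightarrow> (\<exists>g. g holomorphic_on ball 0 1 \<and> g 0 = c \<and> (\<forall>t. Im t > 0 \<longrightarrow> h t = g (e2pi t)))"

lemma qval_const [simp]: "qval (\<lambda>t. c) c"
  unfolding qval_def by (intro exI[of _ "\<lambda>_. c"]) auto

lemma qval_add: "qval f a \<Longrightarrow> qval g b \<Longrightarrow> qval (\<lambda>t. f t + g t) (a + b)"
  unfolding qval_def
proof (elim exE conjE)
  fix F G assume "F holomorphic_on ball 0 1" "G holomorphic_on ball 0 1" "F 0 = a" "G 0 = b"
    "\<forall>t. 0 < Im t \<longrightarrow> f t = F (e2pi t)" "\<forall>t. 0 < Im t \<longrightarrow> g t = G (e2pi t)"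
  then show "\<exists>H. H holomorphic_on ball 0 1 \<and> H 0 = a + b \<and> (\<forall>t. 0 < Im t \<longrightarrow> f t + g t = H (e2pi t))"
    by (intro exI[of _ "\<lambda>q. F q + G q"]) (auto intro!: holomorphic_intros)
qed

lemma qval_mult: "qval f a \<Longrightarrow> qval g b \<Longrightarrow> qval (\<lambda>t. f t * g t) (a * b)"
  unfolding qval_def
proof (elim exE conjE)
  fix F G assume "F holomorphic_on ball 0 1" "G holomorphic_on ball 0 1" "F 0 = a" "G 0 = b"
    "\<forall>t. 0 < Im t \<longrightarrow> f t = F (e2pi t)" "\<forall>t. 0 < Im t \<longrightarrow> g t = G (e2pi t)"
  then show "\<exists>H. H holomorphic_on ball 0 1 \<and> H 0 = a * b \<and> (\<forall>t. 0 < Im t \<longrightarrow> f t * g t = H (e2pi t))"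
    by (intro exI[of _ "\<lambda>q. F q * G q"]) (auto intro!: holomorphic_intros)
qed

lemma qval_cong: "(\<And>t. Im t > 0 \<Longrightarrow> f t = g t) \<Longrightarrow> a = b \<Longrightarrow> qval f a \<longleftrightarrow> qval g b"
  unfolding qval_def by auto

lemma qval_minus: "qval f a \<Longrightarrow> qval (\<lambda>t. - f t) (- a)"
  using qval_mult[OF qval_const[of "-1"], of f a] by simp

lemma qval_diff: "qval f a \<Longrightarrow> qval g b \<Longrightarrow> qval (\<lambda>t. f t - g t) (a - b)"
  using qval_add[OF _ qval_minus, of f a g b] by simp

lemma qval_sum: "finite I \<Longrightarrow> (\<And>i. i \<in> I \<Longrightarrow> qval (f i) (a i)) \<Longrightarrow> qval (\<lambda>t. \<Sum>i\<in>I. f i t) (\<Sum>i\<in>I. a i)"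
  by (induction I rule: finite_induct) (auto intro: qval_add)

lemma qval_power: "qval f a \<Longrightarrow> qval (\<lambda>t. f t ^ n) (a ^ n)"
  by (induction n) (auto intro: qval_mult)

lemma qval_isCont:
  assumes "g holomorphic_on ball 0 1" shows "isCont g (0::complex)"
  using holomorphic_on_imp_continuous_on[OF assms] by (simp add: continuous_on_eq_continuous_at)

text \<open>The nome omits only the value 0 of the disc, so the two representing functions agree
  near 0 and, by continuity, at 0.\<close>

lemma qval_unique:
  assumes "qval h a" "qval h b" shows "a = b"
proof -
  obtain F where F: "F holomorphic_on ball 0 1" "F 0 = a" "\<And>t. 0 < Im t \<Longrightarrow> h t = F (e2pi t)"
    using assms(1) unfolding qval_def by blast
  obtain G where G: "G holomorphic_on ball 0 1" "G 0 = b" "\<And>t. 0 < Im t \<Longrightarrow> h t = G (e2pi t)"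
    using assms(2) unfolding qval_def by blast
  have "F \<midarrow>0\<rightarrow> F 0" "G \<midarrow>0\<rightarrow> G 0"
    using qval_isCont[OF F(1)] qval_isCont[OF G(1)] by (auto simp: isCont_def)
  moreover have "eventually (\<lambda>q. F q = G q) (at 0)"
  proof -
    have "eventually (\<lambda>q. q \<in> ball 0 1 - {0}) (at (0::complex))"
      by (rule eventually_at_in_open) auto
    then show ?thesis
    proof eventually_elim
      case (elim q)
      then obtain t where "e2pi t = q" "Im t > 0" using e2pi_surj_H[of q] by auto
      then show ?case using F(3) G(3) by metis
    qed
  qed
  ultimately have "G \<midarrow>0\<rightarrow> F 0" by (metis tendsto_cong)
  then have "F 0 = G 0" using \<open>G \<midarrow>0\<rightarrow> G 0\<close> by (rule LIM_unique)
  then show ?thesis using F G by simp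
qed

text \<open>Every q with 0 < |q| < 1 is some e(t), so the collected power series converges on the
  whole unit disc.\<close>

lemma qval_series:
  fixes N :: "'k \<Rightarrow> nat"
  assumes hs: "\<And>t. Im t > 0 \<Longrightarrow> ((\<lambda>k. c k * e2pi (of_nat (N k) * t)) has_sum h t) UNIV"
  shows "qval h (\<Sum>\<^sub>\<infinity>k. if N k = 0 then c k else 0)"
proof -
  let ?F = "\<lambda>n. {k. N k = n}"
  let ?X = "\<lambda>t k. c k * e2pi (of_nat (N k) * t)"
  define a where "a = (\<lambda>n. \<Sum>\<^sub>\<infinity>k\<in>?F n. c k)"
  have sumfib: "c summable_on ?F n" for n
  proof -
    have "?X \<i> summable_on UNIV" using hs[of \<i>] by (auto simp: summable_on_def)
    then have "?X \<i> summable_on ?F n" by (rule summable_on_subset_banach) auto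
    also have "?this \<longleftrightarrow> (\<lambda>k. c k * e2pi (of_nat n * \<i>)) summable_on ?F n"
      by (rule summable_on_cong) auto
    finally have "(\<lambda>k. c k * e2pi (of_nat n * \<i>) * inverse (e2pi (of_nat n * \<i>))) summable_on ?F n"
      by (rule summable_on_cmult_left)
    then show ?thesis by (simp add: mult.assoc)
  qed
  have s: "(\<lambda>n. a n * e2pi t ^ n) sums h t" if t: "Im t > 0" for t
  proof -
    have bij: "bij_betw snd (Sigma UNIV ?F) UNIV"
      by (rule bij_betwI[where g = "\<lambda>k. (N k, k)"]) auto
    have "((\<lambda>x. ?X t (snd x)) has_sum h t) (Sigma UNIV ?F)"
      using hs[OF t] has_sum_reindex_bij_betw[OF bij, of "?X t"] by blast
    moreover have "((\<lambda>k. ?X t (snd (n, k))) has_sum (a n * e2pi t ^ n)) (?F n)" for n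
    proof -
      have "((\<lambda>k. c k * e2pi t ^ n) has_sum a n * e2pi t ^ n) (?F n)"
        unfolding a_def by (intro has_sum_cmult_left has_sum_infsum sumfib)
      then show ?thesis by (subst has_sum_cong[where g = "\<lambda>k. c k * e2pi t ^ n"]) (auto simp: e2pi_of_nat_mult)
    qed
    ultimately have "((\<lambda>n. a n * e2pi t ^ n) has_sum h t) UNIV"
      by (rule has_sum_SigmaD)
    then show ?thesis by (rule has_sum_imp_sums)
  qed
  define g where "g = (\<lambda>q. suminf (\<lambda>n. a n * q ^ n))"
  have gs: "(\<lambda>n. a n * q ^ n) sums g q" if "q \<in> ball 0 1" for q
  proof (cases "q = 0")
    case True
    have "(\<lambda>n. a n * q ^ n) sums a 0" using powser_sums_zero[of a] True by simp
    then show ?thesis unfolding g_def by (simp add: sums_iff)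
  next
    case False
    have "norm q < 1" using that by simp
    then obtain t where "e2pi t = q" "Im t > 0" using e2pi_surj_H[OF False] by blast
    then show ?thesis using s[of t] unfolding g_def by (auto simp: sums_iff)
  qed
  have "g holomorphic_on ball 0 1"
    by (rule power_series_holomorphic[where a = a]) (use gs in auto)
  moreover have "g 0 = a 0" unfolding g_def by (rule powser_zero)
  moreover have "a 0 = (\<Sum>\<^sub>\<infinity>k. if N k = 0 then c k else 0)"
    unfolding a_def by (rule infsum_cong_neutral) auto
  moreover have "h t = g (e2pi t)" if "Im t > 0" for t
    using s[OF that] gs[OF e2pi_in_ball[OF that]] by (rule sums_unique2)
  ultimately show ?thesis unfolding qval_def by metis
qed

subsection \<open>Families of entire functions\<close>

text \<open>\<open>p\<close> is the value at the cusp, that is, the q^0-row as a function of z. Only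
  the Taylor coefficients at z = 0 are required to be functions of the nome: this weak condition
  survives division by a theta function, and it still determines \<open>p\<close>.\<close>

definition jfam :: "jform \<Rightarrow> (complex \<Rightarrow> complex) \<Rightarrow> bool" where
  "jfam \<phi> p \<longleftrightarrow> (\<forall>t. Im t > 0 \<longrightarrow> \<phi> t is_entire) \<and> p is_entire \<and>
     (\<forall>k. qval (\<lambda>t. (deriv ^^ k) (\<phi> t) 0) ((deriv ^^ k) p 0))"

lemma jfam_hol: "jfam \<phi> p \<Longrightarrow> Im t > 0 \<Longrightarrow> \<phi> t is_entire"
  and jfam_hol_p: "jfam \<phi> p \<Longrightarrow> p is_entire"
  and jfam_qval: "jfam \<phi> p \<Longrightarrow> qval (\<lambda>t. (deriv ^^ k) (\<phi> t) 0) ((deriv ^^ k) p 0)"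
  unfolding jfam_def by auto

lemma jfam_qval0: "jfam \<phi> p \<Longrightarrow> qval (\<lambda>t. \<phi> t 0) (p 0)"
  using jfam_qval[of \<phi> p 0] by simp

text \<open>An entire function is determined by its Taylor coefficients at 0, and those of
  \<open>p\<close> are cusp values.\<close>

lemma jfam_unique: assumes "jfam \<phi> p" "jfam \<phi> r" shows "p = r"
proof
  fix w
  show "p w = r w"
    by (rule holomorphic_fun_eq_on_connected[OF jfam_hol_p[OF assms(1)] jfam_hol_p[OF assms(2)], of 0])
       (auto intro: qval_unique[OF jfam_qval[OF assms(1)] jfam_qval[OF assms(2)]])
qed

lemma jfam_cong: "(\<And>t z. Im t > 0 \<Longrightarrow> \<phi> t z = \<psi> t z) \<Longrightarrow> jfam \<phi> p \<longleftrightarrow> jfam \<psi> p"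
proof -
  assume a: "\<And>t z. Im t > 0 \<Longrightarrow> \<phi> t z = \<psi> t z"
  have e: "Im t > 0 \<Longrightarrow> \<phi> t = \<psi> t" for t using a by auto
  have "qval (\<lambda>t. (deriv ^^ k) (\<phi> t) 0) ((deriv ^^ k) p 0) \<longleftrightarrow> qval (\<lambda>t. (deriv ^^ k) (\<psi> t) 0) ((deriv ^^ k) p 0)" for k
    by (rule qval_cong) (simp_all add: e)
  then show ?thesis unfolding jfam_def using e by auto
qed

lemma jfam_add: assumes "jfam \<phi> p" "jfam \<psi> r" shows "jfam (\<lambda>t z. \<phi> t z + \<psi> t z) (\<lambda>z. p z + r z)"
  unfolding jfam_def
proof (intro conjI allI impI)
  fix k
  have "qval (\<lambda>t. (deriv ^^ k) (\<phi> t) 0 + (deriv ^^ k) (\<psi> t) 0) ((deriv ^^ k) p 0 + (deriv ^^ k) r 0)"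
    by (intro qval_add jfam_qval assms)
  then show "qval (\<lambda>t. (deriv ^^ k) (\<lambda>z. \<phi> t z + \<psi> t z) 0) ((deriv ^^ k) (\<lambda>z. p z + r z) 0)"
    by (rule iffD1[OF qval_cong, rotated 2])
       (auto simp: higher_deriv_add[OF jfam_hol[OF assms(1)] jfam_hol[OF assms(2)] open_UNIV]
          higher_deriv_add[OF jfam_hol_p[OF assms(1)] jfam_hol_p[OF assms(2)] open_UNIV])
qed (use jfam_hol[OF assms(1)] jfam_hol[OF assms(2)] jfam_hol_p[OF assms(1)] jfam_hol_p[OF assms(2)] in \<open>auto intro!: holomorphic_intros\<close>)

lemma jfam_mult: assumes "jfam \<phi> p" "jfam \<psi> r" shows "jfam (\<lambda>t z. \<phi> t z * \<psi> t z) (\<lambda>z. p z * r z)"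
  unfolding jfam_def
proof (intro conjI allI impI)
  fix k
  have "qval (\<lambda>t. \<Sum>i = 0..k. of_nat (k choose i) * (deriv ^^ i) (\<phi> t) 0 * (deriv ^^ (k - i)) (\<psi> t) 0)
     (\<Sum>i = 0..k. of_nat (k choose i) * (deriv ^^ i) p 0 * (deriv ^^ (k - i)) r 0)"
    by (intro qval_sum qval_mult qval_const jfam_qval assms) auto
  then show "qval (\<lambda>t. (deriv ^^ k) (\<lambda>z. \<phi> t z * \<psi> t z) 0) ((deriv ^^ k) (\<lambda>z. p z * r z) 0)"
    by (rule iffD1[OF qval_cong, rotated 2])
       (auto simp: higher_deriv_mult[OF jfam_hol[OF assms(1)] jfam_hol[OF assms(2)] open_UNIV]
          higher_deriv_mult[OF jfam_hol_p[OF assms(1)] jfam_hol_p[OF assms(2)] open_UNIV])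
qed (use jfam_hol[OF assms(1)] jfam_hol[OF assms(2)] jfam_hol_p[OF assms(1)] jfam_hol_p[OF assms(2)] in \<open>auto intro!: holomorphic_intros\<close>)

lemma jfam_qval_const: assumes "qval h c" shows "jfam (\<lambda>t z. h t) (\<lambda>z. c)"
  unfolding jfam_def
proof (intro conjI allI impI)
  fix k
  show "qval (\<lambda>t. (deriv ^^ k) (\<lambda>z. h t) 0) ((deriv ^^ k) (\<lambda>z. c) 0)"
    using assms by (cases "k = 0") auto
qed auto

lemma jfam_const: "jfam (\<lambda>t z. c) (\<lambda>z. c)"
  by (rule jfam_qval_const) auto

lemma jfam_minus: "jfam \<phi> p \<Longrightarrow> jfam (\<lambda>t z. - \<phi> t z) (\<lambda>z. - p z)"
  using jfam_mult[OF jfam_const[of "-1"], of \<phi> p] by simp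

lemma jfam_diff: "jfam \<phi> p \<Longrightarrow> jfam \<psi> r \<Longrightarrow> jfam (\<lambda>t z. \<phi> t z - \<psi> t z) (\<lambda>z. p z - r z)"
  using jfam_add[OF _ jfam_minus, of \<phi> p \<psi> r] by simp

lemma jfam_power: "jfam \<phi> p \<Longrightarrow> jfam (\<lambda>t z. \<phi> t z ^ n) (\<lambda>z. p z ^ n)"
  by (induction n) (auto intro: jfam_mult jfam_const)

lemma jfam_deriv: assumes "jfam \<phi> p" shows "jfam (\<lambda>t. deriv (\<phi> t)) (deriv p)"
  unfolding jfam_def
proof (intro conjI allI impI)
  fix k
  show "qval (\<lambda>t. (deriv ^^ k) (deriv (\<phi> t)) 0) ((deriv ^^ k) (deriv p) 0)"
    using jfam_qval[OF assms, of "Suc k"] by (simp add: funpow_Suc_right del: funpow.simps)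
qed (use jfam_hol[OF assms] jfam_hol_p[OF assms] in \<open>auto intro!: holomorphic_deriv\<close>)

lemma jfam_scale: assumes "jfam \<phi> p" shows "jfam (\<lambda>t z. \<phi> t (u * z)) (\<lambda>z. p (u * z))"
  unfolding jfam_def
proof (intro conjI allI impI)
  fix k
  have "qval (\<lambda>t. u ^ k * (deriv ^^ k) (\<phi> t) 0) (u ^ k * (deriv ^^ k) p 0)"
    by (intro qval_mult qval_const jfam_qval assms)
  then show "qval (\<lambda>t. (deriv ^^ k) (\<lambda>z. \<phi> t (u * z)) 0) ((deriv ^^ k) (\<lambda>z. p (u * z)) 0)"
    by (rule iffD1[OF qval_cong, rotated 2])
       (auto simp: higher_deriv_compose_linear[OF jfam_hol[OF assms] open_UNIV open_UNIV] higher_deriv_compose_linear[OF jfam_hol_p[OF assms] open_UNIV open_UNIV])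
next
  fix t :: complex assume "Im t > 0"
  then show "(\<lambda>z. \<phi> t (u * z)) is_entire"
    using holomorphic_on_compose_gen[OF _ jfam_hol[OF assms], of "\<lambda>z. u * z" UNIV t] by (auto simp: o_def intro!: holomorphic_intros)
next
  show "(\<lambda>z. p (u * z)) is_entire"
    using holomorphic_on_compose_gen[OF _ jfam_hol_p[OF assms], of "\<lambda>z. u * z" UNIV] by (auto simp: o_def intro!: holomorphic_intros)
qed

text \<open>Leibniz at order k + 1: the term with no derivative on F vanishes, the next one contains
  the wanted derivative of G, and all others involve lower derivatives of G.\<close>

lemma higher_deriv_quotient:
  fixes F G H :: "complex \<Rightarrow> complex"
  assumes "F is_entire" "G is_entire" "\<And>z. F z * G z = H z" "F 0 = 0" "deriv F 0 = \<delta>" "\<delta> \<noteq> 0"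
  shows "(deriv ^^ k) G 0 = inverse (of_nat (Suc k) * \<delta>) *
     ((deriv ^^ Suc k) H 0 + - 1 * (\<Sum>i = 2..Suc k. of_nat (Suc k choose i) * (deriv ^^ i) F 0 * (deriv ^^ (Suc k - i)) G 0))"
proof -
  have "H = (\<lambda>z. F z * G z)" using assms(3) by auto
  then have "(deriv ^^ Suc k) H 0 = (\<Sum>i = 0..Suc k. of_nat (Suc k choose i) * (deriv ^^ i) F 0 * (deriv ^^ (Suc k - i)) G 0)"
    by (simp only: higher_deriv_mult[OF assms(1,2) open_UNIV UNIV_I])
  also have "{0..Suc k} = insert 0 (insert 1 {2..Suc k})" by auto
  also have "(\<Sum>i\<in>insert 0 (insert 1 {2..Suc k}). of_nat (Suc k choose i) * (deriv ^^ i) F 0 * (deriv ^^ (Suc k - i)) G 0)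
     = of_nat (Suc k) * \<delta> * (deriv ^^ k) G 0 + (\<Sum>i = 2..Suc k. of_nat (Suc k choose i) * (deriv ^^ i) F 0 * (deriv ^^ (Suc k - i)) G 0)"
    using assms(4,5) by (subst sum.insert | simp)+
  finally show ?thesis using assms(6) by (simp add: field_simps del: of_nat_Suc funpow.simps binomial_Suc_Suc)
qed

text \<open>The recursion of \<open>higher_deriv_quotient\<close> divides only by the constants (k +
  1) \<delta>. As \<delta> does not depend on t, no inverse of a function of the nome is
  taken.\<close>

lemma jfam_divide:
  assumes A: "jfam A a" and B: "jfam B b"
    and C: "\<And>t. Im t > 0 \<Longrightarrow> C t is_entire" "c is_entire"
    and mult: "\<And>t z. Im t > 0 \<Longrightarrow> A t z * C t z = B t z" "\<And>z. a z * c z = b z"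
    and A0: "\<And>t. Im t > 0 \<Longrightarrow> A t 0 = 0" "\<And>t. Im t > 0 \<Longrightarrow> deriv (A t) 0 = \<delta>" "\<delta> \<noteq> 0"
    and a0: "a 0 = 0" "deriv a 0 = \<delta>"
  shows "jfam C c"
  unfolding jfam_def
proof (intro conjI allI impI)
  fix k
  show "qval (\<lambda>t. (deriv ^^ k) (C t) 0) ((deriv ^^ k) c 0)"
  proof (induction k rule: less_induct)
    case (less k)
    have 0: "qval (\<lambda>t. inverse (of_nat (Suc k) * \<delta>) *
     ((deriv ^^ Suc k) (B t) 0 + - 1 * (\<Sum>i = 2..Suc k. of_nat (Suc k choose i) * (deriv ^^ i) (A t) 0 * (deriv ^^ (Suc k - i)) (C t) 0)))
     (inverse (of_nat (Suc k) * \<delta>) *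
     ((deriv ^^ Suc k) b 0 + - 1 * (\<Sum>i = 2..Suc k. of_nat (Suc k choose i) * (deriv ^^ i) a 0 * (deriv ^^ (Suc k - i)) c 0)))"
      by (intro qval_mult qval_const qval_add qval_sum jfam_qval[OF A] jfam_qval[OF B] less) auto
    have 1: "(deriv ^^ k) (C t) 0 = inverse (of_nat (Suc k) * \<delta>) *
     ((deriv ^^ Suc k) (B t) 0 + - 1 * (\<Sum>i = 2..Suc k. of_nat (Suc k choose i) * (deriv ^^ i) (A t) 0 * (deriv ^^ (Suc k - i)) (C t) 0))" if "Im t > 0" for t
      by (rule higher_deriv_quotient[OF jfam_hol[OF A that] C(1)[OF that] mult(1)[OF that] A0(1)[OF that] A0(2)[OF that] A0(3)])
    have 2: "(deriv ^^ k) c 0 = inverse (of_nat (Suc k) * \<delta>) *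
     ((deriv ^^ Suc k) b 0 + - 1 * (\<Sum>i = 2..Suc k. of_nat (Suc k choose i) * (deriv ^^ i) a 0 * (deriv ^^ (Suc k - i)) c 0))"
      by (rule higher_deriv_quotient[OF jfam_hol_p[OF A] C(2) mult(2) a0 A0(3)])
    show ?case by (rule iffD2[OF qval_cong, OF 1 2 0])
  qed
qed (use C in auto)

subsection \<open>Exponential sums as families\<close>

lemma esum_has_field_derivative:
  assumes "esummable c N M" "Im t > 0"
  shows "(esum c N M t has_field_derivative esum (\<lambda>k. c k * (\<kappa> * of_real (M k))) N M t z) (at z)"
proof -
  let ?A = "esum (\<lambda>k. c k * (\<kappa> * of_real (N k))) N M t z" and ?B = "esum (\<lambda>k. c k * (\<kappa> * of_real (M k))) N M t z"
  have d: "(Pair t has_derivative (\<lambda>k. (0, k))) (at z)"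
    by (auto intro!: derivative_eq_intros)
  have "((\<lambda>w. (\<lambda>(t, z). esum c N M t z) (t, w)) has_derivative (\<lambda>k. (\<lambda>(h, k). ?A * h + ?B * k) (0, k))) (at z)"
    by (rule has_derivative_compose[OF d]) (rule esum_has_derivative[OF assms])
  then show ?thesis by (simp add: has_field_derivative_def)
qed

lemma esum_higher_deriv:
  assumes "esummable c N M" "Im t > 0"
  shows "(deriv ^^ j) (esum c N M t) z = esum (\<lambda>k. c k * (\<kappa> * of_real (M k)) ^ j) N M t z"
    and "esummable (\<lambda>k. c k * (\<kappa> * of_real (M k)) ^ j) N M"
proof -
  have *: "esummable (\<lambda>k. c k * (\<kappa> * of_real (M k)) ^ j) N M" for j
  proof (induction j)
    case (Suc j)
    from esummable_deriv_z[OF this] show ?case by (simp add: mult_ac)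
  qed (use assms in simp)
  show "esummable (\<lambda>k. c k * (\<kappa> * of_real (M k)) ^ j) N M" by (rule *)
  show "(deriv ^^ j) (esum c N M t) z = esum (\<lambda>k. c k * (\<kappa> * of_real (M k)) ^ j) N M t z"
  proof (induction j arbitrary: z)
    case (Suc j)
    have "(deriv ^^ j) (esum c N M t) = esum (\<lambda>k. c k * (\<kappa> * of_real (M k)) ^ j) N M t"
      using Suc by (intro ext)
    then have "(deriv ^^ Suc j) (esum c N M t) z = deriv (esum (\<lambda>k. c k * (\<kappa> * of_real (M k)) ^ j) N M t) z"
      by simp
    also have "\<dots> = esum (\<lambda>k. c k * (\<kappa> * of_real (M k)) ^ j * (\<kappa> * of_real (M k))) N M t z"
      by (rule DERIV_imp_deriv[OF esum_has_field_derivative[OF * assms(2)]])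
    finally show ?case by (simp add: mult_ac)
  qed simp
qed

lemma esum_holomorphic: "esummable c N M \<Longrightarrow> Im t > 0 \<Longrightarrow> esum c N M t is_entire"
  unfolding holomorphic_on_def field_differentiable_def using esum_has_field_derivative[of c N M t] by auto

lemma esum_has_sum: "esummable c N M \<Longrightarrow> Im t > 0 \<Longrightarrow> (eterm c N M t z has_sum esum c N M t z) UNIV"
  unfolding esummable_def esum_def by (intro has_sum_infsum) auto

text \<open>Terms with \<open>N k = 0\<close> do not depend on t, so the cusp value is itself an
  exponential sum, which may be evaluated at any point, here at i.\<close>

lemma jfam_esum:
  fixes N :: "'k \<Rightarrow> nat"
  assumes c: "esummable c (\<lambda>k. real (N k)) M"
  shows "jfam (esum c (\<lambda>k. real (N k)) M) (\<lambda>z. \<Sum>\<^sub>\<infinity>k\<in>{k. N k = 0}. c k * e2pi (of_real (M k) * z))"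
proof -
  define c0 where "c0 = (\<lambda>k. if N k = 0 then c k else 0)"
  have c0: "esummable c0 (\<lambda>k. real (N k)) M"
    by (rule esummable_comparison[OF c, of _ 1]) (auto simp: c0_def)
  have p: "(\<lambda>z. \<Sum>\<^sub>\<infinity>k\<in>{k. N k = 0}. c k * e2pi (of_real (M k) * z)) = esum c0 (\<lambda>k. real (N k)) M \<i>"
    unfolding esum_def by (rule ext, rule infsum_cong_neutral) (auto simp: c0_def eterm_def)
  show ?thesis unfolding p jfam_def
  proof (intro conjI allI impI)
    fix k
    let ?d = "\<lambda>x. c x * (\<kappa> * of_real (M x)) ^ k"
    have d: "esummable ?d (\<lambda>k. real (N k)) M" using esum_higher_deriv(2)[OF c, of \<i>] by simp
    have "qval (\<lambda>t. esum ?d (\<lambda>k. real (N k)) M t 0) (\<Sum>\<^sub>\<infinity>x. if N x = 0 then ?d x else 0)"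
      using esum_has_sum[OF d, of _ 0] by (intro qval_series) (simp add: eterm_def[abs_def])
    also have "(\<Sum>\<^sub>\<infinity>x. if N x = 0 then ?d x else 0) = esum (\<lambda>x. c0 x * (\<kappa> * of_real (M x)) ^ k) (\<lambda>k. real (N k)) M \<i> 0"
      unfolding esum_def by (rule infsum_cong) (auto simp: c0_def eterm_def)
    finally show "qval (\<lambda>t. (deriv ^^ k) (esum c (\<lambda>k. real (N k)) M t) 0) ((deriv ^^ k) (esum c0 (\<lambda>k. real (N k)) M \<i>) 0)"
      by (rule iffD1[OF qval_cong, rotated 2]) (simp_all add: esum_higher_deriv[OF c] esum_higher_deriv[OF c0])
  qed (use esum_holomorphic[OF c] esum_holomorphic[OF c0] in auto)
qed

lemma has_fourier_expansion_esum:
  assumes "has_fourier_expansion \<phi> f"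
  shows "esummable (\<lambda>(n, l). f n l) (\<lambda>p. real (fst p)) (\<lambda>p. real_of_int (snd p))"
    and "Im t > 0 \<Longrightarrow> \<phi> t z = esum (\<lambda>(n, l). f n l) (\<lambda>p. real (fst p)) (\<lambda>p. real_of_int (snd p)) t z"
proof -
  have *: "(eterm (\<lambda>(n, l). f n l) (\<lambda>p. real (fst p)) (\<lambda>p. real_of_int (snd p)) t z has_sum \<phi> t z) UNIV" if "Im t > 0" for t z
    using assms that unfolding has_fourier_expansion_def by (simp add: eterm_def[abs_def] case_prod_unfold)
  then show "esummable (\<lambda>(n, l). f n l) (\<lambda>p. real (fst p)) (\<lambda>p. real_of_int (snd p))"
    unfolding esummable_def using has_sum_imp_summable by blast
  show "\<phi> t z = esum (\<lambda>(n, l). f n l) (\<lambda>p. real (fst p)) (\<lambda>p. real_of_int (snd p)) t z" if "Im t > 0"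
    unfolding esum_def by (rule infsumI[symmetric], rule *[OF that])
qed

lemma has_fourier_expansion_jfam:
  assumes "has_fourier_expansion \<phi> f"
  shows "jfam \<phi> (\<lambda>z. \<Sum>\<^sub>\<infinity>l. f 0 l * e2pi (of_int l * z))"
proof -
  have "jfam \<phi> (\<lambda>z. \<Sum>\<^sub>\<infinity>k\<in>{k. fst k = 0}. (case k of (n, l) \<Rightarrow> f n l) * e2pi (of_real (real_of_int (snd k)) * z))"
    using jfam_esum[OF has_fourier_expansion_esum(1)[OF assms]] has_fourier_expansion_esum(2)[OF assms] by (subst jfam_cong) auto
  moreover have "(\<Sum>\<^sub>\<infinity>k\<in>{k. fst k = 0}. (case k of (n, l) \<Rightarrow> f n l) * e2pi (of_real (real_of_int (snd k)) * z)) = (\<Sum>\<^sub>\<infinity>l. f 0 l * e2pi (of_int l * z))" for z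
    by (rule infsum_reindex_bij_witness[where i = "\<lambda>l. (0, l)" and j = snd]) auto
  ultimately show ?thesis by simp
qed

lemma has_fourier_expansion_qval:
  assumes "has_fourier_expansion \<phi> f"
  shows "qval (\<lambda>t. \<phi> t z) (\<Sum>\<^sub>\<infinity>l. f 0 l * e2pi (of_int l * z))"
proof -
  have "qval (\<lambda>t. \<phi> t z) (\<Sum>\<^sub>\<infinity>k. if fst k = 0 then (f (fst k) (snd k) * e2pi (of_int (snd k) * z)) else 0)"
    by (rule qval_series) (use assms in \<open>simp add: has_fourier_expansion_def case_prod_unfold mult_ac\<close>)
  also have "(\<Sum>\<^sub>\<infinity>k. if fst k = (0::nat) then (f (fst k) (snd k) * e2pi (of_int (snd k) * z)) else 0) = (\<Sum>\<^sub>\<infinity>k\<in>{k. fst k = 0}. f (fst k) (snd k) * e2pi (of_int (snd k) * z))"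
    by (rule infsum_cong_neutral) auto
  also have "\<dots> = (\<Sum>\<^sub>\<infinity>l. f 0 l * e2pi (of_int l * z))"
    by (rule infsum_reindex_bij_witness[where i = "\<lambda>l. (0, l)" and j = snd]) auto
  finally show ?thesis .
qed

lemma has_fourier_expansion_holomorphic:
  assumes f: "has_fourier_expansion \<phi> f" shows "holomorphic_HC \<phi>"
  unfolding holomorphic_HC_def
proof (intro allI impI)
  fix t z :: complex assume t: "Im t > 0"
  note es = has_fourier_expansion_esum[OF f]
  let ?c = "\<lambda>(n, l). f n l" and ?N = "\<lambda>p. real (fst p)" and ?M = "\<lambda>p. real_of_int (snd p)"
  from esum_has_derivative[OF es(1) t, of z]
  obtain A B where d: "((\<lambda>(t, z). esum ?c ?N ?M t z) has_derivative (\<lambda>(h, k). A * h + B * k)) (at (t, z))"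
    by blast
  have op: "open {p :: complex \<times> complex. Im (fst p) > 0}"
    by (intro open_Collect_less continuous_intros)
  have "((\<lambda>(t, w). \<phi> t w) has_derivative (\<lambda>(h, k). A * h + B * k)) (at (t, z))"
    by (rule has_derivative_transform_within_open[OF d op]) (use t in \<open>auto simp: es(2)\<close>)
  then show "\<exists>A B. ((\<lambda>(t, w). \<phi> t w) has_derivative (\<lambda>(h, k). A * h + B * k)) (at (t, z))" by blast
qed

lemma qval_FE: assumes "qval h c" shows "FE UNIV (\<lambda>t z. h t)"
proof -
  obtain g where g: "g holomorphic_on ball 0 1" "\<And>t. Im t > 0 \<Longrightarrow> h t = g (e2pi t)"
    using assms unfolding qval_def by blast
  define a where "a = (\<lambda>n. (deriv ^^ n) g 0 / fact n)"
  have s: "(\<lambda>n. a n * q ^ n) sums g q" if "q \<in> ball 0 1" for q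
    using holomorphic_power_series[OF g(1) that] by (simp add: a_def)
  show ?thesis
  proof (rule FE_series[where c = a and N = "\<lambda>n. n" and M = "\<lambda>_. 0"])
    fix t z :: complex assume t: "Im t > 0"
    \<comment> \<open>Power series converge absolutely strictly inside the disc; r supplies the
      margin.\<close>
    obtain r where r: "norm (e2pi t) < r" "r < 1" using norm_e2pi_less_1[OF t] dense by blast
    have "r > 0" using r norm_ge_zero[of "e2pi t"] by linarith
    then have "of_real r \<in> ball (0::complex) 1" using r by simp
    from s[OF this] have "summable (\<lambda>n. a n * of_real r ^ n)" by (rule sums_summable)
    then have "summable (\<lambda>n. norm (a n * e2pi t ^ n))"
      by (rule powser_insidea) (use r \<open>r > 0\<close> in auto)
    then have "((\<lambda>n. a n * e2pi t ^ n) has_sum g (e2pi t)) UNIV"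
      using s[OF e2pi_in_ball[OF t]] by (rule norm_summable_imp_has_sum)
    then show "((\<lambda>k. a k * e2pi (of_nat k * t) * e2pi (of_int 0 * z)) has_sum h t) UNIV"
      by (simp add: g(2)[OF t] e2pi_of_nat_mult)
  qed auto
qed

subsection \<open>Entire functions on a complex torus\<close>

text \<open>Near a common zero the quotient equals the quotient of the difference quotients of f and
  g. These are entire, and the one of g does not vanish there because the zero is simple.\<close>

lemma entire_divide:
  assumes f: "f is_entire" and g: "g is_entire"
    and z: "\<And>w. g w = 0 \<Longrightarrow> f w = 0" "\<And>w. g w = 0 \<Longrightarrow> deriv g w \<noteq> 0"
  obtains h where "h is_entire" "\<And>z. h z * g z = f z"
proof
  define h where "h = (\<lambda>z. if g z = 0 then deriv f z / deriv g z else f z / g z)"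
  show "h z * g z = f z" for z using assms by (auto simp: h_def)
  have "h field_differentiable at a" for a
  proof -
    define f1 where "f1 = (\<lambda>z. if z = a then deriv f a else (f z - f a) / (z - a))"
    define g1 where "g1 = (\<lambda>z. if z = a then deriv g a else (g z - g a) / (z - a))"
    have fg1: "f1 is_entire" "g1 is_entire"
      unfolding f1_def g1_def by (intro pole_lemma assms; simp)+
    show ?thesis
    proof (cases "g a = 0")
      case True
      define U where "U = {w. g1 w \<noteq> 0}"
      have oU: "open U"
        unfolding U_def by (intro open_Collect_neq continuous_intros holomorphic_on_imp_continuous_on[OF fg1(2)])
      have aU: "a \<in> U" using z(2)[OF True] by (simp add: U_def g1_def)
      have "(\<lambda>w. f1 w / g1 w) holomorphic_on U"
        by (intro holomorphic_intros holomorphic_on_subset[OF fg1(1)] holomorphic_on_subset[OF fg1(2)]) (auto simp: U_def)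
      then have "(\<lambda>w. f1 w / g1 w) field_differentiable at a"
        using oU aU holomorphic_on_imp_differentiable_at by blast
      moreover have "f1 w / g1 w = h w" if "w \<in> U" for w
        using that True z(1)[OF True] by (auto simp: U_def f1_def g1_def h_def)
      ultimately show ?thesis
        unfolding field_differentiable_def by (meson aU oU has_field_derivative_transform_within_open)
    next
      case False
      define U where "U = {w. g w \<noteq> 0}"
      have oU: "open U"
        unfolding U_def by (intro open_Collect_neq continuous_intros holomorphic_on_imp_continuous_on[OF g])
      have aU: "a \<in> U" using False by (simp add: U_def)
      have "(\<lambda>w. f w / g w) holomorphic_on U"
        by (intro holomorphic_intros holomorphic_on_subset[OF f] holomorphic_on_subset[OF g]) (auto simp: U_def)
      then have "(\<lambda>w. f w / g w) field_differentiable at a"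
        using oU aU holomorphic_on_imp_differentiable_at by blast
      moreover have "f w / g w = h w" if "w \<in> U" for w
        using that by (auto simp: U_def h_def)
      ultimately show ?thesis
        unfolding field_differentiable_def by (meson aU oU has_field_derivative_transform_within_open)
    qed
  qed
  then show "h is_entire" by (simp add: holomorphic_on_def)
qed

lemma norm_periodic_int:
  fixes h :: "complex \<Rightarrow> complex"
  assumes "\<And>z. norm (h (z + w)) = norm (h z)"
  shows "norm (h (z + of_int n * w)) = norm (h z)"
proof -
  have nat: "norm (h (z + of_nat m * w)) = norm (h z)" for m z
  proof (induction m)
    case (Suc m)
    have "h (z + of_nat (Suc m) * w) = h (z + of_nat m * w + w)" by (simp add: algebra_simps)
    then show ?case using Suc assms by simp
  qed simp
  show ?thesis
  proof (cases "n \<ge> 0")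
    case True
    then show ?thesis using nat[of z "nat n"] by simp
  next
    case False
    then show ?thesis using nat[of "z + of_int n * w" "nat (- n)"] by simp
  qed
qed

text \<open>Liouville after reduction to the period parallelogram. The hypothesis concerns the norm,
  so that functions periodic up to unknown signs are covered.\<close>

lemma entire_norm_periodic_constant:
  assumes h: "h is_entire" and t: "Im t > 0"
    and "\<And>z. norm (h (z + 1)) = norm (h z)" "\<And>z. norm (h (z + t)) = norm (h z)"
  obtains c where "\<And>z. h z = c"
proof -
  have "compact (h ` cball 0 (1 + norm t))"
    by (intro compact_continuous_image holomorphic_on_imp_continuous_on holomorphic_on_subset[OF h]) auto
  then obtain B where B: "\<And>z. z \<in> cball 0 (1 + norm t) \<Longrightarrow> norm (h z) \<le> B"
    by (meson bounded_iff compact_imp_bounded imageI)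
  have "norm (h z) \<le> B" for z
  proof -
    \<comment> \<open>\<open>n\<close> and \<open>m\<close> are the integral parts of the
      coordinates of z in the basis t, 1.\<close>
    define n where "n = \<lfloor>Im z / Im t\<rfloor>"
    define w where "w = z - of_int n * t"
    define m where "m = \<lfloor>Re w - Im w / Im t * Re t\<rfloor>"
    define v where "v = w - of_int m"
    define y where "y = Im z / Im t - of_int n"
    have y: "0 \<le> y" "y \<le> 1" unfolding y_def n_def by linarith+
    have Imw: "Im w / Im t = y" using t by (simp add: w_def y_def field_simps)
    define x where "x = Re w - y * Re t - of_int m"
    have x: "0 \<le> x" "x \<le> 1" unfolding x_def m_def Imw by linarith+
    have "v = of_real x + of_real y * t"
      using Imw t by (auto simp: complex_eq_iff v_def x_def field_simps)
    then have "norm v \<le> \<bar>x\<bar> + \<bar>y\<bar> * norm t"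
      by (metis norm_triangle_ineq norm_mult norm_of_real)
    also have "\<dots> \<le> 1 + 1 * norm t" using x y by (intro add_mono mult_right_mono) auto
    finally have "norm (h v) \<le> B" by (intro B) simp
    moreover have "norm (h z) = norm (h v)"
    proof -
      have "norm (h (v + of_int m * 1 + of_int n * t)) = norm (h v)"
        using norm_periodic_int[of h t "v + of_int m * 1" n] norm_periodic_int[of h 1 v m] assms by simp
      moreover have "v + of_int m * 1 + of_int n * t = z" by (simp add: v_def w_def)
      ultimately show ?thesis by simp
    qed
    ultimately show ?thesis by simp
  qed
  then have "bounded (range h)" unfolding bounded_iff by blast
  from Liouville_theorem[OF h this] show ?thesis
    using that unfolding constant_on_def by blast
qed

subsection \<open>Theta series\<close>

lemma summable_on_exp_abs_int: "(\<lambda>k::int. exp (- \<bar>real_of_int k\<bar>)) summable_on UNIV"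
proof -
  have n: "(\<lambda>n::nat. exp (- real n)) summable_on UNIV"
  proof (rule summable_nonneg_imp_summable_on)
    have "summable (\<lambda>n::nat. (exp (-1::real)) ^ n)" by (intro summable_geometric) simp
    also have "(\<lambda>n::nat. (exp (-1::real)) ^ n) = (\<lambda>n. exp (- real n))"
      by (simp add: exp_of_nat_mult [symmetric])
    finally show "summable (\<lambda>n. exp (- real n))" .
  qed auto
  have "(\<lambda>k::int. exp (- \<bar>real_of_int k\<bar>)) summable_on range int"
    by (subst summable_on_reindex) (use n in \<open>auto simp: o_def\<close>)
  moreover have "(\<lambda>k::int. exp (- \<bar>real_of_int k\<bar>)) summable_on range (\<lambda>n. - int n)"
    by (subst summable_on_reindex) (use n in \<open>auto simp: o_def inj_on_def\<close>)
  ultimately have "(\<lambda>k::int. exp (- \<bar>real_of_int k\<bar>)) summable_on (range int \<union> range (\<lambda>n. - int n))"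
    by (rule summable_on_union)
  moreover have "range int \<union> range (\<lambda>n. - int n) = UNIV"
    by (auto, metis int_cases2 rangeI)
  ultimately show ?thesis by simp
qed

text \<open>The quadratic growth of the q-exponent beats the linear growth of the
  y-exponent.\<close>

lemma esummable_theta:
  fixes c :: "int \<Rightarrow> complex"
  assumes c: "\<And>k. norm (c k) \<le> 1" and N: "\<And>k. N k \<ge> a * (real_of_int k)\<^sup>2 - b" and a: "a > 0"
    and M: "\<And>k. \<bar>M k\<bar> \<le> A * \<bar>real_of_int k\<bar> + B"
  shows "esummable c N M"
  unfolding esummable_def
proof (intro allI impI)
  fix t z :: complex assume t: "Im t > 0"
  define \<alpha> where "\<alpha> = 2 * pi * Im t * a"
  define \<beta> where "\<beta> = 2 * pi * \<bar>Im z\<bar> * A"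
  define \<gamma> where "\<gamma> = 2 * pi * Im t * b + 2 * pi * \<bar>Im z\<bar> * B"
  \<comment> \<open>The square is completed so that the exponent is at most K - |k|, which leaves a
    convergent geometric majorant.\<close>
  define K where "K = \<gamma> + (\<beta> + 1)\<^sup>2 / (4 * \<alpha>)"
  have \<alpha>: "\<alpha> > 0" using t a by (simp add: \<alpha>_def)
  have "(\<lambda>k. exp K * exp (- \<bar>real_of_int k\<bar>)) summable_on UNIV"
    by (intro summable_on_cmult_right summable_on_exp_abs_int)
  then have "(\<lambda>k. norm (eterm c N M t z k)) summable_on UNIV"
  proof (rule summable_on_comparison_test)
    fix k :: int
    define x where "x = \<bar>real_of_int k\<bar>"
    have "2 * pi * Im t * N k \<ge> 2 * pi * Im t * (a * x\<^sup>2 - b)"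
      using N[of k] t by (intro mult_left_mono) (auto simp: x_def)
    moreover have "2 * pi * M k * Im z \<ge> - (2 * pi * \<bar>Im z\<bar> * (A * x + B))"
    proof -
      have "\<bar>2 * pi * M k * Im z\<bar> = 2 * pi * \<bar>Im z\<bar> * \<bar>M k\<bar>" by (simp add: abs_mult)
      also have "\<dots> \<le> 2 * pi * \<bar>Im z\<bar> * (A * x + B)"
        using M[of k] by (intro mult_left_mono) (auto simp: x_def)
      finally show ?thesis by linarith
    qed
    ultimately have "- (2 * pi * (N k * Im t + M k * Im z)) \<le> - \<alpha> * x\<^sup>2 + \<beta> * x + \<gamma>"
      by (simp add: \<alpha>_def \<beta>_def \<gamma>_def algebra_simps)
    also have "\<dots> \<le> K - x"
    proof -
      have "0 \<le> \<alpha> * (x - (\<beta> + 1) / (2 * \<alpha>))\<^sup>2" using \<alpha> by simp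
      also have "\<dots> = \<alpha> * x\<^sup>2 - (\<beta> + 1) * x + (\<beta> + 1)\<^sup>2 / (4 * \<alpha>)"
        using \<alpha> by (simp add: power2_eq_square field_simps)
      finally show ?thesis by (simp add: K_def algebra_simps)
    qed
    finally have e: "exp (- (2 * pi * (N k * Im t + M k * Im z))) \<le> exp (K - x)" by simp
    have "norm (c k) * exp (- (2 * pi * (N k * Im t + M k * Im z))) \<le> 1 * exp (K - x)"
      by (intro mult_mono e c) auto
    then show "norm (eterm c N M t z k) \<le> exp K * exp (- \<bar>real_of_int k\<bar>)"
      by (simp add: norm_eterm x_def exp_diff exp_minus field_simps)
  qed auto
  then show "eterm c N M t z summable_on UNIV"
    by (simp add: summable_on_iff_abs_summable_on_complex)
qed

text \<open>For n = 2 k + 1 one has n^2/8 = \<open>tN k\<close> + 1/8, so these triangular numbers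
  are the q-exponents of theta once q^(1/8) is split off.\<close>

definition tN :: "int \<Rightarrow> nat" where "tN k = nat (k * (k + 1) div 2)"

lemma tN_nonneg: "k * (k + 1) div 2 \<ge> (0::int)"
proof -
  have "k * (k + 1) \<ge> 0"
    by (cases "k \<ge> 0") (auto simp: mult_nonpos_nonpos)
  then show ?thesis by simp
qed

lemma int_tN: "2 * int (tN k) = k * (k + 1)"
proof -
  have "even (k * (k + 1))" by simp
  then show ?thesis unfolding tN_def using tN_nonneg[of k] by simp
qed

lemma real_tN: "real (tN k) = (real_of_int k * (real_of_int k + 1)) / 2"
proof -
  have "real_of_int (2 * int (tN k)) = real_of_int (k * (k + 1))" by (simp only: int_tN)
  then show ?thesis by simp
qed

lemma complex_tN: "(of_nat (tN k) :: complex) = (of_int k * (of_int k + 1)) / 2"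
proof -
  have "(of_int (2 * int (tN k)) :: complex) = of_int (k * (k + 1))" by (simp only: int_tN)
  then show ?thesis by (simp add: eq_divide_eq mult.commute)
qed

lemma tN_eq_0_iff: "tN k = 0 \<longleftrightarrow> k = 0 \<or> k = -1"
  using int_tN[of k] by auto

abbreviation tM :: "int \<Rightarrow> real" where "tM k \<equiv> real_of_int k + 1 / 2"

text \<open>This is \<open>jtheta\<close> without its factor q^(1/8), as
  \<open>jtheta_has_sum\<close> shows; the Kronecker symbol at 2 k + 1 is the sign (-1)^k.\<close>

definition tser :: "complex \<Rightarrow> complex \<Rightarrow> complex" where
  "tser = esum (\<lambda>k::int. (-1) powi k) (\<lambda>k. real (tN k)) tM"

lemma norm_powi_m1 [simp]: "norm ((-1::complex) powi k) = 1"
  by (simp add: norm_power_int)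

lemma esummable_tser: "esummable (\<lambda>k::int. (-1) powi k) (\<lambda>k. real (tN k)) tM"
proof (rule esummable_theta[where a = "1/4" and b = "1" and A = 1 and B = 1])
  fix k :: int
  have "0 \<le> (real_of_int k + 1)\<^sup>2" by simp
  then show "real (tN k) \<ge> 1 / 4 * (real_of_int k)\<^sup>2 - 1"
    unfolding real_tN by (simp add: power2_eq_square algebra_simps)
qed auto

lemma tser_has_sum:
  assumes "Im t > 0"
  shows "((\<lambda>k. (-1) powi k * e2pi (of_nat (tN k) * t + (of_int k + 1/2) * z)) has_sum tser t z) UNIV"
  using esum_has_sum[OF esummable_tser assms, of z] by (simp add: tser_def eterm_def[abs_def] e2pi_add mult_ac)

lemma tser_holomorphic: "Im t > 0 \<Longrightarrow> tser t is_entire"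
  unfolding tser_def by (rule esum_holomorphic[OF esummable_tser])

lemma jfam_tser: "jfam tser (\<lambda>z. e2pi (z/2) - e2pi (-z/2))"
proof -
  have "{k. tN k = 0} = {0, -1}" using tN_eq_0_iff by auto
  then show ?thesis using jfam_esum[OF esummable_tser] unfolding tser_def by simp
qed

lemma powi_m1_add: "(-1::complex) powi (a + b) = (-1) powi a * (-1) powi b"
  by (simp add: power_int_add)

lemma powi_m1_sq: "(-1::complex) powi a * (-1) powi a = 1"
  by (simp add: power_int_mult_distrib [symmetric])

lemma has_sum_shift_int: "((\<lambda>k. f (k + a)) has_sum s) UNIV \<longleftrightarrow> (f has_sum s) (UNIV :: int set)"
  by (rule has_sum_reindex_bij_betw, rule bij_betwI[where g = "\<lambda>k. k - a"]) auto

lemma has_sum_reflect_int: "((\<lambda>k. f (a - k)) has_sum s) UNIV \<longleftrightarrow> (f has_sum s) (UNIV :: int set)"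
  by (rule has_sum_reindex_bij_betw, rule bij_betwI[where g = "\<lambda>k. a - k"]) auto

text \<open>Replacing k by k + a completes the square in the exponent.\<close>

lemma tser_shift:
  assumes t: "Im t > 0"
  shows "tser t (z + of_int a * t + of_int b) = (-1) powi (a + b) * e2pi (- (of_int a)\<^sup>2 / 2 * t - of_int a * z) * tser t z"
proof -
  let ?C = "(-1) powi (a + b) * e2pi (- (of_int a)\<^sup>2 / 2 * t - of_int a * z)"
  let ?f = "\<lambda>k. (-1) powi k * e2pi (of_nat (tN k) * t + (of_int k + 1/2) * z)"
  have "((\<lambda>k. ?f (k + a)) has_sum tser t z) UNIV"
    using tser_has_sum[OF t, of z] has_sum_shift_int[of ?f a] by blast
  then have "((\<lambda>k. ?C * ?f (k + a)) has_sum ?C * tser t z) UNIV"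
    by (rule has_sum_cmult_right)
  moreover have "?C * ?f (k + a) = (-1) powi k * e2pi (of_nat (tN k) * t + (of_int k + 1/2) * (z + of_int a * t + of_int b))" for k
  proof -
    have s: "(-1) powi (a + b) * (-1) powi (k + a) = (-1) powi k * (-1::complex) powi b"
      using powi_m1_sq[of a] by (simp add: powi_m1_add mult_ac)
    have e: "e2pi ((of_int k + 1/2) * of_int b) = (-1) powi b"
    proof -
      have "(of_int k + 1/2) * of_int b = (of_int (k * b) + of_int b / 2 :: complex)" by (simp add: algebra_simps)
      then show ?thesis by (simp only: e2pi_add e2pi_of_int e2pi_of_int_half mult_1)
    qed
    have "?C * ?f (k + a) = ((-1) powi (a + b) * (-1) powi (k + a)) * e2pi ((- (of_int a)\<^sup>2 / 2 * t - of_int a * z) + (of_nat (tN (k + a)) * t + (of_int (k + a) + 1/2) * z))"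
      by (simp add: e2pi_add mult_ac)
    also have "(- (of_int a)\<^sup>2 / 2 * t - of_int a * z) + (of_nat (tN (k + a)) * t + (of_int (k + a) + 1/2) * z) = of_nat (tN k) * t + (of_int k + 1/2) * (z + of_int a * t)"
      by (simp add: complex_tN power2_eq_square field_simps)
    also have "((-1) powi (a + b) * (-1) powi (k + a)) * e2pi (of_nat (tN k) * t + (of_int k + 1/2) * (z + of_int a * t)) = (-1) powi k * (e2pi (of_nat (tN k) * t + (of_int k + 1/2) * (z + of_int a * t)) * e2pi ((of_int k + 1/2) * of_int b))"
      unfolding s e by simp
    finally show ?thesis by (simp add: e2pi_add [symmetric] algebra_simps)
  qed
  ultimately have "((\<lambda>k. (-1) powi k * e2pi (of_nat (tN k) * t + (of_int k + 1/2) * (z + of_int a * t + of_int b))) has_sum ?C * tser t z) UNIV"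
    by simp
  then show ?thesis using tser_has_sum[OF t] has_sum_unique by blast
qed

text \<open>The reflection of k to -1 - k preserves \<open>tN k\<close> and reverses both the sign
  and the y-exponent.\<close>

lemma tser_odd: assumes t: "Im t > 0" shows "tser t (- z) = - tser t z"
proof -
  let ?f = "\<lambda>k. (-1) powi k * e2pi (of_nat (tN k) * t + (of_int k + 1/2) * z)"
  have "((\<lambda>k. ?f (- 1 - k)) has_sum tser t z) UNIV"
    using tser_has_sum[OF t, of z] has_sum_reflect_int[of ?f "-1"] by blast
  then have "((\<lambda>k. - ?f (- 1 - k)) has_sum - tser t z) UNIV" by (rule has_sum_uminusI)
  moreover have "- ?f (- 1 - k) = (-1) powi k * e2pi (of_nat (tN k) * t + (of_int k + 1/2) * (- z))" for k
  proof -
    have "(-1::complex) powi (- 1 - k) = - ((-1) powi k)"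
      by (simp add: power_int_diff power_int_minus field_simps)
    moreover have "of_nat (tN (- 1 - k)) = (of_nat (tN k) :: complex)" by (simp add: complex_tN field_simps)
    moreover have "(of_int (- 1 - k) + 1/2) * z = (of_int k + 1/2) * (- z)" by (simp add: field_simps)
    ultimately show ?thesis by simp
  qed
  ultimately have "((\<lambda>k. (-1) powi k * e2pi (of_nat (tN k) * t + (of_int k + 1/2) * (- z))) has_sum - tser t z) UNIV"
    by (simp only:)
  then show ?thesis using tser_has_sum[OF t] has_sum_unique by blast
qed

subsection \<open>The triple product identity\<close>

text \<open>Gaussian binomial coefficients, defined by a q-Pascal rule so that no denominator 1 -
  q^i appears.\<close>

fun qbin :: "complex \<Rightarrow> nat \<Rightarrow> nat \<Rightarrow> complex" where
  "qbin q n 0 = 1"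
| "qbin q 0 (Suc j) = 0"
| "qbin q (Suc n) (Suc j) = qbin q n (Suc j) + q ^ (n - j) * qbin q n j"

definition qfac :: "complex \<Rightarrow> nat \<Rightarrow> complex" where
  "qfac q n = (\<Prod>i<n. 1 - q ^ Suc i)"

lemma qfac_Suc: "qfac q (Suc n) = qfac q n * (1 - q ^ Suc n)"
  by (simp add: qfac_def)

lemma qbin_eq_0: "j > n \<Longrightarrow> qbin q n j = 0"
  by (induction q n j rule: qbin.induct) auto

lemma qbin_self: "qbin q n n = 1"
  by (induction n) (auto simp: qbin_eq_0)

lemma qbin_qfac: "j \<le> n \<Longrightarrow> qbin q n j * (qfac q j * qfac q (n - j)) = qfac q n"
proof (induction q n j rule: qbin.induct)
  case (1 q n)
  then show ?case by (simp add: qfac_def)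
next
  case (3 q n j)
  show ?case
  proof (cases "j = n")
    case True
    then show ?thesis by (simp add: qbin_eq_0 qbin_self) (simp add: qfac_def)
  next
    case False
    then have jn: "Suc j \<le> n" "j \<le> n" using 3 by auto
    then obtain d where d: "n = Suc (j + d)" by (metis Suc_le_eq less_iff_Suc_add)
    have IH1: "qbin q n (Suc j) * (qfac q (Suc j) * qfac q d) = qfac q n"
      using 3(1) jn d by simp
    have IH2: "qbin q n j * (qfac q j * qfac q (Suc d)) = qfac q n"
      using 3(2) jn d by simp
    have "qbin q (Suc n) (Suc j) * (qfac q (Suc j) * qfac q (Suc n - Suc j))
      = (qbin q n (Suc j) + q ^ Suc d * qbin q n j) * (qfac q (Suc j) * qfac q (Suc d))"
      using d by simp
    also have "\<dots> = (qbin q n (Suc j) * (qfac q (Suc j) * qfac q d)) * (1 - q ^ Suc d) + q ^ Suc d * (1 - q ^ Suc j) * (qbin q n j * (qfac q j * qfac q (Suc d)))"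
      unfolding qfac_Suc by (simp add: algebra_simps del: power_Suc)
    also have "\<dots> = qfac q n * (1 - q ^ Suc d * q ^ Suc j)"
      unfolding IH1 IH2 by (simp add: algebra_simps del: power_Suc)
    also have "q ^ Suc d * q ^ Suc j = q ^ Suc n" using d by (simp add: power_add)
    finally show ?thesis by (simp add: qfac_Suc del: power_Suc)
  qed
qed auto

text \<open>The last factor either is skipped or raises j by one, which is the q-Pascal
  rule.\<close>

lemma qbinomial_theorem:
  "(\<Prod>i<n. 1 + e2pi (of_nat i * t + x)) = (\<Sum>j\<le>n. e2pi (of_nat j * (of_nat j - 1) / 2 * t + of_nat j * x) * qbin (e2pi t) n j)"
proof (induction n)
  case (Suc n)
  let ?E = "\<lambda>j::nat. e2pi (of_nat j * (of_nat j - 1) / 2 * t + of_nat j * x)"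
  let ?q = "e2pi t"
  have E: "?E j * e2pi (of_nat n * t + x) = ?E (Suc j) * ?q ^ (n - j)" if "j \<le> n" for j
  proof -
    have "of_nat n = of_nat j + (of_nat (n - j) :: complex)" using that by (simp add: of_nat_diff)
    then show ?thesis
      unfolding e2pi_of_nat_mult [symmetric] e2pi_add [symmetric]
      by (intro arg_cong[where f = e2pi]) (simp add: field_simps)
  qed
  have "(\<Prod>i<Suc n. 1 + e2pi (of_nat i * t + x)) = (\<Sum>j\<le>n. ?E j * qbin ?q n j) * (1 + e2pi (of_nat n * t + x))"
    unfolding prod.lessThan_Suc Suc ..
  also have "\<dots> = (\<Sum>j\<le>n. ?E j * qbin ?q n j) + (\<Sum>j\<le>n. (?E j * e2pi (of_nat n * t + x)) * qbin ?q n j)"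
    unfolding distrib_left sum_distrib_right by (simp add: mult_ac)
  also have "(\<Sum>j\<le>n. (?E j * e2pi (of_nat n * t + x)) * qbin ?q n j) = (\<Sum>j\<le>n. ?E (Suc j) * (?q ^ (n - j) * qbin ?q n j))"
    by (intro sum.cong) (simp_all only: E atMost_iff mult.assoc)
  also have "(\<Sum>j\<le>n. ?E j * qbin ?q n j) = ?E 0 + (\<Sum>j\<le>n. ?E (Suc j) * qbin ?q n (Suc j))"
  proof -
    have "(\<Sum>j\<le>Suc n. ?E j * qbin ?q n j) = ?E 0 * qbin ?q n 0 + (\<Sum>j\<le>n. ?E (Suc j) * qbin ?q n (Suc j))"
      by (rule sum.atMost_Suc_shift)
    then show ?thesis by (simp add: qbin_eq_0)
  qed
  finally have "(\<Prod>i<Suc n. 1 + e2pi (of_nat i * t + x)) = ?E 0 + (\<Sum>j\<le>n. ?E (Suc j) * qbin ?q (Suc n) (Suc j))"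
    by (simp only: qbin.simps distrib_left sum.distrib add.assoc)
  also have "\<dots> = (\<Sum>j\<le>Suc n. ?E j * qbin ?q (Suc n) j)"
    by (subst sum.atMost_Suc_shift) simp
  finally show ?case .
qed simp

definition qp :: "complex \<Rightarrow> complex" where
  "qp t = prodinf (\<lambda>n. 1 - e2pi (of_nat (Suc n) * t))"

text \<open>In Pochhammer notation \<open>tp\<close> is (q y; q)_infinity and \<open>qp\<close> is
  (q; q)_infinity. Writing y as e(z) lets shifts by t and by 1/2 act on the argument.\<close>

definition tp :: "complex \<Rightarrow> complex \<Rightarrow> complex" where
  "tp t z = prodinf (\<lambda>n. 1 - e2pi (of_nat (Suc n) * t + z))"

lemma summable_e2pi_shift: "Im t > 0 \<Longrightarrow> summable (\<lambda>n. norm (e2pi (of_nat (Suc n) * t + z)))"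
proof -
  assume t: "Im t > 0"
  have "summable (\<lambda>n. (norm (e2pi t)) ^ n * norm (e2pi (t + z)))"
    by (intro summable_mult2 summable_geometric) (simp add: norm_e2pi_less_1 t)
  moreover have "e2pi (of_nat (Suc n) * t + z) = e2pi t ^ n * e2pi (t + z)" for n
    by (simp add: e2pi_add [symmetric] e2pi_of_nat_mult [symmetric] algebra_simps)
  ultimately show ?thesis by (simp only: norm_mult norm_power)
qed

lemma convergent_prod_tp: "Im t > 0 \<Longrightarrow> convergent_prod (\<lambda>n. 1 - e2pi (of_nat (Suc n) * t + z))"
  by (intro abs_convergent_prod_imp_convergent_prod summable_imp_abs_convergent_prod)
     (use summable_e2pi_shift[of t z] in simp)

lemma qp_eq_tp: "qp t = tp t 0"
  by (simp add: qp_def tp_def)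

lemma tp_LIMSEQ: "Im t > 0 \<Longrightarrow> (\<lambda>N. \<Prod>n<N. 1 - e2pi (of_nat (Suc n) * t + z)) \<longlonglongrightarrow> tp t z"
  unfolding tp_def by (rule has_prod_imp_tendsto', rule convergent_prod_has_prod, rule convergent_prod_tp)

lemma tp_nonzero:
  assumes t: "Im t > 0" and "\<And>n. e2pi (of_nat (Suc n) * t + z) \<noteq> 1"
  shows "tp t z \<noteq> 0"
  unfolding tp_def by (rule prodinf_nonzero[OF convergent_prod_tp[OF t]]) (use assms in auto)

lemma e2pi_Suc_neq_1: "Im t > 0 \<Longrightarrow> e2pi (of_nat (Suc n) * t) \<noteq> 1"
proof
  assume t: "Im t > 0" and "e2pi (of_nat (Suc n) * t) = 1"
  then have "norm (e2pi (of_nat (Suc n) * t)) = 1" by simp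
  moreover have "Im (of_nat (Suc n) * t) > 0" using t by (simp del: of_nat_Suc)
  ultimately show False using norm_e2pi_less_1 by fastforce
qed

lemma qp_nonzero: "Im t > 0 \<Longrightarrow> qp t \<noteq> 0"
  unfolding qp_eq_tp by (rule tp_nonzero) (use e2pi_Suc_neq_1 in auto)

lemma qfac_LIMSEQ: "Im t > 0 \<Longrightarrow> qfac (e2pi t) \<longlonglongrightarrow> qp t"
  using tp_LIMSEQ[of t 0] unfolding qfac_def[abs_def] qp_eq_tp
  by (simp add: e2pi_of_nat_mult [symmetric] del: of_nat_Suc power_Suc)

lemma qfac_nonzero: "Im t > 0 \<Longrightarrow> qfac (e2pi t) n \<noteq> 0"
  unfolding qfac_def e2pi_of_nat_mult [symmetric] using e2pi_Suc_neq_1[of t] by (auto simp del: of_nat_Suc)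

text \<open>The q-binomial theorem with 2 N factors, recentred: half of them are turned upside down
  to become the factors in 1/y.\<close>

lemma jtp_finite:
  "(\<Prod>n<N. 1 - e2pi (of_nat n * t + z)) * (\<Prod>n<N. 1 - e2pi (of_nat (Suc n) * t - z)) =
   (\<Sum>j\<le>2*N. (-1) powi (int j - int N) * e2pi ((of_int (int j - int N) * (of_int (int j - int N) - 1)) / 2 * t + of_int (int j - int N) * z) * qbin (e2pi t) (2*N) j)"
proof -
  \<comment> \<open>The shift by N t centres the 2 N factors; the 1/2 supplies the minus sign in
    each of them.\<close>
  define x where "x = z + 1/2 - of_nat N * t"
  have pm: "e2pi (1/2) = -1" by (rule e2pi_half)
  have m: "1 - e2pi w = 1 + e2pi (w + 1/2)" "1 - e2pi w = 1 + e2pi (w - 1/2)" for w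
    by (simp_all add: e2pi_add e2pi_diff pm)
  have A: "(\<Prod>n<N. 1 - e2pi (of_nat n * t + z)) = (\<Prod>i\<in>{N..<2*N}. 1 + e2pi (of_nat i * t + x))"
    unfolding m(1)
    by (rule prod.reindex_bij_witness[where i = "\<lambda>i. i - N" and j = "\<lambda>i. i + N"])
       (auto simp: x_def algebra_simps)
  have B: "(\<Prod>n<N. e2pi (z + 1/2 - of_nat (Suc n) * t)) * (\<Prod>n<N. 1 - e2pi (of_nat (Suc n) * t - z)) = (\<Prod>i<N. 1 + e2pi (of_nat i * t + x))"
    unfolding m(2) prod.distrib [symmetric]
  proof (rule prod.reindex_bij_witness[where i = "\<lambda>i. N - Suc i" and j = "\<lambda>i. N - Suc i"])
    fix n assume "n \<in> {..<N}"
    then have n: "of_nat (N - Suc n) = (of_nat N - of_nat (Suc n) :: complex)" by (simp add: of_nat_diff del: of_nat_Suc)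
    show "1 + e2pi (of_nat (N - Suc n) * t + x) = e2pi (z + 1/2 - of_nat (Suc n) * t) * (1 + e2pi (of_nat (Suc n) * t - z - 1/2))"
      unfolding distrib_left e2pi_add [symmetric] n x_def by (simp add: algebra_simps)
  qed auto
  have C: "(\<Prod>n<N. e2pi (z + 1/2 - of_nat (Suc n) * t)) = e2pi (of_nat N * (z + 1/2) - of_nat N * (of_nat N + 1) / 2 * t)"
  proof (induction N)
    case (Suc N)
    show ?case unfolding prod.lessThan_Suc Suc e2pi_add [symmetric]
      by (rule e2pi_cong) (simp add: field_simps)
  qed simp
  have S: "(\<Prod>i<2*N. 1 + e2pi (of_nat i * t + x)) = (\<Prod>i<N. 1 + e2pi (of_nat i * t + x)) * (\<Prod>i\<in>{N..<2*N}. 1 + e2pi (of_nat i * t + x))"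
    by (simp add: lessThan_atLeast0 prod.atLeastLessThan_concat)
  have "e2pi (of_nat N * (z + 1/2) - of_nat N * (of_nat N + 1) / 2 * t) * ((\<Prod>n<N. 1 - e2pi (of_nat n * t + z)) * (\<Prod>n<N. 1 - e2pi (of_nat (Suc n) * t - z)))
     = (\<Prod>i<2*N. 1 + e2pi (of_nat i * t + x))"
    unfolding S A B [symmetric] C by (simp only: mult_ac)
  also have "\<dots> = (\<Sum>j\<le>2*N. e2pi (of_nat j * (of_nat j - 1) / 2 * t + of_nat j * x) * qbin (e2pi t) (2*N) j)"
    by (rule qbinomial_theorem)
  finally have "e2pi (of_nat N * (z + 1/2) - of_nat N * (of_nat N + 1) / 2 * t) * ((\<Prod>n<N. 1 - e2pi (of_nat n * t + z)) * (\<Prod>n<N. 1 - e2pi (of_nat (Suc n) * t - z)))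
     = (\<Sum>j\<le>2*N. e2pi (of_nat j * (of_nat j - 1) / 2 * t + of_nat j * x) * qbin (e2pi t) (2*N) j)" .
  then have "(\<Prod>n<N. 1 - e2pi (of_nat n * t + z)) * (\<Prod>n<N. 1 - e2pi (of_nat (Suc n) * t - z))
     = e2pi (- (of_nat N * (z + 1/2) - of_nat N * (of_nat N + 1) / 2 * t)) * (\<Sum>j\<le>2*N. e2pi (of_nat j * (of_nat j - 1) / 2 * t + of_nat j * x) * qbin (e2pi t) (2*N) j)"
    unfolding e2pi_minus by (simp add: field_simps)
  also have "\<dots> = (\<Sum>j\<le>2*N. (-1) powi (int j - int N) * e2pi ((of_int (int j - int N) * (of_int (int j - int N) - 1)) / 2 * t + of_int (int j - int N) * z) * qbin (e2pi t) (2*N) j)"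
    unfolding sum_distrib_left
  proof (rule sum.cong[OF refl])
    fix j
    let ?k = "of_int (int j - int N) :: complex"
    have "e2pi (- (of_nat N * (z + 1/2) - of_nat N * (of_nat N + 1) / 2 * t)) * e2pi (of_nat j * (of_nat j - 1) / 2 * t + of_nat j * x)
      = e2pi (?k / 2 + (?k * (?k - 1) / 2 * t + ?k * z))"
      unfolding e2pi_add [symmetric] by (rule e2pi_cong) (simp add: x_def field_simps)
    also have "\<dots> = (-1) powi (int j - int N) * e2pi (?k * (?k - 1) / 2 * t + ?k * z)"
      by (simp only: e2pi_add e2pi_of_int_half)
    finally show "e2pi (- (of_nat N * (z + 1/2) - of_nat N * (of_nat N + 1) / 2 * t)) * (e2pi (of_nat j * (of_nat j - 1) / 2 * t + of_nat j * x) * qbin (e2pi t) (2*N) j)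
      = (-1) powi (int j - int N) * e2pi (?k * (?k - 1) / 2 * t + ?k * z) * qbin (e2pi t) (2*N) j"
      by (simp only: mult.assoc [symmetric])
  qed
  finally show ?thesis .
qed

text \<open>Dominated convergence for sums over the integers, reduced to series by
  \<open>int_decode\<close>.\<close>

lemma infsum_int_tannery:
  fixes a :: "nat \<Rightarrow> int \<Rightarrow> complex"
  assumes lim: "\<And>k. (\<lambda>n. a n k) \<longlonglongrightarrow> b k" and bd: "\<And>n k. norm (a n k) \<le> M k" and M: "M summable_on UNIV"
  shows "(\<lambda>n. infsum (a n) UNIV) \<longlonglongrightarrow> infsum b UNIV"
proof -
  have nb: "norm (b k) \<le> M k" for k
    by (rule LIMSEQ_le_const2[OF tendsto_norm[OF lim[of k]]]) (use bd in auto)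
  have sM: "summable (\<lambda>i. M (int_decode i))"
  proof -
    have "(\<lambda>i. M (int_decode i)) summable_on UNIV"
      using M summable_on_reindex_bij_betw[OF bij_int_decode, of M] by simp
    then show ?thesis by (rule summable_on_imp_summable)
  qed
  have e: "infsum f UNIV = suminf (\<lambda>i. f (int_decode i))" if "\<And>k. norm (f k) \<le> M k" for f :: "int \<Rightarrow> complex"
  proof -
    have "infsum f UNIV = infsum (\<lambda>i. f (int_decode i)) UNIV"
      using infsum_reindex_bij_betw[OF bij_int_decode, of f] by simp
    also have s: "summable (\<lambda>i. norm (f (int_decode i)))"
      by (rule summable_comparison_test'[OF sM, of 0]) (use that in auto)
    have "((\<lambda>i. f (int_decode i)) has_sum suminf (\<lambda>i. f (int_decode i))) UNIV"
      by (rule norm_summable_imp_has_sum[OF s summable_sums[OF summable_norm_cancel[OF s]]])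
    then have "infsum (\<lambda>i. f (int_decode i)) UNIV = suminf (\<lambda>i. f (int_decode i))" by (rule infsumI)
    finally show ?thesis .
  qed
  have "(\<lambda>n. suminf (\<lambda>i. a n (int_decode i))) \<longlonglongrightarrow> suminf (\<lambda>i. b (int_decode i))"
    using tannerys_theorem[where a = "\<lambda>i n. a n (int_decode i)" and b = "\<lambda>i. b (int_decode i)" and M = "\<lambda>i. M (int_decode i)" and F = sequentially]
      lim bd sM by (auto intro!: always_eventually)
  then show ?thesis using e[OF bd] e[OF nb] by simp
qed

text \<open>Let N tend to infinity in \<open>jtp_finite\<close>. For fixed k the Gaussian
  coefficients tend to 1 / \<open>qp t\<close>, and they are uniformly bounded because both
  \<open>qfac\<close> and its inverse converge.\<close>

theorem jacobi_triple_product: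
  assumes t: "Im t > 0"
  shows "tser t z = (e2pi (z/2) - e2pi (-z/2)) * qp t * tp t z * tp t (-z)"
proof -
  define C where "C = (\<lambda>N k. if \<bar>k\<bar> \<le> int N then qbin (e2pi t) (2*N) (nat (k + int N)) else 0)"
  define f where "f = (\<lambda>k::int. (-1) powi k * e2pi ((of_int k * (of_int k - 1)) / 2 * t + of_int k * z))"
  define PA where "PA = (\<lambda>N. \<Prod>n<N. 1 - e2pi (of_nat (Suc n) * t + z))"
  define PB where "PB = (\<lambda>N. \<Prod>n<N. 1 - e2pi (of_nat (Suc n) * t + (- z)))"
  let ?F = "\<lambda>N. (\<Prod>n<N. 1 - e2pi (of_nat n * t + z)) * PB N"
  have F: "?F N = infsum (\<lambda>k. f k * C N k) UNIV" for N
  proof -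
    have "?F N = (\<Sum>j\<le>2*N. f (int j - int N) * qbin (e2pi t) (2*N) j)"
      unfolding PB_def f_def using jtp_finite[where N = N and t = t and z = z] by simp
    also have "\<dots> = (\<Sum>k\<in>{-int N..int N}. f k * C N k)"
      by (rule sum.reindex_bij_witness[where i = "\<lambda>k. nat (k + int N)" and j = "\<lambda>j. int j - int N"]) (auto simp: C_def)
    also have "\<dots> = infsum (\<lambda>k. f k * C N k) {-int N..int N}" by simp
    also have "\<dots> = infsum (\<lambda>k. f k * C N k) UNIV"
      by (rule infsum_cong_neutral) (auto simp: C_def)
    finally show ?thesis .
  qed
  let ?Q = "qfac (e2pi t)"
  have nz: "?Q n \<noteq> 0" for n by (rule qfac_nonzero[OF t])
  have Cq: "C N k = ?Q (2*N) * inverse (?Q (nat (k + int N))) * inverse (?Q (nat (int N - k)))" if "\<bar>k\<bar> \<le> int N" for N k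
  proof -
    have "nat (k + int N) \<le> 2 * N" "2 * N - nat (k + int N) = nat (int N - k)" using that by auto
    then have "C N k * (?Q (nat (k + int N)) * ?Q (nat (int N - k))) = ?Q (2 * N)"
      using qbin_qfac[of "nat (k + int N)" "2*N" "e2pi t"] that by (simp add: C_def)
    then show ?thesis using nz by (simp add: field_simps)
  qed
  have limQ: "?Q \<longlonglongrightarrow> qp t" by (rule qfac_LIMSEQ[OF t])
  have limQi: "(\<lambda>n. inverse (?Q n)) \<longlonglongrightarrow> inverse (qp t)"
    by (intro tendsto_inverse limQ qp_nonzero t)
  obtain K1 where K1: "\<And>n. norm (?Q n) \<le> K1"
    using convergent_imp_Bseq[of ?Q] limQ unfolding convergent_def Bseq_def by blast
  obtain K2 where K2: "\<And>n. norm (inverse (?Q n)) \<le> K2"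
    using convergent_imp_Bseq[of "\<lambda>n. inverse (?Q n)"] limQi unfolding convergent_def Bseq_def by blast
  have K0: "0 \<le> K1" "0 \<le> K2" using K1[of 0] K2[of 0] norm_ge_zero order.trans by blast+
  have Cb: "norm (C N k) \<le> K1 * K2 * K2" for N k
  proof (cases "\<bar>k\<bar> \<le> int N")
    case True
    show ?thesis unfolding Cq[OF True] norm_mult
      by (intro mult_mono K1 K2 mult_nonneg_nonneg K0 norm_ge_zero)
  next
    case False
    then show ?thesis using K0 by (simp add: C_def)
  qed
  have Cl: "(\<lambda>N. C N k) \<longlonglongrightarrow> inverse (qp t)" for k
  proof -
    have a: "filterlim (\<lambda>N. 2 * N) at_top sequentially" "filterlim (\<lambda>N. nat (k + int N)) at_top sequentially" "filterlim (\<lambda>N. nat (int N - k)) at_top sequentially"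
      unfolding filterlim_at_top eventually_sequentially
      subgoal by (metis le_add2 mult_2 order.trans)
      subgoal by (rule allI, rule_tac x = "nat (int Z + \<bar>k\<bar>)" in exI) auto
      subgoal by (rule allI, rule_tac x = "nat (int Z + \<bar>k\<bar>)" in exI) auto
      done
    have "(\<lambda>N. ?Q (2*N) * inverse (?Q (nat (k + int N))) * inverse (?Q (nat (int N - k)))) \<longlonglongrightarrow> qp t * inverse (qp t) * inverse (qp t)"
      by (intro tendsto_mult filterlim_compose[OF limQ] filterlim_compose[OF limQi] a)
    also have "qp t * inverse (qp t) * inverse (qp t) = inverse (qp t)"
      using qp_nonzero[OF t] by simp
    finally show ?thesis
    proof (rule Lim_transform_eventually)
      show "eventually (\<lambda>N. ?Q (2*N) * inverse (?Q (nat (k + int N))) * inverse (?Q (nat (int N - k))) = C N k) sequentially"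
        using eventually_ge_at_top[of "nat \<bar>k\<bar>"] by eventually_elim (subst Cq, auto)
    qed
  qed
  \<comment> \<open>\<open>f\<close> carries the exponent k (k - 1) / 2 and \<open>tser\<close>
    carries k (k + 1) / 2, whence the index shift by one.\<close>
  have hsf: "((\<lambda>k. f k) has_sum - (e2pi (z/2) * tser t z)) UNIV"
  proof -
    have "((\<lambda>k. f (k + 1)) has_sum - (e2pi (z/2) * tser t z)) UNIV"
    proof -
      have "((\<lambda>k. - (e2pi (z/2) * ((-1) powi k * e2pi (of_nat (tN k) * t + (of_int k + 1/2) * z)))) has_sum - (e2pi (z/2) * tser t z)) UNIV"
        by (intro has_sum_uminusI has_sum_cmult_right tser_has_sum t)
      moreover have "- (e2pi (z/2) * ((-1) powi k * e2pi (of_nat (tN k) * t + (of_int k + 1/2) * z))) = f (k + 1)" for k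
      proof -
        have "- (e2pi (z/2) * ((-1) powi k * e2pi (of_nat (tN k) * t + (of_int k + 1/2) * z))) = (-1) powi (k + 1) * e2pi (z/2 + (of_nat (tN k) * t + (of_int k + 1/2) * z))"
          by (simp add: powi_m1_add e2pi_add)
        also have "z/2 + (of_nat (tN k) * t + (of_int k + 1/2) * z) = (of_int (k + 1) * (of_int (k + 1) - 1)) / 2 * t + of_int (k + 1) * z"
          by (simp add: complex_tN field_simps)
        finally show ?thesis by (simp add: f_def)
      qed
      ultimately show ?thesis by simp
    qed
    then show ?thesis by (subst (asm) has_sum_shift_int)
  qed
  have "(\<lambda>k. norm (f k)) summable_on UNIV"
    using hsf[THEN has_sum_imp_summable] by (simp only: summable_on_iff_abs_summable_on_complex)
  then have sM: "(\<lambda>k. norm (f k) * (K1 * K2 * K2)) summable_on UNIV" by (rule summable_on_cmult_left)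
  have "(\<lambda>N. ?F N) \<longlonglongrightarrow> infsum (\<lambda>k. f k * inverse (qp t)) UNIV"
    unfolding F
    by (rule infsum_int_tannery[OF _ _ sM]) (auto intro!: tendsto_mult tendsto_const Cl simp: norm_mult mult_left_mono Cb)
  moreover have "infsum (\<lambda>k. f k * inverse (qp t)) UNIV = - (e2pi (z/2) * tser t z) * inverse (qp t)"
    by (rule infsumI, rule has_sum_cmult_left, rule hsf)
  ultimately have l1: "(\<lambda>N. ?F N) \<longlonglongrightarrow> - (e2pi (z/2) * tser t z) * inverse (qp t)" by simp
  \<comment> \<open>The first product of \<open>?F\<close> starts at n = 0, so its factor 1 - y is
    split off and N is raised by one.\<close>
  have "(\<lambda>N. (1 - e2pi z) * (PA N * PB (Suc N))) \<longlonglongrightarrow> (1 - e2pi z) * (tp t z * tp t (- z))"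
    using tp_LIMSEQ[OF t, of z] LIMSEQ_Suc[OF tp_LIMSEQ[OF t, of "- z"]] unfolding PA_def PB_def by (intro tendsto_intros)
  moreover have "(1 - e2pi z) * (PA N * PB (Suc N)) = ?F (Suc N)" for N
  proof -
    have "(\<Prod>n<Suc N. 1 - e2pi (of_nat n * t + z)) = (1 - e2pi z) * PA N"
      unfolding prod.lessThan_Suc_shift PA_def by simp
    then show ?thesis by (simp only: mult.assoc)
  qed
  ultimately have "(\<lambda>N. ?F (Suc N)) \<longlonglongrightarrow> (1 - e2pi z) * (tp t z * tp t (- z))" by simp
  from LIMSEQ_unique[OF this LIMSEQ_Suc[OF l1]]
  have "(1 - e2pi z) * (tp t z * tp t (- z)) = - (e2pi (z/2) * tser t z) * inverse (qp t)" .
  then have eq: "- (e2pi (z/2) * tser t z) = (1 - e2pi z) * (qp t * tp t z * tp t (- z))"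
    using qp_nonzero[OF t] by (simp add: field_simps)
  have h: "e2pi z = e2pi (z/2) * e2pi (z/2)" "e2pi (-z/2) = inverse (e2pi (z/2))"
    by (simp add: e2pi_add [symmetric], simp add: e2pi_minus [symmetric])
  have "e2pi (z/2) * tser t z = e2pi (z/2) * ((e2pi (z/2) - e2pi (-z/2)) * qp t * tp t z * tp t (- z))"
    using eq unfolding h by (simp add: algebra_simps)
  then show ?thesis by simp
qed

subsection \<open>The normalised theta function\<close>

text \<open>Uniform convergence near 0 gives continuity there, which \<open>dn_eq_qp\<close> uses to
  pass to the limit in the triple product.\<close>

lemma continuous_tp:
  assumes t: "Im t > 0" shows "isCont (tp t) 0"
proof -
  let ?A = "cball (0::complex) 1" and ?f = "\<lambda>n z. 1 - e2pi (of_nat (Suc n) * t + z)"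
  have "uniformly_convergent_on ?A (\<lambda>N z. \<Prod>n<N. ?f n z)"
  proof (rule uniformly_convergent_on_prod')
    show "continuous_on ?A (?f n)" for n
      by (intro holomorphic_on_imp_continuous_on holomorphic_intros)
    show "uniformly_convergent_on ?A (\<lambda>N z. \<Sum>n<N. norm (?f n z - 1))"
    proof (rule Weierstrass_m_test')
      show "norm (norm (?f n z - 1)) \<le> norm (e2pi (of_nat (Suc n) * t + 0)) * exp (2 * pi)" if "z \<in> ?A" for n z
      proof -
        have "Im z \<ge> -1" using abs_Im_le_cmod[of z] that by simp
        then have "pi * - 1 \<le> pi * Im z" by (intro mult_left_mono) auto
        then have "norm (e2pi z) \<le> exp (2 * pi)" by (simp add: norm_e2pi)
        then show ?thesis by (simp add: e2pi_add norm_mult mult_left_mono)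
      qed
      show "summable (\<lambda>n. norm (e2pi (of_nat (Suc n) * t + 0)) * exp (2 * pi))"
        by (intro summable_mult2 summable_e2pi_shift t)
    qed
  qed auto
  then obtain l where l: "uniform_limit ?A (\<lambda>N z. \<Prod>n<N. ?f n z) l sequentially"
    by (auto simp: uniformly_convergent_on_def)
  have "continuous_on ?A l"
    by (rule uniform_limit_theorem[OF _ l]) (auto intro!: always_eventually continuous_on_prod holomorphic_on_imp_continuous_on holomorphic_intros)
  moreover have "l z = tp t z" if "z \<in> ?A" for z
    using tendsto_uniform_limitI[OF l that] tp_LIMSEQ[OF t, of z] LIMSEQ_unique by blast
  ultimately have "continuous_on ?A (tp t)" by (subst (asm) continuous_on_cong) auto
  then have "continuous_on (ball 0 1) (tp t)" by (rule continuous_on_subset) auto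
  then show ?thesis by (simp add: continuous_on_eq_continuous_at)
qed

definition dn :: "complex \<Rightarrow> complex" where
  "dn t = deriv (tser t) 0 / \<kappa>"

text \<open>Jacobi's formula theta'(0) = 2 pi i eta^3, without the power of q. In the triple product
  only the sine factor vanishes at 0, so the derivative is that of the sine times the value of the
  rest.\<close>

lemma dn_eq_qp: assumes t: "Im t > 0" shows "dn t = qp t ^ 3"
proof -
  define S where "S = (\<lambda>z. e2pi (z/2) - e2pi (-z/2))"
  define H where "H = (\<lambda>z. qp t * tp t z * tp t (- z))"
  have S': "(S has_field_derivative \<kappa>) (at 0)"
    unfolding S_def by (auto intro!: derivative_eq_intros)
  have c: "isCont H 0"
  proof -
    have "isCont (\<lambda>z. tp t (- z)) 0"
      by (rule isCont_o2[where f = uminus]) (use continuous_tp[OF t] in auto)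
    then show ?thesis unfolding H_def using continuous_tp[OF t] by (intro continuous_intros)
  qed
  have "((\<lambda>z. S z / z * H z) \<longlongrightarrow> \<kappa> * H 0) (at 0)"
    using S' c by (intro tendsto_mult) (auto simp: has_field_derivative_iff S_def isCont_def)
  moreover have "((\<lambda>z. tser t z / z) \<longlongrightarrow> deriv (tser t) 0) (at 0)"
  proof -
    have "(tser t has_field_derivative deriv (tser t) 0) (at 0)"
      using tser_holomorphic[OF t] by (intro holomorphic_derivI) auto
    moreover have "tser t 0 = 0" using tser_odd[OF t, of 0] by simp
    ultimately show ?thesis by (auto simp: has_field_derivative_iff)
  qed
  moreover have "tser t z / z = S z / z * H z" for z
    by (simp add: jacobi_triple_product[OF t] S_def H_def mult_ac)
  ultimately have "deriv (tser t) 0 = \<kappa> * H 0"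
    using LIM_unique by auto
  then show ?thesis by (simp add: dn_def H_def qp_eq_tp power3_eq_cube)
qed

lemma dn_nonzero: "Im t > 0 \<Longrightarrow> dn t \<noteq> 0"
  using dn_eq_qp qp_nonzero by simp

lemma qval_inverse:
  assumes "qval h c" "c \<noteq> 0" "\<And>t. Im t > 0 \<Longrightarrow> h t \<noteq> 0"
  shows "qval (\<lambda>t. inverse (h t)) (inverse c)"
proof -
  obtain g where g: "g holomorphic_on ball 0 1" "g 0 = c" "\<And>t. 0 < Im t \<Longrightarrow> h t = g (e2pi t)"
    using assms(1) unfolding qval_def by blast
  have "g q \<noteq> 0" if "q \<in> ball 0 1" for q
  proof (cases "q = 0")
    case False
    have "norm q < 1" using that by simp
    then obtain t where "e2pi t = q" "Im t > 0" using e2pi_surj_H[OF False] by blast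
    then show ?thesis using assms(3) g(3) by metis
  qed (use g assms in simp)
  then have "(\<lambda>q. inverse (g q)) holomorphic_on ball 0 1" by (intro holomorphic_intros g)
  then show ?thesis unfolding qval_def using g by (intro exI[of _ "\<lambda>q. inverse (g q)"]) auto
qed

text \<open>This is 2 i sin(pi z), the cusp value of theta and of T. Its square y - 2 + 1/y is the
  variable u in which all q^0-terms are written.\<close>

definition sy :: "complex \<Rightarrow> complex" where "sy z = e2pi (z/2) - e2pi (-z/2)"

lemma deriv_sy: "deriv sy z = of_real pi * \<i> * (e2pi (z/2) + e2pi (- z/2))"
  unfolding sy_def[abs_def] by (rule DERIV_imp_deriv) (auto intro!: derivative_eq_intros simp: algebra_simps)

lemma deriv_s: "deriv sy 0 = \<kappa>"
  by (simp add: deriv_sy)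

lemma jfam_tser_sy: "jfam tser sy"
  using jfam_tser by (simp only: sy_def[abs_def])

lemma qval_dn: "qval dn 1"
proof -
  have "qval (\<lambda>t. deriv (tser t) 0 * inverse \<kappa>) (deriv sy 0 * inverse \<kappa>)"
    by (intro qval_mult qval_const jfam_qval0 jfam_deriv jfam_tser_sy)
  also have "deriv sy 0 * inverse \<kappa> = 1"
    unfolding deriv_s by (rule right_inverse) simp
  finally show ?thesis by (simp only: dn_def[abs_def] divide_inverse)
qed

text \<open>This is T = theta / eta^3, the powers of q cancelling. Its derivative at 0 is the
  constant 2 pi i, so it transforms with weight -1 and index 1/2 and without a multiplier
  system.\<close>

definition th :: "complex \<Rightarrow> complex \<Rightarrow> complex" where
  "th t z = tser t z / dn t"

lemma th_holomorphic: "Im t > 0 \<Longrightarrow> th t is_entire"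
  unfolding th_def[abs_def] by (intro holomorphic_intros tser_holomorphic dn_nonzero)

lemma jfam_th: "jfam th sy"
proof -
  have "jfam (\<lambda>t z. tser t z * inverse (dn t)) (\<lambda>z. sy z * inverse 1)"
    by (intro jfam_mult jfam_tser_sy jfam_qval_const qval_inverse qval_dn) (auto simp: dn_nonzero)
  then show ?thesis by (simp only: th_def[abs_def] divide_inverse inverse_1 mult_1_right)
qed

lemma th_odd: "Im t > 0 \<Longrightarrow> th t (- z) = - th t z"
  by (simp add: th_def tser_odd)

lemma th_0 [simp]: "Im t > 0 \<Longrightarrow> th t 0 = 0"
  using th_odd[of t 0] by simp

lemma deriv_th_0: "Im t > 0 \<Longrightarrow> deriv (th t) 0 = \<kappa>"
proof -
  assume t: "Im t > 0"
  have "deriv (\<lambda>z. tser t z / dn t) 0 = deriv (tser t) 0 / dn t"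
    by (rule deriv_cdivide_right) (use tser_holomorphic[OF t] holomorphic_on_imp_differentiable_at in auto)
  moreover have "deriv (tser t) 0 \<noteq> 0" using dn_nonzero[OF t] by (auto simp: dn_def)
  ultimately show ?thesis by (simp add: th_def[abs_def] dn_def)
qed

lemma th_shift:
  "Im t > 0 \<Longrightarrow> th t (z + of_int a * t + of_int b) = (-1) powi (a + b) * e2pi (- (of_int a)\<^sup>2 / 2 * t - of_int a * z) * th t z"
  by (simp add: th_def tser_shift)

lemma th_product: "Im t > 0 \<Longrightarrow> th t z = (e2pi (z/2) - e2pi (-z/2)) * tp t z * tp t (-z) / qp t ^ 2"
  by (simp add: th_def dn_eq_qp jacobi_triple_product qp_nonzero power3_eq_cube power2_eq_square field_simps)

lemma th_lattice_zero: "Im t > 0 \<Longrightarrow> th t (of_int a * t + of_int b) = 0"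
  using th_shift[of t 0 a b] by simp

text \<open>The zeros are read off from the product: a factor vanishes only where q^n y equals 1 for
  some integer n.\<close>

lemma th_eq_0_iff: assumes t: "Im t > 0" shows "th t z = 0 \<longleftrightarrow> (\<exists>a b. z = of_int a * t + of_int b)"
proof
  assume "th t z = 0"
  then consider "e2pi (z/2) = e2pi (-z/2)" | "tp t z = 0" | "tp t (- z) = 0"
    using qp_nonzero[OF t] by (auto simp: th_product[OF t])
  then show "\<exists>a b. z = of_int a * t + of_int b"
  proof cases
    case 1
    then obtain n where "z / 2 = - z / 2 + of_int n" unfolding e2pi_eq_iff by blast
    then have "z = of_int 0 * t + of_int n" by (simp add: field_simps)
    then show ?thesis by blast
  next
    case 2
    then obtain n where "e2pi (of_nat (Suc n) * t + z) = 1" using tp_nonzero[OF t] by blast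
    then obtain m where "of_nat (Suc n) * t + z = of_int m" unfolding e2pi_eq_1_iff by blast
    then have "z = of_int (- int (Suc n)) * t + of_int m" by (simp add: algebra_simps)
    then show ?thesis by blast
  next
    case 3
    then obtain n where "e2pi (of_nat (Suc n) * t - z) = 1" using tp_nonzero[OF t, of "- z"] by auto
    then obtain m where "of_nat (Suc n) * t - z = of_int m" unfolding e2pi_eq_1_iff by blast
    then have "z = of_int (int (Suc n)) * t + of_int (- m)" by (simp add: algebra_simps)
    then show ?thesis by blast
  qed
qed (use th_lattice_zero[OF t] in auto)

text \<open>A lattice translation multiplies T by a nowhere vanishing exponential and so carries the
  simple zero at 0 to every other zero.\<close>

lemma deriv_th_nonzero: assumes t: "Im t > 0" and "th t z = 0" shows "deriv (th t) z \<noteq> 0"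
proof -
  obtain a b where z: "z = of_int a * t + of_int b" using assms th_eq_0_iff by blast
  let ?C = "(-1) powi (a + b) * e2pi (- (of_int a)\<^sup>2 / 2 * t)"
  have d0: "(th t has_field_derivative deriv (th t) w) (at w)" for w
    using th_holomorphic[OF t] by (intro holomorphic_derivI) auto
  have "((\<lambda>w. th t (w + z)) has_field_derivative deriv (th t) z) (at 0)"
    using d0[of "0 + z"] unfolding DERIV_shift by simp
  moreover have "(\<lambda>w. th t (w + z)) = (\<lambda>w. ?C * e2pi (- of_int a * w) * th t w)"
  proof (rule ext)
    fix w
    have "th t (w + z) = th t (w + of_int a * t + of_int b)" by (simp only: z add.assoc)
    also have "\<dots> = (-1) powi (a + b) * e2pi (- (of_int a)\<^sup>2 / 2 * t - of_int a * w) * th t w" by (rule th_shift[OF t])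
    also have "e2pi (- (of_int a)\<^sup>2 / 2 * t - of_int a * w) = e2pi (- (of_int a)\<^sup>2 / 2 * t) * e2pi (- of_int a * w)"
      unfolding e2pi_add [symmetric] by (rule e2pi_cong) simp
    finally show "th t (w + z) = ?C * e2pi (- of_int a * w) * th t w" by (simp only: mult.assoc)
  qed
  moreover have "((\<lambda>w. ?C * e2pi (- of_int a * w) * th t w) has_field_derivative ?C * \<kappa>) (at 0)"
    using d0[of 0] by (auto intro!: derivative_eq_intros simp: t deriv_th_0)
  ultimately have "deriv (th t) z = ?C * \<kappa>" by (metis DERIV_unique)
  then show ?thesis by (simp add: power_int_eq_0_iff)
qed

lemma th_divide:
  assumes t: "Im t > 0" and F: "F is_entire" and "\<And>a b. F (of_int a * t + of_int b) = 0"
  obtains G where "G is_entire" "\<And>z. G z * th t z = F z"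
proof (rule entire_divide[OF F th_holomorphic[OF t]])
  show "F w = 0" if w0: "th t w = 0" for w
  proof -
    obtain a b where "w = of_int a * t + of_int b" using w0 unfolding th_eq_0_iff[OF t] by blast
    then show ?thesis by (simp only: assms(3))
  qed
qed (use deriv_th_nonzero[OF t] that in auto)

text \<open>The identity theorem, applied on the open set where h does not vanish. Functional
  equations of quotients are proved by it after multiplication with the denominator.\<close>

lemma entire_cancel:
  assumes "A is_entire" "B is_entire" "\<And>z. A z * h z = B z * h z" "h is_entire" "h w \<noteq> 0"
  shows "A z = (B z :: complex)"
proof (rule analytic_continuation_open[of "{z. h z \<noteq> 0}" UNIV A B])
  show "open {z. h z \<noteq> 0}"
    by (intro open_Collect_neq continuous_intros holomorphic_on_imp_continuous_on assms)
qed (use assms in auto)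

lemma th_half_nonzero: assumes t: "Im t > 0" shows "th t (1/2) \<noteq> 0"
proof
  assume "th t (1/2) = 0"
  then obtain a b where ab: "1/2 = of_int a * t + of_int b" unfolding th_eq_0_iff[OF t] by blast
  then have "Im (1/2) = Im (of_int a * t + of_int b)" by metis
  then have "a = 0" using t by simp
  with ab have "(1::complex) = of_int (2 * b)" by (simp add: field_simps)
  then have "1 = 2 * b" by (metis of_int_1 of_int_eq_iff)
  then show False by presburger
qed

lemma th_cancel:
  assumes t: "Im t > 0" and "A is_entire" "B is_entire" "\<And>z. A z * th t z = B z * th t z"
  shows "A z = B z"
  using assms(2,3,4) th_holomorphic[OF t] th_half_nonzero[OF t] by (rule entire_cancel)

subsection \<open>The elliptic transformation law\<close>

definition ell :: "complex \<Rightarrow> nat \<Rightarrow> (complex \<Rightarrow> complex) \<Rightarrow> bool" where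
  "ell t m F \<longleftrightarrow> F is_entire \<and> (\<forall>a b z. F (z + of_int a * t + of_int b) =
     e2pi (- of_nat m * ((of_int a)\<^sup>2 * t + 2 * of_int a * z)) * F z)"

lemma e2pi_index_add: "e2pi (- of_nat (m + n) * x) = e2pi (- of_nat m * x) * e2pi (- of_nat n * x)"
  unfolding e2pi_add [symmetric] by (rule e2pi_cong) (simp add: algebra_simps)

lemma ell_mult: assumes "ell t m F" "ell t n G" shows "ell t (m + n) (\<lambda>z. F z * G z)"
  unfolding ell_def
proof (intro conjI allI)
  show "(\<lambda>z. F z * G z) is_entire" using assms unfolding ell_def by (intro holomorphic_intros) auto
  fix a b z
  show "F (z + of_int a * t + of_int b) * G (z + of_int a * t + of_int b) =
     e2pi (- of_nat (m + n) * ((of_int a)\<^sup>2 * t + 2 * of_int a * z)) * (F z * G z)"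
    using assms unfolding ell_def e2pi_index_add by (simp only: mult_ac)
qed

lemma ell_add: "ell t m F \<Longrightarrow> ell t m G \<Longrightarrow> ell t m (\<lambda>z. F z + G z)"
  unfolding ell_def by (auto simp: distrib_left intro!: holomorphic_intros)

lemma ell_cmult: "ell t m F \<Longrightarrow> ell t m (\<lambda>z. c * F z)"
  unfolding ell_def by (auto intro!: holomorphic_intros)

lemma ell_const: "ell t 0 (\<lambda>z. c)"
  unfolding ell_def by auto

lemma ell_0_constant:
  assumes "ell t 0 F" "Im t > 0" shows "F z = F 0"
proof -
  have *: "F (z + of_int a * t + of_int b) = F z" for a b z using assms by (simp add: ell_def)
  obtain c where "\<And>z. F z = c"
  proof (rule entire_norm_periodic_constant[of F t])
    show "cmod (F (z + 1)) = cmod (F z)" for z using *[of z 0 1] by simp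
    show "cmod (F (z + t)) = cmod (F z)" for z using *[of z 1 0] by simp
  qed (use assms in \<open>auto simp: ell_def\<close>)
  then show ?thesis by simp
qed

lemma ell_th_sq: assumes t: "Im t > 0" shows "ell t 1 (\<lambda>z. th t z ^ 2)"
  unfolding ell_def
proof (intro conjI allI)
  fix a b z
  have "e2pi (- (of_int a)\<^sup>2 / 2 * t - of_int a * z) ^ 2 = e2pi (- of_nat 1 * ((of_int a)\<^sup>2 * t + 2 * of_int a * z))"
    unfolding e2pi_of_nat_mult [symmetric] by (rule e2pi_cong) (simp add: field_simps)
  then show "th t (z + of_int a * t + of_int b) ^ 2 = e2pi (- of_nat 1 * ((of_int a)\<^sup>2 * t + 2 * of_int a * z)) * th t z ^ 2"
    unfolding th_shift[OF t] power_mult_distrib by (simp add: power2_eq_square powi_m1_sq)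
qed (intro holomorphic_intros th_holomorphic t)

lemma holomorphic_shift: "F is_entire \<Longrightarrow> (\<lambda>z. F (z + w)) is_entire"
  by (rule holomorphic_on_compose_gen[unfolded o_def, of "\<lambda>z. z + w" UNIV F UNIV]) (auto intro!: holomorphic_intros)

lemma holomorphic_shift2: "F is_entire \<Longrightarrow> (\<lambda>z. F (z + w + v)) is_entire"
  using holomorphic_shift[of F "w + v"] by (simp only: add.assoc)

lemma holomorphic_scale: "F is_entire \<Longrightarrow> (\<lambda>z. F (u * z)) is_entire"
  by (rule holomorphic_on_compose_gen[unfolded o_def, of "\<lambda>z. u * z" UNIV F UNIV]) (auto intro!: holomorphic_intros)

lemma holomorphic_reflect: "F is_entire \<Longrightarrow> (\<lambda>z. F (- z)) is_entire"
  using holomorphic_scale[of F "-1"] by simp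

text \<open>After one division the quotient is odd, so it vanishes at 0 and, by its translation law,
  on the whole lattice. This is why a zero of an even function permits two divisions.\<close>

lemma ell_divide_th_sq:
  assumes t: "Im t > 0" and F: "ell t (Suc m) F" and ev: "\<And>z. F (- z) = F z" and F0: "F 0 = 0"
  obtains G where "ell t m G" "\<And>z. G (- z) = G z" "\<And>z. th t z ^ 2 * G z = F z"
proof -
  have Fh: "F is_entire" using F by (simp add: ell_def)
  have "F (of_int a * t + of_int b) = 0" for a b
    using F F0 unfolding ell_def by (metis add_0 mult_zero_right)
  from th_divide[OF t Fh this] obtain G1 where G1: "G1 is_entire" "\<And>z. G1 z * th t z = F z" by blast
  have odd1: "G1 (- z) = - G1 z" for z
  proof (rule th_cancel[OF t, of "\<lambda>z. G1 (- z)" "\<lambda>z. - G1 z"])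
    show "G1 (- z) * th t z = - G1 z * th t z" for z
      using G1(2)[of "- z"] G1(2)[of z] ev[of z] th_odd[OF t, of z] by (simp add: minus_equation_iff)
  qed (intro holomorphic_intros holomorphic_reflect G1)+
  let ?E = "\<lambda>a z. e2pi (- of_nat (Suc m) * ((of_int a)\<^sup>2 * t + 2 * of_int a * z))"
  let ?e = "\<lambda>a b z. (-1) powi (a + b) * e2pi (- (of_int a)\<^sup>2 / 2 * t - of_int a * z)"
  have ene: "?e a b z \<noteq> 0" for a b z by (simp add: power_int_eq_0_iff)
  have sh1: "G1 (z + of_int a * t + of_int b) * ?e a b z = ?E a z * G1 z" for a b z
  proof (rule th_cancel[OF t, of "\<lambda>z. G1 (z + of_int a * t + of_int b) * ?e a b z" "\<lambda>z. ?E a z * G1 z"])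
    show "G1 (z + of_int a * t + of_int b) * ?e a b z * th t z = ?E a z * G1 z * th t z" for z
      using G1(2)[of "z + of_int a * t + of_int b"] G1(2)[of z] F th_shift[OF t, of z a b]
      unfolding ell_def by (simp add: mult.assoc)
    show "(\<lambda>z. G1 (z + of_int a * t + of_int b) * ?e a b z) is_entire"
      by (intro holomorphic_intros holomorphic_shift2 G1)
    show "(\<lambda>z. ?E a z * G1 z) is_entire" by (intro holomorphic_intros G1)
  qed
  have "G1 (of_int a * t + of_int b) = 0" for a b
  proof -
    have "G1 0 = 0" using odd1[of 0] by simp
    then show ?thesis using sh1[of 0 a b] ene[of a b 0] by simp
  qed
  from th_divide[OF t G1(1) this] obtain G where G: "G is_entire" "\<And>z. G z * th t z = G1 z" by blast
  have FG: "th t z ^ 2 * G z = F z" for z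
    unfolding G1(2)[symmetric] G(2)[symmetric] by (simp only: power2_eq_square mult_ac)
  have "G (- z) = G z" for z
  proof (rule th_cancel[OF t, of "\<lambda>z. G (- z)" "\<lambda>z. G z"])
    show "G (- z) * th t z = G z * th t z" for z
      using G(2)[of "- z"] G(2)[of z] odd1[of z] th_odd[OF t, of z] by (auto simp add: minus_equation_iff)
  qed (intro holomorphic_reflect G)+
  moreover have "ell t m G"
    unfolding ell_def
  proof (intro conjI allI)
    show "G is_entire" by (rule G)
    fix a b z
    let ?Em = "\<lambda>z. e2pi (- of_nat m * ((of_int a)\<^sup>2 * t + 2 * of_int a * z))"
    show "G (z + of_int a * t + of_int b) = ?Em z * G z"
    proof (rule entire_cancel[of "\<lambda>z. G (z + of_int a * t + of_int b)" "\<lambda>z. ?Em z * G z" "\<lambda>z. th t z ^ 2"])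
      show "(\<lambda>z. G (z + of_int a * t + of_int b)) is_entire"
        by (intro holomorphic_shift2 G)
      show "(\<lambda>z. ?Em z * G z) is_entire" by (intro holomorphic_intros G)
      show "(\<lambda>z. (th t z)\<^sup>2) is_entire" by (intro holomorphic_intros th_holomorphic t)
      show "(th t (1/2))\<^sup>2 \<noteq> 0" using th_half_nonzero[OF t] by simp
      fix z
      let ?E1 = "e2pi (- of_nat 1 * ((of_int a)\<^sup>2 * t + 2 * of_int a * z))"
      have "(?E1 * th t z ^ 2) * G (z + of_int a * t + of_int b) = (?E1 * ?Em z) * (th t z ^ 2 * G z)"
      proof -
        have "?E1 * th t z ^ 2 = th t (z + of_int a * t + of_int b) ^ 2"
          using ell_th_sq[OF t] unfolding ell_def by simp
        moreover have "?E1 * ?Em z = ?E a z"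
          unfolding e2pi_add [symmetric] by (rule e2pi_cong) (simp add: algebra_simps)
        ultimately show ?thesis using FG[of "z + of_int a * t + of_int b"] FG[of z] F
          unfolding ell_def by metis
      qed
      then show "G (z + of_int a * t + of_int b) * (th t z)\<^sup>2 = ?Em z * G z * (th t z)\<^sup>2"
        by (simp add: mult_ac)
    qed
  qed
  ultimately show ?thesis using that FG by blast
qed

subsection \<open>The modular transformation law\<close>

locale sl2 =
  fixes a b c d :: int and t :: complex
  assumes det: "a * d - b * c = 1" and t: "Im t > 0"
begin

definition j :: complex where "j = of_int c * t + of_int d"
definition g :: complex where "g = (of_int a * t + of_int b) / j"

lemma det': "of_int a * of_int d - of_int b * of_int c = (1::complex)"
  using det by (metis of_int_1 of_int_diff of_int_mult)

lemma j_nonzero: "j \<noteq> 0"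
proof
  assume "j = 0"
  then have j: "of_int c * t + of_int d = 0" by (simp add: j_def)
  then have "Im (aut c d t) = 0" by (simp only: zero_complex.sel)
  then have c: "c = 0" using t by simp
  then have "d = 0" using j by simp
  then show False using c det by simp
qed

lemma inverse_j: "1 / j = of_int a - of_int c * g"
  using det' j_nonzero by (simp add: g_def j_def field_simps)

lemma t_div_j: "t / j = of_int d * g - of_int b"
proof -
  have "of_int d * (of_int a * t + of_int b) - of_int b * j = (of_int a * of_int d - of_int b * of_int c) * t"
    by (simp add: j_def algebra_simps)
  then have "of_int d * (of_int a * t + of_int b) - of_int b * j = t" using det' by simp
  then show ?thesis using j_nonzero by (simp add: g_def field_simps)
qed

lemma Im_g: "Im g > 0"
proof -
  have "Im g * (norm j)\<^sup>2 = Im t"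
  proof -
    have "g * (j * cnj j) = (of_int a * t + of_int b) * cnj j"
      using j_nonzero by (simp add: g_def)
    then have "Im (g * of_real ((norm j)\<^sup>2)) = Im ((of_int a * t + of_int b) * cnj j)"
      by (simp only: complex_norm_square)
    also have "\<dots> = (of_int a * of_int d - of_int b * of_int c) * Im t"
      by (simp add: j_def algebra_simps)
    also have "(of_int a * of_int d - of_int b * of_int c :: real) = 1"
      using det by (metis of_int_1 of_int_diff of_int_mult)
    finally show ?thesis by simp
  qed
  then show ?thesis using t j_nonzero by (metis zero_less_mult_pos2 zero_less_norm_iff zero_less_power)
qed

text \<open>The left side with its exponential removed, divided by T at t, is entire and periodic up
  to signs, since z / j maps the lattice of t into that of g. So it is constant. The signs are
  carried along without being evaluated.\<close>

lemma th_modular: "th g (z / j) = e2pi (of_int c * z\<^sup>2 / (2 * j)) / j * th t z"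
proof -
  define F where "F = (\<lambda>z. th g (z / j) * e2pi (- (of_int c * z\<^sup>2 / (2 * j))))"
  have Fh: "F is_entire"
    unfolding F_def using holomorphic_scale[OF th_holomorphic[OF Im_g], of "1 / j"]
    by (intro holomorphic_intros) (auto simp: j_nonzero)
  have lat: "F (of_int m * t + of_int n) = 0" for m n
  proof -
    have "(of_int m * t + of_int n) / j = of_int m * (t / j) + of_int n * (1 / j)"
      by (simp add: add_divide_distrib)
    also have "\<dots> = of_int (m * d - n * c) * g + of_int (n * a - m * b)"
      unfolding inverse_j t_div_j by (simp add: algebra_simps)
    finally show ?thesis by (simp only: F_def th_lattice_zero[OF Im_g] mult_zero_left)
  qed
  from th_divide[OF t Fh lat] obtain G where G: "G is_entire" "\<And>z. G z * th t z = F z" by blast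
  have F1: "F (z + 1) = ((-1) powi (- c + a) * (-1) powi (- (a * c))) * F z" for z
  proof -
    have "(z + 1) / j = z / j + of_int (- c) * g + of_int a"
      using inverse_j by (simp add: add_divide_distrib)
    then have "F (z + 1) = (-1) powi (- c + a) * (e2pi (- (of_int (- c))\<^sup>2 / 2 * g - of_int (- c) * (z / j)) * e2pi (- (of_int c * (z + 1)\<^sup>2 / (2 * j)))) * th g (z / j)"
      unfolding F_def by (simp only: th_shift[OF Im_g] mult_ac)
    also have "e2pi (- (of_int (- c))\<^sup>2 / 2 * g - of_int (- c) * (z / j)) * e2pi (- (of_int c * (z + 1)\<^sup>2 / (2 * j)))
      = e2pi (of_int (- (a * c)) / 2) * e2pi (- (of_int c * z\<^sup>2 / (2 * j)))"
      unfolding e2pi_add [symmetric]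
    proof (rule e2pi_cong)
      have "- (of_int (- c))\<^sup>2 / 2 * g - of_int (- c) * (z / j) + - (of_int c * (z + 1)\<^sup>2 / (2 * j))
        = - (of_int c * z\<^sup>2 / (2 * j)) - of_int c / 2 * (of_int c * g + 1 / j)"
        using j_nonzero by (simp add: power2_eq_square field_simps)
      also have "of_int c * g + 1 / j = of_int a" using inverse_j by simp
      finally show "- (of_int (- c))\<^sup>2 / 2 * g - of_int (- c) * (z / j) + - (of_int c * (z + 1)\<^sup>2 / (2 * j)) = of_int (- (a * c)) / 2 + - (of_int c * z\<^sup>2 / (2 * j))"
        by (simp add: mult.commute)
    qed
    finally show ?thesis by (simp only: F_def e2pi_of_int_half mult_ac)
  qed
  have F2: "F (z + t) = ((-1) powi (d + - b) * (-1) powi (- (b * d))) * (e2pi (- (1/2) * t - z) * F z)" for z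
  proof -
    have "(z + t) / j = z / j + of_int d * g + of_int (- b)"
      using t_div_j by (simp add: add_divide_distrib)
    then have "F (z + t) = (-1) powi (d + - b) * (e2pi (- (of_int d)\<^sup>2 / 2 * g - of_int d * (z / j)) * e2pi (- (of_int c * (z + t)\<^sup>2 / (2 * j)))) * th g (z / j)"
      unfolding F_def by (simp only: th_shift[OF Im_g] mult_ac)
    also have "e2pi (- (of_int d)\<^sup>2 / 2 * g - of_int d * (z / j)) * e2pi (- (of_int c * (z + t)\<^sup>2 / (2 * j)))
      = e2pi (of_int (- (b * d)) / 2) * (e2pi (- (1/2) * t - z) * e2pi (- (of_int c * z\<^sup>2 / (2 * j))))"
      unfolding e2pi_add [symmetric]
    proof (rule e2pi_cong)
      have A: "(of_int d * z + of_int c * (z * t)) / j = z"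
        using j_nonzero by (simp add: divide_eq_eq j_def algebra_simps)
      \<comment> \<open>Clearing the denominator j turns this into the determinant condition a d - b
        c = 1.\<close>
      have B: "(of_int d)\<^sup>2 * g + of_int c * t\<^sup>2 / j = t + of_int (b * d)"
      proof -
        have "of_int d * (of_int a * of_int d) * t + (of_int d)\<^sup>2 * of_int b + of_int c * t\<^sup>2 = (t + of_int (b * d)) * j + of_int d * (of_int a * of_int d - of_int b * of_int c - 1) * t"
          by (simp add: j_def power2_eq_square algebra_simps)
        then have "of_int d * (of_int a * of_int d) * t + (of_int d)\<^sup>2 * of_int b + of_int c * t\<^sup>2 = (t + of_int (b * d)) * j"
          using det' by simp
        moreover have "((of_int d)\<^sup>2 * g + of_int c * t\<^sup>2 / j) * j = of_int d * (of_int a * of_int d) * t + (of_int d)\<^sup>2 * of_int b + of_int c * t\<^sup>2"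
          using j_nonzero by (simp add: g_def power2_eq_square field_simps)
        ultimately show ?thesis using j_nonzero by (metis mult_right_cancel)
      qed
      have "- (of_int d)\<^sup>2 / 2 * g - of_int d * (z / j) + - (of_int c * (z + t)\<^sup>2 / (2 * j))
        = - (of_int c * z\<^sup>2 / (2 * j)) - (of_int d * z + of_int c * (z * t)) / j - ((of_int d)\<^sup>2 * g + of_int c * t\<^sup>2 / j) / 2"
        using j_nonzero by (simp add: power2_eq_square field_simps)
      then have L: "- (of_int d)\<^sup>2 / 2 * g - of_int d * (z / j) + - (of_int c * (z + t)\<^sup>2 / (2 * j)) = - (of_int c * z\<^sup>2 / (2 * j)) - z - (t + of_int (b * d)) / 2"
        unfolding A B .
      show "- (of_int d)\<^sup>2 / 2 * g - of_int d * (z / j) + - (of_int c * (z + t)\<^sup>2 / (2 * j)) = of_int (- (b * d)) / 2 + (- (1 / 2) * t - z + - (of_int c * z\<^sup>2 / (2 * j)))"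
        unfolding L by (simp add: add_divide_distrib)
    qed
    finally show ?thesis by (simp only: F_def e2pi_of_int_half mult_ac)
  qed
  have G1: "G (z + 1) = (- ((-1) powi (- c + a) * (-1) powi (- (a * c)))) * G z" for z
  proof (rule th_cancel[OF t, of "\<lambda>z. G (z + 1)" "\<lambda>z. (- ((-1) powi (- c + a) * (-1) powi (- (a * c)))) * G z"])
    fix z
    let ?s = "(-1) powi (- c + a) * (-1) powi (- (a * c)) :: complex"
    have "th t (z + 1) = - th t z" using th_shift[OF t, of z 0 1] by simp
    then have h: "G (z + 1) * (- th t z) = ?s * (G z * th t z)"
      using G(2)[of "z + 1"] G(2)[of z] F1[of z] by simp
    have "G (z + 1) * th t z = - (G (z + 1) * (- th t z))" by simp
    also have "\<dots> = - (?s * (G z * th t z))" by (simp only: h)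
    finally show "G (z + 1) * th t z = - ?s * G z * th t z" by (simp only: mult_minus_left mult.assoc)
  qed (intro holomorphic_intros holomorphic_shift G)+
  have G2: "G (z + t) = (- ((-1) powi (d + - b) * (-1) powi (- (b * d)))) * G z" for z
  proof (rule th_cancel[OF t, of "\<lambda>z. G (z + t)" "\<lambda>z. (- ((-1) powi (d + - b) * (-1) powi (- (b * d)))) * G z"])
    fix z
    let ?e = "e2pi (- (1/2) * t - z)" and ?s = "(-1) powi (d + - b) * (-1) powi (- (b * d)) :: complex"
    have "th t (z + t) = - (?e * th t z)" using th_shift[OF t, of z 1 0] by simp
    then have "G (z + t) * (- (?e * th t z)) = ?s * (?e * (G z * th t z))"
      using G(2)[of "z + t"] G(2)[of z] F2[of z] by simp
    then have "?e * (G (z + t) * th t z) = ?e * (- ?s * G z * th t z)" by (simp add: algebra_simps) (metis add.inverse_inverse)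
    then show "G (z + t) * th t z = - ?s * G z * th t z" by (simp only: mult_cancel_left e2pi_nonzero if_False simp_thms)
  qed (intro holomorphic_intros holomorphic_shift G)+
  obtain C where C: "\<And>z. G z = C"
  proof (rule entire_norm_periodic_constant[OF G(1) t])
    show "cmod (G (z + 1)) = cmod (G z)" for z by (simp add: G1 norm_mult)
    show "cmod (G (z + t)) = cmod (G z)" for z by (simp add: G2 norm_mult)
  qed blast
  have FC: "F z = C * th t z" for z using G(2)[of z] C by simp
  \<comment> \<open>Both thetas have derivative \<kappa> at 0, and the chain rule contributes 1 /
    j.\<close>
  have "C = 1 / j"
  proof -
    have "(th g has_field_derivative \<kappa>) (at (0 / j))"
      using holomorphic_derivI[OF th_holomorphic[OF Im_g] open_UNIV UNIV_I, of 0] deriv_th_0[OF Im_g] by simp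
    moreover have "((\<lambda>z. z / j) has_field_derivative 1 / j) (at 0)"
      using j_nonzero by (auto intro!: derivative_eq_intros)
    ultimately have "((\<lambda>z. th g (z / j)) has_field_derivative \<kappa> * (1 / j)) (at 0)"
      by (rule DERIV_chain2)
    then have "(F has_field_derivative \<kappa> / j) (at 0)"
      unfolding F_def using j_nonzero by (auto intro!: derivative_eq_intros simp: Im_g)
    moreover have "((\<lambda>z. C * th t z) has_field_derivative C * \<kappa>) (at 0)"
      using holomorphic_derivI[OF th_holomorphic[OF t] open_UNIV UNIV_I, of 0] deriv_th_0[OF t] by (intro DERIV_cmult) simp
    moreover have "F = (\<lambda>z. C * th t z)" using FC by auto
    ultimately have "\<kappa> / j = C * \<kappa>" by (metis DERIV_unique)
    then have "(1 / j) * \<kappa> = C * \<kappa>" by simp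
    then show ?thesis by (subst (asm) mult_cancel_right) auto
  qed
  then have "th g (z / j) * e2pi (- (of_int c * z\<^sup>2 / (2 * j))) = 1 / j * th t z"
    using FC[of z] by (simp add: F_def)
  then have "th g (z / j) = 1 / j * th t z * e2pi (of_int c * z\<^sup>2 / (2 * j))"
    unfolding e2pi_minus by (simp add: field_simps)
  then show ?thesis by (simp add: mult_ac)
qed

end

subsection \<open>Modular functions\<close>

lemma Im_S: "Im (- 1 / t) = Im t / (norm t)\<^sup>2"
proof -
  have "- 1 / t = - cnj t / of_real ((norm t)\<^sup>2)"
    by (cases "t = 0") (simp_all only: complex_norm_square divide_simps, auto)
  then have "Im (- 1 / t) = Im (- cnj t) / (norm t)\<^sup>2" by (simp only: Im_divide_of_real)
  then show ?thesis by simp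
qed

lemma Im_S_pos: assumes "Im t > 0" shows "Im (- 1 / t) > 0"
proof -
  have "t \<noteq> 0" using assms by auto
  then show ?thesis unfolding Im_S using assms by (simp add: zero_less_divide_iff)
qed

text \<open>In the strip |Re| <= 1/2 a point with imaginary part below 1/2 has |s|^2 <= 1/2, so
  inversion at least doubles the imaginary part. The induction counts the doublings that
  remain.\<close>

lemma fundamental_domain_reduction:
  assumes T: "\<And>t n. Im t > 0 \<Longrightarrow> M (t - of_int n) = M t" and S: "\<And>t. Im t > 0 \<Longrightarrow> M (- 1 / t) = M t"
    and t: "Im t > 0"
  shows "\<exists>s. Im s \<ge> 1/2 \<and> M s = M t"
proof -
  have *: "Im t > 0 \<Longrightarrow> Im t * 2 ^ n \<ge> 1/2 \<Longrightarrow> \<exists>s. Im s \<ge> 1/2 \<and> M s = M t" for n t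
  proof (induction n arbitrary: t)
    case 0
    then show ?case by auto
  next
    case (Suc n)
    define s where "s = t - of_int (round (Re t))"
    have s: "Im s = Im t" "\<bar>Re s\<bar> \<le> 1/2"
      using of_int_round_abs_le[of "Re t"] by (auto simp: s_def abs_minus_commute)
    have Ms: "M s = M t" unfolding s_def using T Suc by blast
    show ?case
    proof (cases "Im s \<ge> 1/2")
      case True
      then show ?thesis using Ms by blast
    next
      case False
      have "(norm s)\<^sup>2 \<le> 1/2"
      proof -
        have "(Re s)\<^sup>2 \<le> (1/2)\<^sup>2" using s(2) abs_le_square_iff[of "Re s" "1/2"] by simp
        moreover have "(Im s)\<^sup>2 \<le> (1/2)\<^sup>2" using False s(1) Suc(2) by (intro power_mono) auto
        moreover have "(1/2 :: real)\<^sup>2 = 1/4" by (simp add: power2_eq_square)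
        ultimately show ?thesis unfolding cmod_power2 by linarith
      qed
      moreover have "(norm s)\<^sup>2 > 0" using s(1) Suc(2) by auto
      ultimately have "Im (- 1 / s) \<ge> 2 * Im t"
        unfolding Im_S s(1) using Suc(2) by (simp add: pos_le_divide_eq mult_left_le)
      then have "Im (- 1 / s) > 0" "Im (- 1 / s) * 2 ^ n \<ge> 1/2"
      proof -
        assume h: "Im (- 1 / s) \<ge> 2 * Im t"
        show "Im (- 1 / s) > 0" using h Suc(2) by linarith
        have "2 * Im t * 2 ^ n \<le> Im (- 1 / s) * 2 ^ n" using h by (intro mult_right_mono) auto
        then show "Im (- 1 / s) * 2 ^ n \<ge> 1/2" using Suc(3) by simp
      qed
      from Suc(1)[OF this] obtain r where "Im r \<ge> 1/2" "M r = M (- 1 / s)" by blast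
      moreover have "M (- 1 / s) = M s" using S s(1) Suc(2) by simp
      ultimately show ?thesis using Ms by auto
    qed
  qed
  obtain n where "1 / (2 * Im t) < 2 ^ n" using real_arch_pow[of 2] by auto
  then have "Im t * 2 ^ n \<ge> 1/2" using t by (simp add: field_simps)
  then show ?thesis using * t by blast
qed

text \<open>Every point is equivalent to one with imaginary part at least 1/2, so |h| attains its
  supremum on the closed disc |q| <= exp(-pi) and the maximum principle applies. Multipliers of
  absolute value 1 are harmless here.\<close>

proposition qval_norm_invariant_constant:
  assumes h: "qval h c" and S: "\<And>t. Im t > 0 \<Longrightarrow> norm (h (- 1 / t)) = norm (h t)" and t: "Im t > 0"
  shows "h t = c"
proof -
  obtain g where g: "g holomorphic_on ball 0 1" "g 0 = c" "\<And>t. 0 < Im t \<Longrightarrow> h t = g (e2pi t)"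
    using h unfolding qval_def by blast
  have T: "norm (h (t - of_int n)) = norm (h t)" if "Im t > 0" for t n
    using that g(3) by (simp add: e2pi_diff)
  define r where "r = exp (- pi)"
  have r: "0 < r" "r < 1" by (auto simp: r_def)
  have cont: "continuous_on (cball 0 r) (\<lambda>q. norm (g q))"
    using r by (intro continuous_intros holomorphic_on_imp_continuous_on holomorphic_on_subset[OF g(1)]) auto
  obtain x where x: "x \<in> cball 0 r" "\<And>y. y \<in> cball 0 r \<Longrightarrow> norm (g y) \<le> norm (g x)"
    using continuous_attains_sup[OF compact_cball _ cont] r by auto
  have max: "norm (g q) \<le> norm (g x)" if q: "q \<in> ball 0 1" for q
  proof (cases "q = 0")
    case True
    then show ?thesis using x(2)[of 0] r by simp
  next
    case False
    have "norm q < 1" using q by simp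
    then obtain u where u: "e2pi u = q" "Im u > 0" using e2pi_surj_H[OF False] by blast
    obtain s where s: "Im s \<ge> 1/2" "norm (h s) = norm (h u)"
      using fundamental_domain_reduction[of "\<lambda>t. norm (h t)" u] T S u(2) by blast
    have "2 * pi * Im s \<ge> 2 * pi * (1/2)" using s(1) by (intro mult_left_mono) auto
    then have "norm (e2pi s) \<le> r" by (simp add: norm_e2pi r_def)
    then have "norm (g (e2pi s)) \<le> norm (g x)" by (intro x(2)) simp
    moreover have "norm (g q) = norm (g (e2pi s))" using s u g(3)[of u] g(3)[of s] by simp
    ultimately show ?thesis by simp
  qed
  have "g constant_on ball 0 1"
    by (rule maximum_modulus_principle[OF g(1), of "ball 0 1" x]) (use max x(1) r in auto)
  then have "g (e2pi t) = g 0"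
    using e2pi_in_ball[OF t] unfolding constant_on_def by auto
  then show ?thesis using g t by simp
qed

subsection \<open>The discriminant\<close>

lemma tp_shift: assumes t: "Im t > 0" shows "tp t (z - t) = (1 - e2pi z) * tp t z"
proof -
  have "tp t z = prodinf (\<lambda>n. 1 - e2pi (of_nat (Suc (Suc n)) * t + (z - t)))"
    unfolding tp_def by (rule prodinf_cong) (simp add: algebra_simps)
  moreover have "(\<lambda>N. \<Prod>n<Suc N. 1 - e2pi (of_nat (Suc n) * t + (z - t))) \<longlonglongrightarrow> tp t (z - t)"
    by (rule LIMSEQ_Suc[OF tp_LIMSEQ[OF t]])
  moreover have "(\<Prod>n<Suc N. 1 - e2pi (of_nat (Suc n) * t + (z - t))) = (1 - e2pi z) * (\<Prod>n<N. 1 - e2pi (of_nat (Suc n) * t + z))" for N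
    unfolding prod.lessThan_Suc_shift by (simp add: algebra_simps)
  moreover have "(\<lambda>N. (1 - e2pi z) * (\<Prod>n<N. 1 - e2pi (of_nat (Suc n) * t + z))) \<longlonglongrightarrow> (1 - e2pi z) * tp t z"
    by (intro tendsto_intros tp_LIMSEQ t)
  ultimately show ?thesis using LIMSEQ_unique by simp
qed

lemma tp_periodic: "tp t (z + 1) = tp t z"
  unfolding tp_def by (rule prodinf_cong) (simp add: e2pi_add)

text \<open>Factor by factor this is (1 - w) (1 + w) = 1 - w^2.\<close>

lemma tp_duplication: assumes t: "Im t > 0" shows "tp t z * tp t (z + 1/2) = tp (2 * t) (2 * z)"
proof -
  have "tp t z * tp t (z + 1/2) = prodinf (\<lambda>n. (1 - e2pi (of_nat (Suc n) * t + z)) * (1 - e2pi (of_nat (Suc n) * t + (z + 1/2))))"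
    unfolding tp_def by (intro prodinf_mult convergent_prod_tp t)
  also have "\<dots> = tp (2 * t) (2 * z)"
    unfolding tp_def
  proof (rule prodinf_cong)
    fix n
    define w where "w = of_nat (Suc n) * t + z"
    have "e2pi (w + 1/2) = - e2pi w" by (simp only: e2pi_add e2pi_half) simp
    moreover have "e2pi (2 * w) = e2pi w * e2pi w" by (simp add: e2pi_add [symmetric])
    ultimately have "(1 - e2pi w) * (1 - e2pi (w + 1/2)) = 1 - e2pi (2 * w)" by (simp add: algebra_simps)
    moreover have "of_nat (Suc n) * t + (z + 1/2) = w + 1/2" "of_nat (Suc n) * (2 * t) + 2 * z = 2 * w"
      by (simp_all add: w_def algebra_simps)
    ultimately show "(1 - e2pi (of_nat (Suc n) * t + z)) * (1 - e2pi (of_nat (Suc n) * t + (z + 1/2))) = 1 - e2pi (of_nat (Suc n) * (2 * t) + 2 * z)"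
      by (simp only: w_def)
  qed
  finally show ?thesis .
qed

text \<open>The factors with odd and with even n are collected separately, at nome q^2.\<close>

lemma tp_odd_even: assumes t: "Im t > 0" shows "tp t 0 = tp (2 * t) (- t) * tp (2 * t) 0"
proof -
  let ?f = "\<lambda>n. 1 - e2pi (of_nat (Suc n) * t + 0)"
  have t2: "Im (2 * t) > 0" using t by simp
  have eq: "(\<Prod>n<2*N. ?f n) = (\<Prod>n<N. 1 - e2pi (of_nat (Suc n) * (2 * t) + (- t))) * (\<Prod>n<N. 1 - e2pi (of_nat (Suc n) * (2 * t) + 0))" for N
  proof (induction N)
    case (Suc N)
    have "(\<Prod>n<2 * Suc N. ?f n) = (\<Prod>n<2*N. ?f n) * (?f (2*N) * ?f (Suc (2*N)))" by (simp add: mult.assoc)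
    also have "?f (2*N) = 1 - e2pi (of_nat (Suc N) * (2 * t) + (- t))" by (simp add: algebra_simps)
    also have "?f (Suc (2*N)) = 1 - e2pi (of_nat (Suc N) * (2 * t) + 0)" by (simp add: algebra_simps)
    finally show ?case unfolding Suc prod.lessThan_Suc by (simp only: mult_ac)
  qed simp
  have "(\<lambda>N. \<Prod>n<2*N. ?f n) \<longlonglongrightarrow> tp t 0"
    by (rule filterlim_compose[OF tp_LIMSEQ[OF t]]) (rule mult_nat_left_at_top, simp)
  moreover have "(\<lambda>N. \<Prod>n<2*N. ?f n) \<longlonglongrightarrow> tp (2 * t) (- t) * tp (2 * t) 0"
    unfolding eq by (intro tendsto_intros tp_LIMSEQ t2)
  ultimately show ?thesis by (rule LIMSEQ_unique)
qed

text \<open>Euler's identity: the product of all (1 + q^n) (1 - q^(2n-1)) is 1. The second kind of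
  factor comes from the two half-periods that involve t.\<close>

lemma tp_half_periods: assumes t: "Im t > 0" shows "tp t (1/2) * tp t (- t / 2) * tp t ((1 - t) / 2) = 1"
proof -
  have t2: "Im (2 * t) > 0" using t by simp
  have a: "tp t (- t / 2) * tp t ((1 - t) / 2) = tp (2 * t) (- t)"
    using tp_duplication[OF t, of "- t / 2"] by (simp add: diff_divide_distrib)
  have b: "tp t 0 * tp t (1/2) = tp (2 * t) 0"
    using tp_duplication[OF t, of 0] by simp
  have "tp (2 * t) 0 * (tp t (1/2) * tp (2 * t) (- t)) = tp (2 * t) 0"
    using b tp_odd_even[OF t] by (simp add: mult_ac)
  moreover have "tp (2 * t) 0 \<noteq> 0" using qp_nonzero[OF t2] by (simp add: qp_eq_tp)
  ultimately have "tp t (1/2) * tp (2 * t) (- t) = 1" by simp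
  then show ?thesis by (simp only: mult.assoc a)
qed

lemma th_S: assumes t: "Im t > 0" shows "th (- 1 / t) (z / t) = e2pi (z\<^sup>2 / (2 * t)) / t * th t z"
proof -
  interpret sl2 0 "-1" 1 0 t by unfold_locales (use t in auto)
  show ?thesis using th_modular[of z] by (simp add: j_def g_def)
qed

text \<open>The values of T at the three nonzero half-periods, which modular transformations
  permute. The factors e(t/8) absorb the exponentials that the modular law of T produces.\<close>

definition half_product :: "complex \<Rightarrow> complex" where
  "half_product t = th t (1/2) * (e2pi (t/8) * th t (t/2)) * (e2pi (t/8) * th t ((1 + t)/2))"

definition del :: "complex \<Rightarrow> complex" where "del t = e2pi t * dn t ^ 8"

text \<open>Inversion exchanges 1/2 and t/2 and fixes (1 + t)/2 up to lattice and sign. Each of the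
  three values has weight -1; a fourth root of unity appears and is removed by taking norms.\<close>

lemma half_product_S: assumes t: "Im t > 0" shows "norm (half_product (- 1 / t)) * norm t ^ 3 = norm (half_product t)"
proof -
  have t0: "t \<noteq> 0" using t by auto
  have a1: "th (- 1 / t) (1/2) = e2pi (t/8) / t * th t (t/2)"
    using th_S[OF t, of "t/2"] t0 by (simp add: power2_eq_square)
  have a2: "e2pi ((- 1 / t) / 8) * th (- 1 / t) ((- 1 / t) / 2) = - th t (1/2) / t"
  proof -
    have "th (- 1 / t) ((- 1 / t) / 2) = e2pi (- ((- 1 / t) / 8)) / t * th t (- (1/2))"
      using th_S[OF t, of "- (1/2)"] t0 by (simp add: power2_eq_square mult.commute)
    then show ?thesis unfolding th_odd[OF t] e2pi_minus by simp
  qed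
  have a3: "norm (e2pi ((- 1 / t) / 8) * th (- 1 / t) ((1 + (- 1 / t)) / 2)) = norm (e2pi (t/8) * th t ((1 + t)/2)) / norm t"
  proof -
    define z where "z = (t - 1) / 2"
    have z: "(1 + (- 1 / t)) / 2 = z / t" using t0 by (simp add: z_def field_simps)
    have "th t z = - th t ((1 + t) / 2)"
    proof -
      have "z = (1 + t) / 2 + of_int 0 * t + of_int (-1)" by (simp add: z_def field_simps)
      then show ?thesis using th_shift[OF t, of "(1 + t) / 2" 0 "-1"] by simp
    qed
    moreover have "z\<^sup>2 / (2 * t) = t/8 - 1/4 - (- 1 / t) / 8"
      using t0 by (simp add: z_def power2_eq_square field_simps)
    then have "e2pi ((- 1 / t) / 8) * e2pi (z\<^sup>2 / (2 * t)) = e2pi (t/8) * e2pi (- (1/4))"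
      unfolding e2pi_add [symmetric] by (simp only:) simp
    moreover have "e2pi ((- 1 / t) / 8) * th (- 1 / t) ((1 + (- 1 / t)) / 2) = (e2pi ((- 1 / t) / 8) * e2pi (z\<^sup>2 / (2 * t))) / t * th t z"
      unfolding z th_S[OF t] by simp
    ultimately have "e2pi ((- 1 / t) / 8) * th (- 1 / t) ((1 + (- 1 / t)) / 2) = - (e2pi (t/8) * e2pi (- (1/4)) / t * th t ((1 + t) / 2))"
      by simp
    moreover have "norm (e2pi (- (1/4))) = 1" by (simp add: norm_e2pi)
    ultimately show ?thesis by (simp add: norm_mult norm_divide)
  qed
  have "norm (half_product (- 1 / t)) = norm (th (- 1 / t) (1/2)) * norm (e2pi ((- 1 / t) / 8) * th (- 1 / t) ((- 1 / t) / 2)) * norm (e2pi ((- 1 / t) / 8) * th (- 1 / t) ((1 + (- 1 / t)) / 2))"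
    by (simp only: half_product_def norm_mult)
  also have "\<dots> = norm (e2pi (t/8) / t * th t (t/2)) * norm (- th t (1/2) / t) * (norm (e2pi (t/8) * th t ((1 + t)/2)) / norm t)"
    by (simp only: a1 a2 a3)
  also have "\<dots> * norm t ^ 3 = norm (half_product t)"
    using t0 by (simp add: half_product_def norm_mult norm_divide power3_eq_cube)
  finally show ?thesis .
qed

lemma half_product_algebra:
  "P \<noteq> 0 \<Longrightarrow> (2 * p ^ 2 / P ^ 2) * (e * r ^ 2 / P ^ 2) * (e * s ^ 2 / P ^ 2) = 2 * e ^ 2 * (p * r * s) ^ 2 / (P :: real) ^ 6"
proof -
  have "P ^ 6 = P ^ 2 * P ^ 2 * P ^ 2" by (simp add: power_add [symmetric])
  then show ?thesis by (simp add: power_mult_distrib power2_eq_square mult_ac)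
qed

text \<open>In the product formula the infinite products at the half-periods enter squared and
  cancel by \<open>tp_half_periods\<close>. What remains is 2, a power of q and (q; q)_infinity to
  the power -6; in norm the fourth power is 16 / Delta.\<close>

lemma half_product_del: assumes t: "Im t > 0" shows "norm (half_product t) ^ 4 * norm (del t) = 16"
proof -
  let ?P = "qp t"
  have P0: "?P \<noteq> 0" by (rule qp_nonzero[OF t])
  have h: "norm (th t z) = norm (e2pi (- z/2)) * norm (tp t (z - t)) * norm (tp t (- z)) / norm ?P ^ 2" for z
  proof -
    have "e2pi (z/2) - e2pi (-z/2) = - (e2pi (- z/2) * (1 - e2pi z))"
    proof -
      have "e2pi (- z/2) * e2pi z = e2pi (z/2)" unfolding e2pi_add [symmetric] by simp
      then show ?thesis by (simp add: algebra_simps)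
    qed
    then have "th t z = - (e2pi (- z/2) * tp t (z - t) * tp t (- z)) / ?P ^ 2"
      by (simp add: th_product[OF t] tp_shift[OF t])
    then show ?thesis by (simp add: norm_mult norm_divide norm_power)
  qed
  have "norm (th t (1/2)) = 2 * norm (tp t (1/2)) ^ 2 / norm ?P ^ 2"
  proof -
    have "e2pi ((1/2)/2) - e2pi (-(1/2)/2) = 2 * \<i>"
    proof -
      have "e2pi (1/4) = \<i>" using exp_pi_i' by (simp add: e2pi_def exp_eq_polar cis_conv_exp[symmetric] complex_eq_iff)
      then show ?thesis using e2pi_minus[of "1/4"] by simp
    qed
    moreover have "tp t (- (1/2)) = tp t (1/2)" using tp_periodic[of t "- (1/2)"] by simp
    ultimately show ?thesis by (simp add: th_product[OF t] norm_mult norm_divide norm_power power2_eq_square)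
  qed
  moreover have "norm (e2pi (t/8) * th t (t/2)) = norm (e2pi (- t/8)) * norm (tp t (- t/2)) ^ 2 / norm ?P ^ 2"
  proof -
    have A: "norm (tp t (t/2 - t)) = norm (tp t (- t/2))" "norm (tp t (- (t/2))) = norm (tp t (- t/2))" by simp_all
    have XY: "norm (e2pi (t/8)) * norm (e2pi (- (t/2)/2)) = norm (e2pi (- t/8))"
      unfolding norm_mult [symmetric] e2pi_add [symmetric] by (rule arg_cong[where f = "\<lambda>x. norm (e2pi x)"]) (simp add: field_simps)
    show ?thesis unfolding norm_mult h A XY [symmetric]
      by (simp only: power2_eq_square times_divide_eq_right mult.assoc)
  qed
  moreover have "norm (e2pi (t/8) * th t ((1 + t)/2)) = norm (e2pi (- t/8)) * norm (tp t ((1 - t)/2)) ^ 2 / norm ?P ^ 2"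
  proof -
    have A: "(1 + t)/2 - t = (1 - t)/2" by (simp add: field_simps)
    have B: "tp t (- ((1 + t)/2)) = tp t ((1 - t)/2)"
    proof -
      have E: "- ((1 + t)/2) + 1 = (1 - t)/2" by (simp add: field_simps)
      show ?thesis using tp_periodic[of t "- ((1 + t)/2)"] unfolding E by (rule sym)
    qed
    have XY: "norm (e2pi (t/8)) * norm (e2pi (- ((1 + t)/2)/2)) = norm (e2pi (- t/8))"
    proof -
      have "norm (e2pi (t/8)) * norm (e2pi (- ((1 + t)/2)/2)) = norm (e2pi (- t/8 + - (1/4)))"
        unfolding norm_mult [symmetric] e2pi_add [symmetric] by (rule arg_cong[where f = "\<lambda>x. norm (e2pi x)"]) (simp add: field_simps)
      also have "\<dots> = norm (e2pi (- t/8))" unfolding e2pi_add norm_mult by (simp add: norm_e2pi)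
      finally show ?thesis .
    qed
    show ?thesis unfolding norm_mult h A B XY [symmetric]
      by (simp only: power2_eq_square times_divide_eq_right mult.assoc)
  qed
  moreover have "norm (half_product t) = norm (th t (1/2)) * norm (e2pi (t/8) * th t (t/2)) * norm (e2pi (t/8) * th t ((1 + t)/2))"
    unfolding half_product_def by (subst norm_mult, subst norm_mult, rule refl)
  ultimately have "norm (half_product t) = 2 * norm (e2pi (- t/8)) ^ 2 * (norm (tp t (1/2)) * norm (tp t (- t / 2)) * norm (tp t ((1 - t) / 2))) ^ 2 / norm ?P ^ 6"
    using P0 by (simp only: half_product_algebra norm_eq_zero not_False_eq_True)
  then have hp: "norm (half_product t) = 2 * norm (e2pi (- t/8)) ^ 2 / norm ?P ^ 6"
    unfolding norm_mult [symmetric] tp_half_periods[OF t] by simp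
  have "(norm (e2pi (- t/8)) ^ 2) ^ 4 * norm (e2pi t) = 1"
  proof -
    have "norm ((e2pi (- t/8) ^ 2) ^ 4 * e2pi t) = norm (e2pi (of_nat 8 * (- t / 8) + t))"
      unfolding power_mult [symmetric] e2pi_add e2pi_of_nat_mult by simp
    then show ?thesis by (simp add: norm_mult norm_power)
  qed
  then show ?thesis
    unfolding hp del_def dn_eq_qp[OF t] using P0
    by (simp add: norm_mult norm_power power_divide power_mult_distrib power_mult [symmetric] field_simps)
qed

lemma del_nonzero: "Im t > 0 \<Longrightarrow> del t \<noteq> 0"
  by (simp add: del_def dn_nonzero)

text \<open>Weight 12 is four times the weight 3 in \<open>half_product_S\<close>.\<close>

lemma del_S: assumes t: "Im t > 0" shows "norm (del (- 1 / t)) = norm t ^ 12 * norm (del t)"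
proof -
  have "norm (half_product (- 1 / t)) ^ 4 * norm (del (- 1 / t)) = norm (half_product t) ^ 4 * norm (del t)"
    using half_product_del[OF t] half_product_del[OF Im_S_pos[OF t]] by simp
  also have "norm (half_product t) ^ 4 = norm (half_product (- 1 / t)) ^ 4 * norm t ^ 12"
    unfolding half_product_S[OF t, symmetric] by (simp add: power_mult_distrib power_mult [symmetric])
  finally have "norm (half_product (- 1 / t)) ^ 4 * norm (del (- 1 / t)) = norm (half_product (- 1 / t)) ^ 4 * (norm t ^ 12 * norm (del t))"
    by (simp add: mult.assoc)
  moreover have "norm (half_product (- 1 / t)) ^ 4 \<noteq> 0"
    using half_product_del[OF Im_S_pos[OF t]] by auto
  ultimately show ?thesis by simp
qed

subsection \<open>Modular forms of small weight\<close>

lemma qval_nome: "qval e2pi 0"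
  unfolding qval_def by (intro exI[of _ "\<lambda>q. q"]) auto

lemma qval_0_divide:
  assumes "qval f 0" obtains f1 c where "qval f1 c" "\<And>t. Im t > 0 \<Longrightarrow> f t = e2pi t * f1 t"
proof -
  obtain g where g: "g holomorphic_on ball 0 1" "g 0 = 0" "\<And>t. 0 < Im t \<Longrightarrow> f t = g (e2pi t)"
    using assms unfolding qval_def by blast
  define g1 where "g1 = (\<lambda>z. if z = 0 then deriv g 0 else (g z - g 0) / (z - 0))"
  have "g1 holomorphic_on ball 0 1" unfolding g1_def by (rule pole_lemma[OF g(1)]) simp
  then have "qval (\<lambda>t. g1 (e2pi t)) (g1 0)" unfolding qval_def by blast
  moreover have "f t = e2pi t * g1 (e2pi t)" if "Im t > 0" for t
    using g that by (simp add: g1_def)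
  ultimately show ?thesis using that by blast
qed

text \<open>f^12 / Delta^k has weight 0 and, because f vanishes at the cusp, order at least 12 - k >
  0 there. It is therefore the constant 0.\<close>

lemma cusp_form_small_weight_zero:
  assumes f: "qval f 0" and S: "\<And>t. Im t > 0 \<Longrightarrow> f (- 1 / t) = t ^ k * f t" and k: "k < 12" and t: "Im t > 0"
  shows "f t = 0"
proof -
  obtain f1 c where f1: "qval f1 c" "\<And>t. Im t > 0 \<Longrightarrow> f t = e2pi t * f1 t"
    using qval_0_divide[OF f] by blast
  define h where "h = (\<lambda>t. f t ^ 12 * inverse (del t) ^ k)"
  have "qval (\<lambda>t. e2pi t ^ (12 - k) * f1 t ^ 12 * inverse (dn t) ^ (8 * k)) (0 ^ (12 - k) * c ^ 12 * inverse 1 ^ (8 * k))"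
    by (intro qval_mult qval_power qval_nome f1 qval_inverse qval_dn) (auto simp: dn_nonzero)
  also have "?this \<longleftrightarrow> qval h 0"
  proof (rule qval_cong)
    show "0 ^ (12 - k) * c ^ 12 * inverse 1 ^ (8 * k) = 0" using k by simp
    fix t :: complex assume t: "Im t > 0"
    have "e2pi t ^ 12 = e2pi t ^ (12 - k) * e2pi t ^ k" using k by (simp add: power_add [symmetric])
    then show "e2pi t ^ (12 - k) * f1 t ^ 12 * inverse (dn t) ^ (8 * k) = h t"
      using dn_nonzero[OF t] by (simp add: h_def f1(2)[OF t] del_def power_mult_distrib power_mult [symmetric] field_simps)
  qed
  finally have "qval h 0" .
  moreover have "norm (h (- 1 / t)) = norm (h t)" if t: "Im t > 0" for t
  proof -
    have t0: "t \<noteq> 0" using t by auto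
    show ?thesis unfolding h_def norm_mult norm_power norm_inverse S[OF t] del_S[OF t]
      using t0 del_nonzero[OF t] by (simp add: power_mult_distrib power_mult [symmetric] norm_mult norm_power mult.commute field_simps)
  qed
  ultimately have "h t = 0" using qval_norm_invariant_constant t by blast
  then show ?thesis using del_nonzero[OF t] by (auto simp: h_def)
qed

text \<open>Here f / Delta is regular at the cusp and invariant in norm, hence constant.\<close>

lemma cusp_form_weight_12:
  assumes f: "qval f 0" and S: "\<And>t. Im t > 0 \<Longrightarrow> f (- 1 / t) = t ^ 12 * f t"
  obtains k where "\<And>t. Im t > 0 \<Longrightarrow> f t = k * del t"
proof -
  obtain f1 c where f1: "qval f1 c" "\<And>t. Im t > 0 \<Longrightarrow> f t = e2pi t * f1 t"
    using qval_0_divide[OF f] by blast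
  define h where "h = (\<lambda>t. f t * inverse (del t))"
  have "qval (\<lambda>t. f1 t * inverse (dn t) ^ 8) (c * inverse 1 ^ 8)"
    by (intro qval_mult qval_power f1 qval_inverse qval_dn) (auto simp: dn_nonzero)
  also have "?this \<longleftrightarrow> qval h c"
    by (rule qval_cong) (auto simp: h_def f1(2) del_def dn_nonzero field_simps)
  finally have "qval h c" .
  moreover have "norm (h (- 1 / t)) = norm (h t)" if t: "Im t > 0" for t
  proof -
    have t0: "t \<noteq> 0" using t by auto
    show ?thesis unfolding h_def norm_mult norm_inverse S[OF t] del_S[OF t]
      using t0 del_nonzero[OF t] by (simp add: norm_mult norm_power field_simps)
  qed
  ultimately have "h t = c" if "Im t > 0" for t using qval_norm_invariant_constant that by blast
  then have "f t = c * del t" if "Im t > 0" for t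
    using that del_nonzero[OF that] by (force simp: h_def field_simps)
  then show ?thesis using that by blast
qed

text \<open>Weight 2 makes f dt invariant, so a primitive F satisfies F(-1/t) = F(t) + k, and the
  fixed point i gives k = 0. The constant term c is detected at the sixth root of unity r, where
  -1/r = r - 1: there F(r - 1) = F(r), while the shape of F gives F(r - 1) = F(r) - c.\<close>

lemma modular_weight_2_zero:
  assumes f: "qval f c" and S: "\<And>t. Im t > 0 \<Longrightarrow> f (- 1 / t) = t ^ 2 * f t"
  shows "c = 0"
proof -
  obtain g where g: "g holomorphic_on ball 0 1" "g 0 = c" "\<And>t. 0 < Im t \<Longrightarrow> f t = g (e2pi t)"
    using f unfolding qval_def by blast
  define g1 where "g1 = (\<lambda>z. if z = 0 then deriv g 0 else (g z - g 0) / (z - 0))"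
  have g1: "g1 holomorphic_on ball 0 1" unfolding g1_def by (rule pole_lemma[OF g(1)]) simp
  obtain G where G: "\<And>q. q \<in> ball 0 1 \<Longrightarrow> (G has_field_derivative g1 q) (at q within ball 0 1)"
    using holomorphic_convex_primitive'[OF convex_ball open_ball g1] by auto
  have G': "(G has_field_derivative g1 q) (at q)" if "q \<in> ball 0 1" for q
    using G[OF that] that at_within_open[OF that open_ball] by simp
  let ?w = "\<kappa> :: complex"
  \<comment> \<open>\<open>G\<close> is a primitive of (g(q) - c) / q in the nome, so
    \<open>F\<close> is a primitive of f in t.\<close>
  define F where "F = (\<lambda>t. c * t + G (e2pi t) / ?w)"
  have dF: "(F has_field_derivative f t) (at t)" if t: "Im t > 0" for t
  proof -
    have "((\<lambda>t. G (e2pi t)) has_field_derivative g1 (e2pi t) * (?w * e2pi t * 1)) (at t)"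
      by (rule DERIV_chain2[where f = G and g = e2pi, OF G'[OF e2pi_in_ball[OF t]]]) (rule e2pi_has_field_derivative[OF DERIV_ident])
    then have "(F has_field_derivative (c * 1 + g1 (e2pi t) * (?w * e2pi t * 1) / ?w)) (at t)"
      unfolding F_def by (intro DERIV_add DERIV_cmult DERIV_cdivide DERIV_ident)
    moreover have "c * 1 + g1 (e2pi t) * (?w * e2pi t * 1) / ?w = f t"
      using g(2,3) t by (simp add: g1_def)
    ultimately show ?thesis by simp
  qed
  let ?H = "{t. Im t > 0}"
  define K where "K = (\<lambda>t. F (- 1 / t) - F t)"
  have dK: "(K has_field_derivative 0) (at t within ?H)" if "t \<in> ?H" for t
  proof -
    have t: "Im t > 0" "t \<noteq> 0" using that by auto
    have "((\<lambda>t. - 1 / t) has_field_derivative 1 / t ^ 2) (at t)"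
      using t(2) by (auto intro!: derivative_eq_intros simp: power2_eq_square)
    from DERIV_chain2[OF dF[OF Im_S_pos[OF t(1)]] this]
    have "((\<lambda>t. F (- 1 / t)) has_field_derivative f (- 1 / t) * (1 / t ^ 2)) (at t)" .
    from DERIV_diff[OF this dF[OF t(1)]] have "(K has_field_derivative f (- 1 / t) * (1 / t ^ 2) - f t) (at t)"
      unfolding K_def .
    then show ?thesis using S[OF t(1)] t(2) by (simp add: has_field_derivative_at_within)
  qed
  have "convex ?H" by (rule convex_halfspace_Im_gt)
  then obtain k where k: "\<And>t. t \<in> ?H \<Longrightarrow> K t = k"
    using has_field_derivative_zero_constant[OF _ dK] by blast
  have "K \<i> = 0" by (simp add: K_def)
  then have k0: "k = 0" using k[of \<i>] by simp
  \<comment> \<open>The sixth root of unity, the fixed point of t to 1 - 1/t.\<close>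
  define r where "r = Complex (1/2) (sqrt 3 / 2)"
  have r: "Im r > 0" by (simp add: r_def)
  have "- 1 / r = r - 1"
  proof -
    have "(r - 1) * r = - 1"
      by (simp add: r_def complex_eq_iff algebra_simps)
    then have "- 1 / r = ((r - 1) * r) / r" by (simp only:)
    also have "\<dots> = r - 1" using r by auto
    finally show ?thesis .
  qed
  then have "F (r - 1) = F r" using k[of r] k0 r by (simp add: K_def)
  moreover have "F (r - 1) = F r - c" by (simp add: F_def e2pi_diff algebra_simps)
  ultimately show ?thesis by simp
qed

subsection \<open>Derivatives under automorphy factors\<close>

lemma entire_deriv: "G is_entire \<Longrightarrow> (G has_field_derivative deriv G z) (at z)"
  by (rule holomorphic_derivI) auto

lemma entire_deriv_holomorphic: "G is_entire \<Longrightarrow> deriv G is_entire"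
  by (rule holomorphic_deriv) auto

text \<open>C e(u z + v z^2) covers both laws of theta: translations have v = 0, modular
  transformations have u = 0.\<close>

lemma gauge_deriv:
  assumes G: "G is_entire"
  shows "deriv (\<lambda>z. C * e2pi (u * z + v * z\<^sup>2) * G z) z = C * e2pi (u * z + v * z\<^sup>2) * (deriv G z + \<kappa> * (u + 2 * v * z) * G z)"
  by (rule DERIV_imp_deriv) (auto intro!: derivative_eq_intros entire_deriv[OF G] simp: algebra_simps)

lemma gauge_deriv2:
  assumes G: "G is_entire"
  shows "deriv (deriv (\<lambda>z. C * e2pi (u * z + v * z\<^sup>2) * G z)) z = C * e2pi (u * z + v * z\<^sup>2) *
    (deriv (deriv G) z + 2 * \<kappa> * (u + 2 * v * z) * deriv G z + (\<kappa>\<^sup>2 * (u + 2 * v * z)\<^sup>2 + 2 * \<kappa> * v) * G z)"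
proof -
  note G' = entire_deriv_holomorphic[OF G]
  have D: "deriv (\<lambda>z. C * e2pi (u * z + v * z\<^sup>2) * G z) = (\<lambda>z. C * e2pi (u * z + v * z\<^sup>2) * (deriv G z + \<kappa> * (u + 2 * v * z) * G z))"
    by (rule ext) (rule gauge_deriv[OF G])
  have "deriv (deriv (\<lambda>z. C * e2pi (u * z + v * z\<^sup>2) * G z)) z = C * e2pi (u * z + v * z\<^sup>2) * (deriv (\<lambda>z. deriv G z + \<kappa> * (u + 2 * v * z) * G z) z + \<kappa> * (u + 2 * v * z) * (deriv G z + \<kappa> * (u + 2 * v * z) * G z))"
    unfolding D by (rule gauge_deriv) (intro holomorphic_intros G G')
  also have "deriv (\<lambda>z. deriv G z + \<kappa> * (u + 2 * v * z) * G z) z = deriv (deriv G) z + \<kappa> * (2 * v) * G z + \<kappa> * (u + 2 * v * z) * deriv G z"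
    by (rule DERIV_imp_deriv) (auto intro!: derivative_eq_intros entire_deriv[OF G] entire_deriv[OF G'] simp: algebra_simps)
  finally show ?thesis by (simp add: power2_eq_square algebra_simps)
qed

lemma e2pi_sq: "e2pi x * e2pi x = e2pi (2 * x)"
  by (simp add: e2pi_add [symmetric])

text \<open>This is -f^2 (log f)'', the numerator of the Weierstrass function, up to an additive
  multiple of f^2, when f is theta.\<close>

definition wr :: "(complex \<Rightarrow> complex) \<Rightarrow> complex \<Rightarrow> complex" where
  "wr f z = (deriv f z)\<^sup>2 - f z * deriv (deriv f) z"

text \<open>The second logarithmic derivative sees only the quadratic part v of the exponent. So the
  translation law is clean and the modular law acquires a single extra term.\<close>

lemma wr_gauge:
  assumes G: "G is_entire"
  shows "wr (\<lambda>z. C * e2pi (u * z + v * z\<^sup>2) * G z) z = C\<^sup>2 * e2pi (2 * (u * z + v * z\<^sup>2)) * (wr G z - 2 * \<kappa> * v * (G z)\<^sup>2)"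
proof -
  define E where "E = C * e2pi (u * z + v * z\<^sup>2)"
  define l where "l = \<kappa> * (u + 2 * v * z)"
  have "C\<^sup>2 * e2pi (2 * (u * z + v * z\<^sup>2)) = E * E"
    unfolding E_def e2pi_sq [symmetric] power2_eq_square[of C] by (simp only: mult_ac)
  moreover have "wr (\<lambda>z. C * e2pi (u * z + v * z\<^sup>2) * G z) z = (E * (deriv G z + l * G z))\<^sup>2 - E * G z * (E * (deriv (deriv G) z + 2 * l * deriv G z + (l\<^sup>2 + 2 * \<kappa> * v) * G z))"
    unfolding wr_def gauge_deriv[OF G] gauge_deriv2[OF G] E_def [symmetric] by (simp add: l_def power_mult_distrib mult.assoc)
  moreover have "\<dots> = E * E * ((deriv G z)\<^sup>2 - G z * deriv (deriv G) z - 2 * \<kappa> * v * (G z)\<^sup>2)"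
    by (simp add: power2_eq_square algebra_simps)
  ultimately show ?thesis by (simp only: wr_def)
qed

text \<open>A Rankin-Cohen type bracket for functions of index 1/2 and 3/2: the coefficients 3 and
  -1 cancel the derivatives of gauge factors whose exponents are in the ratio 1 : 3.\<close>

definition rc :: "(complex \<Rightarrow> complex) \<Rightarrow> (complex \<Rightarrow> complex) \<Rightarrow> complex \<Rightarrow> complex" where
  "rc f g z = 3 * deriv f z * g z - f z * deriv g z"

lemma rc_gauge:
  assumes F: "F is_entire" and G: "G is_entire"
  shows "rc (\<lambda>z. C * e2pi (u * z + v * z\<^sup>2) * F z) (\<lambda>z. D * e2pi (3 * u * z + 3 * v * z\<^sup>2) * G z) z
    = C * D * e2pi (4 * (u * z + v * z\<^sup>2)) * rc F G z"
proof -
  define E where "E = e2pi (u * z + v * z\<^sup>2)"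
  define E3 where "E3 = e2pi (3 * u * z + 3 * v * z\<^sup>2)"
  have "e2pi (4 * (u * z + v * z\<^sup>2)) = E * E3"
    unfolding E_def E3_def e2pi_add [symmetric] by (rule e2pi_cong) (simp add: algebra_simps)
  then show ?thesis
    unfolding rc_def gauge_deriv[OF F] gauge_deriv[OF G] E_def [symmetric] E3_def [symmetric]
    by (simp add: algebra_simps)
qed

lemma deriv_translate: "G is_entire \<Longrightarrow> deriv (\<lambda>z. G (z + w)) z = deriv G (z + w)"
  using entire_deriv[of G "z + w"] by (intro DERIV_imp_deriv) (simp add: DERIV_shift)

lemma deriv_scale: "G is_entire \<Longrightarrow> deriv (\<lambda>z. G (u * z)) z = u * deriv G (u * z)"
proof -
  assume G: "G is_entire"
  have "((\<lambda>z. G (u * z)) has_field_derivative deriv G (u * z) * u) (at z)"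
    by (rule DERIV_chain2[where f = G and g = "\<lambda>z. u * z", OF entire_deriv[OF G]]) (auto intro!: derivative_eq_intros)
  then show ?thesis by (simp add: DERIV_imp_deriv mult.commute)
qed

lemma wr_translate: "G is_entire \<Longrightarrow> wr (\<lambda>z. G (z + w)) z = wr G (z + w)"
proof -
  assume G: "G is_entire"
  have "deriv (\<lambda>z. G (z + w)) = (\<lambda>z. deriv G (z + w))" using deriv_translate[OF G] by auto
  then show ?thesis unfolding wr_def by (simp add: deriv_translate[OF entire_deriv_holomorphic[OF G]])
qed

lemma wr_scale: "G is_entire \<Longrightarrow> wr (\<lambda>z. G (u * z)) z = u\<^sup>2 * wr G (u * z)"
proof -
  assume G: "G is_entire"
  have 1: "deriv (\<lambda>z. G (u * z)) = (\<lambda>z. u * deriv G (u * z))" using deriv_scale[OF G] by auto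
  have 2: "deriv (\<lambda>z. u * deriv G (u * z)) z = u * (u * deriv (deriv G) (u * z))"
    using deriv_scale[OF entire_deriv_holomorphic[OF G], of u z]
    by (subst deriv_cmult) (auto intro!: holomorphic_on_imp_differentiable_at[of _ UNIV] holomorphic_scale entire_deriv_holomorphic G)
  show ?thesis unfolding wr_def 1 2 by (simp add: power2_eq_square algebra_simps)
qed

lemma rc_translate: "F is_entire \<Longrightarrow> G is_entire \<Longrightarrow> rc (\<lambda>z. F (z + w)) (\<lambda>z. G (z + w)) z = rc F G (z + w)"
  by (simp add: rc_def deriv_translate)

lemma rc_scale: "F is_entire \<Longrightarrow> G is_entire \<Longrightarrow> rc (\<lambda>z. F (u * z)) (\<lambda>z. G (u * z)) z = u * rc F G (u * z)"
  unfolding rc_def by (simp only: deriv_scale[of F u z] deriv_scale[of G u z]) (simp add: algebra_simps)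

lemma wr_holomorphic: "G is_entire \<Longrightarrow> wr G is_entire"
  unfolding wr_def[abs_def] by (intro holomorphic_intros entire_deriv_holomorphic)

lemma rc_holomorphic: "F is_entire \<Longrightarrow> G is_entire \<Longrightarrow> rc F G is_entire"
  unfolding rc_def[abs_def] by (intro holomorphic_intros entire_deriv_holomorphic)

lemma jfam_wr: "jfam \<phi> p \<Longrightarrow> jfam (\<lambda>t. wr (\<phi> t)) (wr p)"
  unfolding wr_def[abs_def] power2_eq_square by (intro jfam_diff jfam_mult jfam_deriv)

lemma jfam_rc: "jfam \<phi> p \<Longrightarrow> jfam \<psi> r \<Longrightarrow> jfam (\<lambda>t. rc (\<phi> t) (\<psi> t)) (rc p r)"
  unfolding rc_def[abs_def] by (intro jfam_diff jfam_mult jfam_const jfam_deriv)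

subsection \<open>Jacobi forms of arbitrary weight\<close>

text \<open>Evenness and the elliptic law without the modular one. The class contains every function
  of the nome in index 0, see \<open>EF_qval\<close>, and the existence of Fourier expansions
  depends on it alone, see \<open>EF_FE\<close>.\<close>

definition EF :: "nat \<Rightarrow> jform \<Rightarrow> (complex \<Rightarrow> complex) \<Rightarrow> bool" where
  "EF m \<phi> p \<longleftrightarrow> jfam \<phi> p \<and> (\<forall>t. Im t > 0 \<longrightarrow> ell t m (\<phi> t) \<and> (\<forall>z. \<phi> t (- z) = \<phi> t z)) \<and> (\<forall>z. p (z + 1) = p z)"

definition sl2_law :: "nat \<Rightarrow> nat \<Rightarrow> jform \<Rightarrow> bool" where
  "sl2_law k m \<phi> \<longleftrightarrow> (\<forall>a b c d :: int. a * d - b * c = 1 \<longrightarrow> (\<forall>t z. Im t > 0 \<longrightarrow>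
     \<phi> (mob a b c d t) (z / aut c d t) =
     aut c d t ^ k * e2pi (of_nat m * of_int c * z\<^sup>2 / aut c d t) * \<phi> t z))"

definition JF :: "nat \<Rightarrow> nat \<Rightarrow> jform \<Rightarrow> (complex \<Rightarrow> complex) \<Rightarrow> bool" where
  "JF k m \<phi> p \<longleftrightarrow> EF m \<phi> p \<and> sl2_law k m \<phi>"

lemma EF_add: "EF m \<phi> p \<Longrightarrow> EF m \<psi> r \<Longrightarrow> EF m (\<lambda>t z. \<phi> t z + \<psi> t z) (\<lambda>z. p z + r z)"
  unfolding EF_def by (auto intro: jfam_add ell_add)

lemma EF_mult: "EF m \<phi> p \<Longrightarrow> EF n \<psi> r \<Longrightarrow> EF (m + n) (\<lambda>t z. \<phi> t z * \<psi> t z) (\<lambda>z. p z * r z)"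
  unfolding EF_def by (auto intro: jfam_mult ell_mult)

lemma EF_qval: "qval h c \<Longrightarrow> EF 0 (\<lambda>t z. h t) (\<lambda>z. c)"
  unfolding EF_def by (auto intro: jfam_qval_const ell_const)

lemma EF_const: "EF 0 (\<lambda>t z. c) (\<lambda>z. c)"
  by (rule EF_qval) simp

lemma EF_power: "EF m \<phi> p \<Longrightarrow> EF (n * m) (\<lambda>t z. \<phi> t z ^ n) (\<lambda>z. p z ^ n)"
proof (induction n)
  case 0
  then show ?case by (simp add: EF_const)
next
  case (Suc n)
  then show ?case using EF_mult[of m \<phi> p "n * m"] by simp
qed

lemma sl2_law_add: "sl2_law k m \<phi> \<Longrightarrow> sl2_law k m \<psi> \<Longrightarrow> sl2_law k m (\<lambda>t z. \<phi> t z + \<psi> t z)"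
  unfolding sl2_law_def by (auto simp: distrib_left)

lemma sl2_law_mult: assumes "sl2_law k m \<phi>" "sl2_law l n \<psi>" shows "sl2_law (k + l) (m + n) (\<lambda>t z. \<phi> t z * \<psi> t z)"
  unfolding sl2_law_def
proof (intro allI impI)
  fix a b c d :: int and t z :: complex
  assume det: "a * d - b * c = 1" and t: "Im t > 0"
  let ?j = "of_int c * t + of_int d"
  have e: "e2pi (of_nat (m + n) * of_int c * z\<^sup>2 / ?j) = e2pi (of_nat m * of_int c * z\<^sup>2 / ?j) * e2pi (of_nat n * of_int c * z\<^sup>2 / ?j)"
    unfolding e2pi_add [symmetric] by (rule e2pi_cong) (simp add: add_divide_distrib ring_distribs)
  show "\<phi> ((of_int a * t + of_int b) / ?j) (z / ?j) * \<psi> ((of_int a * t + of_int b) / ?j) (z / ?j) =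
      ?j ^ (k + l) * e2pi (of_nat (m + n) * of_int c * z\<^sup>2 / ?j) * (\<phi> t z * \<psi> t z)"
    unfolding e using assms det t unfolding sl2_law_def by (simp add: power_add)
qed

lemma sl2_law_const: "sl2_law 0 0 (\<lambda>t z. c)"
  unfolding sl2_law_def by simp

lemma JF_add: "JF k m \<phi> p \<Longrightarrow> JF k m \<psi> r \<Longrightarrow> JF k m (\<lambda>t z. \<phi> t z + \<psi> t z) (\<lambda>z. p z + r z)"
  unfolding JF_def by (auto intro: EF_add sl2_law_add)

lemma JF_mult: "JF k m \<phi> p \<Longrightarrow> JF l n \<psi> r \<Longrightarrow> JF (k + l) (m + n) (\<lambda>t z. \<phi> t z * \<psi> t z) (\<lambda>z. p z * r z)"
  unfolding JF_def by (auto intro: EF_mult sl2_law_mult)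

lemma JF_const: "JF 0 0 (\<lambda>t z. c) (\<lambda>z. c)"
  unfolding JF_def by (auto intro: EF_const sl2_law_const)

lemma JF_cmult: "JF k m \<phi> p \<Longrightarrow> JF k m (\<lambda>t z. c * \<phi> t z) (\<lambda>z. c * p z)"
  using JF_mult[OF JF_const] by force

lemma JF_diff: "JF k m \<phi> p \<Longrightarrow> JF k m \<psi> r \<Longrightarrow> JF k m (\<lambda>t z. \<phi> t z - \<psi> t z) (\<lambda>z. p z - r z)"
  using JF_add[OF _ JF_cmult[of k m \<psi> r "-1"], of \<phi> p] by simp

lemma JF_power: "JF k m \<phi> p \<Longrightarrow> JF (n * k) (n * m) (\<lambda>t z. \<phi> t z ^ n) (\<lambda>z. p z ^ n)"
proof (induction n)
  case 0
  then show ?case by (simp add: JF_const)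
next
  case (Suc n)
  then show ?case using JF_mult[of k m \<phi> p "n * k" "n * m"] by simp
qed

lemma EF_cong: "(\<And>t z. Im t > 0 \<Longrightarrow> \<phi> t z = \<psi> t z) \<Longrightarrow> EF m \<phi> p \<Longrightarrow> EF m \<psi> p"
proof -
  assume a: "\<And>t z. Im t > 0 \<Longrightarrow> \<phi> t z = \<psi> t z" and "EF m \<phi> p"
  moreover have "Im t > 0 \<Longrightarrow> \<phi> t = \<psi> t" for t using a by auto
  ultimately show ?thesis unfolding EF_def by (simp add: jfam_cong[of \<psi> \<phi>])
qed

lemma sl2_law_cong: "(\<And>t z. Im t > 0 \<Longrightarrow> \<phi> t z = \<psi> t z) \<Longrightarrow> sl2_law k m \<phi> \<Longrightarrow> sl2_law k m \<psi>"
  unfolding sl2_law_def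
proof (intro allI impI)
  fix a b c d :: int and t z :: complex
  assume a: "\<And>t z. Im t > 0 \<Longrightarrow> \<phi> t z = \<psi> t z"
    and s: "\<forall>a b c d. a * d - b * c = 1 \<longrightarrow> (\<forall>t z. 0 < Im t \<longrightarrow> \<phi> (mob a b c d t) (z / aut c d t) =
       aut c d t ^ k * e2pi (of_nat m * of_int c * z\<^sup>2 / aut c d t) * \<phi> t z)"
    and det: "a * d - b * c = 1" and t: "Im t > 0"
  interpret sl2 a b c d t by unfold_locales (use det t in auto)
  show "\<psi> (mob a b c d t) (z / aut c d t) =
       aut c d t ^ k * e2pi (of_nat m * of_int c * z\<^sup>2 / aut c d t) * \<psi> t z"
  proof -
    have "\<phi> g (z / j) = j ^ k * e2pi (of_nat m * of_int c * z\<^sup>2 / j) * \<phi> t z"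
      using s det t unfolding g_def j_def by blast
    then show ?thesis unfolding a[OF t] a[OF Im_g] unfolding g_def j_def .
  qed
qed

lemma JF_cong: "(\<And>t z. Im t > 0 \<Longrightarrow> \<phi> t z = \<psi> t z) \<Longrightarrow> JF k m \<phi> p \<Longrightarrow> JF k m \<psi> p"
  unfolding JF_def using EF_cong sl2_law_cong by blast

text \<open>Uniqueness of the cusp value transfers evenness from the family to it.\<close>

lemma EF_p_even: assumes "EF m \<phi> p" shows "p (- z) = p z"
proof -
  have "jfam \<phi> p" using assms by (simp add: EF_def)
  moreover have "jfam \<phi> (\<lambda>z. p (- z))"
    using jfam_scale[OF calculation, of "-1"] assms by (subst jfam_cong[of _ "\<lambda>t z. \<phi> t (- 1 * z)"]) (auto simp: EF_def)
  ultimately show ?thesis using jfam_unique by metis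
qed

section \<open>Division by T^2 in families and at the cusp\<close>

lemma sy_zero: "sy z = 0 \<Longrightarrow> \<exists>n. z = of_int n"
proof -
  assume "sy z = 0"
  then have "e2pi (z/2) = e2pi (- z/2)" by (simp add: sy_def)
  then obtain n where "z/2 = - z/2 + of_int n" unfolding e2pi_eq_iff by blast
  then have "z = of_int n" by (simp add: field_simps)
  then show ?thesis by blast
qed

lemma sy_holomorphic: "sy is_entire"
  unfolding sy_def[abs_def] by (intro holomorphic_intros) auto

lemma sy_0 [simp]: "sy 0 = 0"
  by (simp add: sy_def)

lemma sy_minus: "sy (- z) = - sy z"
  by (simp add: sy_def)

lemma sy_plus_1: "sy (z + 1) = - sy z"
proof -
  have "(z + 1)/2 = z/2 + 1/2" "- (z + 1)/2 = - z/2 - 1/2" by (simp_all add: field_simps)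
  then show ?thesis unfolding sy_def by (simp only: e2pi_add e2pi_diff e2pi_half) simp
qed

lemma sy_divide:
  assumes p: "p is_entire" "\<And>n. p (of_int n) = 0"
  obtains r where "r is_entire" "\<And>z. r z * sy z = p z"
proof (rule entire_divide[OF p(1) sy_holomorphic])
  show "p w = 0" if "sy w = 0" for w using sy_zero[OF that] p(2) by auto
  show "deriv sy w \<noteq> 0" if "sy w = 0" for w using that by (simp add: deriv_sy sy_def)
qed (use that in auto)

lemma sy_half: "sy (1/2) \<noteq> 0"
proof
  assume "sy (1/2) = 0"
  then obtain n where "(1/2 :: complex) = of_int n" using sy_zero by blast
  then have "(1 :: complex) = of_int (2 * n)" by (simp add: mult.commute)
  then have "1 = 2 * n" by (metis of_int_1 of_int_eq_iff)
  then show False by presburger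
qed

lemma sy_cancel:
  assumes "A is_entire" "B is_entire" "\<And>z. A z * sy z = B z * sy z" shows "A z = B z"
  using assms sy_holomorphic sy_half by (rule entire_cancel)

lemma periodic_int: assumes "\<And>z. p (z + 1) = (s::complex) * p z" "p 0 = (0::complex)" "s \<noteq> 0" shows "p (of_int n) = 0"
proof (induction n rule: int_induct[where k = 0])
  case base
  then show ?case using assms by simp
next
  case (step1 i)
  then show ?case using assms(1)[of "of_int i"] by simp
next
  case (step2 i)
  then show ?case using assms(1)[of "of_int (i - 1)"] assms(3) by simp
qed

text \<open>The cusp counterpart of \<open>ell_divide_th_sq\<close>: evenness again turns one zero
  into a double one, and periodicity spreads it over the integers.\<close>

lemma sy_sq_divide:
  assumes p: "p is_entire" "\<And>z. p (z + 1) = p z" "\<And>z. p (- z) = p z" "p 0 = 0"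
  obtains r where "r is_entire" "\<And>z. sy z ^ 2 * r z = p z" "\<And>z. r (z + 1) = r z"
proof -
  obtain p1 where p1: "p1 is_entire" "\<And>z. p1 z * sy z = p z"
    using sy_divide[OF p(1)] periodic_int[of p 1] p by auto
  have p1s: "p1 (z + 1) = - 1 * p1 z" for z
  proof (rule sy_cancel[of "\<lambda>z. p1 (z + 1)" "\<lambda>z. -1 * p1 z"])
    show "p1 (z + 1) * sy z = - 1 * p1 z * sy z" for z
      using p1(2)[of "z + 1"] p1(2)[of z] p(2)[of z] unfolding sy_plus_1 by (auto simp: minus_equation_iff)
  qed (use p1(1) holomorphic_shift[OF p1(1), of 1] in \<open>auto intro!: holomorphic_intros\<close>)
  have p1o: "p1 (- z) = - p1 z" for z
  proof (rule sy_cancel[of "\<lambda>z. p1 (- z)" "\<lambda>z. - p1 z"])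
    show "p1 (- z) * sy z = - p1 z * sy z" for z
      using p1(2)[of "- z"] p1(2)[of z] p(3)[of z] unfolding sy_minus by (auto simp: minus_equation_iff)
  qed (use p1(1) holomorphic_reflect[OF p1(1)] in \<open>auto intro!: holomorphic_intros\<close>)
  have "p1 0 = 0" using p1o[of 0] by simp
  then obtain r where r: "r is_entire" "\<And>z. r z * sy z = p1 z"
    using sy_divide[OF p1(1)] periodic_int[of p1 "-1"] p1s by auto
  have "r (z + 1) = r z" for z
  proof (rule sy_cancel[of "\<lambda>z. r (z + 1)" "\<lambda>z. r z"])
    show "r (z + 1) * sy z = r z * sy z" for z
      using r(2)[of "z + 1"] r(2)[of z] p1s[of z] unfolding sy_plus_1 by (auto simp: minus_equation_iff)
  qed (use r(1) holomorphic_shift[OF r(1), of 1] in auto)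
  moreover have "sy z ^ 2 * r z = p z" for z
    unfolding p1(2)[symmetric] r(2)[symmetric] by (simp add: power2_eq_square)
  ultimately show ?thesis using that r by blast
qed

text \<open>The division takes place fibrewise for each t and separately at the cusp; two
  applications of \<open>jfam_divide\<close> show that the quotients still match.\<close>

lemma EF_divide:
  assumes E: "EF (Suc m) \<phi> p" and z0: "\<And>t. Im t > 0 \<Longrightarrow> \<phi> t 0 = 0"
  obtains \<psi> r where "EF m \<psi> r" "\<And>t z. Im t > 0 \<Longrightarrow> th t z ^ 2 * \<psi> t z = \<phi> t z" "\<And>z. sy z ^ 2 * r z = p z"
proof -
  have j: "jfam \<phi> p" using E by (simp add: EF_def)
  have "\<exists>G. ell t m G \<and> (\<forall>z. G (- z) = G z) \<and> (\<forall>z. th t z ^ 2 * G z = \<phi> t z)" if t: "Im t > 0" for t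
    using ell_divide_th_sq[OF t, of m "\<phi> t"] E z0[OF t] t unfolding EF_def by metis
  then obtain \<psi> where \<psi>: "\<And>t. Im t > 0 \<Longrightarrow> ell t m (\<psi> t)" "\<And>t z. Im t > 0 \<Longrightarrow> \<psi> t (- z) = \<psi> t z"
     "\<And>t z. Im t > 0 \<Longrightarrow> th t z ^ 2 * \<psi> t z = \<phi> t z" by metis
  have "qval (\<lambda>t. \<phi> t 0) (p 0)" by (rule jfam_qval0[OF j])
  moreover have "qval (\<lambda>t. \<phi> t 0) 0" using z0 by (subst qval_cong[of _ "\<lambda>t. 0"]) auto
  ultimately have p0: "p 0 = 0" by (rule qval_unique)
  have pp: "\<And>z. p (z + 1) = p z" using E by (simp add: EF_def)
  obtain r where r: "r is_entire" "\<And>z. sy z ^ 2 * r z = p z" "\<And>z. r (z + 1) = r z"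
    using sy_sq_divide[of p] jfam_hol_p[OF j] pp EF_p_even[OF E] p0 by blast
  have h: "\<psi> t is_entire" if "Im t > 0" for t using \<psi>(1)[OF that] by (simp add: ell_def)
  have "jfam (\<lambda>t z. th t z * \<psi> t z) (\<lambda>z. sy z * r z)"
    by (rule jfam_divide[OF jfam_th j, where \<delta> = "\<kappa>"])
       (auto simp: deriv_th_0 deriv_s \<psi>(3)[symmetric] r(2)[symmetric] power2_eq_square intro!: holomorphic_intros th_holomorphic h r sy_holomorphic)
  from jfam_divide[OF jfam_th this, of \<psi> r "\<kappa>"] have "jfam \<psi> r"
    by (auto simp: deriv_th_0 deriv_s h r)
  then have "EF m \<psi> r" using \<psi> r by (auto simp: EF_def)
  then show ?thesis by (rule that[OF _ \<psi>(3) r(2)])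
qed

lemma th_sq_law: assumes "a * d - b * c = 1" "Im t > 0"
  shows "th (mob a b c d t) (z / aut c d t) ^ 2 * aut c d t ^ 2 =
     e2pi (of_int c * z\<^sup>2 / aut c d t) * th t z ^ 2"
proof -
  interpret sl2 a b c d t by unfold_locales (use assms in auto)
  have "e2pi (of_int c * z\<^sup>2 / (2 * j)) ^ 2 = e2pi (of_int c * z\<^sup>2 / j)"
    unfolding e2pi_of_nat_mult [symmetric] by (rule e2pi_cong) simp
  then have "th g (z / j) ^ 2 * j ^ 2 = e2pi (of_int c * z\<^sup>2 / j) * th t z ^ 2"
    unfolding th_modular using j_nonzero by (simp add: power_mult_distrib power_divide)
  then show ?thesis unfolding g_def j_def .
qed

text \<open>T^2 has weight -2 and index 1, so the quotient gains two in weight and loses one in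
  index.\<close>

lemma JF_divide:
  assumes E: "JF k (Suc m) \<phi> p" and z0: "\<And>t. Im t > 0 \<Longrightarrow> \<phi> t 0 = 0"
  obtains \<psi> r where "JF (k + 2) m \<psi> r" "\<And>t z. Im t > 0 \<Longrightarrow> th t z ^ 2 * \<psi> t z = \<phi> t z" "\<And>z. sy z ^ 2 * r z = p z"
proof -
  obtain \<psi> r where \<psi>: "EF m \<psi> r" "\<And>t z. Im t > 0 \<Longrightarrow> th t z ^ 2 * \<psi> t z = \<phi> t z" "\<And>z. sy z ^ 2 * r z = p z"
    using EF_divide[of m \<phi> p] E z0 unfolding JF_def by blast
  have h: "\<psi> t is_entire" if "Im t > 0" for t using \<psi>(1) that by (simp add: EF_def ell_def)
  have "sl2_law (k + 2) m \<psi>"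
    unfolding sl2_law_def
  proof (intro allI impI)
    fix a b c d :: int and t z :: complex
    assume det: "a * d - b * c = 1" and t: "Im t > 0"
    interpret sl2 a b c d t by unfold_locales (use det t in auto)
    let ?e = "\<lambda>m z. e2pi (of_nat m * of_int c * z\<^sup>2 / j)"
    have "\<psi> g (z / j) = j ^ (k + 2) * ?e m z * \<psi> t z"
    proof (rule entire_cancel[of "\<lambda>z. \<psi> g (z / j)" "\<lambda>z. j ^ (k + 2) * ?e m z * \<psi> t z" "\<lambda>z. th t z ^ 2"])
      show "(\<lambda>z. \<psi> g (z / j)) is_entire"
        using holomorphic_scale[OF h[OF Im_g], of "1 / j"] by simp
      show "(\<lambda>z. j ^ (k + 2) * ?e m z * \<psi> t z) is_entire"
        by (intro holomorphic_intros h t) (auto simp: j_nonzero)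
      show "(\<lambda>z. (th t z)\<^sup>2) is_entire" by (intro holomorphic_intros th_holomorphic t)
      show "(th t (1/2))\<^sup>2 \<noteq> 0" using th_half_nonzero[OF t] by simp
      fix z
      have 1: "\<phi> g (z / j) = j ^ k * ?e (Suc m) z * \<phi> t z"
        using E det t unfolding JF_def sl2_law_def g_def j_def by blast
      have 2: "th g (z / j) ^ 2 * j ^ 2 = e2pi (of_int c * z\<^sup>2 / j) * th t z ^ 2"
        using th_sq_law[OF det t] unfolding g_def j_def .
      have 3: "?e (Suc m) z = ?e m z * e2pi (of_int c * z\<^sup>2 / j)"
        unfolding e2pi_add [symmetric] by (rule e2pi_cong) (simp add: field_simps add_divide_distrib)
      have "e2pi (of_int c * z\<^sup>2 / j) * (th t z ^ 2 * \<psi> g (z / j)) = j ^ 2 * (th g (z / j) ^ 2 * \<psi> g (z / j))"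
        using 2 by (simp only: mult.assoc [symmetric] mult.commute[of "j ^ 2"])
      also have "\<dots> = j ^ 2 * (j ^ k * (?e m z * e2pi (of_int c * z\<^sup>2 / j)) * (th t z ^ 2 * \<psi> t z))"
        by (simp only: \<psi>(2)[OF Im_g] \<psi>(2)[OF t] 1 3)
      also have "\<dots> = e2pi (of_int c * z\<^sup>2 / j) * (j ^ (k + 2) * ?e m z * \<psi> t z * th t z ^ 2)"
        by (simp add: power_add mult_ac power2_eq_square)
      finally show "\<psi> g (z / j) * (th t z)\<^sup>2 = j ^ (k + 2) * ?e m z * \<psi> t z * (th t z)\<^sup>2"
        by (simp add: mult_ac)
    qed
    then show "\<psi> (mob a b c d t) (z / aut c d t) =
       aut c d t ^ (k + 2) * e2pi (of_nat m * of_int c * z\<^sup>2 / aut c d t) * \<psi> t z"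
      unfolding g_def j_def .
  qed
  then show ?thesis using that \<psi> unfolding JF_def by blast
qed

lemma JF_at_0_S:
  assumes "JF k m \<phi> p" and t: "Im t > 0" shows "\<phi> (- 1 / t) 0 = t ^ k * \<phi> t 0"
proof -
  have "sl2_law k m \<phi>" using assms by (simp add: JF_def)
  from this[unfolded sl2_law_def, rule_format, of 0 0 "-1" 1 t 0] t show ?thesis by simp
qed

lemma JF_qval0: "JF k m \<phi> p \<Longrightarrow> qval (\<lambda>t. \<phi> t 0) (p 0)"
  unfolding JF_def EF_def by (blast intro: jfam_qval0)

lemma JF_index_0: "JF k 0 \<phi> p \<Longrightarrow> Im t > 0 \<Longrightarrow> \<phi> t z = \<phi> t 0"
  unfolding JF_def EF_def using ell_0_constant by blast

text \<open>At z = 0 the current quotient restricts to a cusp form of weight 2 n < 12, hence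
  vanishes, and another T^2 splits off. Six steps reach weight 12, where Delta stops the
  descent.\<close>

lemma JF_cusp_divide:
  assumes J: "JF 0 m \<phi> (\<lambda>_. 0)" and "n \<le> 6"
  shows "(\<forall>t z. Im t > 0 \<longrightarrow> \<phi> t z = 0) \<or>
     (\<exists>\<psi>. n \<le> m \<and> JF (2 * n) (m - n) \<psi> (\<lambda>_. 0) \<and> (\<forall>t z. Im t > 0 \<longrightarrow> th t z ^ (2 * n) * \<psi> t z = \<phi> t z))"
  using \<open>n \<le> 6\<close>
proof (induction n)
  case 0
  then show ?case using J by (intro disjI2 exI[of _ \<phi>]) auto
next
  case (Suc n)
  then consider "\<forall>t z. Im t > 0 \<longrightarrow> \<phi> t z = 0" | \<psi> where "n \<le> m" "JF (2 * n) (m - n) \<psi> (\<lambda>_. 0)" "\<forall>t z. Im t > 0 \<longrightarrow> th t z ^ (2 * n) * \<psi> t z = \<phi> t z"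
    by auto
  then show ?case
  proof cases
    case (2 \<psi>)
    have z: "\<psi> t 0 = 0" if "Im t > 0" for t
      by (rule cusp_form_small_weight_zero[of "\<lambda>t. \<psi> t 0" "2 * n"])
         (use JF_qval0[OF 2(2)] JF_at_0_S[OF 2(2)] that Suc(2) in auto)
    show ?thesis
    proof (cases "m - n")
      \<comment> \<open>With the index exhausted the quotient is constant in z and equals its
        vanishing value at z = 0.\<close>
      case 0
      then have "\<phi> t z = 0" if "Im t > 0" for t z
        using JF_index_0[of "2*n" \<psi> "\<lambda>_. 0" t z] 2(2,3) z that by (metis mult_zero_right)
      then show ?thesis by blast
    next
      case (Suc m')
      then obtain \<psi>' r where \<psi>': "JF (2 * n + 2) m' \<psi>' r" "\<And>t z. Im t > 0 \<Longrightarrow> th t z ^ 2 * \<psi>' t z = \<psi> t z" "\<And>z. sy z ^ 2 * r z = 0"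
        using JF_divide[of "2*n" m' \<psi> "\<lambda>_. 0"] 2(2) z by metis
      \<comment> \<open>The cusp value of the new quotient is again zero, because its product with
        the square of \<open>sy\<close> is.\<close>
      have "r z = 0" for z
      proof (rule entire_cancel[of r "\<lambda>_. 0" "\<lambda>z. sy z ^ 2" "1/2"])
        show "r is_entire" using \<psi>'(1) unfolding JF_def EF_def by (blast dest: jfam_hol_p)
        show "r z * sy z ^ 2 = 0 * sy z ^ 2" for z using \<psi>'(3)[of z] by (simp add: mult.commute)
        show "(sy (1/2))\<^sup>2 \<noteq> 0" using sy_half by simp
      qed (intro holomorphic_intros sy_holomorphic)+
      then have "r = (\<lambda>_. 0)" by auto
      moreover have "th t z ^ (2 * Suc n) * \<psi>' t z = \<phi> t z" if "Im t > 0" for t z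
      proof -
        have "th t z ^ (2 * Suc n) = th t z ^ (2 * n) * th t z ^ 2" by (simp only: power_add [symmetric]) simp
        then show ?thesis using \<psi>'(2)[OF that, of z] 2(3) that by (simp only: mult.assoc)
      qed
      moreover have "m' = m - Suc n" "Suc n \<le> m" using Suc by auto
      ultimately show ?thesis
        using \<psi>'(1) by (intro disjI2 exI[of _ \<psi>']) auto
    qed
  qed auto
qed

subsection \<open>Quotients of theta functions\<close>

text \<open>T(n z) / T(z) as an entire function: the zeros of T are simple, and multiplication by n
  maps the lattice into itself. The weight is 0 and the index (n^2 - 1)/2, that is 3/2 for n = 2 and
  4 for n = 3.\<close>

definition thq :: "nat \<Rightarrow> complex \<Rightarrow> complex \<Rightarrow> complex" where
  "thq n t = (SOME G. G is_entire \<and> (\<forall>z. G z * th t z = th t (of_nat n * z)))"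

lemma thq_spec:
  assumes t: "Im t > 0"
  shows "thq n t is_entire \<and> (\<forall>z. thq n t z * th t z = th t (of_nat n * z))"
proof -
  have "th t (of_nat n * (of_int a * t + of_int b)) = 0" for a b
  proof -
    have "of_nat n * (of_int a * t + of_int b) = of_int (int n * a) * t + of_int (int n * b)" by (simp add: algebra_simps)
    then show ?thesis by (simp only: th_lattice_zero[OF t])
  qed
  from th_divide[OF t holomorphic_scale[OF th_holomorphic[OF t]] this]
  obtain G where "G is_entire" "\<And>z. G z * th t z = th t (of_nat n * z)" by blast
  then have "\<exists>G. G is_entire \<and> (\<forall>z. G z * th t z = th t (of_nat n * z))" by blast
  then show ?thesis unfolding thq_def by (rule someI_ex)
qed

lemma thq_holomorphic: "Im t > 0 \<Longrightarrow> thq n t is_entire"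
  and thq_mult: "Im t > 0 \<Longrightarrow> thq n t z * th t z = th t (of_nat n * z)"
  using thq_spec by blast+

lemma thq_even: assumes t: "Im t > 0" shows "thq n t (- z) = thq n t z"
proof (rule th_cancel[OF t, of "\<lambda>z. thq n t (- z)" "thq n t"])
  show "thq n t (- z) * th t z = thq n t z * th t z" for z
    using thq_mult[OF t, of n "- z"] thq_mult[OF t, of n z] th_odd[OF t, of z] th_odd[OF t, of "of_nat n * z"]
    by simp
qed (intro holomorphic_reflect thq_holomorphic t)+

lemma th_translate:
  assumes t: "Im t > 0"
  shows "(\<lambda>z. th t (z + (of_int a * t + of_int b))) = (\<lambda>z. ((-1) powi (a + b) * e2pi (- (of_int a)\<^sup>2 / 2 * t)) * e2pi (- of_int a * z + 0 * z\<^sup>2) * th t z)"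
proof
  fix z
  have "th t (z + (of_int a * t + of_int b)) = (-1) powi (a + b) * e2pi (- (of_int a)\<^sup>2 / 2 * t - of_int a * z) * th t z"
    using th_shift[OF t, of z a b] by (simp only: add.assoc)
  also have "e2pi (- (of_int a)\<^sup>2 / 2 * t - of_int a * z) = e2pi (- (of_int a)\<^sup>2 / 2 * t) * e2pi (- of_int a * z + 0 * z\<^sup>2)"
    unfolding e2pi_add [symmetric] by (rule e2pi_cong) simp
  finally show "th t (z + (of_int a * t + of_int b)) = ((-1) powi (a + b) * e2pi (- (of_int a)\<^sup>2 / 2 * t)) * e2pi (- of_int a * z + 0 * z\<^sup>2) * th t z"
    by (simp only: mult.assoc)
qed

text \<open>The numerator contributes n^2 to the exponent and the denominator subtracts 1.\<close>

lemma thq_translate: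
  assumes t: "Im t > 0" and n: "n > 0"
  shows "thq n t (z + (of_int a * t + of_int b)) = ((-1) powi (int (n - 1) * (a + b)) * e2pi (- of_nat (n\<^sup>2 - 1) * (of_int a)\<^sup>2 / 2 * t)) *
     e2pi (- of_nat (n\<^sup>2 - 1) * of_int a * z) * thq n t z"
proof (rule th_cancel[OF t, of "\<lambda>z. thq n t (z + (of_int a * t + of_int b))" "\<lambda>z. ((-1) powi (int (n - 1) * (a + b)) * e2pi (- of_nat (n\<^sup>2 - 1) * (of_int a)\<^sup>2 / 2 * t)) * e2pi (- of_nat (n\<^sup>2 - 1) * of_int a * z) * thq n t z"])
  fix z
  let ?w = "of_int a * t + of_int b"
  define E1 where "E1 = (-1) powi (a + b) * e2pi (- (of_int a)\<^sup>2 / 2 * t - of_int a * z)"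
  have E10: "E1 \<noteq> 0" by (simp add: E1_def power_int_eq_0_iff)
  have n2: "of_nat (n\<^sup>2 - 1) = (of_nat n)\<^sup>2 - (1::complex)"
    using n by (simp add: of_nat_diff)
  have "th t (of_nat n * (z + ?w)) = (-1) powi (int n * a + int n * b) * e2pi (- (of_int (int n * a))\<^sup>2 / 2 * t - of_int (int n * a) * (of_nat n * z)) * th t (of_nat n * z)"
    using th_shift[OF t, of "of_nat n * z" "int n * a" "int n * b"] by (simp add: algebra_simps)
  also have "(-1::complex) powi (int n * a + int n * b) = (-1) powi (int (n - 1) * (a + b)) * (-1) powi (a + b)"
    unfolding powi_m1_add [symmetric] using n by (intro arg_cong[where f = "power_int (-1)"]) (simp add: algebra_simps of_nat_diff)
  also have "e2pi (- (of_int (int n * a))\<^sup>2 / 2 * t - of_int (int n * a) * (of_nat n * z)) =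
     e2pi (- of_nat (n\<^sup>2 - 1) * (of_int a)\<^sup>2 / 2 * t) * e2pi (- of_nat (n\<^sup>2 - 1) * of_int a * z) * e2pi (- (of_int a)\<^sup>2 / 2 * t - of_int a * z)"
    unfolding e2pi_add [symmetric] n2 by (rule e2pi_cong) (simp add: power2_eq_square field_simps)
  finally have "th t (of_nat n * (z + ?w)) = E1 * (((-1) powi (int (n - 1) * (a + b)) * e2pi (- of_nat (n\<^sup>2 - 1) * (of_int a)\<^sup>2 / 2 * t)) *
     e2pi (- of_nat (n\<^sup>2 - 1) * of_int a * z) * (thq n t z * th t z))"
    unfolding thq_mult[OF t] E1_def by (simp only: mult_ac)
  moreover have "th t (of_nat n * (z + ?w)) = E1 * (thq n t (z + ?w) * th t z)"
    unfolding thq_mult[OF t, symmetric] E1_def using th_shift[OF t, of z a b] by (simp add: add.assoc mult_ac)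
  ultimately show "thq n t (z + ?w) * th t z = ((-1) powi (int (n - 1) * (a + b)) * e2pi (- of_nat (n\<^sup>2 - 1) * (of_int a)\<^sup>2 / 2 * t)) *
     e2pi (- of_nat (n\<^sup>2 - 1) * of_int a * z) * thq n t z * th t z"
    using E10 by (simp add: mult.assoc)
next
  show "(\<lambda>z. thq n t (z + (of_int a * t + of_int b))) is_entire"
    by (rule holomorphic_shift[OF thq_holomorphic[OF t]])
qed (intro holomorphic_intros thq_holomorphic t)

context sl2 begin

lemma th_modular_fun: "(\<lambda>z. th g (1 / j * z)) = (\<lambda>z. (1 / j) * e2pi (0 * z + of_int c / (2 * j) * z\<^sup>2) * th t z)"
  using th_modular by (auto simp: fun_eq_iff)

lemma thq_modular:
  assumes n: "n > 0"
  shows "thq n g (z / j) = e2pi (of_nat (n\<^sup>2 - 1) * of_int c / (2 * j) * z\<^sup>2) * thq n t z"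
proof (rule th_cancel[OF t, of "\<lambda>z. thq n g (z / j)" "\<lambda>z. e2pi (of_nat (n\<^sup>2 - 1) * of_int c / (2 * j) * z\<^sup>2) * thq n t z"])
  fix z
  have n2: "of_nat (n\<^sup>2 - 1) = (of_nat n)\<^sup>2 - (1::complex)"
    using n by (simp add: of_nat_diff)
  let ?e = "e2pi (of_int c * z\<^sup>2 / (2 * j)) / j"
  have "?e * (thq n g (z / j) * th t z) = thq n g (z / j) * th g (z / j)"
    unfolding th_modular by simp
  also have "\<dots> = th g (of_nat n * z / j)" unfolding thq_mult[OF Im_g] by simp
  also have "\<dots> = e2pi (of_int c * (of_nat n * z)\<^sup>2 / (2 * j)) / j * th t (of_nat n * z)" by (rule th_modular)
  also have "e2pi (of_int c * (of_nat n * z)\<^sup>2 / (2 * j)) = e2pi (of_int c * z\<^sup>2 / (2 * j)) * e2pi (of_nat (n\<^sup>2 - 1) * of_int c / (2 * j) * z\<^sup>2)"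
    unfolding e2pi_add [symmetric] n2 using j_nonzero by (intro arg_cong[where f = e2pi]) (simp add: power2_eq_square field_simps)
  also have "th t (of_nat n * z) = thq n t z * th t z" by (rule thq_mult[OF t, symmetric])
  finally have "?e * (thq n g (z / j) * th t z) = ?e * (e2pi (of_nat (n\<^sup>2 - 1) * of_int c / (2 * j) * z\<^sup>2) * thq n t z * th t z)"
    by (simp add: mult_ac)
  then show "thq n g (z / j) * th t z = e2pi (of_nat (n\<^sup>2 - 1) * of_int c / (2 * j) * z\<^sup>2) * thq n t z * th t z"
    using j_nonzero by simp
next
  show "(\<lambda>z. thq n g (z / j)) is_entire"
    using holomorphic_scale[OF thq_holomorphic[OF Im_g], of n "1 / j"] by simp
qed (intro holomorphic_intros thq_holomorphic t, use j_nonzero in auto)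

end

text \<open>The cusp value is the same quotient formed with \<open>sy\<close> in place of T.\<close>

lemma jfam_thq:
  assumes "p is_entire" "\<And>z. sy z * p z = sy (of_nat n * z)"
  shows "jfam (thq n) p"
proof (rule jfam_divide[OF jfam_th jfam_scale[OF jfam_th, of "of_nat n"], where \<delta> = "\<kappa>"])
  show "th t z * thq n t z = th t (of_nat n * z)" if "Im t > 0" for t z
    using thq_mult[OF that, of n z] by (simp add: mult.commute)
qed (use assms in \<open>auto simp: thq_holomorphic deriv_th_0 deriv_s\<close>)

text \<open>This is 2 cos(pi z), the cusp value of T(2 z) / T(z).\<close>

definition co :: "complex \<Rightarrow> complex" where "co z = e2pi (z/2) + e2pi (-z/2)"

lemma e2pi_half_half: "e2pi (z/2) * e2pi (-z/2) = 1" "e2pi (z/2) * e2pi (z/2) = e2pi z" "e2pi (-z/2) * e2pi (-z/2) = e2pi (-z)"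
  unfolding e2pi_add [symmetric] by simp_all

lemma co_sq: "co z ^ 2 = 4 + sy z ^ 2"
proof -
  have "co z ^ 2 - sy z ^ 2 = 4 * (e2pi (z/2) * e2pi (-z/2))"
    by (simp add: co_def sy_def power2_eq_square algebra_simps)
  then show ?thesis by (simp only: e2pi_half_half) (simp add: algebra_simps)
qed

lemma sy_sq: "sy z ^ 2 = e2pi z - 2 + e2pi (- z)"
proof -
  have "sy z ^ 2 = e2pi (z/2) * e2pi (z/2) - 2 * (e2pi (z/2) * e2pi (-z/2)) + e2pi (-z/2) * e2pi (-z/2)"
    by (simp add: sy_def power2_eq_square algebra_simps)
  then show ?thesis by (simp only: e2pi_half_half) simp
qed

lemma co_holomorphic: "co is_entire"
  unfolding co_def[abs_def] by (intro holomorphic_intros) auto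

lemma sy_double: "sy z * co z = sy (of_nat 2 * z)"
  by (simp add: sy_def co_def algebra_simps e2pi_half_half[simplified])

lemma sy_triple: "sy z * (3 + sy z ^ 2) = sy (of_nat 3 * z)"
proof -
  have "sy (of_nat 3 * z) = e2pi (z/2) * e2pi (z/2) * e2pi (z/2) - e2pi (-z/2) * e2pi (-z/2) * e2pi (-z/2)"
    unfolding sy_def e2pi_add [symmetric] by (simp add: field_simps)
  also have "\<dots> = sy z * (3 * (e2pi (z/2) * e2pi (-z/2)) + sy z ^ 2)"
    by (simp add: sy_def power2_eq_square algebra_simps)
  finally show ?thesis by (simp only: e2pi_half_half) simp
qed

lemma deriv_co: "deriv co z = of_real pi * \<i> * sy z"
  unfolding sy_def co_def[abs_def] by (rule DERIV_imp_deriv) (auto intro!: derivative_eq_intros simp: algebra_simps)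

lemma deriv_sy_co: "deriv sy = (\<lambda>z. of_real pi * \<i> * co z)"
  by (auto simp: deriv_sy co_def)

lemma deriv2_sy: "deriv (deriv sy) z = (of_real pi * \<i>)\<^sup>2 * sy z"
  unfolding deriv_sy_co using co_holomorphic
  by (subst deriv_cmult) (auto simp: deriv_co power2_eq_square holomorphic_on_imp_differentiable_at)

subsection \<open>The four generators\<close>

text \<open>It has the transformation law of the Eisenstein series of weight 2, and the constant in
  front gives it the cusp value 1.\<close>

definition e2 :: "complex \<Rightarrow> complex" where "e2 t = 4 / \<kappa> ^ 3 * deriv (deriv (deriv (th t))) 0"

text \<open>Up to a constant the Weierstrass function times T^2; the factor in front of
  \<open>wr\<close> makes the q^0-term u + 12.\<close>

definition f1 :: jform where "f1 t z = 12 / \<kappa>\<^sup>2 * wr (th t) z + e2 t * th t z ^ 2"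
text \<open>The bracket of T, of index 1/2, with T(2 z) / T(z), of index 3/2. The double series
  \<open>phi02\<close> is this bracket, see \<open>phi02_eq\<close>.\<close>

definition f2 :: jform where "f2 t z = 1 / \<kappa> * rc (th t) (thq 2 t) z"
definition f3 :: jform where "f3 t z = thq 2 t z ^ 2"
definition f4 :: jform where "f4 t z = thq 3 t z"

lemma wr_even: assumes "G is_entire" "\<And>z. G (- z) = - G z" shows "wr G (- z) = wr G z"
proof -
  have "(\<lambda>z. G (-1 * z)) = (\<lambda>z. - G z)" using assms(2) by auto
  then have "wr (\<lambda>z. - G z) z = (-1)\<^sup>2 * wr G (-1 * z)" using wr_scale[OF assms(1), of "-1" z] by simp
  moreover have "wr (\<lambda>z. (-1) * e2pi (0 * z + 0 * z\<^sup>2) * G z) z = (-1)\<^sup>2 * e2pi (2 * (0 * z + 0 * z\<^sup>2)) * (wr G z - 2 * \<kappa> * 0 * (G z)\<^sup>2)"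
    by (rule wr_gauge[OF assms(1)])
  ultimately show ?thesis by simp
qed

lemma deriv_odd: assumes "G is_entire" "\<And>z. G (- z) = - G z" shows "deriv G (- z) = deriv G z"
proof -
  have "deriv (\<lambda>z. G (-1 * z)) z = -1 * deriv G (-1 * z)" by (rule deriv_scale[OF assms(1)])
  moreover have "(\<lambda>z. G (-1 * z)) = (\<lambda>z. (-1) * G z)" using assms(2) by auto
  moreover have "deriv (\<lambda>z. (-1) * G z) z = (-1) * deriv G z"
    by (rule DERIV_imp_deriv, rule DERIV_cmult, rule entire_deriv[OF assms(1)])
  ultimately show ?thesis by simp
qed

lemma deriv_even: assumes "G is_entire" "\<And>z. G (- z) = G z" shows "deriv G (- z) = - deriv G z"
proof -
  have "deriv (\<lambda>z. G (-1 * z)) z = -1 * deriv G (-1 * z)" by (rule deriv_scale[OF assms(1)])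
  moreover have "(\<lambda>z. G (-1 * z)) = G" using assms(2) by auto
  ultimately show ?thesis by simp
qed

lemma EF_f1: "EF 1 f1 (\<lambda>z. 12 + sy z ^ 2)"
  unfolding EF_def
proof (intro conjI allI impI)
  have "qval (\<lambda>t. (deriv ^^ 3) (th t) 0) ((deriv ^^ 3) sy 0)" by (rule jfam_qval[OF jfam_th])
  then have "qval (\<lambda>t. deriv (deriv (deriv (th t))) 0) (deriv (deriv (deriv sy)) 0)"
    by (simp add: eval_nat_numeral)
  also have "deriv (deriv (deriv sy)) 0 = 2 * (of_real pi * \<i>) ^ 3"
  proof -
    have "deriv (deriv sy) = (\<lambda>z. (of_real pi * \<i>)\<^sup>2 * sy z)" using deriv2_sy by auto
    then have "deriv (deriv (deriv sy)) 0 = (of_real pi * \<i>)\<^sup>2 * deriv sy 0"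
      using sy_holomorphic by (simp add: holomorphic_on_imp_differentiable_at)
    then show ?thesis by (simp add: deriv_s power3_eq_cube power2_eq_square)
  qed
  finally have q: "qval e2 (4 / \<kappa> ^ 3 * (2 * (of_real pi * \<i>) ^ 3))"
    unfolding e2_def[abs_def] by (intro qval_mult qval_const)
  have k8: "4 / \<kappa> ^ 3 * (2 * (of_real pi * \<i>) ^ 3) = 1"
  proof -
    have "\<kappa> ^ 3 = 8 * (of_real pi * \<i>) ^ 3" by (simp add: power3_eq_cube)
    moreover have "(of_real pi * \<i> :: complex) ^ 3 \<noteq> 0" by simp
    ultimately show ?thesis by (simp only: times_divide_eq_left) simp
  qed
  have "jfam f1 (\<lambda>z. 12 / \<kappa>\<^sup>2 * wr sy z + 1 * sy z ^ 2)"
    unfolding f1_def[abs_def] using q k8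
    by (intro jfam_add jfam_mult jfam_const jfam_wr jfam_power jfam_th jfam_qval_const) simp
  moreover have "12 / \<kappa>\<^sup>2 * wr sy z + 1 * sy z ^ 2 = 12 + sy z ^ 2" for z
  proof -
    have "wr sy z = (of_real pi * \<i>)\<^sup>2 * (co z ^ 2 - sy z ^ 2)"
      unfolding wr_def deriv2_sy unfolding deriv_sy_co by (simp add: power2_eq_square algebra_simps)
    also have "\<dots> = \<kappa>\<^sup>2" unfolding co_sq by (simp add: power_mult_distrib)
    finally show ?thesis by simp
  qed
  ultimately show "jfam f1 (\<lambda>z. 12 + sy z ^ 2)" by simp
  fix t :: complex assume t: "Im t > 0"
  note h = th_holomorphic[OF t]
  show "f1 t (- z) = f1 t z" for z
    unfolding f1_def using wr_even[OF h th_odd[OF t]] by (simp add: th_odd[OF t])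
  show "ell t 1 (f1 t)"
  proof -
    have "ell t 1 (wr (th t))"
      unfolding ell_def
    proof (intro conjI allI)
      fix a b z
      let ?w = "of_int a * t + of_int b"
      let ?C = "(-1) powi (a + b) * e2pi (- (of_int a)\<^sup>2 / 2 * t)"
      have "wr (th t) (z + ?w) = wr (\<lambda>z. th t (z + ?w)) z" by (rule wr_translate[OF h, symmetric])
      also have "\<dots> = ?C\<^sup>2 * e2pi (2 * (- of_int a * z + 0 * z\<^sup>2)) * (wr (th t) z - 2 * \<kappa> * 0 * (th t z)\<^sup>2)"
        unfolding th_translate[OF t] by (rule wr_gauge[OF h])
      also have "?C\<^sup>2 = e2pi (- (of_int a)\<^sup>2 * t)"
        by (simp add: power2_eq_square[of "_ * _"] e2pi_sq powi_m1_sq mult_ac flip: mult.assoc) 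
      also have "e2pi (- (of_int a)\<^sup>2 * t) * e2pi (2 * (- of_int a * z + 0 * z\<^sup>2)) = e2pi (- of_nat 1 * ((of_int a)\<^sup>2 * t + 2 * of_int a * z))"
        unfolding e2pi_add [symmetric] by (rule e2pi_cong) (simp add: algebra_simps)
      finally show "wr (th t) (z + of_int a * t + of_int b) = e2pi (- of_nat 1 * ((of_int a)\<^sup>2 * t + 2 * of_int a * z)) * wr (th t) z"
        by (simp add: add.assoc)
    qed (rule wr_holomorphic[OF h])
    then have "ell t 1 (\<lambda>z. 12 / \<kappa>\<^sup>2 * wr (th t) z + e2 t * th t z ^ 2)"
      by (intro ell_add ell_cmult ell_th_sq t)
    then show ?thesis by (simp only: f1_def[abs_def])
  qed
next
  fix z
  show "12 + sy (z + 1) ^ 2 = 12 + sy z ^ 2" by (simp add: sy_plus_1)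
qed

text \<open>Supplies the anomaly of \<open>e2\<close>: the third derivative at a zero of G picks up
  a multiple of v.\<close>

lemma deriv3_gauge_0:
  assumes G: "G is_entire" "G 0 = 0"
  shows "deriv (deriv (deriv (\<lambda>z. C * e2pi (0 * z + v * z\<^sup>2) * G z))) 0 = C * (deriv (deriv (deriv G)) 0 + 6 * \<kappa> * v * deriv G 0)"
proof -
  note G' = entire_deriv_holomorphic[OF G(1)]
  have D: "deriv (deriv (\<lambda>z. C * e2pi (0 * z + v * z\<^sup>2) * G z)) = (\<lambda>z. C * e2pi (0 * z + v * z\<^sup>2) *
    (deriv (deriv G) z + 2 * \<kappa> * (0 + 2 * v * z) * deriv G z + (\<kappa>\<^sup>2 * (0 + 2 * v * z)\<^sup>2 + 2 * \<kappa> * v) * G z))"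
    by (rule ext) (rule gauge_deriv2[OF G(1)])
  have h: "(\<lambda>z. deriv (deriv G) z + 2 * \<kappa> * (0 + 2 * v * z) * deriv G z + (\<kappa>\<^sup>2 * (0 + 2 * v * z)\<^sup>2 + 2 * \<kappa> * v) * G z) is_entire"
    by (intro holomorphic_intros G(1) G' entire_deriv_holomorphic)
  have "((\<lambda>z. deriv (deriv G) z + 2 * \<kappa> * (0 + 2 * v * z) * deriv G z + (\<kappa>\<^sup>2 * (0 + 2 * v * z)\<^sup>2 + 2 * \<kappa> * v) * G z) has_field_derivative
     deriv (deriv (deriv G)) 0 + 6 * \<kappa> * v * deriv G 0) (at 0)"
    by (auto intro!: derivative_eq_intros entire_deriv[OF G(1)] entire_deriv[OF G'] entire_deriv[OF entire_deriv_holomorphic[OF G']] simp: G(2) algebra_simps)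
  then show ?thesis unfolding D gauge_deriv[OF h] using G(2) by (simp add: DERIV_imp_deriv)
qed

text \<open>Both \<open>wr\<close> and \<open>e2\<close> fail to be modular by a multiple of v T^2,
  and the two multiples, -24/\<kappa> and 24/\<kappa>, cancel.\<close>

lemma sl2_law_f1: "sl2_law 0 1 f1"
  unfolding sl2_law_def
proof (intro allI impI)
  fix a b c d :: int and t z :: complex
  assume det: "a * d - b * c = 1" and t: "Im t > 0"
  interpret sl2 a b c d t by unfold_locales (use det t in auto)
  note h = th_holomorphic[OF t] and hg = th_holomorphic[OF Im_g]
  define v where "v = of_int c / (2 * j)"
  have k0: "\<kappa> \<noteq> 0" by simp
  have W: "wr (th g) (z / j) = e2pi (2 * (v * z\<^sup>2)) * (wr (th t) z - 2 * \<kappa> * v * (th t z)\<^sup>2)"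
  proof -
    have "(1 / j)\<^sup>2 * wr (th g) (1 / j * z) = wr (\<lambda>z. th g (1 / j * z)) z" by (rule wr_scale[OF hg, symmetric])
    also have "\<dots> = (1 / j)\<^sup>2 * e2pi (2 * (0 * z + v * z\<^sup>2)) * (wr (th t) z - 2 * \<kappa> * v * (th t z)\<^sup>2)"
      unfolding th_modular_fun v_def by (rule wr_gauge[OF h])
    finally show ?thesis using j_nonzero by simp
  qed
  have E: "e2 g = j\<^sup>2 * (e2 t + 24 / \<kappa> * v)"
  proof -
    have s: "deriv (\<lambda>z. G (1 / j * z)) = (\<lambda>z. 1 / j * deriv G (1 / j * z))" if "G is_entire" for G
      by (rule ext) (rule deriv_scale[OF that])
    have s': "deriv (\<lambda>z. C * G (1 / j * z)) = (\<lambda>z. C * (1 / j * deriv G (1 / j * z)))" if "G is_entire" for G C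
    proof
      fix z
      have "((\<lambda>z. C * G (1 / j * z)) has_field_derivative C * deriv (\<lambda>z. G (1 / j * z)) z) (at z)"
        by (intro DERIV_cmult entire_deriv holomorphic_scale that)
      then show "deriv (\<lambda>z. C * G (1 / j * z)) z = C * (1 / j * deriv G (1 / j * z))"
        using s[OF that] by (simp add: DERIV_imp_deriv)
    qed
    note hg' = entire_deriv_holomorphic[OF hg]
    have "deriv (deriv (deriv (\<lambda>z. th g (1 / j * z)))) 0 = 1 / j * (1 / j * (1 / j * deriv (deriv (deriv (th g))) 0))"
      unfolding s[OF hg] s'[OF hg'] using s'[OF entire_deriv_holomorphic[OF hg'], of "1 / j * (1 / j)"] by (simp add: mult.assoc)
    moreover have "deriv (deriv (deriv (\<lambda>z. th g (1 / j * z)))) 0 = 1 / j * (deriv (deriv (deriv (th t))) 0 + 6 * \<kappa> * v * \<kappa>)"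
      unfolding th_modular_fun v_def using deriv3_gauge_0[OF h, of "1/j" "of_int c / (2 * j)"] t by (simp add: deriv_th_0)
    ultimately have "1 / j * (1 / j * (1 / j * deriv (deriv (deriv (th g))) 0)) = 1 / j * (deriv (deriv (deriv (th t))) 0 + 6 * \<kappa> * v * \<kappa>)"
      by (rule trans[OF sym])
    moreover have "u = j\<^sup>2 * v" if "1 / j * (1 / j * (1 / j * u)) = 1 / j * v" for u v
      using that j_nonzero by (simp add: field_simps power2_eq_square)
    ultimately have "deriv (deriv (deriv (th g))) 0 = j\<^sup>2 * (deriv (deriv (deriv (th t))) 0 + 6 * \<kappa> * v * \<kappa>)"
      by blast
    then have "e2 g = 4 / \<kappa> ^ 3 * (j\<^sup>2 * (deriv (deriv (deriv (th t))) 0 + 6 * \<kappa> * v * \<kappa>))"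
      by (simp only: e2_def)
    also have "\<dots> = j\<^sup>2 * (4 / \<kappa> ^ 3 * deriv (deriv (deriv (th t))) 0 + (4 / \<kappa> ^ 3 * (6 * \<kappa> * \<kappa>)) * v)"
      by (simp only: distrib_left mult_ac)
    also have "4 / \<kappa> ^ 3 * (6 * \<kappa> * \<kappa>) = 24 / \<kappa>"
    proof -
      have "4 / w ^ 3 * (6 * w * w) = 24 / w" if "w \<noteq> 0" for w :: complex
        using that by (simp add: power3_eq_cube)
      from this[OF k0] show ?thesis .
    qed
    finally show ?thesis by (simp only: e2_def)
  qed
  have T: "th g (z / j) ^ 2 * j\<^sup>2 = e2pi (2 * (v * z\<^sup>2)) * th t z ^ 2"
  proof -
    have "th g (z / j) ^ 2 * j\<^sup>2 = e2pi (of_int c * z\<^sup>2 / j) * th t z ^ 2"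
      using th_sq_law[OF det t, of z] unfolding g_def j_def .
    moreover have "of_int c * z\<^sup>2 / j = 2 * (v * z\<^sup>2)" using j_nonzero by (simp add: v_def)
    ultimately show ?thesis by simp
  qed
  have "f1 g (z / j) = 12 / \<kappa>\<^sup>2 * (e2pi (2 * (v * z\<^sup>2)) * (wr (th t) z - 2 * \<kappa> * v * (th t z)\<^sup>2)) + (e2 t + 24 / \<kappa> * v) * (th g (z / j) ^ 2 * j\<^sup>2)"
    unfolding f1_def W E by (simp only: mult_ac)
  also have "\<dots> = e2pi (2 * (v * z\<^sup>2)) * f1 t z + e2pi (2 * (v * z\<^sup>2)) * th t z ^ 2 * v * (24 / \<kappa> - 12 / \<kappa>\<^sup>2 * (2 * \<kappa>))"
    unfolding T f1_def by (simp only: algebra_simps)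
  also have "24 / \<kappa> - 12 / \<kappa>\<^sup>2 * (2 * \<kappa>) = 0"
  proof -
    have "24 / w - 12 / w\<^sup>2 * (2 * w) = 0" if "w \<noteq> 0" for w :: complex
      using that by (simp add: power2_eq_square)
    from this[OF k0] show ?thesis .
  qed
  also have "2 * (v * z\<^sup>2) = of_nat 1 * of_int c * z\<^sup>2 / j" using j_nonzero by (simp add: v_def)
  finally show "f1 (mob a b c d t) (z / aut c d t) =
       aut c d t ^ 0 * e2pi (of_nat 1 * of_int c * z\<^sup>2 / aut c d t) * f1 t z"
    unfolding g_def j_def by simp
qed

lemma JF_f1: "JF 0 1 f1 (\<lambda>z. 12 + sy z ^ 2)"
  unfolding JF_def using EF_f1 sl2_law_f1 by blast

text \<open>Both laws follow from \<open>rc_gauge\<close>, with v = 0 for translations and u = 0 for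
  modular transformations. The differentiation in \<open>rc\<close> adds one to the weight -1 of T
  and so gives weight 0.\<close>

lemma JF_f2: "JF 0 2 f2 (\<lambda>z. 6 + sy z ^ 2)"
  unfolding JF_def EF_def
proof (intro conjI allI impI)
  have "jfam f2 (\<lambda>z. 1 / \<kappa> * rc sy co z)"
    unfolding f2_def[abs_def] by (intro jfam_mult jfam_const jfam_rc jfam_th jfam_thq co_holomorphic sy_double)
  moreover have "1 / \<kappa> * rc sy co z = 6 + sy z ^ 2" for z
  proof -
    have "rc sy co z = of_real pi * \<i> * (3 * co z ^ 2 - sy z ^ 2)"
      unfolding rc_def deriv_sy_co deriv_co by (simp add: power2_eq_square algebra_simps)
    then have "rc sy co z = \<kappa> * (6 + sy z ^ 2)" unfolding co_sq by (simp add: algebra_simps)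
    then show ?thesis by simp
  qed
  ultimately show "jfam f2 (\<lambda>z. 6 + sy z ^ 2)" by simp
  show "6 + sy (z + 1) ^ 2 = 6 + sy z ^ 2" for z by (simp add: sy_plus_1)
  fix t :: complex assume t: "Im t > 0"
  note h = th_holomorphic[OF t] and hq = thq_holomorphic[OF t, of 2]
  show "f2 t (- z) = f2 t z" for z
    unfolding f2_def rc_def by (simp add: th_odd[OF t] thq_even[OF t] deriv_odd[OF h th_odd[OF t]] deriv_even[OF hq thq_even[OF t]])
  show "ell t 2 (f2 t)"
    unfolding ell_def
  proof (intro conjI allI)
    show "f2 t is_entire" unfolding f2_def[abs_def] by (intro holomorphic_intros rc_holomorphic h hq)
    fix a b z
    let ?w = "of_int a * t + of_int b"
    let ?C = "(-1) powi (a + b) * e2pi (- (of_int a)\<^sup>2 / 2 * t)" and ?D = "(-1) powi (a + b) * e2pi (- 3 * (of_int a)\<^sup>2 / 2 * t)"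
    have q: "(\<lambda>z. thq 2 t (z + ?w)) = (\<lambda>z. ?D * e2pi (3 * (- of_int a) * z + 3 * 0 * z\<^sup>2) * thq 2 t z)"
      using thq_translate[OF t, of 2 _ a b] by (auto simp: fun_eq_iff)
    have "rc (th t) (thq 2 t) (z + ?w) = rc (\<lambda>z. th t (z + ?w)) (\<lambda>z. thq 2 t (z + ?w)) z"
      by (rule rc_translate[OF h hq, symmetric])
    also have "\<dots> = ?C * ?D * e2pi (4 * (- of_int a * z + 0 * z\<^sup>2)) * rc (th t) (thq 2 t) z"
      unfolding th_translate[OF t] q by (rule rc_gauge[OF h hq])
    also have "?C * ?D = ((-1) powi (a + b) * (-1) powi (a + b)) * (e2pi (- (of_int a)\<^sup>2 / 2 * t) * e2pi (- 3 * (of_int a)\<^sup>2 / 2 * t))"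
      by (simp only: mult_ac)
    also have "\<dots> * e2pi (4 * (- of_int a * z + 0 * z\<^sup>2)) = e2pi (- of_nat 2 * ((of_int a)\<^sup>2 * t + 2 * of_int a * z))"
      unfolding powi_m1_sq mult_1 e2pi_add [symmetric] by (rule e2pi_cong) (simp add: field_simps)
    finally show "f2 t (z + of_int a * t + of_int b) = e2pi (- of_nat 2 * ((of_int a)\<^sup>2 * t + 2 * of_int a * z)) * f2 t z"
      by (simp add: f2_def add.assoc)
  qed
next
  show "sl2_law 0 2 f2"
    unfolding sl2_law_def
  proof (intro allI impI)
    fix a b c d :: int and t z :: complex
    assume det: "a * d - b * c = 1" and t: "Im t > 0"
    interpret sl2 a b c d t by unfold_locales (use det t in auto)
    note h = th_holomorphic[OF t] and hg = th_holomorphic[OF Im_g] and hq = thq_holomorphic[OF t, of 2] and hqg = thq_holomorphic[OF Im_g, of 2]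
    define v where "v = of_int c / (2 * j)"
    have q: "(\<lambda>z. thq 2 g (1 / j * z)) = (\<lambda>z. 1 * e2pi (3 * 0 * z + 3 * v * z\<^sup>2) * thq 2 t z)"
      using thq_modular[of 2] by (auto simp: fun_eq_iff v_def)
    have "1 / j * rc (th g) (thq 2 g) (1 / j * z) = rc (\<lambda>z. th g (1 / j * z)) (\<lambda>z. thq 2 g (1 / j * z)) z"
      by (rule rc_scale[OF hg hqg, symmetric])
    also have "\<dots> = 1 / j * 1 * e2pi (4 * (0 * z + v * z\<^sup>2)) * rc (th t) (thq 2 t) z"
      unfolding th_modular_fun q v_def[symmetric] by (rule rc_gauge[OF h hq])
    finally have "rc (th g) (thq 2 g) (z / j) = e2pi (4 * (v * z\<^sup>2)) * rc (th t) (thq 2 t) z"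
      using j_nonzero by simp
    moreover have "4 * (v * z\<^sup>2) = of_nat 2 * of_int c * z\<^sup>2 / j" using j_nonzero by (simp add: v_def)
    ultimately show "f2 (mob a b c d t) (z / aut c d t) =
       aut c d t ^ 0 * e2pi (of_nat 2 * of_int c * z\<^sup>2 / aut c d t) * f2 t z"
      unfolding f2_def g_def j_def by simp
  qed
qed

lemma JF_f3: "JF 0 3 f3 (\<lambda>z. 4 + sy z ^ 2)"
  unfolding JF_def EF_def
proof (intro conjI allI impI)
  have "jfam f3 (\<lambda>z. co z ^ 2)"
    unfolding f3_def[abs_def] by (intro jfam_power jfam_thq co_holomorphic sy_double)
  then show "jfam f3 (\<lambda>z. 4 + sy z ^ 2)" by (simp only: co_sq)
  show "4 + sy (z + 1) ^ 2 = 4 + sy z ^ 2" for z by (simp add: sy_plus_1)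
  fix t :: complex assume t: "Im t > 0"
  show "f3 t (- z) = f3 t z" for z by (simp add: f3_def thq_even[OF t])
  show "ell t 3 (f3 t)"
    unfolding ell_def
  proof (intro conjI allI)
    show "f3 t is_entire" unfolding f3_def[abs_def] by (intro holomorphic_intros thq_holomorphic t)
    fix a b z
    let ?A = "e2pi (- of_nat (2\<^sup>2 - 1) * (of_int a)\<^sup>2 / 2 * t) * e2pi (- of_nat (2\<^sup>2 - 1) * of_int a * z)"
    have "thq 2 t (z + (of_int a * t + of_int b)) = (-1) powi (a + b) * ?A * thq 2 t z"
      using thq_translate[OF t, of 2 z a b] by simp
    then have "f3 t (z + (of_int a * t + of_int b)) = ((-1) powi (a + b) * (-1) powi (a + b)) * (?A * ?A) * f3 t z"
      by (simp only: f3_def power2_eq_square mult_ac)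
    also have "?A * ?A = e2pi (- of_nat 3 * ((of_int a)\<^sup>2 * t + 2 * of_int a * z))"
      unfolding e2pi_add [symmetric] by (rule e2pi_cong) (simp add: field_simps)
    finally show "f3 t (z + of_int a * t + of_int b) = e2pi (- of_nat 3 * ((of_int a)\<^sup>2 * t + 2 * of_int a * z)) * f3 t z"
      by (simp only: powi_m1_sq mult_1 add.assoc)
  qed
next
  show "sl2_law 0 3 f3"
    unfolding sl2_law_def
  proof (intro allI impI)
    fix a b c d :: int and t z :: complex
    assume det: "a * d - b * c = 1" and t: "Im t > 0"
    interpret sl2 a b c d t by unfold_locales (use det t in auto)
    have "f3 g (z / j) = e2pi (of_nat (2\<^sup>2 - 1) * of_int c / (2 * j) * z\<^sup>2) * e2pi (of_nat (2\<^sup>2 - 1) * of_int c / (2 * j) * z\<^sup>2) * f3 t z"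
      using thq_modular[of 2 z] by (simp add: f3_def power2_eq_square)
    also have "e2pi (of_nat (2\<^sup>2 - 1) * of_int c / (2 * j) * z\<^sup>2) * e2pi (of_nat (2\<^sup>2 - 1) * of_int c / (2 * j) * z\<^sup>2) = e2pi (of_nat 3 * of_int c * z\<^sup>2 / j)"
      unfolding e2pi_add [symmetric] by (rule e2pi_cong) (use j_nonzero in \<open>simp add: field_simps\<close>)
    finally show "f3 (mob a b c d t) (z / aut c d t) =
       aut c d t ^ 0 * e2pi (of_nat 3 * of_int c * z\<^sup>2 / aut c d t) * f3 t z"
      unfolding g_def j_def by simp
  qed
qed

lemma JF_f4: "JF 0 4 f4 (\<lambda>z. 3 + sy z ^ 2)"
  unfolding JF_def EF_def
proof (intro conjI allI impI)
  show "jfam f4 (\<lambda>z. 3 + sy z ^ 2)"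
    unfolding f4_def[abs_def] by (intro jfam_thq sy_triple holomorphic_intros sy_holomorphic)
  show "3 + sy (z + 1) ^ 2 = 3 + sy z ^ 2" for z by (simp add: sy_plus_1)
  fix t :: complex assume t: "Im t > 0"
  show "f4 t (- z) = f4 t z" for z by (simp add: f4_def thq_even[OF t])
  show "ell t 4 (f4 t)"
    unfolding ell_def
  proof (intro conjI allI)
    show "f4 t is_entire" unfolding f4_def[abs_def] by (intro thq_holomorphic t)
    fix a b z
    have s: "(-1::complex) powi (int (3 - 1) * (a + b)) = 1"
    proof -
      have "int (3 - 1) * (a + b) = (a + b) + (a + b)" by simp
      then show ?thesis by (simp only: powi_m1_add[of "a + b" "a + b"] powi_m1_sq)
    qed
    have "thq 3 t (z + (of_int a * t + of_int b)) = e2pi (- of_nat (3\<^sup>2 - 1) * (of_int a)\<^sup>2 / 2 * t) * e2pi (- of_nat (3\<^sup>2 - 1) * of_int a * z) * thq 3 t z"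
      using thq_translate[OF t, of 3 z a b] unfolding s by simp
    also have "e2pi (- of_nat (3\<^sup>2 - 1) * (of_int a)\<^sup>2 / 2 * t) * e2pi (- of_nat (3\<^sup>2 - 1) * of_int a * z) = e2pi (- of_nat 4 * ((of_int a)\<^sup>2 * t + 2 * of_int a * z))"
      unfolding e2pi_add [symmetric] by (rule e2pi_cong) (simp add: field_simps)
    finally show "f4 t (z + of_int a * t + of_int b) = e2pi (- of_nat 4 * ((of_int a)\<^sup>2 * t + 2 * of_int a * z)) * f4 t z"
      by (simp only: f4_def add.assoc)
  qed
next
  show "sl2_law 0 4 f4"
    unfolding sl2_law_def
  proof (intro allI impI)
    fix a b c d :: int and t z :: complex
    assume det: "a * d - b * c = 1" and t: "Im t > 0"
    interpret sl2 a b c d t by unfold_locales (use det t in auto)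
    have "f4 g (z / j) = e2pi (of_nat 4 * of_int c * z\<^sup>2 / j) * f4 t z"
      using thq_modular[of 3 z] j_nonzero by (simp add: f4_def)
    then show "f4 (mob a b c d t) (z / aut c d t) =
       aut c d t ^ 0 * e2pi (of_nat 4 * of_int c * z\<^sup>2 / aut c d t) * f4 t z"
      unfolding g_def j_def by simp
  qed
qed

subsection \<open>Kronecker symbols\<close>

text \<open>Both sides lie in {-1, 0, 1} and are congruent modulo p > 2 by Euler's criterion, so
  they are equal.\<close>

lemma Legendre_eqI:
  assumes p: "Factorial_Ring.prime p" "2 < p" and s: "s \<in> {-1, 0, 1}" "[s = a ^ ((p - 1) div 2)] (mod int p)"
  shows "Legendre a (int p) = s"
proof -
  have "[Legendre a (int p) = s] (mod int p)"
    using euler_criterion[OF p, of a] s(2) by (metis cong_sym cong_trans)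
  then have "int p dvd Legendre a (int p) - s" by (simp add: cong_iff_dvd_diff)
  moreover have "\<bar>Legendre a (int p) - s\<bar> < int p"
    using s(1) p(2) by (auto simp: Legendre_def)
  ultimately show ?thesis using dvd_imp_le_int[of "Legendre a (int p) - s" "int p"] by fastforce
qed

lemma cong_two_power: assumes "Factorial_Ring.prime p" "2 < (p::nat)" shows "[(4::int) ^ ((p - 1) div 2) = 1] (mod int p)"
proof -
  have "odd p" using assms prime_odd_nat by blast
  then have e: "2 * ((p - 1) div 2) = p - 1" by (simp add: even_two_times_div_two)
  have "\<not> p dvd 2" using assms by (auto dest: dvd_imp_le)
  then have "[2 ^ (p - 1) = 1] (mod p)" using fermat_theorem assms(1) by blast
  then have "[int (2 ^ (p - 1)) = int 1] (mod int p)" by (simp only: cong_int_iff)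
  moreover have "(4::int) ^ ((p - 1) div 2) = int (2 ^ (p - 1))"
  proof -
    have "(2::int) ^ (p - 1) = 2 ^ (2 * ((p - 1) div 2))" by (simp only: e)
    also have "\<dots> = 4 ^ ((p - 1) div 2)" unfolding power_mult by simp
    finally show ?thesis by simp
  qed
  ultimately show ?thesis by simp
qed

text \<open>\<open>chi4\<close> and \<open>chi12\<close> are the Kronecker symbols of -4 and 12 on
  positive integers, given as periodic characters so that congruences evaluate them.\<close>

definition chi4 :: "nat \<Rightarrow> int" where "chi4 n = (if n mod 4 = 1 then 1 else if n mod 4 = 3 then -1 else 0)"
definition chi12 :: "nat \<Rightarrow> int" where "chi12 n = (if n mod 12 \<in> {1, 11} then 1 else if n mod 12 \<in> {5, 7} then -1 else 0)"

lemma chi4_mult: "chi4 (m * n) = chi4 m * chi4 n"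
proof -
  have "\<forall>a\<in>set [0..<4]. \<forall>b\<in>set [0..<4]. chi4 (a * b) = chi4 a * chi4 b" unfolding chi4_def by code_simp
  moreover have "chi4 (k mod 4) = chi4 k" for k by (simp add: chi4_def)
  moreover have "chi4 (m * n) = chi4 ((m mod 4) * (n mod 4))" by (simp add: chi4_def mod_mult_eq)
  ultimately show ?thesis by simp
qed

lemma chi12_mult: "chi12 (m * n) = chi12 m * chi12 n"
proof -
  have "\<forall>a\<in>set [0..<12]. \<forall>b\<in>set [0..<12]. chi12 (a * b) = chi12 a * chi12 b" unfolding chi12_def by code_simp
  moreover have "chi12 (k mod 12) = chi12 k" for k by (simp add: chi12_def)
  moreover have "chi12 (m * n) = chi12 ((m mod 12) * (n mod 12))" by (simp add: chi12_def mod_mult_eq)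
  ultimately show ?thesis by simp
qed

lemma chi4_even: assumes "even m" shows "chi4 m = 0"
proof -
  have "m mod 4 \<noteq> 1" "m mod 4 \<noteq> 3" using assms by presburger+
  then show ?thesis by (simp add: chi4_def)
qed

lemma chi4_prime: assumes p: "Factorial_Ring.prime p" shows "chi4 p = kronecker_prime (-4) p"
proof (cases "p = 2")
  case False
  then have p2: "2 < p" using p prime_ge_2_nat[of p] by auto
  have "odd p" using p p2 prime_odd_nat by blast
  then have "p mod 4 = 1 \<or> p mod 4 = 3" by presburger
  then have "Legendre (-4) (int p) = chi4 p"
  proof (intro Legendre_eqI p p2)
    have "(-4::int) ^ ((p - 1) div 2) = (-1) ^ ((p - 1) div 2) * 4 ^ ((p - 1) div 2)"
      by (simp add: power_mult_distrib [symmetric])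
    moreover have "(-1::int) ^ ((p - 1) div 2) = chi4 p"
      using \<open>p mod 4 = 1 \<or> p mod 4 = 3\<close>
    proof
      assume a: "p mod 4 = 1"
      then have "even ((p - 1) div 2)" by presburger
      then show ?thesis using a by (simp add: chi4_def)
    next
      assume a: "p mod 4 = 3"
      then have "odd ((p - 1) div 2)" by presburger
      then show ?thesis using a by (simp add: chi4_def)
    qed
    ultimately show "[chi4 p = (- 4) ^ ((p - 1) div 2)] (mod int p)"
      using cong_scalar_left[OF cong_two_power[OF p p2], of "chi4 p"] by (simp add: cong_sym)
  qed (auto simp: chi4_def)
  then show ?thesis using False by (simp add: kronecker_prime_def)
qed (simp add: chi4_def kronecker_prime_def)

text \<open>As 12 is 3 times a square, the symbol at p > 3 is that of 3, which quadratic reciprocity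
  expresses by p modulo 3 and modulo 4.\<close>

lemma chi12_prime: assumes p: "Factorial_Ring.prime p" shows "chi12 p = kronecker_prime 12 p"
proof -
  consider "p = 2" | "p = 3" | "p > 3" using p prime_ge_2_nat[of p] by linarith
  then show ?thesis
  proof cases
    case 3
    then have p2: "2 < p" by simp
    have "odd p" using p p2 prime_odd_nat by blast
    have "\<not> 3 dvd p" using p 3 by (auto simp: prime_nat_iff)
    have L3: "Legendre (int p) 3 = (if p mod 3 = 1 then 1 else -1)"
    proof -
      have "Legendre (int p) (int 3) = (if p mod 3 = 1 then 1 else -1)"
      proof (rule Legendre_eqI)
        have "p mod 3 = 1 \<or> p mod 3 = 2" using \<open>\<not> 3 dvd p\<close> by presburger
        then have "[(if p mod 3 = 1 then 1 else -1) = int p] (mod 3)"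
        proof
          assume a: "p mod 3 = 1"
          then have "int p mod 3 = 1" by presburger
          then show ?thesis using a by (simp add: cong_def)
        next
          assume a: "p mod 3 = 2"
          then have "int p mod 3 = 2" by presburger
          then show ?thesis using a by (simp add: cong_def)
        qed
        then show "[(if p mod 3 = 1 then 1 else -1) = int p ^ ((3 - 1) div 2)] (mod int 3)" by simp
      qed auto
      then show ?thesis by simp
    qed
    have QR: "Legendre (int p) (int 3) * Legendre (int 3) (int p) = (-1::int) ^ ((p - 1) div 2 * ((3 - 1) div 2))"
      by (rule Quadratic_Reciprocity) (use p p2 3 in auto)
    have ceq: "Legendre 3 (int p) = chi12 p"
    proof -
      have "p mod 12 \<in> {1, 5, 7, 11}" using \<open>odd p\<close> \<open>\<not> 3 dvd p\<close> by simp presburger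
      then consider "p mod 12 = 1" | "p mod 12 = 5" | "p mod 12 = 7" | "p mod 12 = 11" by auto
      then show ?thesis
      proof cases
        case 1
        then have "p mod 3 = 1" "even ((p - 1) div 2)" by presburger+
        then show ?thesis using QR L3 1 by (simp add: chi12_def)
      next
        case 2
        then have "p mod 3 = 2" "even ((p - 1) div 2)" by presburger+
        then show ?thesis using QR L3 2 by (simp add: chi12_def)
      next
        case 3
        then have "p mod 3 = 1" "odd ((p - 1) div 2)" by presburger+
        then show ?thesis using QR L3 3 by (simp add: chi12_def)
      next
        case 4
        then have "p mod 3 = 2" "odd ((p - 1) div 2)" by presburger+
        then show ?thesis using QR L3 4 by (simp add: chi12_def)
      qed
    qed
    have "Legendre 12 (int p) = chi12 p"
    proof (rule Legendre_eqI[OF p p2])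
      have "[chi12 p = 3 ^ ((p - 1) div 2)] (mod int p)" using euler_criterion[OF p p2, of 3] ceq by simp
      then have "[chi12 p * 1 = 3 ^ ((p - 1) div 2) * 4 ^ ((p - 1) div 2)] (mod int p)"
        by (rule cong_mult) (rule cong_sym[OF cong_two_power[OF p p2]])
      then show "[chi12 p = 12 ^ ((p - 1) div 2)] (mod int p)" by (simp add: power_mult_distrib [symmetric])
    qed (auto simp: chi12_def)
    then show ?thesis using 3 by (simp add: kronecker_prime_def)
  qed (simp_all add: chi12_def kronecker_prime_def Legendre_def cong_def)
qed

text \<open>A completely multiplicative function is determined by its values at primes.\<close>

lemma kronecker_prod:
  assumes h: "h 1 = (1::int)" "\<And>m n. h (m * n) = h m * h n" "\<And>p. Factorial_Ring.prime p \<Longrightarrow> h p = kronecker_prime a p" and n: "n > 0"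
  shows "(\<Prod>p\<in>prime_factors n. kronecker_prime a p ^ multiplicity p n) = h n"
proof -
  have pow: "h (m ^ k) = h m ^ k" for m k by (induction k) (use h in auto)
  have "h (\<Prod>p\<in>F. p ^ multiplicity p n) = (\<Prod>p\<in>F. h p ^ multiplicity p n)" if "finite F" for F
    using that by (induction F rule: finite_induct) (use h pow in auto)
  then have "h (\<Prod>p\<in>prime_factors n. p ^ multiplicity p n) = (\<Prod>p\<in>prime_factors n. h p ^ multiplicity p n)" by simp
  also have "(\<Prod>p\<in>prime_factors n. p ^ multiplicity p n) = n" using prime_factorization_nat[OF n] by simp
  also have "(\<Prod>p\<in>prime_factors n. h p ^ multiplicity p n) = (\<Prod>p\<in>prime_factors n. kronecker_prime a p ^ multiplicity p n)"
    by (rule prod.cong) (auto simp: h(3) in_prime_factors_iff)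
  finally show ?thesis ..
qed

lemma kronecker_m4_odd: "kronecker_symbol (-4) (2 * k + 1) = (if even k then 1 else -1)"
proof -
  have c: "(\<Prod>p\<in>prime_factors n. kronecker_prime (-4) p ^ multiplicity p n) = chi4 n" if "n > 0" for n
    by (rule kronecker_prod) (use that chi4_mult chi4_prime in \<open>auto simp: chi4_def\<close>)
  show ?thesis
  proof (cases "k \<ge> 0")
    case True
    define n where "n = nat k"
    have k: "k = int n" using True by (simp add: n_def)
    have n2: "nat \<bar>2 * k + 1\<bar> = 2 * n + 1" using k by simp
    have "kronecker_symbol (-4) (2 * k + 1) = chi4 (2 * n + 1)"
      unfolding kronecker_symbol_def n2 using c[of "2 * n + 1"] k by auto
    moreover have "chi4 (2 * n + 1) = (if even n then 1 else -1)"
      unfolding chi4_def by (auto, presburger+)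
    ultimately show ?thesis using k by simp
  next
    case False
    \<comment> \<open>Here 2 k + 1 = -(2 n + 1), and the convention for two negative arguments
      contributes the factor -1, matching the opposite parities of k and n.\<close>
    define n where "n = nat (- k - 1)"
    have k: "k = - int n - 1" using False by (simp add: n_def)
    have n2: "nat \<bar>2 * k + 1\<bar> = 2 * n + 1" using k by simp
    have "kronecker_symbol (-4) (2 * k + 1) = - chi4 (2 * n + 1)"
      unfolding kronecker_symbol_def n2 using c[of "2 * n + 1"] k by auto
    moreover have "chi4 (2 * n + 1) = (if even n then 1 else -1)"
      unfolding chi4_def by (auto, presburger+)
    ultimately show ?thesis using k by simp
  qed
qed

lemma kronecker_m4_even: "even n \<Longrightarrow> kronecker_symbol (-4) n = 0"
proof (cases "n = 0")
  case False
  assume e: "even n"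
  have "(\<Prod>p\<in>prime_factors n. kronecker_prime (-4) p ^ multiplicity p n) = chi4 n" if "n > 0" for n
    by (rule kronecker_prod) (use that chi4_mult chi4_prime in \<open>auto simp: chi4_def\<close>)
  from this[of "nat \<bar>n\<bar>"] False have "kronecker_symbol (-4) n = 0 \<longleftrightarrow> chi4 (nat \<bar>n\<bar>) = 0"
    unfolding kronecker_symbol_def by auto
  moreover have "even (nat \<bar>n\<bar>)" using e by (simp add: even_nat_iff)
  then have "chi4 (nat \<bar>n\<bar>) = 0" by (rule chi4_even)
  ultimately show ?thesis by simp
qed (simp add: kronecker_symbol_def)

lemma kronecker_12: "kronecker_symbol 12 n = (if n mod 12 \<in> {1, 11} then 1 else if n mod 12 \<in> {5, 7} then -1 else 0)"
proof (cases "n = 0")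
  case False
  have "(\<Prod>p\<in>prime_factors m. kronecker_prime 12 p ^ multiplicity p m) = chi12 m" if "m > 0" for m
    by (rule kronecker_prod) (use that chi12_mult chi12_prime in \<open>auto simp: chi12_def\<close>)
  from this[of "nat \<bar>n\<bar>"] False have k: "kronecker_symbol 12 n = chi12 (nat \<bar>n\<bar>)"
    unfolding kronecker_symbol_def by auto
  show ?thesis
  proof (cases "n \<ge> 0")
    case True
    then have "int (nat \<bar>n\<bar> mod 12) = n mod 12" by (simp add: zmod_int)
    then have "nat \<bar>n\<bar> mod 12 = 1 \<longleftrightarrow> n mod 12 = 1" "nat \<bar>n\<bar> mod 12 = 5 \<longleftrightarrow> n mod 12 = 5" "nat \<bar>n\<bar> mod 12 = 7 \<longleftrightarrow> n mod 12 = 7" "nat \<bar>n\<bar> mod 12 = 11 \<longleftrightarrow> n mod 12 = 11"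
      by linarith+
    then show ?thesis unfolding k chi12_def by simp
  next
    case False
    then have "int (nat \<bar>n\<bar> mod 12) = (- n) mod 12" by (simp add: zmod_int)
    then have "nat \<bar>n\<bar> mod 12 = 1 \<longleftrightarrow> (- n) mod 12 = 1" "nat \<bar>n\<bar> mod 12 = 5 \<longleftrightarrow> (- n) mod 12 = 5" "nat \<bar>n\<bar> mod 12 = 7 \<longleftrightarrow> (- n) mod 12 = 7" "nat \<bar>n\<bar> mod 12 = 11 \<longleftrightarrow> (- n) mod 12 = 11"
      by linarith+
    moreover have "(- n) mod 12 = 1 \<longleftrightarrow> n mod 12 = 11" by presburger
    moreover have "(- n) mod 12 = 5 \<longleftrightarrow> n mod 12 = 7" by presburger
    moreover have "(- n) mod 12 = 7 \<longleftrightarrow> n mod 12 = 5" by presburger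
    moreover have "(- n) mod 12 = 11 \<longleftrightarrow> n mod 12 = 1" by presburger
    ultimately show ?thesis unfolding k chi12_def by auto
  qed
qed (simp add: kronecker_symbol_def)

lemma even_powi_m1: "even k \<Longrightarrow> (-1::complex) powi k = 1"
proof (elim evenE)
  fix b assume "k = 2 * b"
  then have "k = b + b" by simp
  then show ?thesis by (simp only: powi_m1_add powi_m1_sq)
qed

lemma odd_powi_m1: "odd k \<Longrightarrow> (-1::complex) powi k = -1"
proof (elim oddE)
  fix b assume "k = 2 * b + 1"
  then have "k = b + b + 1" by simp
  then show ?thesis by (simp only: powi_m1_add powi_m1_sq) simp
qed

section \<open>The theta functions of the statement in terms of T\<close>

lemma tser_deriv_has_sum:
  assumes t: "Im t > 0"
  shows "((\<lambda>k. (-1) powi k * (\<kappa> * (of_int k + 1/2)) ^ j * e2pi (of_nat (tN k) * t) * e2pi ((of_int k + 1/2) * z)) has_sum (deriv ^^ j) (tser t) z) UNIV"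
proof -
  have e: "(deriv ^^ j) (tser t) z = esum (\<lambda>k. (-1) powi k * (\<kappa> * of_real (tM k)) ^ j) (\<lambda>k. real (tN k)) tM t z"
    unfolding tser_def by (rule esum_higher_deriv(1)[OF esummable_tser t])
  show ?thesis
    using esum_has_sum[OF esum_higher_deriv(2)[OF esummable_tser t] t, of j z] unfolding e
    by (simp add: eterm_def[abs_def])
qed

lemma jtheta_deriv_has_sum:
  assumes t: "Im t > 0"
  shows "((\<lambda>n::int. of_int (kronecker_symbol (-4) n) * (\<kappa> * (of_int n / 2)) ^ j * e2pi ((of_int n)\<^sup>2 / 8 * t) * e2pi (of_int n / 2 * z)) has_sum e2pi (t / 8) * (deriv ^^ j) (tser t) z) UNIV"
proof -
  let ?f = "\<lambda>n::int. of_int (kronecker_symbol (-4) n) * (\<kappa> * (of_int n / 2)) ^ j * e2pi ((of_int n)\<^sup>2 / 8 * t) * e2pi (of_int n / 2 * z)"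
  have "((\<lambda>k. e2pi (t / 8) * ((-1) powi k * (\<kappa> * (of_int k + 1/2)) ^ j * e2pi (of_nat (tN k) * t) * e2pi ((of_int k + 1/2) * z))) has_sum e2pi (t / 8) * (deriv ^^ j) (tser t) z) UNIV"
    by (intro has_sum_cmult_right tser_deriv_has_sum t)
  moreover have "e2pi (t / 8) * ((-1) powi k * (\<kappa> * (of_int k + 1/2)) ^ j * e2pi (of_nat (tN k) * t) * e2pi ((of_int k + 1/2) * z)) = ?f (2 * k + 1)" for k
  proof -
    have s: "of_int (kronecker_symbol (-4) (2 * k + 1)) = (-1::complex) powi k"
      unfolding kronecker_m4_odd by (simp add: even_powi_m1 odd_powi_m1)
    have h: "of_int (2 * k + 1) / 2 = (of_int k + 1/2 :: complex)" by (simp add: field_simps)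
    have e: "e2pi ((of_int (2 * k + 1))\<^sup>2 / 8 * t) = e2pi (t / 8) * e2pi (of_nat (tN k) * t)"
      unfolding e2pi_add [symmetric] by (rule e2pi_cong) (simp add: complex_tN power2_eq_square field_simps)
    show ?thesis unfolding s h e by (simp only: mult_ac)
  qed
  ultimately have "((\<lambda>k. ?f (2 * k + 1)) has_sum e2pi (t / 8) * (deriv ^^ j) (tser t) z) UNIV" by (simp only:)
  also have "?this \<longleftrightarrow> (?f has_sum e2pi (t / 8) * (deriv ^^ j) (tser t) z) (range (\<lambda>k. 2 * k + 1))"
    by (subst has_sum_reindex) (auto simp: inj_on_def o_def)
  also have "\<dots> \<longleftrightarrow> (?f has_sum e2pi (t / 8) * (deriv ^^ j) (tser t) z) UNIV"
  proof (rule has_sum_cong_neutral)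
    fix n :: int assume "n \<in> UNIV - range (\<lambda>k. 2 * k + 1)"
    then have "even n" by (metis DiffD2 oddE rangeI)
    then show "?f n = 0" by (simp add: kronecker_m4_even)
  qed auto
  finally show ?thesis .
qed

lemma jtheta_has_sum:
  assumes t: "Im t > 0"
  shows "((\<lambda>n::int. of_int (kronecker_symbol (-4) n) * e2pi ((of_int n)\<^sup>2 / 8 * t) * e2pi (of_int n / 2 * z)) has_sum e2pi (t / 8) * tser t z) UNIV"
  using jtheta_deriv_has_sum[OF t, of 0 z] by simp

lemma jtheta_eq: "Im t > 0 \<Longrightarrow> jtheta t z = e2pi (t / 8) * dn t * th t z"
  unfolding jtheta_def using infsumI[OF jtheta_has_sum] by (simp add: th_def dn_nonzero)

text \<open>\<open>remove_sings\<close> is determined by the limit at each point, and f agrees with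
  the entire function G off the isolated zeros of H.\<close>

lemma remove_sings_quotient:
  assumes G: "G is_entire" and H: "H is_entire" "H w \<noteq> 0" and eq: "\<And>z. H z \<noteq> 0 \<Longrightarrow> f z = G z"
  shows "remove_sings f z = G z"
proof (rule remove_sings_eqI)
  have "isCont G z"
    using holomorphic_on_imp_continuous_on[OF G] by (simp add: continuous_on_eq_continuous_at)
  moreover have "eventually (\<lambda>x. f x = G x) (at z)"
  proof -
    have "eventually (\<lambda>x. H x \<noteq> 0) (at z)"
      using non_zero_neighbour_alt[OF H(1) open_UNIV connected_UNIV UNIV_I UNIV_I H(2)]
      by (auto elim: eventually_mono)
    then show ?thesis by eventually_elim (rule eq)
  qed
  ultimately show "f \<midarrow>z\<rightarrow> G z"
    unfolding isCont_def by (simp add: tendsto_cong)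
qed

definition cut :: "jform \<Rightarrow> jform" where "cut \<phi> t z = (if Im t > 0 then \<phi> t z else 0)"

lemma phi03_eq: "phi03 = cut f3"
proof (intro ext)
  fix t z
  show "phi03 t z = cut f3 t z"
  proof (cases "Im t > 0")
    case t: True
    have "remove_sings (\<lambda>w. (jtheta t (2 * w) / jtheta t w)\<^sup>2) z = f3 t z"
    proof (rule remove_sings_quotient[where H = "th t" and w = "1/2"])
      show "f3 t is_entire" unfolding f3_def[abs_def] by (intro holomorphic_intros thq_holomorphic t)
      fix w assume w: "th t w \<noteq> 0"
      have "jtheta t (2 * w) = e2pi (t / 8) * dn t * (thq 2 t w * th t w)"
        using jtheta_eq[OF t] thq_mult[OF t, of 2 w] by simp
      then show "(jtheta t (2 * w) / jtheta t w)\<^sup>2 = f3 t w"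
        using w dn_nonzero[OF t] by (simp add: jtheta_eq[OF t] f3_def)
    qed (use th_holomorphic[OF t] th_half_nonzero[OF t] in auto)
    then show ?thesis using t by (simp add: phi03_def cut_def)
  qed (simp add: phi03_def cut_def)
qed

lemma phi04_eq: "phi04 = cut f4"
proof (intro ext)
  fix t z
  show "phi04 t z = cut f4 t z"
  proof (cases "Im t > 0")
    case t: True
    have "remove_sings (\<lambda>w. jtheta t (3 * w) / jtheta t w) z = f4 t z"
    proof (rule remove_sings_quotient[where H = "th t" and w = "1/2"])
      show "f4 t is_entire" unfolding f4_def[abs_def] by (intro thq_holomorphic t)
      fix w assume w: "th t w \<noteq> 0"
      have "jtheta t (3 * w) = e2pi (t / 8) * dn t * (thq 3 t w * th t w)"
        using jtheta_eq[OF t] thq_mult[OF t, of 3 w] by simp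
      then show "jtheta t (3 * w) / jtheta t w = f4 t w"
        using w dn_nonzero[OF t] by (simp add: jtheta_eq[OF t] f4_def)
    qed (use th_holomorphic[OF t] th_half_nonzero[OF t] in auto)
    then show ?thesis using t by (simp add: phi04_def cut_def)
  qed (simp add: phi04_def cut_def)
qed

subsection \<open>Fourier expansions\<close>

text \<open>A single theta series has half-integral powers of y, which a Fourier expansion excludes.
  A product of two has integral ones.\<close>

lemma tser_pair_has_sum:
  assumes t: "Im t > 0"
  shows "((\<lambda>(k, l). ((-1) powi k * (\<kappa> * (of_int k + 1/2)) ^ i * ((-1) powi l * (\<kappa> * (of_int l + 1/2)) ^ j)) *
     e2pi (of_nat (tN k + tN l) * t) * e2pi (of_int (k + l + 1) * z)) has_sum (deriv ^^ i) (tser t) z * (deriv ^^ j) (tser t) z) UNIV"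
proof -
  have e: "e2pi (of_nat (tN k + tN l) * t) * e2pi (of_int (k + l + 1) * z) =
    (e2pi (of_nat (tN k) * t) * e2pi ((of_int k + 1/2) * z)) * (e2pi (of_nat (tN l) * t) * e2pi ((of_int l + 1/2) * z))" for k l
    unfolding e2pi_add [symmetric] by (rule e2pi_cong) (simp add: algebra_simps)
  have "((\<lambda>(k, l). ((-1) powi k * (\<kappa> * (of_int k + 1/2)) ^ i * e2pi (of_nat (tN k) * t) * e2pi ((of_int k + 1/2) * z)) *
      ((-1) powi l * (\<kappa> * (of_int l + 1/2)) ^ j * e2pi (of_nat (tN l) * t) * e2pi ((of_int l + 1/2) * z))) has_sum
      (deriv ^^ i) (tser t) z * (deriv ^^ j) (tser t) z) (UNIV \<times> UNIV)"
    by (rule has_sum_mult_prod[OF tser_deriv_has_sum[OF t] tser_deriv_has_sum[OF t]])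
  then show ?thesis by (simp only: UNIV_Times_UNIV mult.assoc e) (simp only: mult_ac)
qed

lemma FE_tser_pair: "FE UNIV (\<lambda>t z. (deriv ^^ i) (tser t) z * (deriv ^^ j) (tser t) z)"
  by (rule FE_series[where c = "\<lambda>(k, l). ((-1) powi k * (\<kappa> * (of_int k + 1/2)) ^ i * ((-1) powi l * (\<kappa> * (of_int l + 1/2)) ^ j))"
        and N = "\<lambda>(k, l). tN k + tN l" and M = "\<lambda>(k, l). k + l + 1"])
     (use tser_pair_has_sum in \<open>auto simp: case_prod_unfold\<close>)

lemma qval_inverse_dn: "qval (\<lambda>t. inverse (dn t)) 1"
  using qval_inverse[OF qval_dn] dn_nonzero by simp

lemma FE_inverse_dn: "FE UNIV (\<lambda>t z. inverse (dn t) ^ n)"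
  by (rule qval_FE[OF qval_power[OF qval_inverse_dn]])

lemma FE_th_sq: "FE UNIV (\<lambda>t z. th t z ^ 2)"
proof -
  have "FE UNIV (\<lambda>t z. inverse (dn t) ^ 2 * ((deriv ^^ 0) (tser t) z * (deriv ^^ 0) (tser t) z))"
    by (rule FE_mult[OF coeff_ring_UNIV FE_inverse_dn FE_tser_pair])
  also have "(\<lambda>t z. inverse (dn t) ^ 2 * ((deriv ^^ 0) (tser t) z * (deriv ^^ 0) (tser t) z)) = (\<lambda>t z. th t z ^ 2)"
    by (simp add: th_def power2_eq_square field_simps)
  finally show ?thesis .
qed

lemma FE_f1: "FE UNIV f1"
proof -
  have q: "\<exists>c. qval e2 c"
    using qval_mult[OF qval_const jfam_qval[OF jfam_th, of 3], of "4 / \<kappa> ^ 3"] unfolding e2_def[abs_def] by (auto simp: eval_nat_numeral)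
  then obtain c where q: "qval e2 c" by blast
  have "FE UNIV (\<lambda>t z. 12 / \<kappa>\<^sup>2 * (inverse (dn t) ^ 2 * ((deriv ^^ 1) (tser t) z * (deriv ^^ 1) (tser t) z - (deriv ^^ 0) (tser t) z * (deriv ^^ 2) (tser t) z)) + e2 t * th t z ^ 2)"
    by (rule FE_add[OF coeff_ring_UNIV FE_mult[OF coeff_ring_UNIV FE_const FE_mult[OF coeff_ring_UNIV FE_inverse_dn FE_diff[OF coeff_ring_UNIV FE_tser_pair FE_tser_pair]]]
        FE_mult[OF coeff_ring_UNIV qval_FE[OF q] FE_th_sq]]) auto
  also have "?this \<longleftrightarrow> FE UNIV f1"
  proof (rule FE_cong)
    fix t z :: complex assume t: "Im t > 0"
    note h = tser_holomorphic[OF t]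
    have c: "deriv (\<lambda>z. G z / dn t) = (\<lambda>z. deriv G z / dn t)" if "G is_entire" for G
      using that by (intro ext deriv_cdivide_right) (auto intro: holomorphic_on_imp_differentiable_at)
    have "wr (th t) z = inverse (dn t) ^ 2 * ((deriv ^^ 1) (tser t) z * (deriv ^^ 1) (tser t) z - (deriv ^^ 0) (tser t) z * (deriv ^^ 2) (tser t) z)"
      unfolding wr_def th_def[abs_def] c[OF h] c[OF entire_deriv_holomorphic[OF h]]
      using dn_nonzero[OF t] by (simp add: eval_nat_numeral field_simps)
    then show "12 / \<kappa>\<^sup>2 * (inverse (dn t) ^ 2 * ((deriv ^^ 1) (tser t) z * (deriv ^^ 1) (tser t) z - (deriv ^^ 0) (tser t) z * (deriv ^^ 2) (tser t) z)) + e2 t * th t z ^ 2 = f1 t z"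
      by (simp only: f1_def)
  qed
  finally show ?thesis .
qed

lemma FE_congI: "(\<And>t z. Im t > 0 \<Longrightarrow> \<phi> t z = \<psi> t z) \<Longrightarrow> FE S \<psi> \<Longrightarrow> FE S \<phi>"
  using FE_cong[of \<phi> \<psi> S] by blast

text \<open>Subtracting h(t) times a power of \<open>f1\<close>, which is 12 at z = 0 for every t,
  makes the family vanish there. Then T^2 splits off and the index drops, while T^2,
  \<open>f1\<close> and h have expansions of their own.\<close>

theorem EF_FE: "EF m \<phi> p \<Longrightarrow> FE UNIV \<phi>"
proof (induction m arbitrary: \<phi> p)
  case 0
  then have "jfam \<phi> p" by (simp add: EF_def)
  then have "FE UNIV (\<lambda>t z. \<phi> t 0)" by (rule qval_FE[OF jfam_qval0])
  moreover have "\<phi> t z = \<phi> t 0" if "Im t > 0" for t z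
    using 0 that ell_0_constant unfolding EF_def by blast
  ultimately show ?case using FE_congI[of \<phi> "\<lambda>t z. \<phi> t 0"] by blast
next
  case (Suc m)
  define h where "h = (\<lambda>t. inverse (12 ^ Suc m) * \<phi> t 0)"
  have "jfam \<phi> p" using Suc.prems by (simp add: EF_def)
  then have q: "qval h (inverse (12 ^ Suc m) * p 0)" unfolding h_def by (intro qval_mult qval_const jfam_qval0)
  have E1: "EF (0 + Suc m) (\<lambda>t z. - h t * f1 t z ^ Suc m) (\<lambda>z. - (inverse (12 ^ Suc m) * p 0) * (12 + sy z ^ 2) ^ Suc m)"
    using EF_mult[OF EF_qval[OF qval_minus[OF q]] EF_power[OF EF_f1, of "Suc m"]] by simp
  from EF_add[OF Suc.prems E1[simplified]]
  have E2: "EF (Suc m) (\<lambda>t z. \<phi> t z + - h t * f1 t z ^ Suc m) (\<lambda>z. p z + - (inverse (12 ^ Suc m) * p 0) * (12 + sy z ^ 2) ^ Suc m)"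
    by simp
  have f10: "f1 t 0 = 12" if "Im t > 0" for t
    using that by (simp add: f1_def wr_def deriv_th_0)
  obtain \<psi> r where \<psi>: "EF m \<psi> r" "\<And>t z. Im t > 0 \<Longrightarrow> th t z ^ 2 * \<psi> t z = \<phi> t z + - h t * f1 t z ^ Suc m"
    by (rule EF_divide[OF E2]) (auto simp: h_def f10)
  have "FE UNIV (\<lambda>t z. th t z ^ 2 * \<psi> t z + h t * f1 t z ^ Suc m)"
    by (rule FE_add[OF coeff_ring_UNIV FE_mult[OF coeff_ring_UNIV FE_th_sq Suc.IH[OF \<psi>(1)]]
        FE_mult[OF coeff_ring_UNIV qval_FE[OF q] FE_power[OF coeff_ring_UNIV FE_f1]]])
  then show ?case by (rule FE_congI[rotated]) (simp add: \<psi>(2))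
qed

text \<open>\<open>jfam\<close> speaks only of Taylor coefficients at 0. A Fourier expansion extends
  the cusp value to all z, as used at 1/2 and 1/3.\<close>

lemma qval_at: assumes "FE UNIV \<phi>" "jfam \<phi> p" shows "qval (\<lambda>t. \<phi> t z) (p z)"
proof -
  obtain f where f: "has_fourier_expansion \<phi> f" using assms(1) by (auto simp: FE_def)
  have "p = (\<lambda>z. \<Sum>\<^sub>\<infinity>l. f 0 l * e2pi (of_int l * z))"
    using jfam_unique[OF assms(2) has_fourier_expansion_jfam[OF f]] .
  then show ?thesis using has_fourier_expansion_qval[OF f, of z] by simp
qed

subsection \<open>Weak Jacobi forms of weight 0\<close>

lemma weak_jacobi_imp_JF:
  assumes w: "weak_jacobi_form m \<phi>" and f: "has_fourier_expansion \<phi> f"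
  shows "JF 0 m \<phi> (\<lambda>z. \<Sum>\<^sub>\<infinity>l. f 0 l * e2pi (of_int l * z))"
  unfolding JF_def EF_def
proof (intro conjI allI impI)
  show j: "jfam \<phi> (\<lambda>z. \<Sum>\<^sub>\<infinity>l. f 0 l * e2pi (of_int l * z))" by (rule has_fourier_expansion_jfam[OF f])
  have law: "\<And>a b c d t z. a * d - b * c = 1 \<Longrightarrow> Im t > 0 \<Longrightarrow>
        \<phi> (mob a b c d t) (z / aut c d t) =
        e2pi (of_nat m * of_int c * z\<^sup>2 / aut c d t) * \<phi> t z"
    using w unfolding weak_jacobi_form_def by blast
  show "sl2_law 0 m \<phi>" unfolding sl2_law_def using law by simp
  \<comment> \<open>The negative of the unit matrix fixes t and changes the sign of z; in weight 0
    this forces evenness.\<close>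
  show "\<phi> t (- z) = \<phi> t z" if "Im t > 0" for t z
    using law[of "-1" "-1" 0 0 t z] that by simp
  show "ell t m (\<phi> t)" if "Im t > 0" for t
    unfolding ell_def using jfam_hol[OF j that] w that unfolding weak_jacobi_form_def by blast
  show "(\<Sum>\<^sub>\<infinity>l. f 0 l * e2pi (of_int l * (z + 1))) = (\<Sum>\<^sub>\<infinity>l. f 0 l * e2pi (of_int l * z))" for z
    by (simp add: ring_distribs e2pi_add)
qed

text \<open>The expansion comes from \<open>EF_FE\<close>, and holomorphy in both variables from the
  expansion.\<close>

lemma JF_imp_weak_jacobi:
  assumes J: "JF 0 m \<phi> p" and z: "\<And>t z. Im t \<le> 0 \<Longrightarrow> \<phi> t z = 0"
  shows "weak_jacobi_form m \<phi>"
proof -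
  have "FE UNIV \<phi>" using J EF_FE unfolding JF_def by blast
  then obtain f where f: "has_fourier_expansion \<phi> f" by (auto simp: FE_def)
  moreover have "holomorphic_HC \<phi>" by (rule has_fourier_expansion_holomorphic[OF f])
  ultimately show ?thesis
    using J z unfolding weak_jacobi_form_def JF_def EF_def sl2_law_def ell_def by auto
qed

lemma cut_JF: "JF k m \<phi> p \<Longrightarrow> JF k m (cut \<phi>) p"
  by (rule JF_cong[of \<phi>]) (auto simp: cut_def)

lemma cut_weak_jacobi: "JF 0 m \<phi> p \<Longrightarrow> weak_jacobi_form m (cut \<phi>)"
  by (rule JF_imp_weak_jacobi[OF cut_JF]) (auto simp: cut_def)

lemma jfam_row0:
  assumes f: "has_fourier_expansion \<phi> f" and j: "jfam \<phi> p"
  shows "p z = (\<Sum>\<^sub>\<infinity>l. f 0 l * e2pi (of_int l * z))"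
  using jfam_unique[OF j has_fourier_expansion_jfam[OF f]] by simp

text \<open>The cusp value carries the whole q^0-row, so a finite trigonometric expression for it
  can be compared coefficientwise.\<close>

lemma fourier_row_unique:
  assumes f: "has_fourier_expansion \<phi> f" and j: "jfam \<phi> p" and F: "finite F" and p: "\<And>z. p z = (\<Sum>l\<in>F. c l * e2pi (of_int l * z))"
  shows "f 0 l = (if l \<in> F then c l else 0)"
proof -
  have hs: "((\<lambda>l. f 0 l * e2pi (of_int l * z)) has_sum p z) UNIV" for z
  proof -
    have S: "(\<lambda>l. f 0 l * e2pi (of_int l * z)) summable_on UNIV"
    proof -
      have "((\<lambda>(n, l). f n l * e2pi (of_nat n * \<i>) * e2pi (of_int l * z)) has_sum \<phi> \<i> z) UNIV"
        using f unfolding has_fourier_expansion_def by simp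
      then have "(\<lambda>(n, l). f n l * e2pi (of_nat n * \<i>) * e2pi (of_int l * z)) summable_on UNIV"
        by (rule has_sum_imp_summable)
      then have "(\<lambda>(n, l). f n l * e2pi (of_nat n * \<i>) * e2pi (of_int l * z)) summable_on range (Pair 0)"
        by (rule summable_on_subset_banach) auto
      then show ?thesis by (subst (asm) summable_on_reindex) (auto simp: inj_on_def o_def)
    qed
    show ?thesis unfolding jfam_row0[OF f j] by (rule has_sum_infsum[OF S])
  qed
  have "((\<lambda>l. (f 0 l - (if l \<in> F then c l else 0)) * e2pi (of_int l * of_real x)) has_sum 0) UNIV" for x :: real
  proof -
    have "((\<lambda>l. (if l \<in> F then c l else 0) * e2pi (of_int l * of_real x)) has_sum p x) UNIV"
      unfolding p by (rule has_sum_finite_neutralI[where B = F]) (use F in \<open>auto intro!: sum.cong split: if_splits\<close>)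
    from has_sum_add[OF hs[of "of_real x"] has_sum_uminusI[OF this]]
    show ?thesis by (simp add: left_diff_distrib)
  qed
  from trig_sum_zero_imp_coeff_zero[where a = "\<lambda>l. f 0 l - (if l \<in> F then c l else 0)", OF this]
  show ?thesis by simp
qed

text \<open>The translation by -t identifies f(n, l) with f(n - l + m, l - 2 m), whose q-exponent is
  negative when l > n + m.\<close>

lemma weak_coeff_zero:
  assumes w: "weak_jacobi_form m \<phi>" and f: "has_fourier_expansion \<phi> f" and l: "l > int n + int m"
  shows "f n l = 0"
proof -
  \<comment> \<open>The difference of the two expansions of \<phi>(t, z - t), indexed by the
    exponents after translation and extended by zero where the original q-exponent would be
    negative.\<close>
  define a where "a = (\<lambda>p :: int \<times> int. (if fst p + snd p \<ge> 0 then f (nat (fst p + snd p)) (snd p) else 0)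
     - (if fst p + int m \<ge> 0 then f (nat (fst p + int m)) (snd p - 2 * int m) else 0))"
  have "a (int n - l, l) * e2pi (of_int (int n - l) * \<i>) = 0"
  proof (rule trig_double_sum_zero_imp_coeff_zero[where a = "\<lambda>p. a p * e2pi (of_int (fst p) * \<i>)" and n = "int n - l" and l = l, simplified fst_conv])
    fix x w' :: real
    define t where "t = \<i> + of_real x"
    define z where "z = (of_real w' :: complex)"
    have t: "Im t > 0" by (simp add: t_def)
    let ?A = "\<lambda>(N, L). (if N + L \<ge> 0 then f (nat (N + L)) L else 0) * e2pi (of_int N * t) * e2pi (of_int L * z)"
    let ?B = "\<lambda>(N, L). (if N + int m \<ge> 0 then f (nat (N + int m)) (L - 2 * int m) else 0) * e2pi (of_int N * t) * e2pi (of_int L * z)"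
    have e2t: "e2pi (of_int n * t) = e2pi (of_int n * \<i>) * e2pi (of_int n * of_real x)" for n
      by (simp add: t_def e2pi_add ring_distribs)
    have A: "(?A has_sum \<phi> t (z - t)) UNIV"
    proof -
      have "((\<lambda>(n, l). f n l * e2pi (of_nat n * t) * e2pi (of_int l * (z - t))) has_sum \<phi> t (z - t)) UNIV"
        using f t unfolding has_fourier_expansion_def by blast
      also have "?this \<longleftrightarrow> (?A has_sum \<phi> t (z - t)) {p. fst p + snd p \<ge> 0}"
      proof (rule has_sum_reindex_bij_witness[where i = "\<lambda>(N, L). (nat (N + L), L)" and j = "\<lambda>(n, l). (int n - l, l)"])
        fix p :: "nat \<times> int"
        obtain n l where p: "p = (n, l)" by (cases p)
        have "e2pi (of_int (int n - l) * t) * e2pi (of_int l * z) = e2pi (of_nat n * t) * e2pi (of_int l * (z - t))"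
          unfolding e2pi_add [symmetric] by (rule e2pi_cong) (simp add: algebra_simps)
        then show "?A (case p of (n, l) \<Rightarrow> (int n - l, l)) =
          (case p of (n, l) \<Rightarrow> f n l * e2pi (of_nat n * t) * e2pi (of_int l * (z - t)))"
          unfolding p by (simp add: mult.assoc)
      qed (simp_all add: case_prod_unfold)
      also have "\<dots> \<longleftrightarrow> (?A has_sum \<phi> t (z - t)) UNIV"
        by (rule has_sum_cong_neutral) (simp_all add: case_prod_unfold)
      finally show ?thesis .
    qed
    have B: "(?B has_sum \<phi> t (z - t)) UNIV"
    proof -
      have sh: "\<phi> t (z - t) = e2pi (- of_nat m * t + 2 * of_nat m * z) * \<phi> t z"
      proof -
        have "\<phi> t (z + of_int (- 1) * t + of_int 0) = e2pi (- of_nat m * ((of_int (- 1))\<^sup>2 * t + 2 * of_int (- 1) * z)) * \<phi> t z"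
          using w t unfolding weak_jacobi_form_def by blast
        moreover have "- of_nat m * ((of_int (- 1))\<^sup>2 * t + 2 * of_int (- 1) * z) = - of_nat m * t + 2 * of_nat m * z"
          by (simp add: algebra_simps)
        ultimately show ?thesis by simp
      qed
      have "((\<lambda>(n, l). f n l * e2pi (of_nat n * t) * e2pi (of_int l * z)) has_sum \<phi> t z) UNIV"
        using f t unfolding has_fourier_expansion_def by blast
      from has_sum_cmult_right[OF this, of "e2pi (- of_nat m * t + 2 * of_nat m * z)"]
      have "((\<lambda>p. e2pi (- of_nat m * t + 2 * of_nat m * z) * (case p of (n, l) \<Rightarrow> f n l * e2pi (of_nat n * t) * e2pi (of_int l * z))) has_sum \<phi> t (z - t)) UNIV"
        unfolding sh .
      also have "?this \<longleftrightarrow> (?B has_sum \<phi> t (z - t)) {p. fst p + int m \<ge> 0}"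
      proof (rule has_sum_reindex_bij_witness[where i = "\<lambda>(N, L). (nat (N + int m), L - 2 * int m)" and j = "\<lambda>(n, l). (int n - int m, l + 2 * int m)"])
        fix p :: "nat \<times> int"
        obtain n l where p: "p = (n, l)" by (cases p)
        have "e2pi (of_int (int n - int m) * t) * e2pi (of_int (l + 2 * int m) * z) = e2pi (- of_nat m * t + 2 * of_nat m * z) * (e2pi (of_nat n * t) * e2pi (of_int l * z))"
          unfolding e2pi_add [symmetric] by (rule e2pi_cong) (simp add: algebra_simps)
        then show "?B (case p of (n, l) \<Rightarrow> (int n - int m, l + 2 * int m)) =
          e2pi (- of_nat m * t + 2 * of_nat m * z) * (case p of (n, l) \<Rightarrow> f n l * e2pi (of_nat n * t) * e2pi (of_int l * z))"
          unfolding p by (simp add: mult.assoc mult.left_commute)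
      qed (simp_all add: case_prod_unfold)
      also have "\<dots> \<longleftrightarrow> (?B has_sum \<phi> t (z - t)) UNIV"
        by (rule has_sum_cong_neutral) (simp_all add: case_prod_unfold)
      finally show ?thesis .
    qed
    from has_sum_add[OF A has_sum_uminusI[OF B]]
    have "((\<lambda>p. a p * e2pi (of_int (fst p) * t) * e2pi (of_int (snd p) * z)) has_sum 0) UNIV"
      by (simp add: a_def case_prod_unfold left_diff_distrib)
    then show "((\<lambda>(n, l). a (n, l) * e2pi (of_int n * \<i>) * e2pi (of_int n * of_real x) * e2pi (of_int l * of_real w')) has_sum 0) UNIV"
      by (simp add: case_prod_unfold e2t z_def mult.assoc)
  qed
  then have "a (int n - l, l) = 0" by simp
  then show ?thesis using l by (simp add: a_def)
qed

lemma weak_coeff_even: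
  assumes w: "weak_jacobi_form m \<phi>" and f: "has_fourier_expansion \<phi> f"
  shows "f n (- l) = f n l"
proof -
  have "has_fourier_expansion \<phi> (\<lambda>n l. f n (- l))"
    unfolding has_fourier_expansion_def
  proof (intro allI impI)
    fix t z :: complex assume t: "Im t > 0"
    have ev: "\<phi> t (- z) = \<phi> t z"
      using weak_jacobi_imp_JF[OF w f] t unfolding JF_def EF_def by blast
    have "((\<lambda>(n, l). f n l * e2pi (of_nat n * t) * e2pi (of_int l * (- z))) has_sum \<phi> t (- z)) UNIV"
      using f t unfolding has_fourier_expansion_def by blast
    also have "?this \<longleftrightarrow> ((\<lambda>(n, l). f n (- l) * e2pi (of_nat n * t) * e2pi (of_int l * z)) has_sum \<phi> t (- z)) UNIV"
      by (rule has_sum_reindex_bij_witness[where i = "\<lambda>(n, l). (n, - l)" and j = "\<lambda>(n, l). (n, - l)"]) auto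
    finally show "((\<lambda>(n, l). f n (- l) * e2pi (of_nat n * t) * e2pi (of_int l * z)) has_sum \<phi> t z) UNIV"
      unfolding ev .
  qed
  from has_fourier_expansion_unique[OF this f] show ?thesis by metis
qed

lemma weak_row0: 
  assumes w: "weak_jacobi_form m \<phi>" and f: "has_fourier_expansion \<phi> f" and l: "\<bar>l\<bar> > int m"
  shows "f 0 l = 0"
proof (cases "l > 0")
  case True
  then show ?thesis using weak_coeff_zero[OF w f, of 0 l] l by simp
next
  case False
  then show ?thesis using weak_coeff_zero[OF w f, of 0 "- l"] weak_coeff_even[OF w f, of 0 l] l by simp
qed

lemma JF_cusp_zero:
  assumes "JF 0 m \<phi> (\<lambda>_. 0)" "m < 6" "Im t > 0" shows "\<phi> t z = 0"
  using JF_cusp_divide[OF assms(1), of 6] assms(2,3) by auto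

text \<open>Identities among forms of index below 6 thus reduce to identities between their
  q^0-terms.\<close>

lemma JF_small_index_unique:
  assumes "JF 0 m \<phi> p" "JF 0 m \<psi> p" "m < 6" "Im t > 0" shows "\<phi> t z = \<psi> t z"
  using JF_cusp_zero[of m "\<lambda>t z. \<phi> t z - \<psi> t z" t z] JF_diff[OF assms(1,2)] assms(3,4) by simp

lemma relation: assumes "Im t > 0" shows "4 * f4 t z = f1 t z * f3 t z - f2 t z ^ 2"
proof (rule JF_small_index_unique[where m = 4 and t = t and z = z])
  have "JF 0 4 (\<lambda>t z. f1 t z * f3 t z - f2 t z ^ 2) (\<lambda>z. (12 + sy z ^ 2) * (4 + sy z ^ 2) - (6 + sy z ^ 2) ^ 2)"
    using JF_diff[OF JF_mult[OF JF_f1 JF_f3, simplified] JF_power[OF JF_f2, of 2, simplified]] by simp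
  moreover have "(12 + sy z ^ 2) * (4 + sy z ^ 2) - (6 + sy z ^ 2) ^ 2 = 4 * (3 + sy z ^ 2)" for z
    by (simp add: power2_eq_square algebra_simps)
  ultimately show "JF 0 4 (\<lambda>t z. f1 t z * f3 t z - f2 t z ^ 2) (\<lambda>z. 4 * (3 + sy z ^ 2))" by simp
  show "JF 0 4 (\<lambda>t z. 4 * f4 t z) (\<lambda>z. 4 * (3 + sy z ^ 2))" by (rule JF_cmult[OF JF_f4])
qed (use assms in auto)

text \<open>The definite description is resolved by uniqueness in index 1: the q^0-term fixes the
  cusp value, and \<open>JF_small_index_unique\<close> does the rest.\<close>

lemma phi01_eq: "phi01 = cut f1"
  unfolding phi01_def
proof (rule the_equality)
  let ?P = "Poly_Mapping.single 1 1 + Poly_Mapping.single 0 10 + Poly_Mapping.single (-1) 1 :: laurent_poly"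
  have J: "JF 0 1 (cut f1) (\<lambda>z. 12 + sy z ^ 2)" by (rule cut_JF[OF JF_f1])
  have w: "weak_jacobi_form 1 (cut f1)" by (rule cut_weak_jacobi[OF JF_f1])
  then obtain f where f: "has_fourier_expansion (cut f1) f" unfolding weak_jacobi_form_def by blast
  have "jfam (cut f1) (\<lambda>z. 12 + sy z ^ 2)" using J by (simp add: JF_def EF_def)
  then have row: "f 0 l = (if l \<in> {-1, 0, 1} then (if l = 0 then 10 else 1) else 0)" for l
    by (rule fourier_row_unique[OF f]) (auto simp: sy_sq)
  have "has_q0_term (cut f1) ?P"
    unfolding has_q0_term_def jcoeff_eq[OF f] row by (auto simp: lookup_add lookup_single lookup_numeral when_def)
  then show "weak_jacobi_form 1 (cut f1) \<and> has_q0_term (cut f1) ?P" using w by blast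
  fix \<phi> assume \<phi>: "weak_jacobi_form 1 \<phi> \<and> has_q0_term \<phi> ?P"
  then obtain g where g: "has_fourier_expansion \<phi> g" unfolding weak_jacobi_form_def by blast
  have "g 0 l = f 0 l" for l
    using \<phi> \<open>has_q0_term (cut f1) ?P\<close> unfolding has_q0_term_def jcoeff_eq[OF f] jcoeff_eq[OF g] by simp
  then have "JF 0 1 \<phi> (\<lambda>z. \<Sum>\<^sub>\<infinity>l. f 0 l * e2pi (of_int l * z))"
    using weak_jacobi_imp_JF[OF conjunct1[OF \<phi>] g] by simp
  moreover have "JF 0 1 (cut f1) (\<lambda>z. \<Sum>\<^sub>\<infinity>l. f 0 l * e2pi (of_int l * z))" by (rule weak_jacobi_imp_JF[OF w f])
  ultimately have "\<phi> t z = cut f1 t z" if "Im t > 0" for t z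
    using JF_small_index_unique[of 1 \<phi> _ "cut f1" t z] that by simp
  moreover have "\<phi> t z = cut f1 t z" if "\<not> Im t > 0" for t z
    using that \<phi> unfolding weak_jacobi_form_def cut_def by auto
  ultimately show "\<phi> = cut f1" by blast
qed

subsection \<open>The pentagonal number theorem and the form of index 2\<close>

lemma tp_mod_3: assumes t: "Im t > 0" shows "tp t 0 = tp (3 * t) (- 2 * t) * tp (3 * t) (- t) * tp (3 * t) 0"
proof -
  let ?f = "\<lambda>n. 1 - e2pi (of_nat (Suc n) * t + 0)"
  have t3: "Im (3 * t) > 0" using t by simp
  have eq: "(\<Prod>n<3*N. ?f n) = (\<Prod>n<N. 1 - e2pi (of_nat (Suc n) * (3 * t) + (- 2 * t))) * (\<Prod>n<N. 1 - e2pi (of_nat (Suc n) * (3 * t) + (- t))) * (\<Prod>n<N. 1 - e2pi (of_nat (Suc n) * (3 * t) + 0))" for N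
  proof (induction N)
    case (Suc N)
    have "3 * Suc N = Suc (Suc (Suc (3 * N)))" by simp
    then have "(\<Prod>n<3 * Suc N. ?f n) = (\<Prod>n<3*N. ?f n) * ?f (3*N) * ?f (Suc (3*N)) * ?f (Suc (Suc (3*N)))"
      by (simp only: prod.lessThan_Suc)
    also have "?f (3*N) = 1 - e2pi (of_nat (Suc N) * (3 * t) + (- 2 * t))" by (simp add: algebra_simps)
    also have "?f (Suc (3*N)) = 1 - e2pi (of_nat (Suc N) * (3 * t) + (- t))" by (simp add: algebra_simps)
    also have "?f (Suc (Suc (3*N))) = 1 - e2pi (of_nat (Suc N) * (3 * t) + 0)" by (simp add: algebra_simps)
    finally show ?case unfolding Suc prod.lessThan_Suc by (simp only: mult_ac)
  qed simp
  have "(\<lambda>N. \<Prod>n<3*N. ?f n) \<longlonglongrightarrow> tp t 0"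
    by (rule filterlim_compose[OF tp_LIMSEQ[OF t]]) (rule mult_nat_left_at_top, simp)
  moreover have "(\<lambda>N. \<Prod>n<3*N. ?f n) \<longlonglongrightarrow> tp (3 * t) (- 2 * t) * tp (3 * t) (- t) * tp (3 * t) 0"
    unfolding eq by (intro tendsto_intros tp_LIMSEQ t3)
  ultimately show ?thesis by (rule LIMSEQ_unique)
qed

definition pN :: "int \<Rightarrow> nat" where "pN k = nat (k * (3 * k + 1) div 2)"

lemma int_pN: "2 * int (pN k) = k * (3 * k + 1)"
proof -
  have "k * (3 * k + 1) \<ge> 0"
    by (cases "k \<ge> 0") (auto simp: mult_nonpos_nonpos)
  moreover have "even (k * (3 * k + 1))" by simp
  ultimately show ?thesis unfolding pN_def by simp
qed

lemma complex_pN: "(of_nat (pN k) :: complex) = of_int k * (3 * of_int k + 1) / 2"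
proof -
  have "(of_int (2 * int (pN k)) :: complex) = of_int (k * (3 * k + 1))" by (simp only: int_pN)
  then show ?thesis by (simp add: eq_divide_eq mult.commute)
qed

text \<open>The triple product at nome q^3 and y = 1/q: its three products run over the residue
  classes modulo 3 and recombine by \<open>tp_mod_3\<close>.\<close>

theorem pentagonal_number_theorem:
  assumes t: "Im t > 0"
  shows "((\<lambda>k. (-1) powi k * e2pi (of_nat (pN k) * t)) has_sum qp t) UNIV"
proof -
  have t3: "Im (3 * t) > 0" using t by simp
  have "((\<lambda>k. e2pi (t/2) * ((-1) powi k * e2pi (of_nat (tN k) * (3 * t) + (of_int k + 1/2) * (- t)))) has_sum e2pi (t/2) * tser (3 * t) (- t)) UNIV"
    by (intro has_sum_cmult_right tser_has_sum t3)
  moreover have "e2pi (t/2) * ((-1) powi k * e2pi (of_nat (tN k) * (3 * t) + (of_int k + 1/2) * (- t))) = (-1) powi k * e2pi (of_nat (pN k) * t)" for k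
  proof -
    have "e2pi (t/2) * e2pi (of_nat (tN k) * (3 * t) + (of_int k + 1/2) * (- t)) = e2pi (of_nat (pN k) * t)"
      unfolding e2pi_add [symmetric] by (rule e2pi_cong) (simp add: complex_tN complex_pN field_simps)
    then show ?thesis by (simp only: mult.left_commute)
  qed
  moreover have "e2pi (t/2) * tser (3 * t) (- t) = qp t"
  proof -
    have "e2pi (t/2) * (e2pi ((- t)/2) - e2pi (- (- t)/2)) = 1 - e2pi t"
    proof -
      have "e2pi (t/2) * e2pi ((- t)/2) = 1" "e2pi (t/2) * e2pi (- (- t)/2) = e2pi t"
        unfolding e2pi_add [symmetric] by simp_all
      then show ?thesis by (simp only: right_diff_distrib)
    qed
    moreover have "(1 - e2pi t) * tp (3 * t) t = tp (3 * t) (- 2 * t)"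
      using tp_shift[OF t3, of t] by simp
    moreover have "tser (3 * t) (- t) = (e2pi ((- t)/2) - e2pi (- (- t)/2)) * qp (3 * t) * tp (3 * t) (- t) * tp (3 * t) t"
      using jacobi_triple_product[OF t3, of "- t"] by simp
    moreover have "e * (b * q * p * r) = q * p * s" if "e * b = c" "c * r = s" for e b c q p r s :: complex
      unfolding that(2) [symmetric] that(1) [symmetric] by (simp only: mult_ac)
    ultimately have "e2pi (t/2) * tser (3 * t) (- t) = qp (3 * t) * tp (3 * t) (- t) * tp (3 * t) (- 2 * t)"
      by (simp only:)
    then show ?thesis unfolding qp_eq_tp tp_mod_3[OF t] by (simp only: mult_ac)
  qed
  ultimately show ?thesis by (simp only:)
qed

text \<open>The second theta factor of \<open>phi02\<close>. Its evaluation in \<open>t32_eq\<close>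
  as eta times theta(2 z) / theta(z) is a form of the quintuple product identity.\<close>

definition t32 :: "complex \<Rightarrow> complex \<Rightarrow> complex" where
  "t32 = esum (\<lambda>n::int. of_int (kronecker_symbol 12 n)) (\<lambda>n. (real_of_int n)\<^sup>2 / 24) (\<lambda>n. real_of_int n / 2)"

lemma esummable_t32: "esummable (\<lambda>n::int. of_int (kronecker_symbol 12 n)) (\<lambda>n. (real_of_int n)\<^sup>2 / 24) (\<lambda>n. real_of_int n / 2)"
  by (rule esummable_theta[where a = "1/24" and b = 0 and A = 1 and B = 0]) (auto simp: kronecker_12)

lemma t32_deriv_has_sum:
  assumes t: "Im t > 0"
  shows "((\<lambda>n. of_int (kronecker_symbol 12 n) * (\<kappa> * (of_int n / 2)) ^ j * e2pi ((of_int n)\<^sup>2 / 24 * t) * e2pi (of_int n / 2 * z)) has_sum (deriv ^^ j) (t32 t) z) UNIV"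
proof -
  have e: "(deriv ^^ j) (t32 t) z = esum (\<lambda>n. of_int (kronecker_symbol 12 n) * (\<kappa> * of_real (real_of_int n / 2)) ^ j) (\<lambda>n. (real_of_int n)\<^sup>2 / 24) (\<lambda>n. real_of_int n / 2) t z"
    unfolding t32_def by (rule esum_higher_deriv(1)[OF esummable_t32 t])
  show ?thesis
    using esum_has_sum[OF esum_higher_deriv(2)[OF esummable_t32 t] t, of j z] unfolding e
    by (simp add: eterm_def[abs_def])
qed

lemma t32_has_sum:
  assumes t: "Im t > 0"
  shows "((\<lambda>n. of_int (kronecker_symbol 12 n) * e2pi ((of_int n)\<^sup>2 / 24 * t + of_int n / 2 * z)) has_sum t32 t z) UNIV"
  using t32_deriv_has_sum[OF t, of 0 z] by (simp add: e2pi_add mult.assoc)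

lemma t32_holomorphic: "Im t > 0 \<Longrightarrow> t32 t is_entire"
  unfolding t32_def by (rule esum_holomorphic[OF esummable_t32])

lemma mod_12_cases: "(n::int) mod 12 \<in> {0, 1, 2, 3, 4, 5, 6, 7, 8, 9, 10, 11}"
proof -
  have "n mod 12 \<in> {0..11}" by simp
  then show ?thesis by (simp add: simp_from_to)
qed

lemma kronecker_12_shift: "of_int (kronecker_symbol 12 (n + 6 * a)) = (-1) powi a * (of_int (kronecker_symbol 12 n) :: complex)"
proof (cases "even a")
  case True
  then obtain b where "a = 2 * b" by blast
  then have "(n + 6 * a) mod 12 = n mod 12" by simp
  then show ?thesis using True by (simp add: kronecker_12 even_powi_m1)
next
  case False
  then obtain b where "a = 2 * b + 1" by (elim oddE)
  then have "n + 6 * a = (n + 6) + b * 12" by simp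
  then have "(n + 6 * a) mod 12 = (n + 6) mod 12" by (simp only: mod_mult_self1)
  also have "\<dots> = (n mod 12 + 6) mod 12" by (simp only: mod_add_left_eq)
  finally have m: "(n + 6 * a) mod 12 = (n mod 12 + 6) mod 12" .
  from mod_12_cases[of n] have "kronecker_symbol 12 (n + 6 * a) = - kronecker_symbol 12 n"
    unfolding kronecker_12 m by auto
  then show ?thesis using False by (simp add: odd_powi_m1)
qed

lemma kronecker_12_minus: "kronecker_symbol 12 (- n) = kronecker_symbol 12 n"
proof -
  have m: "(- n) mod 12 = (- (n mod 12)) mod 12" by (simp only: mod_minus_eq)
  from mod_12_cases[of n] show ?thesis unfolding kronecker_12 m by auto
qed

lemma kronecker_12_odd: "kronecker_symbol 12 n \<noteq> 0 \<Longrightarrow> odd n"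
proof -
  assume "kronecker_symbol 12 n \<noteq> 0"
  then have "n mod 12 = 1 \<or> n mod 12 = 11 \<or> n mod 12 = 5 \<or> n mod 12 = 7" unfolding kronecker_12 by (auto split: if_splits)
  then show "odd n" by presburger
qed

text \<open>Here n is replaced by n + 6 a, under which the symbol of 12 changes by (-1)^a.\<close>

lemma t32_shift:
  assumes t: "Im t > 0"
  shows "t32 t (z + of_int a * t + of_int b) = (-1) powi (a + b) * e2pi (- 3 * (of_int a)\<^sup>2 / 2 * t - 3 * of_int a * z) * t32 t z"
proof -
  let ?K = "\<lambda>n. of_int (kronecker_symbol 12 n) :: complex"
  let ?C = "(-1) powi (a + b) * e2pi (- 3 * (of_int a)\<^sup>2 / 2 * t - 3 * of_int a * z)"
  let ?f = "\<lambda>n. ?K n * e2pi ((of_int n)\<^sup>2 / 24 * t + of_int n / 2 * z)"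
  have "((\<lambda>n. ?f (n + 6 * a)) has_sum t32 t z) UNIV"
    using t32_has_sum[OF t, of z] has_sum_shift_int[of ?f "6 * a"] by blast
  then have "((\<lambda>n. ?C * ?f (n + 6 * a)) has_sum ?C * t32 t z) UNIV"
    by (rule has_sum_cmult_right)
  moreover have "?C * ?f (n + 6 * a) = ?K n * e2pi ((of_int n)\<^sup>2 / 24 * t + of_int n / 2 * (z + of_int a * t + of_int b))" for n
  proof (cases "kronecker_symbol 12 n = 0")
    case True
    then show ?thesis using kronecker_12_shift[of n a] by simp
  next
    case False
    then have "odd n" by (rule kronecker_12_odd)
    then obtain k where k: "n = 2 * k + 1" by (elim oddE)
    have e: "e2pi (of_int n / 2 * of_int b) = (-1) powi b"
    proof -
      have "of_int n / 2 * of_int b = (of_int (k * b) + of_int b / 2 :: complex)" unfolding k by (simp add: field_simps)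
      then show ?thesis by (simp only: e2pi_add e2pi_of_int e2pi_of_int_half mult_1)
    qed
    have "?C * ?f (n + 6 * a) = ((-1) powi (a + b) * (-1) powi a) * ?K n * e2pi ((- 3 * (of_int a)\<^sup>2 / 2 * t - 3 * of_int a * z) + ((of_int (n + 6 * a))\<^sup>2 / 24 * t + of_int (n + 6 * a) / 2 * z))"
      unfolding kronecker_12_shift e2pi_add[of "- 3 * (of_int a)\<^sup>2 / 2 * t - 3 * of_int a * z"] by (simp only: mult_ac)
    also have "(- 3 * (of_int a)\<^sup>2 / 2 * t - 3 * of_int a * z) + ((of_int (n + 6 * a))\<^sup>2 / 24 * t + of_int (n + 6 * a) / 2 * z) = (of_int n)\<^sup>2 / 24 * t + of_int n / 2 * (z + of_int a * t)"
      by (simp add: power2_eq_square field_simps)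
    also have "(-1) powi (a + b) * (-1) powi a = (-1::complex) powi b"
      using powi_m1_sq[of a] by (simp add: powi_m1_add mult_ac)
    also have "(-1) powi b * ?K n * e2pi ((of_int n)\<^sup>2 / 24 * t + of_int n / 2 * (z + of_int a * t)) = ?K n * (e2pi ((of_int n)\<^sup>2 / 24 * t + of_int n / 2 * (z + of_int a * t)) * e2pi (of_int n / 2 * of_int b))"
      unfolding e by (simp only: mult_ac)
    also have "e2pi ((of_int n)\<^sup>2 / 24 * t + of_int n / 2 * (z + of_int a * t)) * e2pi (of_int n / 2 * of_int b) = e2pi ((of_int n)\<^sup>2 / 24 * t + of_int n / 2 * (z + of_int a * t + of_int b))"
      unfolding e2pi_add [symmetric] by (rule e2pi_cong) (simp only: distrib_left add.assoc)
    finally show ?thesis .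
  qed
  ultimately have "((\<lambda>n. ?K n * e2pi ((of_int n)\<^sup>2 / 24 * t + of_int n / 2 * (z + of_int a * t + of_int b))) has_sum ?C * t32 t z) UNIV"
    by simp
  then show ?thesis using t32_has_sum[OF t] has_sum_unique by blast
qed

lemma t32_even: assumes t: "Im t > 0" shows "t32 t (- z) = t32 t z"
proof -
  let ?f = "\<lambda>n. of_int (kronecker_symbol 12 n) * e2pi ((of_int n)\<^sup>2 / 24 * t + of_int n / 2 * z)"
  have "((\<lambda>n. ?f (0 - n)) has_sum t32 t z) UNIV"
    using t32_has_sum[OF t, of z] has_sum_reflect_int[of ?f 0] by blast
  moreover have "?f (0 - n) = of_int (kronecker_symbol 12 n) * e2pi ((of_int n)\<^sup>2 / 24 * t + of_int n / 2 * (- z))" for n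
    by (simp add: kronecker_12_minus)
  ultimately have "((\<lambda>n. of_int (kronecker_symbol 12 n) * e2pi ((of_int n)\<^sup>2 / 24 * t + of_int n / 2 * (- z))) has_sum t32 t z) UNIV" by simp
  then show ?thesis using t32_has_sum[OF t] has_sum_unique by blast
qed

text \<open>The symbol of 12 lives on the integers 6 k + 1 and their negatives, and each of the two
  families reproduces the pentagonal series.\<close>

lemma t32_0: assumes t: "Im t > 0" shows "t32 t 0 = 2 * (e2pi (t / 24) * qp t)"
proof -
  let ?f = "\<lambda>n. of_int (kronecker_symbol 12 n) * e2pi ((of_int n)\<^sup>2 / 24 * t)"
  have P: "((\<lambda>k. e2pi (t / 24) * ((-1) powi k * e2pi (of_nat (pN k) * t))) has_sum e2pi (t / 24) * qp t) UNIV"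
    by (intro has_sum_cmult_right pentagonal_number_theorem t)
  have k1: "of_int (kronecker_symbol 12 (6 * k + 1)) = (-1::complex) powi k" for k
    using kronecker_12_shift[of 1 k] by (simp add: kronecker_12 add.commute)
  have f1: "?f (6 * k + 1) = e2pi (t / 24) * ((-1) powi k * e2pi (of_nat (pN k) * t))" for k
  proof -
    have "e2pi ((of_int (6 * k + 1))\<^sup>2 / 24 * t) = e2pi (t / 24) * e2pi (of_nat (pN k) * t)"
      unfolding e2pi_add [symmetric] by (rule e2pi_cong) (simp add: complex_pN power2_eq_square field_simps)
    then show ?thesis unfolding k1 by (simp only: mult.left_commute)
  qed
  have A: "(?f has_sum e2pi (t / 24) * qp t) (range (\<lambda>k. 6 * k + 1))"
    by (subst has_sum_reindex) (use P f1 in \<open>auto simp: inj_on_def o_def\<close>)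
  have f2: "?f (- (6 * k + 1)) = ?f (6 * k + 1)" for k
    unfolding kronecker_12_minus of_int_minus power2_minus ..
  have B: "(?f has_sum e2pi (t / 24) * qp t) (range (\<lambda>k. - (6 * k + 1)))"
    by (subst has_sum_reindex) (use P f1 f2 in \<open>auto simp: inj_on_def o_def simp del: minus_add_distrib\<close>)
  have disj: "range (\<lambda>k. 6 * k + 1) \<inter> range (\<lambda>k. - (6 * k + 1 :: int)) = {}"
    by (auto, presburger)
  have "(?f has_sum e2pi (t / 24) * qp t + e2pi (t / 24) * qp t) (range (\<lambda>k. 6 * k + 1) \<union> range (\<lambda>k. - (6 * k + 1)))"
    by (rule has_sum_Un_disjoint[OF A B disj])
  also have "?this \<longleftrightarrow> (?f has_sum e2pi (t / 24) * qp t + e2pi (t / 24) * qp t) UNIV"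
  proof (rule has_sum_cong_neutral)
    fix n :: int assume n: "n \<in> UNIV - (range (\<lambda>k. 6 * k + 1) \<union> range (\<lambda>k. - (6 * k + 1)))"
    have "kronecker_symbol 12 n = 0"
    proof (rule ccontr)
      assume "kronecker_symbol 12 n \<noteq> 0"
      then have "n mod 12 = 1 \<or> n mod 12 = 11 \<or> n mod 12 = 5 \<or> n mod 12 = 7" unfolding kronecker_12 by (auto split: if_splits)
      then have "(\<exists>k. n = 6 * k + 1) \<or> (\<exists>k. n = - (6 * k + 1))" by presburger
      then show False using n by blast
    qed
    then show "?f n = 0" by simp
  qed auto
  finally show ?thesis
    using has_sum_unique[OF t32_has_sum[OF t, of 0]] by simp
qed

text \<open>The quotient of \<open>t32\<close> times T(z) by T(2 z) is entire and doubly periodic,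
  hence constant, and z = 0 evaluates it through \<open>t32_0\<close>.\<close>

theorem t32_eq:
  assumes t: "Im t > 0"
  shows "t32 t z = e2pi (t / 24) * qp t * thq 2 t z"
proof -
  let ?H = "\<lambda>z. th t (2 * z)" and ?F = "\<lambda>z. t32 t z * th t z"
  have Hh: "?H is_entire" by (rule holomorphic_scale[OF th_holomorphic[OF t]])
  have Fh: "?F is_entire" by (intro holomorphic_intros t32_holomorphic th_holomorphic t)
  have F0: "?F w = 0" if "?H w = 0" for w
  proof -
    obtain a b where ab: "2 * w = of_int a * t + of_int b" using \<open>?H w = 0\<close> unfolding th_eq_0_iff[OF t] by blast
    show ?thesis
    proof (cases "even a \<and> even b")
      case True
      then obtain a' b' where "a = 2 * a'" "b = 2 * b'" by (auto elim!: evenE)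
      then have "2 * w = 2 * (of_int a' * t + of_int b')" using ab by (simp add: distrib_left mult.assoc)
      then have "w = of_int a' * t + of_int b'" by (simp only: mult_cancel_left) simp
      then show ?thesis using th_lattice_zero[OF t] by simp
    next
      \<comment> \<open>At a half-period outside the lattice, translation by -2 w takes w to -w.
        Evenness and the multiplier -1 then force a zero of \<open>t32\<close>.\<close>
      case False
      have w: "w + of_int (- a) * t + of_int (- b) = - w" using ab by (simp add: algebra_simps)
      then have "t32 t w = (-1) powi (- a + - b) * e2pi (- 3 * (of_int (- a))\<^sup>2 / 2 * t - 3 * of_int (- a) * w) * t32 t w"
        using t32_shift[OF t, of w "- a" "- b"] unfolding w t32_even[OF t] by (simp only:)
      also have "- 3 * (of_int (- a))\<^sup>2 / 2 * t - 3 * of_int (- a) * w = of_int (3 * (a * b)) / 2"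
      proof -
        have w: "w = (of_int a * t + of_int b) / 2" using ab by (simp add: field_simps)
        show ?thesis unfolding w by (simp add: power2_eq_square field_simps)
      qed
      also have "(-1) powi (- a + - b) * e2pi (of_int (3 * (a * b)) / 2) = (-1::complex) powi (- a + - b + 3 * (a * b))"
        unfolding e2pi_of_int_half powi_m1_add ..
      also have "\<dots> = -1" by (rule odd_powi_m1) (use False in auto)
      finally show ?thesis by simp
    qed
  qed
  have dH: "deriv ?H w \<noteq> 0" if "?H w = 0" for w
    using deriv_th_nonzero[OF t that] deriv_scale[OF th_holomorphic[OF t], of 2 w] by simp
  obtain G where G: "G is_entire" "\<And>z. G z * ?H z = ?F z"
    using entire_divide[OF Fh Hh F0 dH] by blast
  have Hq: "?H (1/4) \<noteq> 0" using th_half_nonzero[OF t] by simp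
  have G1: "G (z + 1) = G z" for z
  proof (rule entire_cancel[of "\<lambda>z. G (z + 1)" G ?H "1/4"])
    fix z
    have "th t (2 * (z + 1)) = th t (2 * z)" using th_shift[OF t, of "2 * z" 0 2] by (simp add: algebra_simps)
    moreover have "t32 t (z + 1) * th t (z + 1) = t32 t z * th t z"
      using t32_shift[OF t, of z 0 1] th_shift[OF t, of z 0 1] by simp
    ultimately show "G (z + 1) * th t (2 * z) = G z * th t (2 * z)" using G(2)[of "z + 1"] G(2)[of z] by simp
  qed (use G(1) Hh Hq holomorphic_shift[OF G(1)] in auto)
  have G2: "G (z + t) = G z" for z
  proof (rule entire_cancel[of "\<lambda>z. G (z + t)" G ?H "1/4"])
    fix z
    have "th t (2 * (z + t)) = e2pi (- 2 * t - 4 * z) * th t (2 * z)" using th_shift[OF t, of "2 * z" 2 0] by (simp add: algebra_simps)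
    moreover have "t32 t (z + t) * th t (z + t) = e2pi (- 2 * t - 4 * z) * (t32 t z * th t z)"
    proof -
      have "e2pi (- 3 * 1 / 2 * t - 3 * 1 * z) * e2pi (- 1 / 2 * t - 1 * z) = e2pi (- 2 * t - 4 * z)"
        unfolding e2pi_add [symmetric] by (rule e2pi_cong) (simp add: field_simps)
      moreover have "t32 t (z + t) = - (e2pi (- 3 * 1 / 2 * t - 3 * 1 * z) * t32 t z)" using t32_shift[OF t, of z 1 0] by simp
      moreover have "th t (z + t) = - (e2pi (- 1 / 2 * t - 1 * z) * th t z)" using th_shift[OF t, of z 1 0] by simp
      ultimately show ?thesis by (simp add: mult_ac)
    qed
    ultimately have "e2pi (- 2 * t - 4 * z) * (G (z + t) * th t (2 * z)) = e2pi (- 2 * t - 4 * z) * (G z * th t (2 * z))"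
      using G(2)[of "z + t"] G(2)[of z] by (simp add: mult.left_commute)
    then show "G (z + t) * th t (2 * z) = G z * th t (2 * z)" by simp
  qed (use G(1) Hh Hq holomorphic_shift[OF G(1)] in auto)
  obtain C where C: "\<And>z. G z = C"
    by (rule entire_norm_periodic_constant[OF G(1) t]) (use G1 G2 in auto)
  have eq: "t32 t z = C * thq 2 t z" for z
  proof (rule th_cancel[OF t, of "t32 t" "\<lambda>z. C * thq 2 t z"])
    show "t32 t z * th t z = C * thq 2 t z * th t z" for z
      using G(2)[of z] C[of z] thq_mult[OF t, of 2 z] by (simp add: mult.assoc)
  qed (intro holomorphic_intros t32_holomorphic thq_holomorphic t)+
  have "thq 2 t 0 = 2"
  proof -
    have "((\<lambda>z. thq 2 t z * th t z) has_field_derivative thq 2 t 0 * \<kappa>) (at 0)"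
      using entire_deriv[OF th_holomorphic[OF t], of 0] entire_deriv[OF thq_holomorphic[OF t], of 2 0]
      by (auto intro!: derivative_eq_intros simp: deriv_th_0[OF t] t)
    moreover have "((\<lambda>z. th t (2 * z)) has_field_derivative 2 * \<kappa>) (at 0)"
      using entire_deriv[OF Hh, of 0] deriv_scale[OF th_holomorphic[OF t], of 2 0] by (simp add: deriv_th_0[OF t])
    moreover have "(\<lambda>z. thq 2 t z * th t z) = (\<lambda>z. th t (2 * z))" using thq_mult[OF t, of 2] by auto
    ultimately have "thq 2 t 0 * \<kappa> = 2 * \<kappa>" by (metis DERIV_unique)
    then show ?thesis by (subst (asm) mult_cancel_right) simp
  qed
  then have "C = e2pi (t / 24) * qp t" using eq[of 0] t32_0[OF t] by simp
  then show ?thesis using eq by simp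
qed

lemma rc_cmult:
  assumes "F is_entire" "G is_entire"
  shows "rc (\<lambda>z. a * F z) (\<lambda>z. b * G z) z = a * b * rc F G z"
proof -
  have "deriv (\<lambda>z. c * H z) z = c * deriv H z" if "H is_entire" for c H
    by (rule DERIV_imp_deriv, rule DERIV_cmult, rule entire_deriv[OF that])
  then show ?thesis unfolding rc_def by (simp add: assms algebra_simps)
qed

text \<open>Termwise, the two derivatives in \<open>rc\<close> contribute (3 m - n)/2, and eta^4
  arises as eta^3 from theta times eta from \<open>t32\<close>.\<close>

lemma phi02_eq: "phi02 = cut f2"
proof (intro ext)
  fix t z
  show "phi02 t z = cut f2 t z"
  proof (cases "Im t > 0")
    case t: True
    let ?K = "\<lambda>m. of_int (kronecker_symbol (-4) m) :: complex" and ?L = "\<lambda>n. of_int (kronecker_symbol 12 n) :: complex"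
    let ?f = "\<lambda>m. ?K m * e2pi ((of_int m)\<^sup>2 / 8 * t) * e2pi (of_int m / 2 * z)"
    define \<theta> where "\<theta> = (\<lambda>z. e2pi (t / 8) * tser t z)"
    have th: "\<theta> = (\<lambda>z. (e2pi (t / 8) * dn t) * th t z)"
      unfolding \<theta>_def th_def using dn_nonzero[OF t] by auto
    have t32: "t32 t = (\<lambda>z. (e2pi (t / 24) * qp t) * thq 2 t z)" using t32_eq[OF t] by auto
    have A: "(?f has_sum \<theta> z) UNIV" unfolding \<theta>_def by (rule jtheta_has_sum[OF t])
    have A': "((\<lambda>m. \<kappa> * (of_int m / 2) * ?f m) has_sum deriv \<theta> z) UNIV"
    proof -
      have d: "deriv \<theta> z = e2pi (t / 8) * deriv (tser t) z"
        unfolding \<theta>_def by (rule DERIV_imp_deriv, rule DERIV_cmult, rule entire_deriv[OF tser_holomorphic[OF t]])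
      show ?thesis unfolding d using jtheta_deriv_has_sum[OF t, of 1 z] by (simp add: mult_ac)
    qed
    let ?g = "\<lambda>n. ?L n * e2pi ((of_int n)\<^sup>2 / 24 * t) * e2pi (of_int n / 2 * z)"
    have B: "(?g has_sum t32 t z) UNIV" using t32_deriv_has_sum[OF t, of 0 z] by simp
    have B': "((\<lambda>n. \<kappa> * (of_int n / 2) * ?g n) has_sum deriv (t32 t) z) UNIV"
      using t32_deriv_has_sum[OF t, of 1 z] by (simp add: mult_ac)
    have "((\<lambda>p. 3 * (case p of (m, n) \<Rightarrow> (\<kappa> * (of_int m / 2) * ?f m) * ?g n) + - (case p of (m, n) \<Rightarrow> ?f m * (\<kappa> * (of_int n / 2) * ?g n))) has_sum 3 * (deriv \<theta> z * t32 t z) + - (\<theta> z * deriv (t32 t) z)) (UNIV \<times> UNIV)"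
      by (intro has_sum_add has_sum_uminusI has_sum_cmult_right has_sum_mult_prod A A' B B')
    then have S: "((\<lambda>p. 1 / \<kappa> * (3 * (case p of (m, n) \<Rightarrow> (\<kappa> * (of_int m / 2) * ?f m) * ?g n) + - (case p of (m, n) \<Rightarrow> ?f m * (\<kappa> * (of_int n / 2) * ?g n)))) has_sum 1 / \<kappa> * rc \<theta> (t32 t) z) UNIV"
      unfolding rc_def UNIV_Times_UNIV by (intro has_sum_cmult_right) (simp add: mult.assoc)
    let ?h = "\<lambda>p. case p of (m, n) \<Rightarrow> of_int (3 * m - n) * ?K m * ?L n * e2pi (of_int (3 * m\<^sup>2 + n\<^sup>2) / 24 * t) * e2pi (of_int (m + n) / 2 * z)"
    have "1 / \<kappa> * (3 * (case p of (m, n) \<Rightarrow> (\<kappa> * (of_int m / 2) * ?f m) * ?g n) + - (case p of (m, n) \<Rightarrow> ?f m * (\<kappa> * (of_int n / 2) * ?g n))) = 1/2 * ?h p" for p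
    proof -
      obtain m n where p: "p = (m, n)" by (cases p)
      have e1: "e2pi (of_int (3 * m\<^sup>2 + n\<^sup>2) / 24 * t) = e2pi ((of_int m)\<^sup>2 / 8 * t) * e2pi ((of_int n)\<^sup>2 / 24 * t)"
        unfolding e2pi_add [symmetric] by (rule e2pi_cong) (simp add: field_simps)
      have e2: "e2pi (of_int (m + n) / 2 * z) = e2pi (of_int m / 2 * z) * e2pi (of_int n / 2 * z)"
        unfolding e2pi_add [symmetric] by (rule e2pi_cong) (simp add: field_simps)
      have gen: "1 / k * (3 * ((k * (of_int m / 2) * (K * a * b)) * (L * c * d)) + - ((K * a * b) * (k * (of_int n / 2) * (L * c * d)))) = 1/2 * (of_int (3 * m - n) * K * L * (a * c) * (b * d))"
        if "k \<noteq> 0" for k K L a b c d :: complex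
        using that by (simp add: field_simps)
      show ?thesis unfolding p case_prod_conv e1 e2 by (rule gen) simp
    qed
    with S have "((\<lambda>p. 1/2 * ?h p) has_sum 1 / \<kappa> * rc \<theta> (t32 t) z) UNIV" by (simp only:)
    from has_sum_cmult_right[OF this, of 2] have "(?h has_sum 2 * (1 / \<kappa> * rc \<theta> (t32 t) z)) UNIV" by simp
    then have inf: "infsum ?h UNIV = 2 * (1 / \<kappa> * rc \<theta> (t32 t) z)" by (rule infsumI)
    have "rc \<theta> (t32 t) z = (e2pi (t / 8) * dn t) * (e2pi (t / 24) * qp t) * rc (th t) (thq 2 t) z"
      unfolding th t32 by (rule rc_cmult[OF th_holomorphic[OF t] thq_holomorphic[OF t]])
    also have "(e2pi (t / 8) * dn t) * (e2pi (t / 24) * qp t) = dedekind_eta t ^ 4"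
    proof -
      have "e2pi (t / 8) * e2pi (t / 24) = e2pi (t / 24) ^ 4"
        unfolding e2pi_of_nat_mult [symmetric] e2pi_add [symmetric] by (rule e2pi_cong) (simp add: field_simps)
      moreover have "dedekind_eta t = e2pi (t / 24) * qp t" by (simp add: dedekind_eta_def qp_def)
      moreover have "dn t * qp t = qp t ^ 4" by (simp add: dn_eq_qp[OF t] eval_nat_numeral)
      ultimately show ?thesis by (simp add: power_mult_distrib) (metis mult.assoc mult.left_commute)
    qed
    finally have eq: "rc \<theta> (t32 t) z = dedekind_eta t ^ 4 * rc (th t) (thq 2 t) z" .
    have "1 / 2 * inverse (dedekind_eta t ^ 4) * infsum ?h UNIV = f2 t z"
    proof -
      have ne: "dedekind_eta t ^ 4 \<noteq> 0" using qp_nonzero[OF t] by (simp add: dedekind_eta_def qp_def)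
      have gen: "1 / 2 * inverse A * (2 * (1 / k * (A * R))) = 1 / k * R" if "A \<noteq> 0" for A k R :: complex
        using that by simp
      show ?thesis unfolding inf f2_def eq by (rule gen[OF ne])
    qed
    then show ?thesis unfolding phi02_def cut_def using t by (simp only: if_True)
  qed (simp add: phi02_def cut_def)
qed

subsection \<open>Integrality of Fourier coefficients\<close>

text \<open>The q^0-row is monic in y, which is what lets division preserve integrality.\<close>

definition lead :: "int \<Rightarrow> jform \<Rightarrow> bool" where
  "lead L \<alpha> \<longleftrightarrow> (\<exists>a. has_fourier_expansion \<alpha> a \<and> (\<forall>n l. a n l \<in> \<int>) \<and> a 0 L = 1 \<and> (\<forall>l>L. a 0 l = 0))"

text \<open>Comparing coefficients of \<open>q\<^sup>N y\<^sup>l\<^sup>+\<^sup>L\<close> in the product determines the coefficient of \<open>q\<^sup>N y\<^sup>l\<close>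
  of the second factor from coefficients of lower order in \<open>q\<close> or higher order in \<open>y\<close>.\<close>

lemma FE_cancel_lead:
  assumes A: "lead L \<alpha>" and b: "has_fourier_expansion \<beta> b" and bd: "\<And>n l. l > K n \<Longrightarrow> b n l = 0"
    and P: "FE \<int> (\<lambda>t z. \<alpha> t z * \<beta> t z)"
  shows "b n l \<in> \<int>"
proof -
  obtain a where a: "has_fourier_expansion \<alpha> a" "\<And>n l. a n l \<in> \<int>" "a 0 L = 1" "\<And>l. l > L \<Longrightarrow> a 0 l = 0"
    using A unfolding lead_def by blast
  obtain c where c: "has_fourier_expansion (\<lambda>t z. \<alpha> t z * \<beta> t z) c" "\<And>n l. c n l \<in> \<int>"
    using P unfolding FE_def by blast
  let ?g = "\<lambda>(p, r). a (fst p) (snd p) * b (fst r) (snd r)"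
  let ?N = "\<lambda>(p, r). fst p + fst r" and ?M = "\<lambda>(p, r). snd p + snd r"
  let ?F = "\<lambda>n l. {k. ?N k = n \<and> ?M k = l}"
  have hs: "((\<lambda>k. ?g k * e2pi (of_nat (?N k) * t) * e2pi (of_int (?M k) * z)) has_sum \<alpha> t z * \<beta> t z) UNIV" if "Im t > 0" for t z
    using has_fourier_expansion_mult[OF a(1) b that, of z] by (simp add: case_prod_unfold)
  have e: "has_fourier_expansion (\<lambda>t z. \<alpha> t z * \<beta> t z) (\<lambda>n l. infsum ?g (?F n l))"
    and sm: "?g summable_on ?F n l" for n l
    using has_fourier_expansion_series[where c = ?g and N = ?N and M = ?M, OF hs] by blast+
  have gs: "(?g has_sum c n l) (?F n l)" for n l
    using has_sum_infsum[OF sm, of n l] fun_cong[OF fun_cong[OF has_fourier_expansion_unique[OF e c(1)], of n], of l] by simp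
  show ?thesis
  proof (induction n arbitrary: l rule: less_induct)
    case (less n)
    note lower = less
    show ?case
    proof (induction "nat (K n - l)" arbitrary: l rule: less_induct)
      case (less l)
      have higher: "b n l' \<in> \<int>" if "l' > l" for l'
      proof (cases "l' > K n")
        case False
        then show ?thesis using that by (intro less) auto
      qed (simp add: bd)
      let ?x = "((0, L), (n, l))"
      have "(?g has_sum ?g ?x) {?x}" using has_sum_finite[of "{?x}" ?g] by simp
      then have "(?g has_sum (c n (l + L) - ?g ?x)) (?F n (l + L) - {?x})"
        by (rule has_sum_Diff[OF gs]) auto
      then have "c n (l + L) - ?g ?x \<in> \<int>"
      proof (rule has_sum_closed_set)
        fix k assume "k \<in> ?F n (l + L) - {?x}"
        moreover obtain n1 l1 n2 l2 where "k = ((n1, l1), (n2, l2))" by (metis prod.collapse)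
        ultimately have k: "k = ((n1, l1), (n2, l2))" "n1 + n2 = n" "l1 + l2 = l + L" "k \<noteq> ?x" by auto
        consider "n1 > 0" | "n1 = 0" "l1 > L" | "n1 = 0" "l1 < L" | "n1 = 0" "l1 = L" by linarith
        then have "a n1 l1 * b n2 l2 \<in> \<int>"
        proof cases
          case 1
          then show ?thesis using k by (intro Ints_mult a(2) lower) auto
        next
          case 2
          then show ?thesis by (simp add: a(4))
        next
          case 3
          then show ?thesis using k higher[of l2] by (intro Ints_mult a(2)) auto
        next
          case 4
          then show ?thesis using k by auto
        qed
        then show "?g k \<in> \<int>" unfolding k by simp
      qed auto
      then have "c n (l + L) - (c n (l + L) - ?g ?x) \<in> \<int>" by (rule Ints_diff[OF c(2)])
      then have "?g ?x \<in> \<int>" by (simp only: diff_diff_eq2 add_diff_cancel_left')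
      then show ?case by (simp add: a(3))
    qed
  qed
qed

text \<open>\<open>weak_coeff_zero\<close> provides the bound on the powers of y in each
  row.\<close>

lemma weak_cancel_lead:
  assumes "weak_jacobi_form m \<beta>" "lead L \<alpha>" "FE \<int> (\<lambda>t z. \<alpha> t z * \<beta> t z)"
  shows "FE \<int> \<beta>"
proof -
  obtain b where b: "has_fourier_expansion \<beta> b" using assms(1) unfolding weak_jacobi_form_def by blast
  have "b n l \<in> \<int>" for n l
    by (rule FE_cancel_lead[OF assms(2) b _ assms(3), of "\<lambda>n. int n + int m"]) (rule weak_coeff_zero[OF assms(1) b])
  then show ?thesis using b unfolding FE_def by blast
qed

lemma leadI:
  assumes "FE \<int> \<alpha>" "jfam \<alpha> p" "finite F" "\<And>z. p z = (\<Sum>l\<in>F. c l * e2pi (of_int l * z))" "L \<in> F" "c L = 1" "\<And>l. l \<in> F \<Longrightarrow> l \<le> L"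
  shows "lead L \<alpha>"
proof -
  obtain a where a: "\<forall>n l. a n l \<in> \<int>" "has_fourier_expansion \<alpha> a" using assms(1) unfolding FE_def by blast
  have "a 0 l = (if l \<in> F then c l else 0)" for l by (rule fourier_row_unique[OF a(2) assms(2,3,4)])
  then have "a 0 L = 1" "\<forall>l>L. a 0 l = 0" using assms(5,6,7) by (simp, metis not_le)
  then show ?thesis unfolding lead_def using a by blast
qed

text \<open>The coefficient of y^l in u^k, where u^k is (y^(1/2) - y^(-1/2)) to the power 2
  k.\<close>

definition uc :: "nat \<Rightarrow> int \<Rightarrow> int" where
  "uc k l = (if \<bar>l\<bar> \<le> int k then (-1) ^ nat (int k + l) * int (2 * k choose nat (int k + l)) else 0)"

lemma sy_power_sum: "sy z ^ (2 * k) = (\<Sum>l\<in>{- int k..int k}. of_int (uc k l) * e2pi (of_int l * z))"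
proof -
  have "sy z ^ (2 * k) = (- e2pi (z/2) + e2pi (-z/2)) ^ (2 * k)"
    unfolding power_mult sy_def by (rule arg_cong[where f = "\<lambda>x. x ^ k"]) (simp add: power2_eq_square algebra_simps)
  also have "\<dots> = (\<Sum>j\<le>2*k. of_nat (2*k choose j) * (- e2pi (z/2)) ^ j * e2pi (-z/2) ^ (2*k - j))"
    by (rule binomial_ring)
  also have "\<dots> = (\<Sum>j\<le>2*k. of_int (uc k (int j - int k)) * e2pi (of_int (int j - int k) * z))"
  proof (rule sum.cong[OF refl])
    fix j assume "j \<in> {..2*k}"
    then have j: "j \<le> 2 * k" by simp
    have "e2pi (z/2) ^ j * e2pi (-z/2) ^ (2*k - j) = e2pi (of_int (int j - int k) * z)"
      unfolding e2pi_of_nat_mult [symmetric] e2pi_add [symmetric]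
      by (rule e2pi_cong) (use j in \<open>simp add: of_nat_diff field_simps\<close>)
    moreover have "uc k (int j - int k) = (-1) ^ j * int (2*k choose j)" using j by (auto simp: uc_def)
    moreover have "(- e2pi (z/2)) ^ j = (-1) ^ j * e2pi (z/2) ^ j" by (rule power_minus)
    ultimately show "of_nat (2*k choose j) * (- e2pi (z/2)) ^ j * e2pi (-z/2) ^ (2*k - j) = of_int (uc k (int j - int k)) * e2pi (of_int (int j - int k) * z)"
      by simp
  qed
  also have "\<dots> = (\<Sum>l\<in>{- int k..int k}. of_int (uc k l) * e2pi (of_int l * z))"
    by (rule sum.reindex_bij_witness[where i = "\<lambda>l. nat (l + int k)" and j = "\<lambda>j. int j - int k"]) auto
  finally show ?thesis .
qed

lemma uc_top [simp]: "uc k (int k) = 1"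
proof -
  have "nat (int k + int k) = 2 * k" by simp
  then show ?thesis unfolding uc_def by (simp only:) simp
qed

lemma powi_m1_Ints: "(-1::complex) powi k \<in> \<int>"
  by (cases "even k") (auto simp: even_powi_m1 odd_powi_m1)

text \<open>\<open>dn\<close> is the cube of \<open>qp\<close>, whose expansion is integral by the
  pentagonal number theorem.\<close>

lemma FE_dn: "FE \<int> (\<lambda>t z. dn t ^ n)"
proof (rule FE_congI)
  have "FE \<int> (\<lambda>t z. qp t)"
    by (rule FE_series[OF coeff_ring_Ints powi_m1_Ints, where N = pN and M = "\<lambda>_. 0"])
       (use pentagonal_number_theorem in simp)
  then show "FE \<int> (\<lambda>t z. (qp t ^ 3) ^ n)" by (intro FE_power coeff_ring_Ints)
qed (simp add: dn_eq_qp)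

text \<open>The parity condition makes the half-integral powers of y add up to integral
  ones.\<close>

lemma FE_tser_scaled:
  assumes "even (a + b)"
  shows "FE \<int> (\<lambda>t z. tser t (of_nat a * z) * tser t (of_nat b * z))"
proof (rule FE_series[OF coeff_ring_Ints, where c = "\<lambda>(k, l). (-1) powi k * (-1) powi l" and N = "\<lambda>(k, l). tN k + tN l"
      and M = "\<lambda>(k, l). int a * k + int b * l + int (a + b) div 2"])
  fix t z :: complex assume t: "Im t > 0"
  have "2 * (int (a + b) div 2) = int (a + b)" using assms by simp
  then have "(of_int (2 * (int (a + b) div 2)) :: complex) = of_int (int (a + b))" by simp
  then have h: "of_int (int (a + b) div 2) = (of_nat a + of_nat b :: complex) / 2" by (simp add: eq_divide_eq mult.commute)
  have e: "(-1) powi k * (-1) powi l * e2pi (of_nat (tN k + tN l) * t) * e2pi (of_int (int a * k + int b * l + int (a + b) div 2) * z) =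
     ((-1) powi k * e2pi (of_nat (tN k) * t + (of_int k + 1/2) * (of_nat a * z))) * ((-1) powi l * e2pi (of_nat (tN l) * t + (of_int l + 1/2) * (of_nat b * z)))" for k l
  proof -
    have "e2pi (of_nat (tN k + tN l) * t) * e2pi (of_int (int a * k + int b * l + int (a + b) div 2) * z) =
      e2pi (of_nat (tN k) * t + (of_int k + 1/2) * (of_nat a * z)) * e2pi (of_nat (tN l) * t + (of_int l + 1/2) * (of_nat b * z))"
      unfolding e2pi_add [symmetric] of_int_add h by (rule e2pi_cong) (simp add: algebra_simps add_divide_distrib)
    then show ?thesis by (simp only: mult.assoc) (simp only: mult.left_commute)
  qed
  show "((\<lambda>k. (case k of (k, l) \<Rightarrow> (-1) powi k * (-1) powi l) * e2pi (of_nat (case k of (k, l) \<Rightarrow> tN k + tN l) * t) *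
      e2pi (of_int (case k of (k, l) \<Rightarrow> int a * k + int b * l + int (a + b) div 2) * z)) has_sum tser t (of_nat a * z) * tser t (of_nat b * z)) UNIV"
    using has_sum_mult_prod[OF tser_has_sum[OF t, of "of_nat a * z"] tser_has_sum[OF t, of "of_nat b * z"]]
    by (simp only: case_prod_unfold e UNIV_Times_UNIV)
qed (auto intro: Ints_mult powi_m1_Ints)

lemma FE_tser_sq: "FE \<int> (\<lambda>t z. tser t z ^ 2)"
  using FE_tser_scaled[of 1 1] by (simp add: power2_eq_square)

text \<open>Theta has the cusp value \<open>sy\<close>, so the row is u^k, which is monic by
  \<open>uc_top\<close>.\<close>

lemma lead_tser: "lead (int k) (\<lambda>t z. tser t z ^ (2 * k))"
proof (rule leadI)
  show "FE \<int> (\<lambda>t z. tser t z ^ (2 * k))"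
    unfolding power_mult by (rule FE_power[OF coeff_ring_Ints FE_tser_sq])
  show "jfam (\<lambda>t z. tser t z ^ (2 * k)) (\<lambda>z. sy z ^ (2 * k))" by (intro jfam_power jfam_tser_sy)
  show "sy z ^ (2 * k) = (\<Sum>l\<in>{- int k..int k}. of_int (uc k l) * e2pi (of_int l * z))" for z
    by (rule sy_power_sum)
qed auto

section \<open>Integrality of the four generators\<close>

lemma tser_th: "Im t > 0 \<Longrightarrow> tser t z = dn t * th t z"
  using dn_nonzero by (simp add: th_def)

text \<open>Multiplication by the monic square of theta clears the denominator and leaves theta(2
  z)^2, which is integral.\<close>

lemma FE_f3: "FE \<int> (cut f3)"
proof (rule weak_cancel_lead[OF cut_weak_jacobi[OF JF_f3] lead_tser[of 1]])
  show "FE \<int> (\<lambda>t z. tser t z ^ (2 * 1) * cut f3 t z)"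
  proof (rule FE_congI[OF _ FE_tser_scaled[of 2 2]])
    fix t z :: complex assume t: "Im t > 0"
    show "tser t z ^ (2 * 1) * cut f3 t z = tser t (of_nat 2 * z) * tser t (of_nat 2 * z)"
      using thq_mult[OF t, of 2 z, symmetric] t by (simp add: tser_th[OF t] cut_def f3_def power2_eq_square mult_ac)
  qed simp
qed

lemma FE_f4: "FE \<int> (cut f4)"
proof (rule weak_cancel_lead[OF cut_weak_jacobi[OF JF_f4] lead_tser[of 1]])
  show "FE \<int> (\<lambda>t z. tser t z ^ (2 * 1) * cut f4 t z)"
  proof (rule FE_congI[OF _ FE_tser_scaled[of 3 1]])
    fix t z :: complex assume t: "Im t > 0"
    show "tser t z ^ (2 * 1) * cut f4 t z = tser t (of_nat 3 * z) * tser t (of_nat 1 * z)"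
      using thq_mult[OF t, of 3 z, symmetric] t by (simp add: tser_th[OF t] cut_def f4_def power2_eq_square mult_ac)
  qed simp
qed

lemma deriv_thq_2:
  assumes t: "Im t > 0"
  shows "deriv (thq 2 t) z * th t z + thq 2 t z * deriv (th t) z = 2 * deriv (th t) (2 * z)"
proof -
  have "((\<lambda>z. thq 2 t z * th t z) has_field_derivative deriv (thq 2 t) z * th t z + thq 2 t z * deriv (th t) z) (at z)"
    using DERIV_mult[OF entire_deriv[OF thq_holomorphic[OF t]] entire_deriv[OF th_holomorphic[OF t]]] by (simp add: add.commute mult.commute)
  moreover have "(\<lambda>z. thq 2 t z * th t z) = (\<lambda>z. th t (2 * z))" using thq_mult[OF t, of 2] by auto
  ultimately show ?thesis
    using DERIV_imp_deriv deriv_scale[OF th_holomorphic[OF t], of 2 z] by metis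
qed

lemma th_reflect: "Im t > 0 \<Longrightarrow> th t (1 - z) = th t z"
  using th_shift[of t "- z" 0 1] th_odd[of t z] by simp

lemma deriv_th_reflect: assumes t: "Im t > 0" shows "deriv (th t) z = - deriv (th t) (1 - z)"
proof -
  have "((\<lambda>z. th t (1 - z)) has_field_derivative deriv (th t) (1 - z) * (- 1)) (at z)"
    by (rule DERIV_chain2[where f = "th t", OF entire_deriv[OF th_holomorphic[OF t]]]) (auto intro!: derivative_eq_intros)
  moreover have "(\<lambda>z. th t (1 - z)) = th t" using th_reflect[OF t] by auto
  ultimately show ?thesis using DERIV_imp_deriv by force
qed

text \<open>The denominators of \<open>f2\<close> are cleared: T(2 z) / T(z) and its derivative are
  eliminated through the equation that defines the quotient.\<close>

lemma f2_tser:
  assumes t: "Im t > 0"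
  shows "dn t * tser t z ^ 2 * f2 t z = 1 / \<kappa> * (4 * (tser t z * deriv (tser t) z * tser t (2 * z)) - tser t z * tser t z * (2 * deriv (tser t) (2 * z)))"
proof -
  have d: "deriv (tser t) z = dn t * deriv (th t) z" for z
    using deriv_cmult[OF holomorphic_on_imp_differentiable_at[OF th_holomorphic[OF t]], of z "dn t"]
    by (simp add: tser_th[OF t, abs_def])
  note r' = deriv_thq_2[OF t]
  have r: "thq 2 t z * th t z = th t (2 * z)" using thq_mult[OF t, of 2 z] by simp
  have "D * (D * x) ^ 2 * (k * (3 * x' * R - x * R')) = k * (4 * ((D * x) * (D * x') * (D * (R * x))) - (D * x) * (D * x) * (D * (R' * x + R * x')))"
    for D x x' k R R' :: complex by (simp add: power2_eq_square algebra_simps)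
  from this[of "dn t" "th t z" "1 / \<kappa>" "deriv (th t) z" "thq 2 t z" "deriv (thq 2 t) z"]
  show ?thesis unfolding r r' f2_def rc_def d tser_th[OF t] by (simp only: mult.left_commute[of 2])
qed

lemma FE_f2: "FE \<int> (cut f2)"
proof (rule weak_cancel_lead[OF cut_weak_jacobi[OF JF_f2]])
  show "lead 1 (\<lambda>t z. dn t * tser t z ^ 2)"
  proof (rule leadI)
    show "FE \<int> (\<lambda>t z. dn t * tser t z ^ 2)"
      using FE_mult[OF coeff_ring_Ints FE_dn[of 1] FE_tser_sq] by simp
    show "jfam (\<lambda>t z. dn t * tser t z ^ 2) (\<lambda>z. 1 * sy z ^ 2)"
      by (intro jfam_mult jfam_qval_const qval_dn jfam_power jfam_tser_sy)
    show "1 * sy z ^ 2 = (\<Sum>l\<in>{- int 1..int 1}. of_int (uc 1 l) * e2pi (of_int l * z))" for z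
      using sy_power_sum[of z 1] by simp
  qed (use uc_top[of 1] in auto)
  \<comment> \<open>The last factor is 4 (l + 1/2) - 2 (m + 1/2); the halves combine to an
    integer.\<close>
  let ?c = "\<lambda>((k, l), m). (-1::complex) powi k * (-1) powi l * (-1) powi m * of_int (4 * l - 2 * m + 1)"
  let ?N = "\<lambda>((k, l), m). tN k + tN l + tN m" and ?M = "\<lambda>((k, l), m). k + l + 2 * m + 2"
  show "FE \<int> (\<lambda>t z. dn t * tser t z ^ 2 * cut f2 t z)"
  proof (rule FE_series[OF coeff_ring_Ints, where c = ?c and N = ?N and M = ?M])
    fix t z :: complex assume t: "Im t > 0"
    let ?s = "\<lambda>k::int. (-1::complex) powi k" and ?w = "\<lambda>k. \<kappa> * (of_int k + 1/2)"
    let ?p = "\<lambda>j (k, l). ?s k * ?w k ^ 0 * (?s l * ?w l ^ j) * e2pi (of_nat (tN k + tN l) * t) * e2pi (of_int (k + l + 1) * z)"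
    let ?d = "\<lambda>j m. ?s m * ?w m ^ j * e2pi (of_nat (tN m) * t) * e2pi ((of_int m + 1/2) * (2 * z))"
    have p: "(?p j has_sum tser t z * (deriv ^^ j) (tser t) z) UNIV" for j
      using tser_pair_has_sum[OF t, of 0 j z] by simp
    have d: "(?d j has_sum (deriv ^^ j) (tser t) (2 * z)) UNIV" for j by (rule tser_deriv_has_sum[OF t])
    have S: "((\<lambda>x. 1 / \<kappa> * (4 * (case x of (x, y) \<Rightarrow> ?p 1 x * ?d 0 y) + - (2 * (case x of (x, y) \<Rightarrow> ?p 0 x * ?d 1 y)))) has_sum
      1 / \<kappa> * (4 * ((tser t z * (deriv ^^ 1) (tser t) z) * (deriv ^^ 0) (tser t) (2 * z)) + - (2 * ((tser t z * (deriv ^^ 0) (tser t) z) * (deriv ^^ 1) (tser t) (2 * z))))) (UNIV \<times> UNIV)"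
      by (intro has_sum_cmult_right has_sum_add has_sum_uminusI has_sum_mult_prod p d)
    have v: "1 / \<kappa> * (4 * ((tser t z * (deriv ^^ 1) (tser t) z) * (deriv ^^ 0) (tser t) (2 * z)) + - (2 * ((tser t z * (deriv ^^ 0) (tser t) z) * (deriv ^^ 1) (tser t) (2 * z))))
      = dn t * tser t z ^ 2 * cut f2 t z"
      using f2_tser[OF t, of z] t by (simp add: cut_def mult_ac)
    have "1 / \<kappa> * (4 * (case x of (x, y) \<Rightarrow> ?p 1 x * ?d 0 y) + - (2 * (case x of (x, y) \<Rightarrow> ?p 0 x * ?d 1 y))) =
      ?c x * e2pi (of_nat (?N x) * t) * e2pi (of_int (?M x) * z)" for x
    proof -
      obtain k l m where x: "x = ((k, l), m)" by (metis prod.collapse)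
      have e: "e2pi (of_nat (tN k + tN l + tN m) * t) = e2pi (of_nat (tN k + tN l) * t) * e2pi (of_nat (tN m) * t)"
        "e2pi (of_int (k + l + 2 * m + 2) * z) = e2pi (of_int (k + l + 1) * z) * e2pi ((of_int m + 1/2) * (2 * z))"
        unfolding e2pi_add [symmetric] by (simp_all add: algebra_simps)
      have gen: "1 / K * (4 * ((a * 1 * (b * (K * (L + 1/2))) * e * f) * (c * 1 * g * h)) + - (2 * ((a * 1 * (b * 1) * e * f) * (c * (K * (M + 1/2)) * g * h)))) =
        a * b * c * (4 * L - 2 * M + 1) * (e * g) * (f * h)" if "K \<noteq> 0" for K L M a b c e f g h :: complex
        using that by (simp add: field_simps)
      have i: "of_int (4 * l - 2 * m + 1) = (4 * of_int l - 2 * of_int m + 1 :: complex)" by simp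
      show ?thesis unfolding x case_prod_conv e power_0 power_one_right i by (rule gen) simp
    qed
    then show "((\<lambda>x. ?c x * e2pi (of_nat (?N x) * t) * e2pi (of_int (?M x) * z)) has_sum dn t * tser t z ^ 2 * cut f2 t z) UNIV"
      using S unfolding v by (simp only: UNIV_Times_UNIV)
  next
    fix x :: "(int \<times> int) \<times> int"
    obtain k l m where x: "x = ((k, l), m)" by (metis prod.collapse)
    show "?c x \<in> \<int>" unfolding x case_prod_conv by (intro Ints_mult powi_m1_Ints Ints_of_int)
  qed
qed

text \<open>The denominators in the definition of \<open>f1\<close> are bypassed: by
  \<open>relation\<close> its product with the monic \<open>f3\<close> is 4 \<open>f4\<close> plus
  the square of \<open>f2\<close>, which is integral.\<close>

lemma FE_f1_Ints: "FE \<int> (cut f1)"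
proof (rule weak_cancel_lead[OF cut_weak_jacobi[OF JF_f1]])
  show "lead 1 (cut f3)"
  proof (rule leadI[OF FE_f3, where F = "{-1, 0, 1}" and c = "\<lambda>l. if l = 0 then 2 else 1"])
    show "jfam (cut f3) (\<lambda>z. 4 + sy z ^ 2)" using cut_JF[OF JF_f3] by (simp add: JF_def EF_def)
    show "4 + sy z ^ 2 = (\<Sum>l\<in>{-1, 0, 1}. (if l = 0 then 2 else 1) * e2pi (of_int l * z))" for z
      unfolding sy_sq by simp
    show "l \<le> 1" if "l \<in> {-1, 0, 1}" for l :: int
    proof -
      have "l = -1 \<or> l = 0 \<or> l = 1" using that by blast
      then show ?thesis by linarith
    qed
  qed simp_all
  have "FE \<int> (\<lambda>t z. 4 * cut f4 t z + cut f2 t z ^ 2)"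
    by (intro FE_add FE_mult FE_power FE_const FE_f4 FE_f2 coeff_ring_Ints) auto
  then show "FE \<int> (\<lambda>t z. cut f3 t z * cut f1 t z)"
  proof (rule FE_congI[rotated])
    fix t z :: complex assume t: "Im t > 0"
    show "cut f3 t z * cut f1 t z = 4 * cut f4 t z + cut f2 t z ^ 2"
      using relation[OF t, of z] t by (simp add: cut_def mult.commute)
  qed
qed

lemma JZ_iff: "\<phi> \<in> JZ m \<longleftrightarrow> (\<forall>t z. Im t \<le> 0 \<longrightarrow> \<phi> t z = 0) \<and> FE \<int> \<phi> \<and> (\<exists>p. JF 0 m \<phi> p)"
proof
  assume "\<phi> \<in> JZ m"
  then have w: "weak_jacobi_form m \<phi>" and i: "\<And>n l. jcoeff \<phi> n l \<in> \<int>" by (auto simp: JZ_def)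
  then obtain f where f: "has_fourier_expansion \<phi> f" unfolding weak_jacobi_form_def by blast
  then have "FE \<int> \<phi>" using i unfolding FE_def jcoeff_eq[OF f] by blast
  moreover have "\<exists>p. JF 0 m \<phi> p" using weak_jacobi_imp_JF[OF w f] by blast
  ultimately show "(\<forall>t z. Im t \<le> 0 \<longrightarrow> \<phi> t z = 0) \<and> FE \<int> \<phi> \<and> (\<exists>p. JF 0 m \<phi> p)"
    using w unfolding weak_jacobi_form_def by blast
next
  assume a: "(\<forall>t z. Im t \<le> 0 \<longrightarrow> \<phi> t z = 0) \<and> FE \<int> \<phi> \<and> (\<exists>p. JF 0 m \<phi> p)"
  then have "weak_jacobi_form m \<phi>" using JF_imp_weak_jacobi by blast
  moreover obtain f where f: "has_fourier_expansion \<phi> f" "\<forall>n l. f n l \<in> \<int>" using a unfolding FE_def by blast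
  ultimately show "\<phi> \<in> JZ m" using jcoeff_eq[OF f(1)] by (simp add: JZ_def)
qed

lemma cut_JZ: "JF 0 m \<phi> p \<Longrightarrow> FE \<int> (cut \<phi>) \<Longrightarrow> cut \<phi> \<in> JZ m"
  unfolding JZ_iff using cut_JF[of 0 m \<phi> p] by (auto simp: cut_def)

subsection \<open>Forms with vanishing constant row\<close>

text \<open>With b2, b4, b6, b8 for \<open>f1\<close>, \<open>f2\<close>, \<open>f3\<close>,
  \<open>f4\<close> this is minus the discriminant formula of a Weierstrass cubic. On the q^0-terms
  it vanishes identically in u, that is, the cubic degenerates at the cusp.\<close>

definition pp :: jform where
  "pp t z = f1 t z ^ 2 * f4 t z + 8 * f2 t z ^ 3 + 27 * f3 t z ^ 2 - 9 * (f1 t z * f2 t z * f3 t z)"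

lemma JF_pp: "JF 0 6 pp (\<lambda>_. 0)"
proof -
  have "JF 0 6 (\<lambda>t z. f1 t z ^ 2 * f4 t z + 8 * f2 t z ^ 3 + 27 * f3 t z ^ 2 - 9 * (f1 t z * f2 t z * f3 t z))
    (\<lambda>z. (12 + sy z ^ 2) ^ 2 * (3 + sy z ^ 2) + 8 * (6 + sy z ^ 2) ^ 3 + 27 * (4 + sy z ^ 2) ^ 2 - 9 * ((12 + sy z ^ 2) * (6 + sy z ^ 2) * (4 + sy z ^ 2)))"
    using JF_diff[OF JF_add[OF JF_add[OF JF_mult[OF JF_power[OF JF_f1, of 2] JF_f4, simplified]
      JF_cmult[OF JF_power[OF JF_f2, of 3, simplified], of 8]] JF_cmult[OF JF_power[OF JF_f3, of 2, simplified], of 27]]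
      JF_cmult[OF JF_mult[OF JF_mult[OF JF_f1 JF_f2] JF_f3, simplified], of 9]] by simp
  moreover have "(12 + u) ^ 2 * (3 + u) + 8 * (6 + u) ^ 3 + 27 * (4 + u) ^ 2 - 9 * ((12 + u) * (6 + u) * (4 + u)) = 0" for u :: complex
    by (simp add: power2_eq_square power3_eq_cube algebra_simps)
  ultimately show ?thesis unfolding pp_def[abs_def] by simp
qed

text \<open>w^3 + 1 = (w + 1) (w^2 - w + 1), and w is not -1.\<close>

lemma e2pi_sixth: "e2pi (1/6) + e2pi (- (1/6)) = 1"
proof -
  let ?w = "e2pi (1/6)"
  have "?w ^ 3 = -1" unfolding e2pi_of_nat_mult [symmetric] using e2pi_half by simp
  then have "(?w + 1) * (?w ^ 2 - ?w + 1) = 0" by (simp add: power2_eq_square power3_eq_cube algebra_simps)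
  moreover have "?w + 1 \<noteq> 0"
  proof
    assume "?w + 1 = 0"
    then have "?w = e2pi (1/2)" by (simp add: e2pi_half add_eq_0_iff2)
    then obtain n where "(1/6 :: complex) = 1/2 + of_int n" unfolding e2pi_eq_iff by blast
    then have "(1 :: complex) = of_int (3 + 6 * n)" by (simp add: field_simps)
    then have "1 = 3 + 6 * n" by (metis of_int_1 of_int_eq_iff)
    then show False by presburger
  qed
  ultimately have "?w ^ 2 - ?w + 1 = 0" by (metis mult_eq_0_iff)
  then have "?w ^ 2 + 1 = ?w" by (simp add: algebra_simps)
  then have "?w * (?w + e2pi (- (1/6))) = ?w * 1"
    by (simp add: power2_eq_square distrib_left e2pi_minus)
  then show ?thesis by (simp only: mult_cancel_left e2pi_nonzero) simp
qed

lemma tN_eq_1_iff: "tN k = 1 \<longleftrightarrow> k = 1 \<or> k = -2"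
proof
  assume "tN k = 1"
  then have "(k - 1) * (k + 2) = 0" using int_tN[of k] by (simp add: algebra_simps)
  then show "k = 1 \<or> k = -2" by auto
qed (auto simp: tN_def)

text \<open>Removing the constant term and dividing by q turns the coefficient of q in theta'(z) /
  (2 pi i), theta taken without q^(1/8), into a value at the cusp.\<close>

lemma qval_deriv_tser:
  "qval (\<lambda>t. (deriv (tser t) z / \<kappa> - (e2pi (z/2) + e2pi (- (z/2))) / 2) * e2pi (- t)) (- 3 / 2 * (e2pi (3 * z / 2) + e2pi (- (3 * z / 2))))"
proof -
  let ?c = "\<lambda>k. (-1) powi k * (of_int k + 1/2) * e2pi ((of_int k + 1/2) * z)"
  \<comment> \<open>The terms with \<open>tN k = 0\<close> are set to zero, so the truncated
    difference \<open>tN k - 1\<close> below does no harm.\<close>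
  let ?d = "\<lambda>k. if tN k = 0 then 0 else ?c k"
  have "qval (\<lambda>t. (deriv (tser t) z / \<kappa> - (e2pi (z/2) + e2pi (- (z/2))) / 2) * e2pi (- t)) (\<Sum>\<^sub>\<infinity>k. if tN k - 1 = 0 then ?d k else 0)"
  proof (rule qval_series)
    fix t :: complex assume t: "Im t > 0"
    have "((\<lambda>k. 1 / \<kappa> * ((-1) powi k * (\<kappa> * (of_int k + 1/2)) ^ 1 * e2pi (of_nat (tN k) * t) * e2pi ((of_int k + 1/2) * z))) has_sum 1 / \<kappa> * (deriv ^^ 1) (tser t) z) UNIV"
      by (intro has_sum_cmult_right tser_deriv_has_sum t)
    moreover have "1 / \<kappa> * ((-1) powi k * (\<kappa> * (of_int k + 1/2)) ^ 1 * e2pi (of_nat (tN k) * t) * e2pi ((of_int k + 1/2) * z)) = ?c k * e2pi (of_nat (tN k) * t)" for k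
    proof -
      have gen: "1 / K * (a * (K * b) ^ 1 * c * d) = a * b * d * c" if "K \<noteq> 0" for K a b c d :: complex using that by simp
      show ?thesis by (rule gen) simp
    qed
    ultimately have "((\<lambda>k. ?c k * e2pi (of_nat (tN k) * t)) has_sum 1 / \<kappa> * (deriv ^^ 1) (tser t) z) UNIV" by (simp only:)
    then have A: "((\<lambda>k. ?c k * e2pi (of_nat (tN k) * t)) has_sum deriv (tser t) z / \<kappa>) UNIV" by simp
    have "((\<lambda>k. ?c k * e2pi (of_nat (tN k) * t)) has_sum (\<Sum>k\<in>{0, -1}. ?c k * e2pi (of_nat (tN k) * t))) {0, -1}"
      by (rule has_sum_finite) simp
    moreover have "(\<Sum>k\<in>{0, -1}. ?c k * e2pi (of_nat (tN k) * t)) = (e2pi (z/2) + e2pi (- (z/2))) / 2"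
      using tN_eq_0_iff[of 0] tN_eq_0_iff[of "-1"] by (simp add: add_divide_distrib)
    ultimately have "((\<lambda>k. ?c k * e2pi (of_nat (tN k) * t)) has_sum deriv (tser t) z / \<kappa> - (e2pi (z/2) + e2pi (- (z/2))) / 2) (UNIV - {0, -1})"
      using has_sum_Diff[OF A] by auto
    also have "?this \<longleftrightarrow> ((\<lambda>k. ?d k * e2pi (of_nat (tN k) * t)) has_sum deriv (tser t) z / \<kappa> - (e2pi (z/2) + e2pi (- (z/2))) / 2) UNIV"
      by (rule has_sum_cong_neutral) (simp_all add: tN_eq_0_iff)
    finally have "((\<lambda>k. ?d k * e2pi (of_nat (tN k) * t) * e2pi (- t)) has_sum (deriv (tser t) z / \<kappa> - (e2pi (z/2) + e2pi (- (z/2))) / 2) * e2pi (- t)) UNIV"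
      by (rule has_sum_cmult_left)
    moreover have "?d k * e2pi (of_nat (tN k) * t) * e2pi (- t) = ?d k * e2pi (of_nat (tN k - 1) * t)" for k
    proof (cases "tN k")
      case (Suc n)
      have "e2pi (of_nat (Suc n) * t) * e2pi (- t) = e2pi (of_nat n * t)"
        unfolding e2pi_add [symmetric] by (rule e2pi_cong) (simp add: algebra_simps)
      then show ?thesis unfolding Suc by (simp only: mult.assoc diff_Suc_1)
    qed simp
    ultimately show "((\<lambda>k. ?d k * e2pi (of_nat (tN k - 1) * t)) has_sum (deriv (tser t) z / \<kappa> - (e2pi (z/2) + e2pi (- (z/2))) / 2) * e2pi (- t)) UNIV"
      by (simp only:)
  qed
  also have "(\<Sum>\<^sub>\<infinity>k. if tN k - 1 = 0 then ?d k else 0) = (\<Sum>\<^sub>\<infinity>k\<in>{1, -2}. ?c k)"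
  proof (rule infsum_cong_neutral)
    fix k :: int assume "k \<in> UNIV - {1, -2}"
    then have "tN k \<noteq> 1" unfolding tN_eq_1_iff by simp
    then show "(if tN k - 1 = 0 then ?d k else 0) = 0" by simp
  next
    fix k :: int assume "k \<in> UNIV \<inter> {1, -2}"
    then have "tN k = 1" unfolding tN_eq_1_iff by simp
    then show "(if tN k - 1 = 0 then ?d k else 0) = ?c k" by simp
  qed simp
  also have "(\<Sum>\<^sub>\<infinity>k\<in>{1, -2}. ?c k) = (\<Sum>k\<in>{1, -2}. ?c k)" by (rule infsum_finite) simp
  also have "\<dots> = - 3 / 2 * (e2pi (3 * z / 2) + e2pi (- (3 * z / 2)))"
  proof -
    have "(-1::complex) powi 1 = -1" "(-1::complex) powi (-2) = 1" by (simp_all add: odd_powi_m1 even_powi_m1)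
    moreover have "(1 + 1/2) * z = 3 * z / 2" "(- 2 + 1/2) * z = - (3 * z / 2)" by simp_all
    ultimately show ?thesis by (simp add: distrib_left)
  qed
  finally show ?thesis .
qed

lemma th_third_nonzero: assumes t: "Im t > 0" shows "th t (1/3) \<noteq> 0"
proof
  assume "th t (1/3) = 0"
  then obtain a b where ab: "(1/3 :: complex) = of_int a * t + of_int b" unfolding th_eq_0_iff[OF t] by blast
  from arg_cong[OF this, of Im] t have "a = 0" by simp
  with ab have "(1 :: complex) = of_int (3 * b)" by (simp add: field_simps)
  then have "1 = 3 * b" by (metis of_int_1 of_int_eq_iff)
  then show False by presburger
qed

text \<open>At a third of a period T(3 z) vanishes and T(2 z) = T(z). So \<open>f4\<close> is 0,
  \<open>f3\<close> is 1, \<open>f1\<close> is the square of \<open>f2\<close>, and P becomes 27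
  minus the cube of \<open>f2\<close>.\<close>

lemma pp_third: assumes t: "Im t > 0" shows "pp t (1/3) = 27 - (6 * deriv (tser t) (1/3) / \<kappa> / dn t) ^ 3"
proof -
  note n = th_third_nonzero[OF t]
  have x23: "th t (2/3) = th t (1/3)" using th_reflect[OF t, of "1/3"] by simp
  have d23: "deriv (th t) (2/3) = - deriv (th t) (1/3)" using deriv_th_reflect[OF t, of "2/3"] by simp
  have q2: "thq 2 t (1/3) = 1" using thq_mult[OF t, of 2 "1/3"] x23 n by simp
  have "th t 1 = 0" using th_lattice_zero[OF t, of 0 1] by simp
  then have f4: "f4 t (1/3) = 0" using thq_mult[OF t, of 3 "1/3"] n by (simp add: f4_def)
  have f3: "f3 t (1/3) = 1" by (simp add: f3_def q2)
  have "deriv (thq 2 t) (1/3) * th t (1/3) = - 3 * deriv (th t) (1/3)"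
  proof -
    have "deriv (thq 2 t) (1/3) * th t (1/3) + deriv (th t) (1/3) = 2 * (- deriv (th t) (1/3))"
      using deriv_thq_2[OF t, of "1/3"] unfolding q2 d23[symmetric] by simp
    moreover have "a = - 3 * b" if "a + b = 2 * (- b)" for a b :: complex
      using arg_cong[OF that, of "\<lambda>x. x - b"] by simp
    ultimately show ?thesis by blast
  qed
  then have f2: "f2 t (1/3) = 6 * deriv (th t) (1/3) / \<kappa>"
    unfolding f2_def rc_def q2 by (simp add: mult.commute)
  have "deriv (tser t) (1/3) = dn t * deriv (th t) (1/3)"
    using deriv_cmult[OF holomorphic_on_imp_differentiable_at[OF th_holomorphic[OF t]], of "1/3" "dn t"]
    by (simp add: tser_th[OF t, abs_def])
  then have v: "6 * deriv (tser t) (1/3) / \<kappa> / dn t = f2 t (1/3)" unfolding f2 using dn_nonzero[OF t] by simp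
  have "f1 t (1/3) = f2 t (1/3) ^ 2" using relation[OF t, of "1/3"] f3 f4 by simp
  then show ?thesis unfolding v pp_def f3 f4 by (simp add: power2_eq_square power3_eq_cube)
qed

text \<open>Six divisions by T^2 leave a form of index 0 and weight 12 that vanishes at the cusp, a
  multiple of Delta. The multiple is found from the coefficient of q at z = 1/3.\<close>

theorem pp_eq: assumes t: "Im t > 0" shows "pp t z = - del t * th t z ^ 12"
proof -
  have "\<exists>c. \<forall>t z. Im t > 0 \<longrightarrow> pp t z = c * del t * th t z ^ 12"
    using JF_cusp_divide[OF JF_pp order_refl]
  proof (elim disjE)
    assume "\<forall>t z. 0 < Im t \<longrightarrow> pp t z = 0"
    then show ?thesis by (intro exI[of _ 0]) simp
  next
    assume "\<exists>\<psi>. 6 \<le> 6 \<and> JF (2 * 6) (6 - 6) \<psi> (\<lambda>_. 0) \<and> (\<forall>t z. 0 < Im t \<longrightarrow> th t z ^ (2 * 6) * \<psi> t z = pp t z)"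
    then obtain \<psi> where \<psi>: "JF 12 0 \<psi> (\<lambda>_. 0)" "\<And>t z. Im t > 0 \<Longrightarrow> th t z ^ 12 * \<psi> t z = pp t z" by auto
    obtain c where c: "\<And>t. Im t > 0 \<Longrightarrow> \<psi> t 0 = c * del t"
      using cusp_form_weight_12[of "\<lambda>t. \<psi> t 0"] JF_qval0[OF \<psi>(1)] JF_at_0_S[OF \<psi>(1)] by blast
    have "pp t z = c * del t * th t z ^ 12" if "Im t > 0" for t z
      using \<psi>(2)[OF that, of z] JF_index_0[OF \<psi>(1) that, of z] c[OF that] by (simp add: mult.commute)
    then show ?thesis by blast
  qed
  then obtain c where c: "\<And>t z. Im t > 0 \<Longrightarrow> pp t z = c * del t * th t z ^ 12" by blast
  have s3: "sy (1/3) ^ 2 = -3"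
  proof -
    have "(e2pi (1/6) + e2pi (- (1/6))) ^ 2 = e2pi (1/3) + 2 + e2pi (- (1/3))"
    proof -
      have "e2pi (1/6) * e2pi (1/6) = e2pi (1/3)" "e2pi (- (1/6)) * e2pi (- (1/6)) = e2pi (- (1/3))" "e2pi (1/6) * e2pi (- (1/6)) = 1"
        unfolding e2pi_add [symmetric] by simp_all
      then show ?thesis unfolding power2_eq_square distrib_left distrib_right mult.commute[of "e2pi (- (1/6))" "e2pi (1/6)"] by (simp only:) simp
    qed
    moreover have "a - 2 + b = -3" if "1 = a + 2 + b" for a b :: complex
      using arg_cong[OF that, of "\<lambda>x. x - 4"] by simp
    ultimately show ?thesis unfolding sy_sq e2pi_sixth power_one by blast
  qed
  let ?v = "\<lambda>t. 6 * deriv (tser t) (1/3) / \<kappa> / dn t"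
  have q1: "qval (\<lambda>t. (deriv (tser t) (1/3) / \<kappa> - 1/2) * e2pi (- t)) 3"
    using qval_deriv_tser[of "1/3"] e2pi_sixth e2pi_half e2pi_minus[of "1/2"] by simp
  have q2: "qval (\<lambda>t. (dn t - 1) * e2pi (- t)) (- 3)"
    using qval_deriv_tser[of 0] by (simp add: dn_def)
  \<comment> \<open>At z = 1/3 the form \<open>f2\<close> begins with 3 + 27 q: the numerator 3 + 18
    q is divided by 1 - 3 q.\<close>
  have qv: "qval (\<lambda>t. (?v t - 3) * e2pi (- t)) 27"
  proof -
    have "qval (\<lambda>t. (6 * ((deriv (tser t) (1/3) / \<kappa> - 1/2) * e2pi (- t)) - 3 * ((dn t - 1) * e2pi (- t))) * inverse (dn t)) ((6 * 3 - 3 * (- 3)) * 1)"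
      by (intro qval_mult qval_diff qval_const q1 q2 qval_inverse_dn)
    also have "?this \<longleftrightarrow> ?thesis"
    proof (rule qval_cong)
      fix t :: complex assume t: "Im t > 0"
      have "(6 * ((A - 1/2) * e) - 3 * ((D - 1) * e)) * inverse D = (6 * A / D - 3) * e" if "D \<noteq> 0" for A D e :: complex
        using that by (simp add: field_simps)
      from this[OF dn_nonzero[OF t], of "deriv (tser t) (1/3) / \<kappa>" "e2pi (- t)"]
      show "(6 * ((deriv (tser t) (1/3) / \<kappa> - 1/2) * e2pi (- t)) - 3 * ((dn t - 1) * e2pi (- t))) * inverse (dn t) = (?v t - 3) * e2pi (- t)"
        by (simp only: times_divide_eq_right)
    qed simp
    finally show ?thesis .
  qed
  have qv0: "qval ?v 3"
  proof -
    have "qval (\<lambda>t. (?v t - 3) * e2pi (- t) * e2pi t + 3) (27 * 0 + 3)"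
      by (intro qval_add qval_mult qv qval_nome qval_const)
    moreover have "e2pi (- t) * e2pi t = 1" for t unfolding e2pi_add [symmetric] by simp
    ultimately show ?thesis by (simp only: mult.assoc) simp
  qed
  have "qval (\<lambda>t. - ((?v t - 3) * e2pi (- t)) * (?v t ^ 2 + 3 * ?v t + 9)) (- 27 * (3 ^ 2 + 3 * 3 + 9))"
    by (intro qval_mult qval_add qval_minus qval_power qval_const qv qv0)
  moreover have "qval (\<lambda>t. c * dn t ^ 8 * th t (1/3) ^ 12) (c * 1 ^ 8 * sy (1/3) ^ 12)"
  proof -
    have "qval (\<lambda>t. th t (1/3) ^ 2) (sy (1/3) ^ 2)"
      by (rule qval_at[OF FE_th_sq]) (intro jfam_power jfam_th)
    then have "qval (\<lambda>t. (th t (1/3) ^ 2) ^ 6) ((sy (1/3) ^ 2) ^ 6)" by (rule qval_power)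
    then have "qval (\<lambda>t. th t (1/3) ^ 12) (sy (1/3) ^ 12)" by (simp add: power_mult [symmetric])
    then show ?thesis by (rule qval_mult[OF qval_mult[OF qval_const qval_power[OF qval_dn]]])
  qed
  moreover have "c * dn t ^ 8 * th t (1/3) ^ 12 = - ((?v t - 3) * e2pi (- t)) * (?v t ^ 2 + 3 * ?v t + 9)" if t: "Im t > 0" for t
  proof -
    have "e2pi (- t) * pp t (1/3) = c * (e2pi (- t) * e2pi t) * dn t ^ 8 * th t (1/3) ^ 12"
      unfolding c[OF t] del_def by (simp only: mult_ac)
    also have "e2pi (- t) * e2pi t = 1" unfolding e2pi_add [symmetric] by simp
    also have "e2pi (- t) * pp t (1/3) = - ((?v t - 3) * e2pi (- t)) * (?v t ^ 2 + 3 * ?v t + 9)"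
    proof -
      have "e * (27 - v ^ 3) = - ((v - 3) * e) * (v ^ 2 + 3 * v + 9)" for e v :: complex
        by (simp add: power2_eq_square power3_eq_cube algebra_simps)
      then show ?thesis unfolding pp_third[OF t] by blast
    qed
    finally show ?thesis by simp
  qed
  \<comment> \<open>Both sides are the coefficient of q at z = 1/3, namely 729 c and -27 times
    27.\<close>
  ultimately have "c * 1 ^ 8 * sy (1/3) ^ 12 = - 27 * (3 ^ 2 + 3 * 3 + 9)"
    by (metis (no_types, lifting) qval_cong qval_unique)
  moreover have "sy (1/3) ^ 12 = 729"
    using arg_cong[OF s3, of "\<lambda>x. x ^ 6"] by (simp add: power_mult [symmetric])
  ultimately have "c = -1" by (simp add: mult.commute minus_equation_iff[of c])
  then show ?thesis using c[OF t] by simp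
qed

text \<open>Division by q lowers every row by one, which the vanishing of the lowest row
  permits.\<close>

lemma FE_nome_shift:
  assumes f: "has_fourier_expansion \<phi> f" and f0: "\<And>l. f 0 l = 0" and S: "\<And>n l. f n l \<in> S"
  shows "FE S (\<lambda>t z. e2pi (- t) * \<phi> t z)"
  unfolding FE_def has_fourier_expansion_def
proof (intro exI[of _ "\<lambda>n l. f (Suc n) l"] conjI allI impI S)
  fix t z :: complex assume t: "Im t > 0"
  let ?g = "\<lambda>(n, l). f n l * e2pi (of_nat n * t) * e2pi (of_int l * z)"
  have "(?g has_sum \<phi> t z) UNIV" using f t unfolding has_fourier_expansion_def by blast
  also have "?this \<longleftrightarrow> (?g has_sum \<phi> t z) (range (\<lambda>(n, l). (Suc n, l)))"
  proof (rule has_sum_cong_neutral)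
    fix p :: "nat \<times> int" assume p: "p \<in> UNIV - range (\<lambda>(n, l). (Suc n, l))"
    obtain n l where nl: "p = (n, l)" by (cases p)
    show "?g p = 0"
    proof (cases n)
      case (Suc k)
      then have "p = (\<lambda>(n, l). (Suc n, l)) (k, l)" using nl by simp
      then show ?thesis using p by blast
    qed (simp add: nl f0)
  qed simp_all
  also have "\<dots> \<longleftrightarrow> ((\<lambda>(n, l). f (Suc n) l * e2pi (of_nat (Suc n) * t) * e2pi (of_int l * z)) has_sum \<phi> t z) UNIV"
    by (subst has_sum_reindex) (simp_all add: inj_on_def o_def case_prod_unfold)
  finally have "((\<lambda>p. e2pi (- t) * (case p of (n, l) \<Rightarrow> f (Suc n) l * e2pi (of_nat (Suc n) * t) * e2pi (of_int l * z))) has_sum e2pi (- t) * \<phi> t z) UNIV"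
    by (rule has_sum_cmult_right)
  moreover have "e2pi (- t) * (case p of (n, l) \<Rightarrow> f (Suc n) l * e2pi (of_nat (Suc n) * t) * e2pi (of_int l * z)) =
    (case p of (n, l) \<Rightarrow> f (Suc n) l * e2pi (of_nat n * t) * e2pi (of_int l * z))" for p
  proof -
    have "e2pi (- t) * e2pi (of_nat (Suc n) * t) = e2pi (of_nat n * t)" for n
      unfolding e2pi_add [symmetric] by (rule e2pi_cong) (simp add: algebra_simps)
    then have "e2pi (- t) * (a * e2pi (of_nat (Suc n) * t) * b) = a * e2pi (of_nat n * t) * b" for n a b
      by (simp only: mult.left_commute[of "e2pi (- t)"] mult.assoc [symmetric]) (simp only: mult_ac)
    then show ?thesis by (simp only: case_prod_unfold)
  qed
  ultimately show "((\<lambda>(n, l). f (Suc n) l * e2pi (of_nat n * t) * e2pi (of_int l * z)) has_sum e2pi (- t) * \<phi> t z) UNIV"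
    by (simp only:)
qed

lemma FE_cusp_shift: assumes "FE S \<phi>" "jfam \<phi> (\<lambda>_. 0)" shows "FE S (\<lambda>t z. e2pi (- t) * \<phi> t z)"
proof -
  obtain f where f: "\<And>n l. f n l \<in> S" "has_fourier_expansion \<phi> f" using assms(1) unfolding FE_def by blast
  show ?thesis
    by (rule FE_nome_shift[OF f(2) _ f(1)]) (use fourier_row_unique[OF f(2) assms(2), of "{}" "\<lambda>_. 0"] in simp)
qed

text \<open>P and T have exact modular laws, so \<open>pp_eq\<close>, read at z = 1/2 where T does
  not vanish, upgrades the law of Delta from norms to values.\<close>

lemma del_modular:
  assumes "a * d - b * c = 1" "Im t > 0"
  shows "del (mob a b c d t) = aut c d t ^ 12 * del t"
proof -
  interpret sl2 a b c d t by unfold_locales (use assms in auto)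
  let ?E = "e2pi (of_nat 6 * of_int c * (1/2)\<^sup>2 / j)"
  have P: "pp g (1/2 / j) = ?E * pp t (1/2)"
  proof -
    have "pp g (1/2 / j) = j ^ 0 * ?E * pp t (1/2)"
      using JF_pp assms unfolding JF_def sl2_law_def g_def j_def by blast
    then show ?thesis by simp
  qed
  have "(th g (1/2 / j) ^ 2 * j ^ 2) ^ 6 = (e2pi (of_int c * (1/2)\<^sup>2 / j) * th t (1/2) ^ 2) ^ 6"
    using th_sq_law[OF assms, of "1/2"] unfolding g_def j_def by simp
  also have "\<dots> = ?E * th t (1/2) ^ 12"
    unfolding power_mult_distrib e2pi_of_nat_mult [symmetric] power_mult [symmetric] by (simp add: mult.assoc)
  finally have T: "th g (1/2 / j) ^ 12 * j ^ 12 = ?E * th t (1/2) ^ 12"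
    by (simp add: power_mult_distrib power_mult [symmetric])
  have "del g * (?E * th t (1/2) ^ 12) = (del g * th g (1/2 / j) ^ 12) * j ^ 12"
    unfolding T [symmetric] by (simp only: mult.assoc)
  also have "del g * th g (1/2 / j) ^ 12 = ?E * (del t * th t (1/2) ^ 12)"
    using P unfolding pp_eq[OF Im_g] pp_eq[OF t] by simp
  finally have "(?E * th t (1/2) ^ 12) * del g = (?E * th t (1/2) ^ 12) * (j ^ 12 * del t)" by (simp only: mult_ac)
  then have "del g = j ^ 12 * del t" using th_half_nonzero[OF t] by simp
  then show ?thesis unfolding g_def j_def .
qed

text \<open>The cofactor of T^12 has weight 12 and vanishes at the cusp, so dividing it by -Delta
  gives a form of weight 0 that is regular there. For integrality, theta^12 is monic, and its
  product with the quotient is an integral series times \<phi> / q.\<close>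

lemma JZ_cusp_divide:
  assumes \<phi>: "\<phi> \<in> JZ m" and J: "JF 0 m \<phi> (\<lambda>_. 0)"
  shows "(\<forall>t z. \<phi> t z = 0) \<or> (\<exists>\<phi>'. 6 \<le> m \<and> \<phi>' \<in> JZ (m - 6) \<and> (\<forall>t z. \<phi> t z = cut pp t z * \<phi>' t z))"
  using JF_cusp_divide[OF J order_refl]
proof (elim disjE)
  assume "\<forall>t z. 0 < Im t \<longrightarrow> \<phi> t z = 0"
  then show ?thesis using \<phi> unfolding JZ_iff by (metis linorder_not_less)
next
  assume "\<exists>\<psi>. 6 \<le> m \<and> JF (2 * 6) (m - 6) \<psi> (\<lambda>_. 0) \<and> (\<forall>t z. 0 < Im t \<longrightarrow> th t z ^ (2 * 6) * \<psi> t z = \<phi> t z)"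
  then obtain \<psi> where m: "6 \<le> m" and \<psi>: "JF 12 (m - 6) \<psi> (\<lambda>_. 0)" and e: "\<And>t z. Im t > 0 \<Longrightarrow> th t z ^ 12 * \<psi> t z = \<phi> t z"
    by auto
  define \<phi>' where "\<phi>' = cut (\<lambda>t z. inverse (- del t) * \<psi> t z)"
  have jp: "jfam \<psi> (\<lambda>_. 0)" and jf: "jfam \<phi> (\<lambda>_. 0)" using \<psi> J by (simp_all add: JF_def EF_def)
  have "FE UNIV \<psi>" using \<psi> EF_FE unfolding JF_def by blast
  from FE_mult[OF coeff_ring_UNIV FE_inverse_dn[of 8] FE_minus[OF coeff_ring_UNIV FE_cusp_shift[OF this jp]]]
  have "FE UNIV \<phi>'"
    by (rule FE_congI[rotated]) (simp add: \<phi>'_def cut_def del_def e2pi_minus power_inverse mult_ac)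
  then obtain f where f: "has_fourier_expansion \<phi>' f" unfolding FE_def by blast
  let ?p = "\<lambda>z. \<Sum>\<^sub>\<infinity>l. f 0 l * e2pi (of_int l * z)"
  have JF': "JF 0 (m - 6) \<phi>' ?p"
    unfolding JF_def EF_def
  proof (intro conjI allI impI)
    show "jfam \<phi>' ?p" by (rule has_fourier_expansion_jfam[OF f])
    show "?p (z + 1) = ?p z" for z by (simp add: ring_distribs e2pi_add)
    fix t :: complex assume t: "Im t > 0"
    have E: "ell t (m - 6) (\<psi> t)" "\<psi> t (- z) = \<psi> t z" for z using \<psi> t unfolding JF_def EF_def by blast+
    have c: "\<phi>' t = (\<lambda>z. inverse (- del t) * \<psi> t z)" using t by (auto simp: \<phi>'_def cut_def)
    show "ell t (m - 6) (\<phi>' t)" unfolding c by (rule ell_cmult[OF E(1)])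
    show "\<phi>' t (- z) = \<phi>' t z" for z unfolding c E(2) ..
  next
    show "sl2_law 0 (m - 6) \<phi>'"
      unfolding sl2_law_def
    proof (intro allI impI)
      fix a b c d :: int and t z :: complex assume det: "a * d - b * c = 1" and t: "Im t > 0"
      interpret sl2 a b c d t by unfold_locales (use det t in auto)
      have "\<psi> g (z / j) = j ^ 12 * e2pi (of_nat (m - 6) * of_int c * z\<^sup>2 / j) * \<psi> t z"
        using \<psi> det t unfolding JF_def sl2_law_def g_def j_def by blast
      moreover have "del g = j ^ 12 * del t" using del_modular[OF det t] unfolding g_def j_def .
      ultimately have "\<phi>' g (z / j) = e2pi (of_nat (m - 6) * of_int c * z\<^sup>2 / j) * \<phi>' t z"
        using Im_g t j_nonzero del_nonzero[OF t] by (simp add: \<phi>'_def cut_def)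
      then show "\<phi>' (mob a b c d t) (z / aut c d t) =
        aut c d t ^ 0 * e2pi (of_nat (m - 6) * of_int c * z\<^sup>2 / aut c d t) * \<phi>' t z"
        unfolding g_def j_def by simp
    qed
  qed
  have z: "Im t \<le> 0 \<Longrightarrow> \<phi>' t z = 0" for t z by (simp add: \<phi>'_def cut_def)
  have "FE \<int> \<phi>'"
  proof (rule weak_cancel_lead[OF JF_imp_weak_jacobi[OF JF' z] lead_tser[of 6]])
    have "FE \<int> \<phi>" using \<phi> JZ_iff by blast
    from FE_mult[OF coeff_ring_Ints FE_dn[of 4] FE_minus[OF coeff_ring_Ints FE_cusp_shift[OF this jf]]]
    show "FE \<int> (\<lambda>t z. tser t z ^ (2 * 6) * \<phi>' t z)"
    proof (rule FE_congI[rotated])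
      fix t z :: complex assume t: "Im t > 0"
      have "(D * x) ^ (2 * 6) * (inverse (- (E * D ^ 8)) * w) = D ^ 4 * - (inverse E * (x ^ 12 * w))" if "D \<noteq> 0" "E \<noteq> 0" for D E x w :: complex
      proof -
        have "D ^ 12 = D ^ 4 * D ^ 8" by (simp add: power_add [symmetric])
        then show ?thesis using that by (simp add: power_mult_distrib field_simps)
      qed
      from this[OF dn_nonzero[OF t] e2pi_nonzero]
      show "tser t z ^ (2 * 6) * \<phi>' t z = dn t ^ 4 * - (e2pi (- t) * \<phi> t z)"
        unfolding e[OF t, symmetric] tser_th[OF t] e2pi_minus using t by (simp add: \<phi>'_def cut_def del_def)
    qed
  qed
  then have "\<phi>' \<in> JZ (m - 6)" unfolding JZ_iff using JF' z by blast
  moreover have "\<phi> t z = cut pp t z * \<phi>' t z" for t z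
  proof (cases "Im t > 0")
    case t: True
    have "- D * x * (inverse (- D) * w) = x * w" if "D \<noteq> 0" for D x w :: complex using that by simp
    from this[OF del_nonzero[OF t]] show ?thesis
      using t unfolding e[OF t, symmetric] by (simp only: cut_def \<phi>'_def pp_eq[OF t] if_True)
  next
    case False
    then show ?thesis using \<phi> unfolding JZ_iff by (simp add: cut_def)
  qed
  ultimately show ?thesis using m by blast
qed

subsection \<open>The constant row as a polynomial in \<open>y - 2 + y\<^sup>-\<^sup>1\<close>\<close>

abbreviation int_poly :: "complex poly \<Rightarrow> bool" where "int_poly Q \<equiv> (\<forall>k. poly.coeff Q k \<in> \<int>)"

lemma uc_minus: "uc k (- l) = uc k l"
proof (cases "\<bar>l\<bar> \<le> int k")
  case True
  let ?n = "nat (int k + l)"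
  have "nat (int k + - l) = 2 * k - ?n" "?n \<le> 2 * k" using True by auto
  moreover have "(2 * k choose (2 * k - ?n)) = (2 * k choose ?n)"
    using \<open>?n \<le> 2 * k\<close> by (rule binomial_symmetric [symmetric])
  moreover have "(-1::int) ^ (2 * k - ?n) = (-1) ^ ?n"
    using \<open>?n \<le> 2 * k\<close> by (simp add: minus_one_power_iff)
  ultimately show ?thesis using True unfolding uc_def by simp
qed (simp add: uc_def)

text \<open>Subtract the top coefficient times the power of u of the same degree, which is monic and
  symmetric, and descend. The coefficients stay integral.\<close>

lemma symmetric_row_poly:
  assumes "\<And>l. a (- l) = a l" "\<And>l. a l \<in> (\<int> :: complex set)"
  shows "\<exists>Q. Polynomial.degree Q \<le> m \<and> int_poly Q \<and> (\<forall>z. (\<Sum>l\<in>{- int m..int m}. a l * e2pi (of_int l * z)) = poly Q (sy z ^ 2))"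
  using assms
proof (induction m arbitrary: a)
  case 0
  then show ?case by (intro exI[of _ "[:a 0:]"]) (auto simp: coeff_pCons split: nat.split)
next
  case (Suc m)
  let ?M = "Suc m"
  let ?b = "\<lambda>l. a l - a (int ?M) * of_int (uc ?M l)"
  obtain Q where Q: "Polynomial.degree Q \<le> m" "int_poly Q" "\<And>z. (\<Sum>l\<in>{- int m..int m}. ?b l * e2pi (of_int l * z)) = poly Q (sy z ^ 2)"
    using Suc.IH[of ?b] Suc.prems by (auto simp: uc_minus)
  have b0: "?b l = 0" if "l \<in> {- int ?M..int ?M} - {- int m..int m}" for l
  proof -
    have "l = int ?M \<or> l = - int ?M" using that by auto
    then show ?thesis using Suc.prems(1)[of "int ?M"] uc_minus[of ?M "int ?M"] uc_top[of ?M] by (auto simp del: of_nat_Suc)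
  qed
  show ?case
  proof (intro exI[of _ "Q + Polynomial.monom (a (int ?M)) ?M"] conjI allI)
    show "Polynomial.degree (Q + Polynomial.monom (a (int ?M)) ?M) \<le> ?M"
      by (rule degree_add_le) (use Q(1) degree_monom_le in auto)
    show "poly.coeff (Q + Polynomial.monom (a (int ?M)) ?M) k \<in> \<int>" for k
      using Q(2) Suc.prems(2) by (simp del: of_nat_Suc)
    fix z
    have "(\<Sum>l\<in>{- int ?M..int ?M}. a l * e2pi (of_int l * z)) =
      (\<Sum>l\<in>{- int ?M..int ?M}. ?b l * e2pi (of_int l * z)) + a (int ?M) * (\<Sum>l\<in>{- int ?M..int ?M}. of_int (uc ?M l) * e2pi (of_int l * z))"
      unfolding sum_distrib_left sum.distrib [symmetric] by (rule sum.cong) (simp_all add: left_diff_distrib mult.assoc del: of_nat_Suc)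
    also have "(\<Sum>l\<in>{- int ?M..int ?M}. ?b l * e2pi (of_int l * z)) = (\<Sum>l\<in>{- int m..int m}. ?b l * e2pi (of_int l * z))"
    proof (rule sum.mono_neutral_right)
      show "\<forall>l\<in>{- int ?M..int ?M} - {- int m..int m}. ?b l * e2pi (of_int l * z) = 0"
        by (intro ballI) (simp only: b0 mult_zero_left)
    qed auto
    finally show "(\<Sum>l\<in>{- int ?M..int ?M}. a l * e2pi (of_int l * z)) = poly (Q + Polynomial.monom (a (int ?M)) ?M) (sy z ^ 2)"
      unfolding Q(3) sy_power_sum [symmetric] by (simp only: poly_add poly_monom power_mult)
  qed
qed

text \<open>y + 1/y = x + 2 is a quadratic equation for y with nonzero roots.\<close>

lemma sy_sq_surj: obtains z where "sy z ^ 2 = x"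
proof -
  define r where "r = csqrt ((x + 2) ^ 2 - 4)"
  define y where "y = (x + 2 + r) / 2"
  have r2: "r * r = (x + 2) ^ 2 - 4" unfolding r_def power2_eq_square [symmetric] by simp
  have y2: "y * (x + 2 - y) = 1"
  proof -
    have "y * (x + 2 - y) = ((x + 2) ^ 2 - r * r) / 4"
      by (simp add: y_def power2_eq_square field_simps)
    then show ?thesis unfolding r2 by simp
  qed
  then have "y \<noteq> 0" by auto
  then obtain z where z: "e2pi z = y" using e2pi_surj by blast
  have "e2pi (- z) = x + 2 - y" unfolding e2pi_minus z by (rule inverse_unique[OF y2])
  then have "sy z ^ 2 = x" unfolding sy_sq z by simp
  then show ?thesis by (rule that)
qed

text \<open>Since u takes every complex value, agreement of rows is agreement of
  polynomials.\<close>

lemma row_poly_unique: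
  assumes "\<And>z. poly Q (sy z ^ 2) = poly R (sy z ^ 2)" shows "Q = R"
proof -
  have "poly Q x = poly R x" for x using assms sy_sq_surj[of x] by metis
  then show ?thesis by (simp add: poly_eq_poly_eq_iff [symmetric] ext)
qed

lemma JZ_row_poly:
  assumes "\<phi> \<in> JZ m"
  obtains Q where "Polynomial.degree Q \<le> m" "int_poly Q" "JF 0 m \<phi> (\<lambda>z. poly Q (sy z ^ 2))"
proof -
  have w: "weak_jacobi_form m \<phi>" using assms by (simp add: JZ_def)
  then obtain f where f: "has_fourier_expansion \<phi> f" unfolding weak_jacobi_form_def by blast
  have i: "f n l \<in> \<int>" for n l using assms jcoeff_eq[OF f] by (simp add: JZ_def)
  have s: "(\<Sum>\<^sub>\<infinity>l. f 0 l * e2pi (of_int l * z)) = (\<Sum>l\<in>{- int m..int m}. f 0 l * e2pi (of_int l * z))" for z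
  proof -
    have "(\<Sum>\<^sub>\<infinity>l. f 0 l * e2pi (of_int l * z)) = (\<Sum>\<^sub>\<infinity>l\<in>{- int m..int m}. f 0 l * e2pi (of_int l * z))"
    proof (rule infsum_cong_neutral)
      fix l assume "l \<in> UNIV - {- int m..int m}"
      then have "\<bar>l\<bar> > int m" by auto
      then show "f 0 l * e2pi (of_int l * z) = 0" using weak_row0[OF w f] by simp
    qed auto
    then show ?thesis by (simp add: infsum_finite)
  qed
  obtain Q where "Polynomial.degree Q \<le> m" "int_poly Q" "\<forall>z. (\<Sum>l\<in>{- int m..int m}. f 0 l * e2pi (of_int l * z)) = poly Q (sy z ^ 2)"
    using symmetric_row_poly[of "f 0" m] weak_coeff_even[OF w f] i by blast
  then show ?thesis using weak_jacobi_imp_JF[OF w f] that unfolding s by simp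
qed

text \<open>A modular form of weight 0 is constant: minus its cusp value it is a cusp form of weight
  0.\<close>

lemma JF_weight_0_at_0: assumes "JF 0 m \<phi> p" "Im t > 0" shows "\<phi> t 0 = p 0"
proof -
  have "qval (\<lambda>t. \<phi> t 0 - p 0) (p 0 - p 0)" by (intro qval_diff qval_const JF_qval0[OF assms(1)])
  then have "\<phi> t 0 - p 0 = 0"
    using cusp_form_small_weight_zero[of "\<lambda>t. \<phi> t 0 - p 0" 0 t] JF_at_0_S[OF assms(1)] assms(2) by simp
  then show ?thesis by simp
qed

text \<open>Subtracting a multiple of the \<open>m\<close>-th power of the index 1 form leaves a form divisible by
  \<open>th\<^sup>2\<close>, and the quotient restricts to a modular form of weight 2 at \<open>z = 0\<close>.\<close>

lemma row_poly_constraint: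
  assumes J: "JF 0 m \<phi> (\<lambda>z. poly Q (sy z ^ 2))" and d: "Polynomial.degree Q \<le> m"
  shows "of_nat m * poly.coeff Q 0 = 12 * poly.coeff Q 1"
proof (cases m)
  case 0
  then show ?thesis using d by (simp add: coeff_eq_0)
next
  case (Suc n)
  define R where "R = Q - Polynomial.smult (poly.coeff Q 0 / 12 ^ m) ([:12, 1:] ^ m)"
  have R: "poly R x = poly Q x - poly.coeff Q 0 / 12 ^ m * (12 + x) ^ m" for x by (simp add: R_def poly_power)
  have "JF 0 m (\<lambda>t z. \<phi> t z - poly.coeff Q 0 / 12 ^ m * f1 t z ^ m) (\<lambda>z. poly Q (sy z ^ 2) - poly.coeff Q 0 / 12 ^ m * (12 + sy z ^ 2) ^ m)"
    using JF_diff[OF J JF_cmult[OF JF_power[OF JF_f1, of m, simplified]]] .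
  then have J': "JF 0 (Suc n) (\<lambda>t z. \<phi> t z - poly.coeff Q 0 / 12 ^ m * f1 t z ^ m) (\<lambda>z. poly R (sy z ^ 2))"
    unfolding R Suc .
  have R0: "poly R 0 = 0" unfolding R by (simp add: poly_0_coeff_0)
  have "\<phi> t 0 - poly.coeff Q 0 / 12 ^ m * f1 t 0 ^ m = 0" if "Im t > 0" for t
    using JF_weight_0_at_0[OF J' that] by (simp add: R0)
  from JF_divide[OF J' this] obtain \<psi> r where \<psi>: "JF 2 n \<psi> r" "\<And>z. sy z ^ 2 * r z = poly R (sy z ^ 2)"
    by (metis add_0)
  have "r 0 = 0"
    using modular_weight_2_zero[OF JF_qval0[OF \<psi>(1)] JF_at_0_S[OF \<psi>(1)]] .
  obtain R1 where R1: "R = pCons 0 R1" using R0 by (cases R) auto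
  have "r z = poly R1 (sy z ^ 2)" for z
  proof (rule sy_cancel[where A = r and B = "\<lambda>z. poly R1 (sy z ^ 2)"])
    show "r is_entire" using \<psi>(1) jfam_hol_p unfolding JF_def EF_def by blast
    show "(\<lambda>z. poly R1 (sy z ^ 2)) is_entire" by (intro holomorphic_intros sy_holomorphic)
    show "r z * sy z = poly R1 (sy z ^ 2) * sy z" for z
      using \<psi>(2)[of z] by (cases "sy z = 0") (simp_all add: R1 power2_eq_square)
  qed
  from this[of 0] have "poly.coeff R 1 = 0" using \<open>r 0 = 0\<close> by (simp add: R1 poly_0_coeff_0)
  moreover have "poly.coeff ([:12, 1:] ^ m) 1 = of_nat m * (12::complex) ^ n"
  proof -
    have "poly.coeff ([:12, 1:] ^ k) 0 = (12::complex) ^ k" for k by (induction k) simp_all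
    then have "poly.coeff ([:12, 1:] ^ Suc k) 1 = of_nat (Suc k) * (12::complex) ^ k" for k
      by (induction k) (simp_all add: algebra_simps)
    then show ?thesis unfolding Suc .
  qed
  ultimately have "poly.coeff Q 1 - poly.coeff Q 0 / 12 ^ m * (of_nat m * 12 ^ n) = 0"
    by (simp only: R_def coeff_diff Polynomial.coeff_smult)
  moreover have "12 ^ m = (12 * 12 ^ n :: complex)" by (simp add: Suc)
  moreover have "M * a = 12 * b" if "b - a / (12 * P) * (M * P) = 0" "P \<noteq> 0" for a b M P :: complex
    using that by (simp add: field_simps)
  ultimately show ?thesis by (metis power_not_zero zero_neq_numeral)
qed

subsection \<open>Generation\<close>

lemma JZ_zero: "(\<lambda>t z. 0) \<in> JZ m"
  unfolding JZ_iff using FE_const[OF coeff_ring_Ints, of 0] JF_cmult[of 0 m _ _ 0, OF JF_power[OF JF_f1, of m, simplified]] by auto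

lemma JZ_one: "cut (\<lambda>t z. 1) \<in> JZ 0"
  by (rule cut_JZ[OF JF_const]) (rule FE_congI[OF _ FE_const[OF coeff_ring_Ints, of 1]], simp_all add: cut_def)

lemma JZ_add: "\<phi> \<in> JZ m \<Longrightarrow> \<psi> \<in> JZ m \<Longrightarrow> (\<lambda>t z. \<phi> t z + \<psi> t z) \<in> JZ m"
  unfolding JZ_iff by (auto intro: FE_add exI[where P = "JF 0 m (\<lambda>t z. \<phi> t z + \<psi> t z)", OF JF_add])

lemma JZ_minus: "\<phi> \<in> JZ m \<Longrightarrow> (\<lambda>t z. - \<phi> t z) \<in> JZ m"
  unfolding JZ_iff using JF_cmult[of 0 m \<phi> _ "-1"] by (auto intro!: FE_minus)

lemma JZ_mult: "\<phi> \<in> JZ m \<Longrightarrow> \<psi> \<in> JZ n \<Longrightarrow> (\<lambda>t z. \<phi> t z * \<psi> t z) \<in> JZ (m + n)"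
  unfolding JZ_iff by (auto intro: FE_mult exI[where P = "JF 0 (m + n) (\<lambda>t z. \<phi> t z * \<psi> t z)", OF JF_mult[of 0 m \<phi> _ 0 n, simplified]])

text \<open>Integral polynomial expressions in the generators, homogeneous by construction because
  every rule tracks the index.\<close>

inductive gen :: "nat \<Rightarrow> jform \<Rightarrow> bool" where
  zero: "gen m (\<lambda>t z. 0)"
| one: "gen 0 (cut (\<lambda>t z. 1))"
| f1: "gen 1 (cut f1)"
| f2: "gen 2 (cut f2)"
| f3: "gen 3 (cut f3)"
| f4: "gen 4 (cut f4)"
| add: "gen m \<phi> \<Longrightarrow> gen m \<psi> \<Longrightarrow> gen m (\<lambda>t z. \<phi> t z + \<psi> t z)"
| minus: "gen m \<phi> \<Longrightarrow> gen m (\<lambda>t z. - \<phi> t z)"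
| mult: "gen m \<phi> \<Longrightarrow> gen n \<psi> \<Longrightarrow> gen (m + n) (\<lambda>t z. \<phi> t z * \<psi> t z)"

lemma gen_JZ: "gen m \<phi> \<Longrightarrow> \<phi> \<in> JZ m"
  by (induction rule: gen.induct)
     (auto simp del: One_nat_def intro: JZ_zero JZ_one JZ_add JZ_minus JZ_mult cut_JZ[OF JF_f1] cut_JZ[OF JF_f2] cut_JZ[OF JF_f3] cut_JZ[OF JF_f4]
       FE_f1_Ints FE_f2 FE_f3 FE_f4)

lemma gen_of_nat: "gen m \<phi> \<Longrightarrow> gen m (\<lambda>t z. of_nat n * \<phi> t z)"
proof (induction n)
  case (Suc n)
  then show ?case using gen.add[of m \<phi> "\<lambda>t z. of_nat n * \<phi> t z"] by (simp add: distrib_right)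
qed (simp add: gen.zero)

lemma gen_of_int: assumes "gen m \<phi>" shows "gen m (\<lambda>t z. of_int n * \<phi> t z)"
proof (cases "n \<ge> 0")
  case True
  then show ?thesis using gen_of_nat[OF assms, of "nat n"] by simp
next
  case False
  then show ?thesis using gen.minus[OF gen_of_nat[OF assms, of "nat (- n)"]] by simp
qed

lemma gen_sum: "finite I \<Longrightarrow> (\<And>i. i \<in> I \<Longrightarrow> gen m (\<phi> i)) \<Longrightarrow> gen m (\<lambda>t z. \<Sum>i\<in>I. \<phi> i t z)"
  by (induction I rule: finite_induct) (auto intro: gen.zero gen.add)

text \<open>The q^0-terms realised by such expressions. Generation modulo forms with zero q^0-term
  becomes arithmetic with polynomials in u.\<close>

definition has :: "nat \<Rightarrow> complex poly \<Rightarrow> bool" where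
  "has m Q \<longleftrightarrow> (\<exists>\<phi>. gen m \<phi> \<and> JF 0 m \<phi> (\<lambda>z. poly Q (sy z ^ 2)))"

lemma hasI:
  assumes "gen m \<phi>" "JF 0 m \<phi> p" "\<And>z. p z = poly Q (sy z ^ 2)" shows "has m Q"
proof -
  have "p = (\<lambda>z. poly Q (sy z ^ 2))" using assms(3) by blast
  then show ?thesis using assms(1,2) unfolding has_def by blast
qed

lemma hasE: assumes "has m Q" obtains \<phi> where "gen m \<phi>" "JF 0 m \<phi> (\<lambda>z. poly Q (sy z ^ 2))"
  using assms unfolding has_def by blast

lemma has_add: assumes "has m Q" "has m R" shows "has m (Q + R)"
proof -
  obtain \<phi> \<psi> where "gen m \<phi>" "JF 0 m \<phi> (\<lambda>z. poly Q (sy z ^ 2))" "gen m \<psi>" "JF 0 m \<psi> (\<lambda>z. poly R (sy z ^ 2))"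
    using assms by (elim hasE)
  then show ?thesis by (intro hasI[OF gen.add JF_add]) (assumption | simp)+
qed

lemma has_smult: assumes "has m Q" shows "has m (Polynomial.smult (of_int n) Q)"
proof -
  obtain \<phi> where "gen m \<phi>" "JF 0 m \<phi> (\<lambda>z. poly Q (sy z ^ 2))" using assms by (elim hasE)
  then show ?thesis by (intro hasI[OF gen_of_int[where n = n] JF_cmult]) (assumption | simp)+
qed

lemma has_diff: assumes "has m Q" "has m R" "P = Q - Polynomial.smult (of_int c) R" shows "has m P"
  using has_add[OF assms(1) has_smult[OF assms(2), of "- c"]] assms(3) by simp

lemma has_mult: assumes "has m Q" "has n R" "k = m + n" "P = Q * R" shows "has k P"
proof -
  obtain \<phi> \<psi> where "gen m \<phi>" "JF 0 m \<phi> (\<lambda>z. poly Q (sy z ^ 2))" "gen n \<psi>" "JF 0 n \<psi> (\<lambda>z. poly R (sy z ^ 2))"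
    using assms by (elim hasE)
  then have "has (m + n) (Q * R)" by (intro hasI[OF gen.mult JF_mult[of 0 m _ _ 0 n, simplified]]) (assumption | simp)+
  then show ?thesis by (simp only: assms(3,4))
qed

lemma has_f1: "has 1 [:12, 1:]" and has_f2: "has 2 [:6, 1:]" and has_f3: "has 3 [:4, 1:]" and has_f4: "has 4 [:3, 1:]"
  by (rule hasI[OF gen.f1 cut_JF[OF JF_f1]], simp) (rule hasI[OF gen.f2 cut_JF[OF JF_f2]] hasI[OF gen.f3 cut_JF[OF JF_f3]] hasI[OF gen.f4 cut_JF[OF JF_f4]], simp)+

text \<open>In index 5 the products \<open>f1 f4\<close> and \<open>f2 f3\<close> have the same
  quadratic term, so their difference is linear in u.\<close>

lemma has_5: "has 5 [:12, 5:]"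
proof (rule has_diff)
  show "has 5 [:36, 15, 1:]" by (rule has_mult[OF has_f1 has_f4]) simp_all
  show "has 5 [:24, 10, 1:]" by (rule has_mult[OF has_f2 has_f3]) simp_all
  show "[:12, 5:] = [:36, 15, 1:] - Polynomial.smult (of_int 1) [:24, 10, 1 :: complex:]" by simp
qed

text \<open>In index 2 to 5 a product of two linear rows is corrected by a multiple of a linear one.
  From index 6 on, u^2 (u + 4) - u^2 (u + 3) = u^2 combines the indices m - 3 and m - 4.\<close>

lemma has_square: assumes "m \<ge> 2" shows "has m [:0, 0, 1:]"
  using assms
proof (induction m rule: less_induct)
  case (less m)
  consider "m = 2" | "m = 3" | "m = 4" | "m = 5" | "m \<ge> 6" using less.prems by linarith
  then show ?case
  proof cases
    case 1
    have "has m [:144, 24, 1:]" by (rule has_mult[OF has_f1 has_f1]) (simp_all add: 1)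
    from has_diff[OF this, of "[:6, 1:]" _ 24] show ?thesis using has_f2 1 by simp
  next
    case 2
    have "has m [:72, 18, 1:]" by (rule has_mult[OF has_f1 has_f2]) (simp_all add: 2)
    from has_diff[OF this, of "[:4, 1:]" _ 18] show ?thesis using has_f3 2 by simp
  next
    case 3
    have "has m [:48, 16, 1:]" by (rule has_mult[OF has_f1 has_f3]) (simp_all add: 3)
    from has_diff[OF this, of "[:3, 1:]" _ 16] show ?thesis using has_f4 3 by simp
  next
    case 4
    have "has m [:36, 15, 1:]" by (rule has_mult[OF has_f1 has_f4]) (simp_all add: 4)
    from has_diff[OF this, of "[:12, 5:]" _ 3] show ?thesis using has_5 4 by simp
  next
    case 5
    have "has m [:0, 0, 4, 1:]" by (rule has_mult[OF less(1)[of "m - 3"] has_f3]) (use 5 in simp_all)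
    moreover have "has m [:0, 0, 3, 1:]" by (rule has_mult[OF less(1)[of "m - 4"] has_f4]) (use 5 in simp_all)
    ultimately show ?thesis by (rule has_diff[where c = 1]) simp
  qed
qed

text \<open>u^(k+1) = u^k (u + 12) - 12 u^k, where the first u^k is taken in index m - 1.\<close>

lemma has_monom: "2 \<le> k \<Longrightarrow> k \<le> m \<Longrightarrow> has m (Polynomial.monom 1 k)"
proof (induction k arbitrary: m rule: dec_induct)
  case base
  then show ?case using has_square[of m] by (simp add: monom_Suc monom_0 numeral_2_eq_2)
next
  case (step k)
  have "has m (Polynomial.monom 1 k * [:12, 1:])" by (rule has_mult[OF step(3)[of "m - 1"] has_f1]) (use step in auto)
  moreover have "has m (Polynomial.monom 1 k)" by (rule step) (use step in auto)
  ultimately show ?case by (rule has_diff[where c = 12]) (simp add: monom_Suc mult.commute)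
qed

text \<open>The greatest common divisors depend only on m modulo 12, so twelve explicit combinations
  suffice. The numerators 6, 4, 3 are 12 / a for the products of indices a and m - a in
  \<open>has_gpoly\<close>.\<close>

lemma bezout_12:
  assumes "5 \<le> m"
  obtains x y z :: int where
    "of_int x * 6 / of_nat (gcd 12 (m - 2)) + of_int y * 4 / of_nat (gcd 12 (m - 3)) + of_int z * 3 / of_nat (gcd 12 (m - 4)) = 1 / (of_nat (gcd 12 m) :: complex)"
proof -
  \<comment> \<open>Adding 12 - a instead of subtracting a avoids truncated subtraction on
    residues.\<close>
  have g: "gcd 12 (m - a) = gcd 12 ((m mod 12 + (12 - a)) mod 12)" if "a \<le> 4" for a
  proof -
    have "gcd 12 (m - a) = gcd 12 ((m - a) mod 12)" by (simp add: gcd_red_nat[of 12 "m - a"] gcd.commute)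
    also have "(m - a) mod 12 = (m - a + 12) mod 12" by simp
    also have "m - a + 12 = m + (12 - a)" using assms that by simp
    finally show ?thesis by (simp only: mod_add_left_eq)
  qed
  define r where "r = m mod 12"
  have "r < 12" by (simp add: r_def)
  then have "r = 0 \<or> r = 1 \<or> r = 2 \<or> r = 3 \<or> r = 4 \<or> r = 5 \<or> r = 6 \<or> r = 7 \<or> r = 8 \<or> r = 9 \<or> r = 10 \<or> r = 11"
    by arith
  then have "\<exists>x y z :: int. of_int x * 6 / of_nat (gcd 12 ((r + (12 - 2)) mod 12)) + of_int y * 4 / of_nat (gcd 12 ((r + (12 - 3)) mod 12)) +
      of_int z * 3 / of_nat (gcd 12 ((r + (12 - 4)) mod 12)) = 1 / (of_nat (gcd 12 ((r + (12 - 0)) mod 12)) :: complex)"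
  proof (elim disjE, goal_cases)
    case 1 then show ?thesis by (intro exI[of _ 0] exI[of _ 4] exI[of _ "-7"]) (simp add: gcd_non_0_nat)
  next
    case 2 then show ?thesis by (intro exI[of _ 0] exI[of _ 0] exI[of _ "1"]) (simp add: gcd_non_0_nat)
  next
    case 3 then show ?thesis by (intro exI[of _ 1] exI[of _ 0] exI[of _ "0"]) (simp add: gcd_non_0_nat)
  next
    case 4 then show ?thesis by (intro exI[of _ 0] exI[of _ 1] exI[of _ "0"]) (simp add: gcd_non_0_nat)
  next
    case 5 then show ?thesis by (intro exI[of _ 0] exI[of _ 0] exI[of _ "1"]) (simp add: gcd_non_0_nat)
  next
    case 6 then show ?thesis by (intro exI[of _ 0] exI[of _ "-1"] exI[of _ "1"]) (simp add: gcd_non_0_nat)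
  next
    case 7 then show ?thesis by (intro exI[of _ 1] exI[of _ "-1"] exI[of _ "0"]) (simp add: gcd_non_0_nat)
  next
    case 8 then show ?thesis by (intro exI[of _ 0] exI[of _ 1] exI[of _ "0"]) (simp add: gcd_non_0_nat)
  next
    case 9 then show ?thesis by (intro exI[of _ 1] exI[of _ 0] exI[of _ "-1"]) (simp add: gcd_non_0_nat)
  next
    case 10 then show ?thesis by (intro exI[of _ 0] exI[of _ "-4"] exI[of _ "1"]) (simp add: gcd_non_0_nat)
  next
    case 11 then show ?thesis by (intro exI[of _ 3] exI[of _ "-1"] exI[of _ "0"]) (simp add: gcd_non_0_nat)
  next
    case 12 then show ?thesis by (intro exI[of _ 0] exI[of _ 1] exI[of _ "0"]) (simp add: gcd_non_0_nat)
  qed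
  then show ?thesis using that g[of 2] g[of 3] g[of 4] g[of 0] unfolding r_def by auto
qed

text \<open>The primitive linear integral solution of m Q(0) = 12 Q'(0).\<close>

definition gpoly :: "nat \<Rightarrow> complex poly" where
  "gpoly m = Polynomial.smult (1 / of_nat (gcd 12 m)) [:12, of_nat m:]"

text \<open>Up to index 4 these are the rows of the generators. Beyond, splitting m as a + (m - a)
  with a in {2, 3, 4} yields three multiples of 12 + m u, and \<open>bezout_12\<close> combines them
  into the primitive one.\<close>

lemma has_gpoly: assumes "m \<ge> 1" shows "has m (gpoly m)"
  using assms
proof (induction m rule: less_induct)
  case (less m)
  consider "m = 1" | "m = 2" | "m = 3" | "m = 4" | "m \<ge> 5" using less.prems by linarith
  then show ?case
  proof cases
    case 1
    then show ?thesis using has_f1 by (simp add: gpoly_def)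
  next
    case 2
    then show ?thesis using has_f2 by (simp add: gpoly_def gcd_non_0_nat)
  next
    case 3
    then show ?thesis using has_f3 by (simp add: gpoly_def gcd_non_0_nat)
  next
    case 4
    then show ?thesis using has_f4 by (simp add: gpoly_def gcd_non_0_nat)
  next
    case m: 5
    let ?G = "[:12, of_nat m:] :: complex poly"
    text \<open>Modulo the square of the variable, \<open>(12 + a u) (12 + b u)\<close> is \<open>12 (12 + (a + b) u)\<close>.\<close>
    have w: "has m (Polynomial.smult (12 / (of_nat a * of_nat (gcd 12 (m - a)))) ?G)" if a: "a \<in> {2, 3, 4}" for a
    proof -
      let ?b = "m - a"
      have ga: "gcd 12 a = a" using a by (auto simp: gcd_non_0_nat)
      have P: "has m (gpoly a * gpoly ?b)" by (rule has_mult[OF less(1)[of a] less(1)[of ?b]]) (use a m in auto)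
      obtain c where c: "?b = gcd 12 ?b * c" using gcd_dvd2 by blast
      have g0: "(of_nat (gcd 12 ?b) :: complex) \<noteq> 0" "(of_nat a :: complex) \<noteq> 0" using a by auto
      have cc: "of_nat ?b / of_nat (gcd 12 ?b) = (of_nat c :: complex)"
        using arg_cong[OF c, of "of_nat :: nat \<Rightarrow> complex"] g0 by (simp only: of_nat_mult) simp
      have mab: "(of_nat m :: complex) = of_nat a + of_nat ?b" using a m by (auto simp: of_nat_diff)
      have "Polynomial.smult (12 / (of_nat a * of_nat (gcd 12 ?b))) ?G = gpoly a * gpoly ?b - Polynomial.smult (of_int (int c)) [:0, 0, 1:]"
      proof -
        have "Polynomial.smult (12 / (A * g)) [:12, A + B:] = Polynomial.smult (1 / A) [:12, A:] * Polynomial.smult (1 / g) [:12, B:] - Polynomial.smult (B / g) [:0, 0, 1:]"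
          if "A \<noteq> 0" "g \<noteq> 0" for A B g :: complex using that by (simp add: field_simps)
        from this[OF g0(2,1)] show ?thesis unfolding gpoly_def ga mab of_int_of_nat_eq cc [symmetric] .
      qed
      then show ?thesis by (rule has_diff[OF P has_square, rotated]) (use m in simp)
    qed
    obtain x y z :: int where xyz: "of_int x * 6 / of_nat (gcd 12 (m - 2)) + of_int y * 4 / of_nat (gcd 12 (m - 3)) + of_int z * 3 / of_nat (gcd 12 (m - 4)) = 1 / (of_nat (gcd 12 m) :: complex)"
      by (rule bezout_12[OF m])
    have "has m (Polynomial.smult (of_int x) (Polynomial.smult (12 / (of_nat 2 * of_nat (gcd 12 (m - 2)))) ?G) + Polynomial.smult (of_int y) (Polynomial.smult (12 / (of_nat 3 * of_nat (gcd 12 (m - 3)))) ?G)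
      + Polynomial.smult (of_int z) (Polynomial.smult (12 / (of_nat 4 * of_nat (gcd 12 (m - 4)))) ?G))"
      by (intro has_add has_smult w) auto
    also have "Polynomial.smult (of_int x) (Polynomial.smult (12 / (of_nat 2 * of_nat (gcd 12 (m - 2)))) ?G) + Polynomial.smult (of_int y) (Polynomial.smult (12 / (of_nat 3 * of_nat (gcd 12 (m - 3)))) ?G)
      + Polynomial.smult (of_int z) (Polynomial.smult (12 / (of_nat 4 * of_nat (gcd 12 (m - 4)))) ?G) =
      Polynomial.smult (of_int x * 6 / of_nat (gcd 12 (m - 2)) + of_int y * 4 / of_nat (gcd 12 (m - 3)) + of_int z * 3 / of_nat (gcd 12 (m - 4))) ?G"
    proof -
      have "Polynomial.smult x' (Polynomial.smult (12 / (of_nat 2 * A)) G) + Polynomial.smult y' (Polynomial.smult (12 / (of_nat 3 * B)) G) + Polynomial.smult z' (Polynomial.smult (12 / (of_nat 4 * C)) G) =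
        Polynomial.smult (x' * 6 / A + y' * 4 / B + z' * 3 / C) G" for x' y' z' A B C :: complex and G
        by (simp add: smult_add_left)
      then show ?thesis .
    qed
    finally show ?thesis unfolding xyz gpoly_def .
  qed
qed

definition bpoly :: "nat \<Rightarrow> nat \<Rightarrow> complex poly" where
  "bpoly m i = (if i = 1 then gpoly m else Polynomial.monom 1 i)"

lemma has_bpoly: "i \<in> {1..m} \<Longrightarrow> has m (bpoly m i)"
  unfolding bpoly_def using has_gpoly has_monom by auto

lemma coeff_bpoly_sum:
  assumes "m \<ge> 1"
  shows "poly.coeff (\<Sum>i\<in>{1..m}. Polynomial.smult (c i) (bpoly m i)) k =
    (if k = 0 then c 1 * 12 / of_nat (gcd 12 m) else if k = 1 then c 1 * of_nat m / of_nat (gcd 12 m) else if k \<le> m then c k else 0)"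
proof -
  have "{1..m} = insert 1 {2..m}" using assms by auto
  then have "poly.coeff (\<Sum>i\<in>{1..m}. Polynomial.smult (c i) (bpoly m i)) k = c 1 * poly.coeff (gpoly m) k + (\<Sum>i\<in>{2..m}. c i * poly.coeff (bpoly m i) k)"
    by (simp add: coeff_sum bpoly_def)
  also have "(\<Sum>i\<in>{2..m}. c i * poly.coeff (bpoly m i) k) = (\<Sum>i\<in>{2..m}. if i = k then c k else 0)"
    by (rule sum.cong) (auto simp: bpoly_def coeff_monom)
  also have "\<dots> = (if 2 \<le> k \<and> k \<le> m then c k else 0)" by simp
  finally show ?thesis
    by (auto simp: gpoly_def coeff_pCons split: nat.split)
qed

text \<open>From m Q(0) = 12 Q'(0) coprimality gives (Q(0), Q'(0)) = r (12, m) / gcd(12, m) with r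
  integral; the higher coefficients are free.\<close>

lemma bpoly_coordinates:
  assumes m: "m \<ge> 1" and d: "Polynomial.degree Q \<le> m" "int_poly Q" and c: "of_nat m * poly.coeff Q 0 = 12 * poly.coeff Q 1"
  obtains b :: "nat \<Rightarrow> int" where "Q = (\<Sum>i\<in>{1..m}. Polynomial.smult (of_int (b i)) (bpoly m i))"
proof -
  obtain q :: "nat \<Rightarrow> int" where q: "\<And>k. poly.coeff Q k = of_int (q k)" using d(2) unfolding Ints_def image_iff by metis
  have "(of_int (int m * q 0) :: complex) = of_int (12 * q 1)" using c by (simp add: q)
  then have e: "int m * q 0 = 12 * q 1" by (simp only: of_int_eq_iff)
  let ?g = "gcd 12 m"
  obtain a where a: "12 = ?g * a" using gcd_dvd1 by blast
  obtain n where n: "m = ?g * n" using gcd_dvd2 by blast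
  have g0: "?g \<noteq> 0" by simp
  have "coprime a n" by (rule gcd_coprime[OF g0]) (use a n in \<open>simp_all add: mult.commute\<close>)
  have "int ?g * (int n * q 0) = int ?g * (int a * q 1)"
    using e a n by (metis mult.assoc of_nat_mult of_nat_numeral)
  then have an: "int n * q 0 = int a * q 1" using g0 by simp
  then have "int a dvd int n * q 0" by simp
  then have "int a dvd q 0" using \<open>coprime a n\<close> by (simp add: coprime_dvd_mult_right_iff)
  then obtain r where r: "q 0 = int a * r" by blast
  have "a \<noteq> 0" using a by (metis mult_0_right zero_neq_numeral)
  then have r1: "q 1 = int n * r" using an unfolding r by simp
  define b where "b = (\<lambda>i. if i = 1 then r else q i)"
  have ca: "(of_nat ?g :: complex) * of_nat a = 12" using a by (metis of_nat_mult of_nat_numeral)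
  have cn: "(of_nat ?g :: complex) * of_nat n = of_nat m" using n by (metis of_nat_mult)
  have gc: "(of_nat ?g :: complex) \<noteq> 0" using g0 by (simp only: of_nat_eq_0_iff not_False_eq_True)
  have "Q = (\<Sum>i\<in>{1..m}. Polynomial.smult (of_int (b i)) (bpoly m i))"
  proof (rule poly_eqI)
    fix k
    have "poly.coeff Q k = 0" if "k > m" using d(1) that by (simp add: coeff_eq_0)
    moreover have "(of_int (q 0) :: complex) = of_int r * 12 / of_nat ?g" unfolding r ca [symmetric] using gc by simp
    moreover have "(of_int (q 1) :: complex) = of_int r * of_nat m / of_nat ?g" unfolding r1 cn [symmetric] using gc by simp
    ultimately show "poly.coeff Q k = poly.coeff (\<Sum>i\<in>{1..m}. Polynomial.smult (of_int (b i)) (bpoly m i)) k"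
      unfolding coeff_bpoly_sum[OF m] by (auto simp: b_def q not_le)
  qed
  then show ?thesis by (rule that)
qed

lemma JF_sum: "finite I \<Longrightarrow> (\<And>i. i \<in> I \<Longrightarrow> JF k m (\<phi> i) (p i)) \<Longrightarrow> JF k m (\<lambda>t z. 0) (\<lambda>z. 0) \<Longrightarrow>
    JF k m (\<lambda>t z. \<Sum>i\<in>I. \<phi> i t z) (\<lambda>z. \<Sum>i\<in>I. p i z)"
  by (induction I rule: finite_induct) (auto intro: JF_add)

lemma JF_zero: "JF 0 m (\<lambda>t z. 0) (\<lambda>z. 0)"
  using JF_cmult[of 0 m _ _ 0, OF JF_power[OF JF_f1, of m, simplified]] by simp

text \<open>Once the q^0-term is matched by a generated form, the difference is zero or P times a
  form of index m - 6, and P is itself a polynomial in the generators.\<close>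

theorem JZ_gen: "\<phi> \<in> JZ m \<Longrightarrow> gen m \<phi>"
proof (induction m arbitrary: \<phi> rule: less_induct)
  case (less m)
  obtain Q where Q: "Polynomial.degree Q \<le> m" "int_poly Q" "JF 0 m \<phi> (\<lambda>z. poly Q (sy z ^ 2))" by (rule JZ_row_poly[OF less.prems])
  have "has m Q"
  proof (cases "m = 0")
    \<comment> \<open>In index 0 the row is an integral constant, a multiple of the unit.\<close>
    case True
    then obtain q where q: "Q = [:q:]" using Q(1) degree_eq_zeroE by blast
    then obtain n where "q = of_int n" using Q(2)[rule_format, of 0] by (auto elim: Ints_cases)
    moreover have "has 0 [:1:]" unfolding has_def using gen.one cut_JF[OF JF_const[of 1]] by auto
    ultimately show ?thesis using has_smult[of 0 "[:1:]" n] q True by simp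
  next
    case False
    obtain b :: "nat \<Rightarrow> int" where b: "Q = (\<Sum>i\<in>{1..m}. Polynomial.smult (of_int (b i)) (bpoly m i))"
      by (rule bpoly_coordinates[OF _ Q(1,2) row_poly_constraint[OF Q(3,1)]]) (use False in auto)
    have "has m (\<Sum>i\<in>I. Polynomial.smult (of_int (b i)) (bpoly m i))" if "I \<subseteq> {1..m}" for I
      using finite_subset[OF that finite_atLeastAtMost] that
    proof (induction I rule: finite_induct)
      case empty
      then show ?case unfolding has_def using gen.zero JF_zero by auto
    qed (auto intro!: has_add has_smult has_bpoly)
    then show ?thesis unfolding b by blast
  qed
  then obtain \<psi> where \<psi>: "gen m \<psi>" "JF 0 m \<psi> (\<lambda>z. poly Q (sy z ^ 2))" unfolding has_def by blast
  define \<rho> where "\<rho> = (\<lambda>t z. \<phi> t z - \<psi> t z)"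
  have \<phi>: "\<phi> = (\<lambda>t z. \<rho> t z + \<psi> t z)" by (simp add: \<rho>_def)
  have "\<rho> \<in> JZ m" using JZ_add[OF less.prems JZ_minus[OF gen_JZ[OF \<psi>(1)]]] by (simp add: \<rho>_def)
  moreover have "JF 0 m \<rho> (\<lambda>_. 0)" using JF_diff[OF Q(3) \<psi>(2)] by (simp add: \<rho>_def)
  ultimately have "(\<forall>t z. \<rho> t z = 0) \<or> (\<exists>\<phi>'. 6 \<le> m \<and> \<phi>' \<in> JZ (m - 6) \<and> (\<forall>t z. \<rho> t z = cut pp t z * \<phi>' t z))"
    by (rule JZ_cusp_divide)
  then have "gen m \<rho>"
  proof
    assume "\<forall>t z. \<rho> t z = 0"
    then have "\<rho> = (\<lambda>t z. 0)" by auto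
    then show ?thesis by (simp add: gen.zero)
  next
    assume "\<exists>\<phi>'. 6 \<le> m \<and> \<phi>' \<in> JZ (m - 6) \<and> (\<forall>t z. \<rho> t z = cut pp t z * \<phi>' t z)"
    then obtain \<phi>' where m: "6 \<le> m" and \<phi>': "\<phi>' \<in> JZ (m - 6)" and "\<forall>t z. \<rho> t z = cut pp t z * \<phi>' t z" by blast
    then have e: "\<rho> = (\<lambda>t z. cut pp t z * \<phi>' t z)" by blast
    have "gen 6 (\<lambda>t z. cut f1 t z * cut f1 t z * cut f4 t z + of_nat 8 * (cut f2 t z * cut f2 t z * cut f2 t z) + of_nat 27 * (cut f3 t z * cut f3 t z)
      + - (of_nat 9 * (cut f1 t z * cut f2 t z * cut f3 t z)))"
      by (intro gen.add gen.minus gen_of_nat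
          gen.mult[OF gen.mult[OF gen.f1 gen.f1] gen.f4, simplified] gen.mult[OF gen.mult[OF gen.f2 gen.f2] gen.f2, simplified]
          gen.mult[OF gen.f3 gen.f3, simplified] gen.mult[OF gen.mult[OF gen.f1 gen.f2] gen.f3, simplified])
    moreover have "(\<lambda>t z. cut f1 t z * cut f1 t z * cut f4 t z + of_nat 8 * (cut f2 t z * cut f2 t z * cut f2 t z) + of_nat 27 * (cut f3 t z * cut f3 t z)
      + - (of_nat 9 * (cut f1 t z * cut f2 t z * cut f3 t z))) = cut pp"
      by (intro ext) (simp add: cut_def pp_def power2_eq_square power3_eq_cube)
    ultimately have P: "gen 6 (cut pp)" by (simp only:)
    have "gen (6 + (m - 6)) \<rho>" unfolding e by (rule gen.mult[OF P less.IH[OF _ \<phi>']]) (use m in simp)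
    then show ?thesis using m by simp
  qed
  then show ?case unfolding \<phi> by (rule gen.add[OF _ \<psi>(1)])
qed

subsection \<open>The quotient module\<close>

lemma has_q0_termI:
  assumes "JF 0 m \<phi> p" "finite F" "\<And>z. p z = (\<Sum>l\<in>F. c l * e2pi (of_int l * z))"
    and "\<And>l. Poly_Mapping.lookup P l = (if l \<in> F then c l else 0)"
  shows "has_q0_term \<phi> P"
proof -
  have E: "EF m \<phi> p" and j: "jfam \<phi> p" using assms(1) by (auto simp: JF_def EF_def)
  obtain f where f: "has_fourier_expansion \<phi> f" using EF_FE[OF E] unfolding FE_def by blast
  show ?thesis
    unfolding has_q0_term_def jcoeff_eq[OF f] assms(4) using fourier_row_unique[OF f j assms(2,3)] by blast
qed

lemma JZq_iff: "\<phi> \<in> JZq m \<longleftrightarrow> \<phi> \<in> JZ m \<and> JF 0 m \<phi> (\<lambda>_. 0)"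
proof
  assume "\<phi> \<in> JZq m"
  then have J: "\<phi> \<in> JZ m" and q: "has_q0_term \<phi> 0" by (auto simp: JZq_def)
  then have w: "weak_jacobi_form m \<phi>" by (simp add: JZ_def)
  then obtain f where f: "has_fourier_expansion \<phi> f" unfolding weak_jacobi_form_def by blast
  have "f 0 l = 0" for l using q unfolding has_q0_term_def jcoeff_eq[OF f] by simp
  then show "\<phi> \<in> JZ m \<and> JF 0 m \<phi> (\<lambda>_. 0)" using weak_jacobi_imp_JF[OF w f] J by simp
next
  assume "\<phi> \<in> JZ m \<and> JF 0 m \<phi> (\<lambda>_. 0)"
  moreover from this have "has_q0_term \<phi> 0" by (intro has_q0_termI[of m \<phi> "\<lambda>_. 0" "{}"]) auto
  ultimately show "\<phi> \<in> JZq m" by (simp add: JZq_def)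
qed

lemma carrier_JZ_group [simp]: "carrier (JZ_group m) = JZ m"
  and mult_JZ_group [simp]: "\<phi> \<otimes>\<^bsub>JZ_group m\<^esub> \<psi> = (\<lambda>t z. \<phi> t z + \<psi> t z)"
  and one_JZ_group [simp]: "\<one>\<^bsub>JZ_group m\<^esub> = (\<lambda>t z. 0)"
  by (simp_all add: JZ_group_def)

lemma comm_group_JZ: "comm_group (JZ_group m)"
proof (rule comm_groupI)
  fix \<phi> assume "\<phi> \<in> carrier (JZ_group m)"
  then show "\<exists>\<psi>\<in>carrier (JZ_group m). \<psi> \<otimes>\<^bsub>JZ_group m\<^esub> \<phi> = \<one>\<^bsub>JZ_group m\<^esub>"
    by (intro bexI[of _ "\<lambda>t z. - \<phi> t z"]) (auto intro: JZ_minus)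
qed (auto intro: JZ_add JZ_zero simp: add_ac)

lemma inv_JZ_group: "\<phi> \<in> JZ m \<Longrightarrow> inv\<^bsub>JZ_group m\<^esub> \<phi> = (\<lambda>t z. - \<phi> t z)"
  by (rule group.inv_equality[OF comm_group.axioms(2)[OF comm_group_JZ]]) (auto intro: JZ_minus)

lemma pow_JZ_group: assumes "\<phi> \<in> JZ m" shows "\<phi> [^]\<^bsub>JZ_group m\<^esub> (n :: int) = (\<lambda>t z. of_int n * \<phi> t z)"
proof -
  have "\<phi> [^]\<^bsub>JZ_group m\<^esub> k = (\<lambda>t z. of_nat k * \<phi> t z)" for k :: nat
    by (induction k) (auto simp: algebra_simps)
  moreover have "(\<lambda>t z. of_nat k * \<phi> t z) \<in> JZ m" for k :: nat
    by (rule gen_JZ[OF gen_of_nat[OF JZ_gen[OF assms]]])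
  ultimately have "\<phi> [^]\<^bsub>JZ_group m\<^esub> n = (if n < 0 then (\<lambda>t z. - (of_nat (nat (- n)) * \<phi> t z)) else (\<lambda>t z. of_nat (nat n) * \<phi> t z))"
    unfolding int_pow_def2 by (simp only: inv_JZ_group)
  then show ?thesis by (auto split: if_splits)
qed

lemma subgroup_JZq: "subgroup (JZq m) (JZ_group m)"
proof (rule group.subgroupI[OF comm_group.axioms(2)[OF comm_group_JZ]])
  have "(\<lambda>t z. 0) \<in> JZq m" by (simp add: JZq_iff JZ_zero JF_zero)
  then show "JZq m \<noteq> {}" by blast
  fix \<phi> assume \<phi>: "\<phi> \<in> JZq m"
  then have "JF 0 m (\<lambda>t z. - \<phi> t z) (\<lambda>_. 0)"
    using JF_cmult[of 0 m \<phi> "\<lambda>_. 0" "-1"] by (simp add: JZq_iff)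
  then show "inv\<^bsub>JZ_group m\<^esub> \<phi> \<in> JZq m" using \<phi> by (simp add: JZq_iff inv_JZ_group JZ_minus)
  fix \<psi> assume "\<psi> \<in> JZq m"
  then show "\<phi> \<otimes>\<^bsub>JZ_group m\<^esub> \<psi> \<in> JZq m"
    using \<phi> JF_add[of 0 m \<phi> "\<lambda>_. 0" \<psi> "\<lambda>_. 0"] by (simp add: JZq_iff JZ_add)
qed (auto simp: JZq_iff)

lemma normal_JZq: "normal (JZq m) (JZ_group m)"
  by (rule comm_group.subgroup_imp_normal[OF comm_group_JZ subgroup_JZq])

section \<open>Classes modulo forms with zero q^0-term\<close>

abbreviation qgroup :: "nat \<Rightarrow> jform set monoid" where "qgroup m \<equiv> JZ_group m Mod JZq m"
abbreviation qcl :: "nat \<Rightarrow> jform \<Rightarrow> jform set" where "qcl m \<phi> \<equiv> JZq m #>\<^bsub>JZ_group m\<^esub> \<phi>"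

lemma qcl_eq_iff:
  assumes "\<phi> \<in> JZ m" "\<psi> \<in> JZ m"
  shows "qcl m \<phi> = qcl m \<psi> \<longleftrightarrow> (\<lambda>t z. \<phi> t z - \<psi> t z) \<in> JZq m"
proof -
  note g = comm_group.axioms(2)[OF comm_group_JZ]
  have "qcl m \<phi> = qcl m \<psi> \<longleftrightarrow> \<phi> \<in> qcl m \<psi>"
    using group.rcos_self[OF g _ subgroup_JZq, where x = \<phi>] group.repr_independence[OF g _ _ subgroup_JZq, where y = \<phi> and x = \<psi>] assms by auto
  also have "\<dots> \<longleftrightarrow> \<phi> \<otimes>\<^bsub>JZ_group m\<^esub> inv\<^bsub>JZ_group m\<^esub> \<psi> \<in> JZq m"
    by (rule subgroup.rcos_module[OF subgroup_JZq g]) (use assms in auto)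
  finally show ?thesis using assms by (simp add: inv_JZ_group)
qed

lemma qcl_hom: "qcl m \<in> hom (JZ_group m) (qgroup m)"
  by (rule normal.r_coset_hom_Mod[OF normal_JZq])

lemma qcl_carrier: "\<phi> \<in> JZ m \<Longrightarrow> qcl m \<phi> \<in> carrier (qgroup m)"
  by (auto simp: carrier_FactGroup)

lemma qcl_add: "\<phi> \<in> JZ m \<Longrightarrow> \<psi> \<in> JZ m \<Longrightarrow> qcl m \<phi> \<otimes>\<^bsub>qgroup m\<^esub> qcl m \<psi> = qcl m (\<lambda>t z. \<phi> t z + \<psi> t z)"
  using hom_mult[OF qcl_hom, where x = \<phi> and y = \<psi>] by simp

lemma group_qgroup: "group (qgroup m)"
  by (rule normal.factorgroup_is_group[OF normal_JZq])

lemma comm_group_qgroup: "comm_group (qgroup m)"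
proof (rule group.group_comm_groupI[OF group_qgroup])
  fix x y assume "x \<in> carrier (qgroup m)" "y \<in> carrier (qgroup m)"
  then obtain \<phi> \<psi> where "\<phi> \<in> JZ m" "\<psi> \<in> JZ m" "x = qcl m \<phi>" "y = qcl m \<psi>" by (auto simp: carrier_FactGroup)
  then show "x \<otimes>\<^bsub>qgroup m\<^esub> y = y \<otimes>\<^bsub>qgroup m\<^esub> x"
    by (simp only: qcl_add) (simp only: add.commute)
qed

lemma qcl_pow: assumes "\<phi> \<in> JZ m" shows "qcl m \<phi> [^]\<^bsub>qgroup m\<^esub> (n :: int) = qcl m (\<lambda>t z. of_int n * \<phi> t z)"
  using hom_int_pow[OF qcl_hom _ comm_group.axioms(2)[OF comm_group_JZ] group_qgroup, of \<phi> m n] assms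
  by (simp add: pow_JZ_group)

text \<open>The family is fixed once, so that the basis property, the isomorphism and the q^0-terms
  refer to the same forms.\<close>

locale index_basis =
  fixes m :: nat and \<psi> :: "nat \<Rightarrow> jform"
  assumes m: "m \<ge> 1" and psi: "\<And>i. i \<in> {1..m} \<Longrightarrow> gen m (\<psi> i)"
    and psi_row: "\<And>i. i \<in> {1..m} \<Longrightarrow> JF 0 m (\<psi> i) (\<lambda>z. poly (bpoly m i) (sy z ^ 2))"
begin

definition comb :: "(nat \<Rightarrow> int) \<Rightarrow> jform" where
  "comb c t z = (\<Sum>i\<in>{1..m}. of_int (c i) * \<psi> i t z)"

definition cpoly :: "(nat \<Rightarrow> int) \<Rightarrow> complex poly" where
  "cpoly c = (\<Sum>i\<in>{1..m}. Polynomial.smult (of_int (c i)) (bpoly m i))"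

lemma psi_JZ: "i \<in> {1..m} \<Longrightarrow> \<psi> i \<in> JZ m" by (rule gen_JZ[OF psi])

lemma comb_JZ: "comb c \<in> JZ m"
  unfolding comb_def[abs_def] by (intro gen_JZ gen_sum gen_of_int psi) auto

lemma comb_row: "JF 0 m (comb c) (\<lambda>z. poly (cpoly c) (sy z ^ 2))"
  unfolding comb_def[abs_def] cpoly_def poly_sum poly_smult by (intro JF_sum JF_cmult psi_row JF_zero) auto

lemma cpoly_inject: assumes "cpoly c = cpoly d" "i \<in> {1..m}" shows "c i = d i"
proof -
  have e: "poly.coeff (cpoly c) k = poly.coeff (cpoly d) k" for k using assms(1) by simp
  show ?thesis
  proof (cases "i = 1")
    case True
    then show ?thesis using e[of 0] unfolding cpoly_def coeff_bpoly_sum[OF m] by simp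
  next
    case False
    then show ?thesis using e[of i] assms(2) unfolding cpoly_def coeff_bpoly_sum[OF m] by auto
  qed
qed

text \<open>The q^0-term determines the class, and its coordinates with respect to
  \<open>bpoly\<close> are integral by \<open>bpoly_coordinates\<close>.\<close>

lemma JZ_coordinates: assumes "\<phi> \<in> JZ m" obtains c where "qcl m \<phi> = qcl m (comb c)"
proof -
  obtain Q where Q: "Polynomial.degree Q \<le> m" "int_poly Q" "JF 0 m \<phi> (\<lambda>z. poly Q (sy z ^ 2))" by (rule JZ_row_poly[OF assms])
  obtain c :: "nat \<Rightarrow> int" where c: "Q = cpoly c"
    unfolding cpoly_def by (rule bpoly_coordinates[OF m Q(1,2) row_poly_constraint[OF Q(3,1)]])
  have "JF 0 m (\<lambda>t z. \<phi> t z - comb c t z) (\<lambda>z. 0)"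
    using JF_diff[OF Q(3) comb_row[of c]] unfolding c by simp
  moreover have "(\<lambda>t z. \<phi> t z - comb c t z) \<in> JZ m"
    using JZ_add[OF assms JZ_minus[OF comb_JZ[of c]]] by simp
  ultimately have "qcl m \<phi> = qcl m (comb c)" unfolding qcl_eq_iff[OF assms comb_JZ] JZq_iff by blast
  then show ?thesis by (rule that)
qed

text \<open>The class determines the cusp value, hence the polynomial in u, whose coefficients give
  back the coordinates.\<close>

lemma comb_class_inject: assumes "qcl m (comb c) = qcl m (comb d)" "i \<in> {1..m}" shows "c i = d i"
proof -
  have J: "JF 0 m (\<lambda>t z. comb c t z - comb d t z) (\<lambda>_. 0)"
    using assms(1) unfolding qcl_eq_iff[OF comb_JZ comb_JZ] JZq_iff by blast
  have "(\<lambda>_. 0) = (\<lambda>z. poly (cpoly c) (sy z ^ 2) - poly (cpoly d) (sy z ^ 2))"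
    by (rule jfam_unique[of "\<lambda>t z. comb c t z - comb d t z"])
       (use J JF_diff[OF comb_row[of c] comb_row[of d]] in \<open>auto simp: JF_def EF_def\<close>)
  then have "poly (cpoly c) (sy z ^ 2) = poly (cpoly d) (sy z ^ 2)" for z
    by (metis eq_iff_diff_eq_0)
  then have "cpoly c = cpoly d" by (rule row_poly_unique)
  then show ?thesis by (rule cpoly_inject[OF _ assms(2)])
qed

lemma finprod_comb: "finprod (qgroup m) (\<lambda>i. qcl m (\<psi> i) [^]\<^bsub>qgroup m\<^esub> c i) {1..m} = qcl m (comb c)"
proof -
  interpret comm_group "qgroup m" by (rule comm_group_qgroup)
  have "finprod (qgroup m) (\<lambda>i. qcl m (\<psi> i) [^]\<^bsub>qgroup m\<^esub> c i) I = qcl m (\<lambda>t z. \<Sum>i\<in>I. of_int (c i) * \<psi> i t z)" if "I \<subseteq> {1..m}" for I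
    using finite_subset[OF that finite_atLeastAtMost] that
  proof (induction I rule: finite_induct)
    case empty
    show ?case using hom_one[OF qcl_hom comm_group.axioms(2)[OF comm_group_JZ] group_qgroup] by simp
  next
    case (insert i I)
    have S: "(\<lambda>t z. \<Sum>i\<in>I. of_int (c i) * \<psi> i t z) \<in> JZ m"
      by (intro gen_JZ gen_sum gen_of_int psi) (use insert in auto)
    have T: "(\<lambda>t z. of_int (c i) * \<psi> i t z) \<in> JZ m" by (intro gen_JZ gen_of_int psi) (use insert in auto)
    have "finprod (qgroup m) (\<lambda>i. qcl m (\<psi> i) [^]\<^bsub>qgroup m\<^esub> c i) (insert i I) =
      qcl m (\<psi> i) [^]\<^bsub>qgroup m\<^esub> c i \<otimes>\<^bsub>qgroup m\<^esub> finprod (qgroup m) (\<lambda>i. qcl m (\<psi> i) [^]\<^bsub>qgroup m\<^esub> c i) I"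
      using insert by (intro finprod_insert Pi_I int_pow_closed qcl_carrier psi_JZ) auto
    also have "\<dots> = qcl m (\<lambda>t z. of_int (c i) * \<psi> i t z) \<otimes>\<^bsub>qgroup m\<^esub> qcl m (\<lambda>t z. \<Sum>i\<in>I. of_int (c i) * \<psi> i t z)"
      using insert qcl_pow[OF psi_JZ] by simp
    also have "\<dots> = qcl m (\<lambda>t z. of_int (c i) * \<psi> i t z + (\<Sum>i\<in>I. of_int (c i) * \<psi> i t z))"
      by (rule qcl_add[OF T S])
    finally show ?case using insert by simp
  qed
  from this[of "{1..m}"] show ?thesis by (simp add: comb_def[abs_def])
qed

lemma is_Z_basis_psi: "is_Z_basis (qgroup m) {1..m} (\<lambda>n. qcl m (\<psi> n))"
  unfolding is_Z_basis_def
proof (intro conjI ballI comm_group_qgroup)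
  show "(\<lambda>n. qcl m (\<psi> n)) \<in> {1..m} \<rightarrow> carrier (qgroup m)" by (auto intro!: qcl_carrier psi_JZ)
  fix x assume "x \<in> carrier (qgroup m)"
  then obtain \<phi> where \<phi>: "\<phi> \<in> JZ m" "x = qcl m \<phi>" by (auto simp: carrier_FactGroup)
  obtain c where c: "x = qcl m (comb c)" using JZ_coordinates[OF \<phi>(1)] \<phi>(2) by metis
  show "\<exists>!c. c \<in> {1..m} \<rightarrow>\<^sub>E (UNIV :: int set) \<and> x = finprod (qgroup m) (\<lambda>i. qcl m (\<psi> i) [^]\<^bsub>qgroup m\<^esub> c i) {1..m}"
    unfolding finprod_comb
  \<comment> \<open>Coordinates are compared as extensional functions, so the chosen one is
    restricted to the index set.\<close>
  proof (rule ex1I[of _ "restrict c {1..m}"])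
    have "comb (restrict c {1..m}) = comb c" by (intro ext) (simp add: comb_def)
    then show "restrict c {1..m} \<in> {1..m} \<rightarrow>\<^sub>E UNIV \<and> x = qcl m (comb (restrict c {1..m}))" using c by simp
    fix d assume d: "d \<in> {1..m} \<rightarrow>\<^sub>E UNIV \<and> x = qcl m (comb d)"
    show "d = restrict c {1..m}"
    proof (rule PiE_ext[where k = "{1..m}" and s = "\<lambda>_. UNIV"])
      show "d i = restrict c {1..m} i" if "i \<in> {1..m}" for i
        using comb_class_inject[of d c i] c d that by simp
    qed (use d in auto)
  qed
qed simp

lemma quotient_free: "qgroup m \<cong> free_Abelian_group {1..m}"
proof -
  let ?h = "\<lambda>f. qcl m (comb (Poly_Mapping.lookup f))"
  have "?h \<in> iso (free_Abelian_group {1..m}) (qgroup m)"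
  proof (rule isoI)
    have "comb (Poly_Mapping.lookup (f + g)) = (\<lambda>t z. comb (Poly_Mapping.lookup f) t z + comb (Poly_Mapping.lookup g) t z)" for f g
      by (intro ext) (simp add: comb_def lookup_add distrib_right sum.distrib)
    then show "?h \<in> hom (free_Abelian_group {1..m}) (qgroup m)"
      by (intro homI) (simp_all add: qcl_carrier comb_JZ qcl_add[OF comb_JZ comb_JZ, symmetric] del: mult_FactGroup)
    show "bij_betw ?h (carrier (free_Abelian_group {1..m})) (carrier (qgroup m))"
      unfolding bij_betw_def
    proof
      show "inj_on ?h (carrier (free_Abelian_group {1..m}))"
      proof (rule inj_onI, rule poly_mapping_eqI)
        fix f g :: "nat \<Rightarrow>\<^sub>0 int" and i
        assume f: "f \<in> carrier (free_Abelian_group {1..m})" and g: "g \<in> carrier (free_Abelian_group {1..m})" and e: "?h f = ?h g"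
        show "Poly_Mapping.lookup f i = Poly_Mapping.lookup g i"
        proof (cases "i \<in> {1..m}")
          case False
          then have "i \<notin> Poly_Mapping.keys f" "i \<notin> Poly_Mapping.keys g" using f g by auto
          then show ?thesis by (simp add: in_keys_iff)
        qed (rule comb_class_inject[OF e])
      qed
      show "?h ` carrier (free_Abelian_group {1..m}) = carrier (qgroup m)"
      proof
        show "?h ` carrier (free_Abelian_group {1..m}) \<subseteq> carrier (qgroup m)" by (auto intro: qcl_carrier comb_JZ)
        show "carrier (qgroup m) \<subseteq> ?h ` carrier (free_Abelian_group {1..m})"
        proof
          fix x assume "x \<in> carrier (qgroup m)"
          then obtain \<phi> where \<phi>: "\<phi> \<in> JZ m" "x = qcl m \<phi>" by (auto simp: carrier_FactGroup)
          obtain c where c: "x = qcl m (comb c)" using JZ_coordinates[OF \<phi>(1)] \<phi>(2) by metis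
          define f where "f = (\<Sum>i\<in>{1..m}. Poly_Mapping.single i (c i))"
          have l: "Poly_Mapping.lookup f k = (if k \<in> {1..m} then c k else 0)" for k
            by (simp add: f_def lookup_sum lookup_single when_def)
          have "comb (Poly_Mapping.lookup f) = comb c" by (intro ext) (simp add: comb_def l)
          moreover have "f \<in> carrier (free_Abelian_group {1..m})"
            using l by (auto simp: in_keys_iff split: if_splits)
          ultimately show "x \<in> ?h ` carrier (free_Abelian_group {1..m})" unfolding c by (metis imageI)
        qed
      qed
    qed
  qed
  then have "free_Abelian_group {1..m} \<cong> qgroup m" by (auto simp: is_iso_def)
  then show ?thesis by (rule group.iso_sym[OF group_free_Abelian_group])
qed

text \<open>For n >= 2 the chosen form has q^0-term u^n; for n = 2 this is y^2 - 4 y + 6 - 4/y +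
  1/y^2.\<close>

lemma psi_q0_monom:
  assumes "n \<in> {2..m}" and "\<And>l. Poly_Mapping.lookup P l = of_int (uc n l)"
  shows "has_q0_term (\<psi> n) P"
proof (rule has_q0_termI)
  show "JF 0 m (\<psi> n) (\<lambda>z. sy z ^ (2 * n))"
    using psi_row[of n] assms(1) by (simp add: bpoly_def poly_monom power_mult)
  show "sy z ^ (2 * n) = (\<Sum>l\<in>{- int n..int n}. of_int (uc n l) * e2pi (of_int l * z))" for z by (rule sy_power_sum)
  show "Poly_Mapping.lookup P l = (if l \<in> {- int n..int n} then of_int (uc n l) else 0)" for l
    unfolding assms(2) by (auto simp: uc_def)
qed simp

lemma psi_q0_1:
  "has_q0_term (\<psi> 1) (Poly_Mapping.single 1 (of_nat m / of_nat (gcd 12 m))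
     + Poly_Mapping.single 0 ((12 - 2 * of_nat m) / of_nat (gcd 12 m))
     + Poly_Mapping.single (-1) (of_nat m / of_nat (gcd 12 m)))"
proof (rule has_q0_termI)
  let ?g = "of_nat (gcd 12 m) :: complex"
  let ?c = "\<lambda>l::int. if l = 0 then (12 - 2 * of_nat m) / ?g else of_nat m / ?g"
  show "JF 0 m (\<psi> 1) (\<lambda>z. poly (bpoly m 1) (sy z ^ 2))" by (rule psi_row) (use m in simp)
  show "poly (bpoly m 1) (sy z ^ 2) = (\<Sum>l\<in>{-1, 0, 1}. ?c l * e2pi (of_int l * z))" for z
  proof -
    have gen: "1 / g * (12 + M * (a - 2 + b)) = M / g * b + ((12 - 2 * M) / g + M / g * a)" for g M a b :: complex
      by (simp add: algebra_simps add_divide_distrib diff_divide_distrib)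
    have "poly (bpoly m 1) (sy z ^ 2) = 1 / ?g * (12 + of_nat m * sy z ^ 2)" by (simp add: bpoly_def gpoly_def add_divide_distrib mult.commute)
    also have "\<dots> = of_nat m / ?g * e2pi (- z) + ((12 - 2 * of_nat m) / ?g + of_nat m / ?g * e2pi z)"
      unfolding sy_sq by (rule gen)
    finally show ?thesis by simp
  qed
qed (auto simp: lookup_add lookup_single when_def)

end

subsection \<open>The graded ring\<close>

lemma JZ_ring_simps [simp]:
  "F \<in> carrier JZ_ring \<longleftrightarrow> (\<forall>m. F m \<in> JZ m) \<and> finite {m. F m \<noteq> (\<lambda>t z. 0)}"
  "F \<otimes>\<^bsub>JZ_ring\<^esub> G = (\<lambda>m t z. \<Sum>k\<le>m. F k t z * G (m - k) t z)"
  "F \<oplus>\<^bsub>JZ_ring\<^esub> G = (\<lambda>m t z. F m t z + G m t z)"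
  "\<zero>\<^bsub>JZ_ring\<^esub> = (\<lambda>m t z. 0)"
  "\<one>\<^bsub>JZ_ring\<^esub> = (\<lambda>m t z. if m = 0 \<and> Im t > 0 then 1 else 0)"
  by (simp_all add: JZ_ring_def)

text \<open>The ring structure is pulled back along evaluation at the points of \<open>\<H> \<times> \<complex>\<close>.\<close>

definition evf :: "complex \<Rightarrow> complex \<Rightarrow> (nat \<Rightarrow> jform) \<Rightarrow> complex fps" where
  "evf t z F = Abs_fps (\<lambda>m. F m t z)"

lemma evf_nth [simp]: "fps_nth (evf t z F) m = F m t z"
  by (simp add: evf_def)

lemma evf_eqI: "(\<And>t z. evf t z F = evf t z G) \<Longrightarrow> F = G"
  by (intro ext) (metis evf_nth)

lemma evf_mult: "evf t z (F \<otimes>\<^bsub>JZ_ring\<^esub> G) = evf t z F * evf t z G"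
  by (rule fps_ext) (simp add: fps_mult_nth atLeast0AtMost)

lemma evf_add: "evf t z (F \<oplus>\<^bsub>JZ_ring\<^esub> G) = evf t z F + evf t z G"
  by (rule fps_ext) simp

lemma evf_zero: "evf t z \<zero>\<^bsub>JZ_ring\<^esub> = 0"
  by (rule fps_ext) simp

lemma evf_one: "Im t > 0 \<Longrightarrow> evf t z \<one>\<^bsub>JZ_ring\<^esub> = 1"
  by (rule fps_ext) (simp add: fps_one_nth)

lemma JZ_ring_mult_closed:
  assumes "F \<in> carrier JZ_ring" "G \<in> carrier JZ_ring"
  shows "F \<otimes>\<^bsub>JZ_ring\<^esub> G \<in> carrier JZ_ring"
proof -
  let ?A = "{m. F m \<noteq> (\<lambda>t z. 0)}" and ?B = "{m. G m \<noteq> (\<lambda>t z. 0)}"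
  have "(\<lambda>t z. \<Sum>k\<le>m. F k t z * G (m - k) t z) \<in> JZ m" for m
  proof (rule gen_JZ, rule gen_sum)
    fix k assume "k \<in> {..m}"
    then show "gen m (\<lambda>t z. F k t z * G (m - k) t z)"
      using gen.mult[of k "F k" "m - k" "G (m - k)"] assms JZ_gen by simp
  qed simp
  moreover have "{m. (\<lambda>t z. \<Sum>k\<le>m. F k t z * G (m - k) t z) \<noteq> (\<lambda>t z. 0)} \<subseteq> (\<lambda>(a, b). a + b) ` (?A \<times> ?B)"
  proof
    fix m assume "m \<in> {m. (\<lambda>t z. \<Sum>k\<le>m. F k t z * G (m - k) t z) \<noteq> (\<lambda>t z. 0)}"
    then obtain t z where "(\<Sum>k\<le>m. F k t z * G (m - k) t z) \<noteq> 0" by (auto simp: fun_eq_iff)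
    then obtain k where k: "k \<in> {..m}" "F k t z * G (m - k) t z \<noteq> 0" by (rule sum.not_neutral_contains_not_neutral)
    then have "F k t z \<noteq> 0" "G (m - k) t z \<noteq> 0" by auto
    then have "(k, m - k) \<in> ?A \<times> ?B" by auto
    moreover have "m = (\<lambda>(a, b). a + b) (k, m - k)" using k by simp
    ultimately show "m \<in> (\<lambda>(a, b). a + b) ` (?A \<times> ?B)" by blast
  qed
  ultimately show ?thesis using assms by (auto intro: finite_subset)
qed

lemma JZ_ring_add_closed:
  assumes "F \<in> carrier JZ_ring" "G \<in> carrier JZ_ring"
  shows "F \<oplus>\<^bsub>JZ_ring\<^esub> G \<in> carrier JZ_ring"
proof -
  have "{m. (\<lambda>t z. F m t z + G m t z) \<noteq> (\<lambda>t z. 0)} \<subseteq> {m. F m \<noteq> (\<lambda>t z. 0)} \<union> {m. G m \<noteq> (\<lambda>t z. 0)}" by auto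
  then show ?thesis using assms by (auto intro: JZ_add finite_subset)
qed

lemma homog_carrier: "\<phi> \<in> JZ m \<Longrightarrow> homog m \<phi> \<in> carrier JZ_ring"
  by (auto simp: homog_def JZ_zero intro: finite_subset[of _ "{m}"])

lemma one_JZ_ring: "\<one>\<^bsub>JZ_ring\<^esub> = homog 0 (cut (\<lambda>t z. 1))"
  by (intro ext) (simp add: homog_def cut_def)

lemma JZ_ring_inverse:
  assumes "F \<in> carrier JZ_ring" shows "(\<lambda>m t z. - F m t z) \<in> carrier JZ_ring"
proof -
  have "{m. (\<lambda>t z. - F m t z) \<noteq> (\<lambda>t z. 0)} \<subseteq> {m. F m \<noteq> (\<lambda>t z. 0)}" by auto
  then show ?thesis using assms by (auto intro: JZ_minus finite_subset)
qed

lemma cring_JZ_ring: "cring JZ_ring"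
proof (rule cringI)
  show "abelian_group JZ_ring"
  proof (rule abelian_groupI)
    fix F assume "F \<in> carrier JZ_ring"
    then show "\<exists>G\<in>carrier JZ_ring. G \<oplus>\<^bsub>JZ_ring\<^esub> F = \<zero>\<^bsub>JZ_ring\<^esub>"
      by (intro bexI[of _ "\<lambda>m t z. - F m t z"] JZ_ring_inverse) simp_all
  qed (use JZ_ring_add_closed in \<open>auto simp: JZ_zero add_ac\<close>)
  show "comm_monoid JZ_ring"
  proof (rule comm_monoidI)
    show "\<one>\<^bsub>JZ_ring\<^esub> \<in> carrier JZ_ring" unfolding one_JZ_ring by (rule homog_carrier[OF JZ_one])
    fix F G H
    show "F \<otimes>\<^bsub>JZ_ring\<^esub> G \<otimes>\<^bsub>JZ_ring\<^esub> H = F \<otimes>\<^bsub>JZ_ring\<^esub> (G \<otimes>\<^bsub>JZ_ring\<^esub> H)"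
      by (rule evf_eqI) (simp only: evf_mult mult.assoc)
    show "F \<otimes>\<^bsub>JZ_ring\<^esub> G = G \<otimes>\<^bsub>JZ_ring\<^esub> F"
      by (rule evf_eqI) (simp only: evf_mult mult.commute)
    assume F: "F \<in> carrier JZ_ring"
    show "\<one>\<^bsub>JZ_ring\<^esub> \<otimes>\<^bsub>JZ_ring\<^esub> F = F"
    proof (rule evf_eqI)
      fix t z :: complex
      show "evf t z (\<one>\<^bsub>JZ_ring\<^esub> \<otimes>\<^bsub>JZ_ring\<^esub> F) = evf t z F"
      \<comment> \<open>Off the half-plane the unit evaluates to 0, and so does every element of the
        carrier.\<close>
      proof (cases "Im t > 0")
        case False
        then have "F m t z = 0" for m using F unfolding JZ_ring_simps(1) JZ_iff by simp
        then have "evf t z F = 0" by (intro fps_ext) simp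
        then show ?thesis unfolding evf_mult by simp
      qed (simp only: evf_mult evf_one mult_1)
    qed
  qed (rule JZ_ring_mult_closed)
  fix F G H
  show "(F \<oplus>\<^bsub>JZ_ring\<^esub> G) \<otimes>\<^bsub>JZ_ring\<^esub> H = F \<otimes>\<^bsub>JZ_ring\<^esub> H \<oplus>\<^bsub>JZ_ring\<^esub> G \<otimes>\<^bsub>JZ_ring\<^esub> H"
    by (rule evf_eqI) (simp only: evf_mult evf_add distrib_right)
qed

interpretation JZr: cring JZ_ring by (rule cring_JZ_ring)

lemma a_inv_JZ_ring: assumes "F \<in> carrier JZ_ring" shows "\<ominus>\<^bsub>JZ_ring\<^esub> F = (\<lambda>m t z. - F m t z)"
  by (rule JZr.minus_equality[OF _ assms JZ_ring_inverse[OF assms]]) simp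

abbreviation gens :: "(nat \<Rightarrow> jform) set" where
  "gens \<equiv> {homog 1 (cut f1), homog 2 (cut f2), homog 3 (cut f3), homog 4 (cut f4)}"

text \<open>Zero is reached as 1 - 1 by the closure rules.\<close>

lemma zero_generated: "(\<lambda>m t z. 0) \<in> generate_ring JZ_ring H"
proof -
  have "\<one>\<^bsub>JZ_ring\<^esub> \<oplus>\<^bsub>JZ_ring\<^esub> \<ominus>\<^bsub>JZ_ring\<^esub> \<one>\<^bsub>JZ_ring\<^esub> \<in> generate_ring JZ_ring H"
    by (intro generate_ring.eng_add generate_ring.a_inv generate_ring.one)
  then show ?thesis using JZr.r_neg[OF JZr.one_closed] by (simp only: JZ_ring_simps(4))
qed

lemma homog_generated: "gen m \<phi> \<Longrightarrow> homog m \<phi> \<in> generate_ring JZ_ring gens"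
proof (induction rule: gen.induct)
  case (zero m)
  have "homog m (\<lambda>t z. 0) = (\<lambda>m t z. 0)" by (intro ext) (simp add: homog_def)
  then show ?case by (simp only: zero_generated)
next
  case one
  then show ?case unfolding one_JZ_ring [symmetric] by (rule generate_ring.one)
next
  case (add m \<phi> \<psi>)
  have "homog m (\<lambda>t z. \<phi> t z + \<psi> t z) = homog m \<phi> \<oplus>\<^bsub>JZ_ring\<^esub> homog m \<psi>" by (intro ext) (simp add: homog_def)
  then show ?case using generate_ring.eng_add[OF add.IH] by (simp only:)
next
  case (minus m \<phi>)
  have "homog m (\<lambda>t z. - \<phi> t z) = \<ominus>\<^bsub>JZ_ring\<^esub> homog m \<phi>"
    unfolding a_inv_JZ_ring[OF homog_carrier[OF gen_JZ[OF minus.hyps]]] by (intro ext) (simp add: homog_def)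
  then show ?case using generate_ring.a_inv[OF minus.IH] by (simp only:)
next
  case (mult m \<phi> n \<psi>)
  have "homog (m + n) (\<lambda>t z. \<phi> t z * \<psi> t z) = homog m \<phi> \<otimes>\<^bsub>JZ_ring\<^esub> homog n \<psi>"
  proof (intro ext)
    fix k t z
    have "(\<Sum>i\<le>k. homog m \<phi> i t z * homog n \<psi> (k - i) t z) = (\<Sum>i\<le>k. if i = m then \<phi> t z * homog n \<psi> (k - m) t z else 0)"
      by (rule sum.cong) (auto simp: homog_def)
    then show "homog (m + n) (\<lambda>t z. \<phi> t z * \<psi> t z) k t z = (homog m \<phi> \<otimes>\<^bsub>JZ_ring\<^esub> homog n \<psi>) k t z"
      by (auto simp: homog_def)
  qed
  then show ?case using generate_ring.eng_mult[OF mult.IH] by (simp only:)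
qed (rule generate_ring.incl, simp)+

text \<open>An element is the finite sum of its homogeneous components, and \<open>JZ_gen\<close>
  places each of them in the subring.\<close>

lemma carrier_generated: "carrier JZ_ring = generate_ring JZ_ring gens"
proof
  have "gens \<subseteq> carrier JZ_ring"
    using gen_JZ[OF gen.f1] gen_JZ[OF gen.f2] gen_JZ[OF gen.f3] gen_JZ[OF gen.f4]
    by (auto simp only: insert_subset intro!: homog_carrier)
  then show "generate_ring JZ_ring gens \<subseteq> carrier JZ_ring" using JZr.generate_ring_in_carrier by blast
  show "carrier JZ_ring \<subseteq> generate_ring JZ_ring gens"
  proof
    fix F assume F: "F \<in> carrier JZ_ring"
    have "finite A \<Longrightarrow> (\<lambda>m. if m \<in> A then F m else (\<lambda>t z. 0)) \<in> generate_ring JZ_ring gens" for A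
    proof (induction A rule: finite_induct)
      case empty
      then show ?case using zero_generated by simp
    next
      case (insert a A)
      have e: "(\<lambda>m. if m \<in> insert a A then F m else (\<lambda>t z. 0)) = homog a (F a) \<oplus>\<^bsub>JZ_ring\<^esub> (\<lambda>m. if m \<in> A then F m else (\<lambda>t z. 0))"
        using insert.hyps(2) by (intro ext) (auto simp: homog_def)
      have "homog a (F a) \<in> generate_ring JZ_ring gens"
        using F by (intro homog_generated JZ_gen) simp
      then show ?case unfolding e by (intro generate_ring.eng_add insert.IH)
    qed
    from this[of "{m. F m \<noteq> (\<lambda>t z. 0)}"] F
    have "(\<lambda>m. if F m \<noteq> (\<lambda>t z. 0) then F m else (\<lambda>t z. 0)) \<in> generate_ring JZ_ring gens" by simp
    moreover have "(\<lambda>m. if F m \<noteq> (\<lambda>t z. 0) then F m else (\<lambda>t z. 0)) = F" by auto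
    ultimately show "F \<in> generate_ring JZ_ring gens" by (simp only:)
  qed
qed

subsection \<open>Algebraic independence\<close>

lemma evf_nat_pow: "Im t > 0 \<Longrightarrow> evf t z (F [^]\<^bsub>JZ_ring\<^esub> (n :: nat)) = evf t z F ^ n"
  by (induction n) (simp_all only: nat_pow_0 nat_pow_Suc evf_one evf_mult power_0 power_Suc2)

lemma evf_finsum: "finite A \<Longrightarrow> f \<in> A \<rightarrow> carrier JZ_ring \<Longrightarrow> evf t z (finsum JZ_ring f A) = (\<Sum>a\<in>A. evf t z (f a))"
proof (induction A rule: finite_induct)
  case (insert a A)
  then have "finsum JZ_ring f (insert a A) = f a \<oplus>\<^bsub>JZ_ring\<^esub> finsum JZ_ring f A" by (intro JZr.finsum_insert) auto
  then show ?case using insert by (simp only: evf_add sum.insert) auto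
qed (simp only: JZr.finsum_empty evf_zero sum.empty)

lemma evf_finprod: "finite A \<Longrightarrow> f \<in> A \<rightarrow> carrier JZ_ring \<Longrightarrow> Im t > 0 \<Longrightarrow> evf t z (finprod JZ_ring f A) = (\<Prod>a\<in>A. evf t z (f a))"
proof (induction A rule: finite_induct)
  case (insert a A)
  then have "finprod JZ_ring f (insert a A) = f a \<otimes>\<^bsub>JZ_ring\<^esub> finprod JZ_ring f A" by (intro JZr.finprod_insert) auto
  then show ?case using insert by (simp only: evf_mult prod.insert) auto
qed (simp only: JZr.finprod_empty evf_one prod.empty)

lemma evf_add_pow_nat: "evf t z ([(n :: nat)] \<cdot>\<^bsub>JZ_ring\<^esub> F) = of_nat n * evf t z F"
proof (induction n)
  case 0
  have "[(0::nat)] \<cdot>\<^bsub>JZ_ring\<^esub> F = \<zero>\<^bsub>JZ_ring\<^esub>" by (simp add: add_pow_def)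
  then show ?case by (simp only: evf_zero) simp
next
  case (Suc n)
  have "[Suc n] \<cdot>\<^bsub>JZ_ring\<^esub> F = [n] \<cdot>\<^bsub>JZ_ring\<^esub> F \<oplus>\<^bsub>JZ_ring\<^esub> F" by (simp add: add_pow_def)
  then show ?case by (simp only: evf_add Suc) (simp add: algebra_simps)
qed

lemma evf_add_pow: assumes "F \<in> carrier JZ_ring" shows "evf t z ([(n :: int)] \<cdot>\<^bsub>JZ_ring\<^esub> F) = of_int n * evf t z F"
proof (cases "n \<ge> 0")
  case True
  then show ?thesis unfolding add_pow_int_ge[OF True] evf_add_pow_nat by simp
next
  case False
  have c: "[nat (- n)] \<cdot>\<^bsub>JZ_ring\<^esub> F \<in> carrier JZ_ring" by (rule JZr.add.nat_pow_closed[OF assms])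
  have "evf t z (\<ominus>\<^bsub>JZ_ring\<^esub> G) = - evf t z G" if "G \<in> carrier JZ_ring" for G
    unfolding a_inv_JZ_ring[OF that] by (rule fps_ext) simp
  then show ?thesis using False add_pow_int_lt[of n JZ_ring F] c evf_add_pow_nat[of t z "nat (- n)" F] by simp
qed

text \<open>The formal variable records the index.\<close>

lemma evf_homog: "evf t z (homog m \<phi>) = fps_const (\<phi> t z) * fps_X ^ m"
  by (rule fps_ext) (simp add: homog_def fps_X_power_nth)

lemma qval_poly: "qval h c \<Longrightarrow> qval (\<lambda>t. poly r (h t)) (poly r c)"
  by (induction r) (simp_all add: qval_add qval_mult)

text \<open>At \<open>z = 1/2\<close> the form of index 3 vanishes, the form of index 2 is constant, and the form of
  index 1 tends to 8 at the cusp without taking the value 8.\<close>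

lemma generators_half:
  assumes t: "Im t > 0"
  shows "f3 t (1/2) = 0" "f2 t (1/2) = 2" "f1 t (1/2) \<noteq> 8"
proof -
  note n = th_half_nonzero[OF t]
  have "th t 1 = 0" using th_lattice_zero[OF t, of 0 1] by simp
  then have q2: "thq 2 t (1/2) = 0" using thq_mult[OF t, of 2 "1/2"] n by simp
  then show f3: "f3 t (1/2) = 0" by (simp add: f3_def)
  have "deriv (th t) 1 = - \<kappa>" using deriv_th_reflect[OF t, of 1] deriv_th_0[OF t] by simp
  then have "th t (1/2) * deriv (thq 2 t) (1/2) = - 2 * \<kappa>"
    using deriv_thq_2[OF t, of "1/2"] q2 by (simp add: mult.commute)
  then show f2: "f2 t (1/2) = 2" unfolding f2_def rc_def q2 by simp
  have "th t (3/2) = - th t (1/2)" using th_shift[OF t, of "1/2" 0 1] by simp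
  then have f4: "f4 t (1/2) = -1" using thq_mult[OF t, of 3 "1/2"] n by (simp add: f4_def nonzero_eq_divide_eq [symmetric])
  \<comment> \<open>P at z = 1/2 with \<open>f2\<close> = 2, \<open>f3\<close> = 0 and
    \<open>f4\<close> = -1 inserted; it does not vanish because Delta and T do not.\<close>
  have "- (f1 t (1/2) ^ 2) + 64 = - del t * th t (1/2) ^ 12"
    using pp_eq[OF t, of "1/2"] unfolding pp_def f2 f3 f4 by simp
  moreover have "del t * th t (1/2) ^ 12 \<noteq> 0" using del_nonzero[OF t] n by simp
  ultimately show "f1 t (1/2) \<noteq> 8" by auto
qed

text \<open>Remove the full power of x - 8 from q. As \<open>f1\<close> never equals 8 at z = 1/2,
  the cofactor vanishes on all its values; at the cusp these tend to 8, so the cofactor would vanish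
  at 8 as well.\<close>

lemma f1_half_transcendental:
  assumes "\<And>t. Im t > 0 \<Longrightarrow> poly q (f1 t (1/2)) = 0" shows "q = 0"
proof (rule ccontr)
  assume "q \<noteq> 0"
  then obtain r where r: "q = [:- 8, 1:] ^ Polynomial.order 8 q * r" "\<not> [:- 8, 1:] dvd r" using order_decomp by blast
  have "qval (\<lambda>t. f1 t (1/2)) (12 + sy (1/2) ^ 2)"
    by (rule qval_at[OF FE_f1]) (use JF_f1 in \<open>simp add: JF_def EF_def\<close>)
  moreover have "12 + sy (1/2) ^ 2 = 8"
    using e2pi_half e2pi_minus[of "1/2"] by (simp add: sy_sq)
  ultimately have "qval (\<lambda>t. poly r (f1 t (1/2))) (poly r 8)" using qval_poly by metis
  moreover have "qval (\<lambda>t. poly r (f1 t (1/2))) 0"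
  proof (subst qval_cong[of _ "\<lambda>t. 0" _ 0])
    fix t :: complex assume t: "Im t > 0"
    then show "poly r (f1 t (1/2)) = 0"
      using assms[OF t] generators_half(3)[OF t] by (subst (asm) r(1)) simp
  qed simp_all
  ultimately have "poly r 8 = 0" by (rule qval_unique)
  then show False using r(2) poly_eq_0_iff_dvd by blast
qed

lemma f_holomorphic: "Im t > 0 \<Longrightarrow> f1 t is_entire" "Im t > 0 \<Longrightarrow> f2 t is_entire" "Im t > 0 \<Longrightarrow> f3 t is_entire"
  using JF_f1 JF_f2 JF_f3 jfam_hol unfolding JF_def EF_def by blast+

text \<open>Induct on the exponent of \<open>f3\<close>: divide by its least remaining power and put
  z = 1/2, where \<open>f3\<close> vanishes and \<open>f2\<close> is 2. With the index and the
  exponent of \<open>f3\<close> fixed, distinct monomials have distinct powers of \<open>f1\<close>,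
  so what remains is a polynomial relation for \<open>f1\<close> alone.\<close>

lemma homogeneous_relation_zero:
  fixes C :: "'k \<Rightarrow> complex" and a b c :: "'k \<Rightarrow> nat"
  assumes K: "finite K" and wt: "\<And>x. x \<in> K \<Longrightarrow> a x + 2 * b x + 3 * c x = m"
    and inj: "\<And>x y. x \<in> K \<Longrightarrow> y \<in> K \<Longrightarrow> a x = a y \<Longrightarrow> b x = b y \<Longrightarrow> c x = c y \<Longrightarrow> x = y"
    and rel: "\<And>t z. Im t > 0 \<Longrightarrow> (\<Sum>x\<in>K. C x * (f1 t z ^ a x * f2 t z ^ b x * f3 t z ^ c x)) = 0"
    and x: "x \<in> K"
  shows "C x = 0"
proof -
  have "\<forall>x\<in>K. c x < M \<longrightarrow> C x = 0" for M
  proof (induction M)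
    case (Suc M)
    let ?L = "{x \<in> K. c x \<ge> M}" and ?E = "{x \<in> K. c x = M}"
    let ?h = "\<lambda>t z. \<Sum>x\<in>?L. C x * (f1 t z ^ a x * f2 t z ^ b x * f3 t z ^ (c x - M))"
    have h: "?h t z = 0" if t: "Im t > 0" for t z
    proof (rule entire_cancel[where A = "?h t" and B = "\<lambda>z. 0" and h = "\<lambda>z. f3 t z ^ M" and w = 0])
      show "?h t is_entire" "(\<lambda>z. f3 t z ^ M) is_entire" by (intro holomorphic_intros f_holomorphic t)+
      show "f3 t 0 ^ M \<noteq> 0" using JF_weight_0_at_0[OF JF_f3 t] by simp
      fix z
      have "?h t z * f3 t z ^ M = (\<Sum>x\<in>?L. C x * (f1 t z ^ a x * f2 t z ^ b x * f3 t z ^ c x))"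
        unfolding sum_distrib_right by (rule sum.cong) (auto simp: mult.assoc power_add [symmetric])
      also have "\<dots> = (\<Sum>x\<in>K. C x * (f1 t z ^ a x * f2 t z ^ b x * f3 t z ^ c x))"
      proof (rule sum.mono_neutral_left[OF K], blast, intro ballI)
        fix x assume "x \<in> K - ?L"
        then have "C x = 0" using Suc.IH by (simp add: not_le)
        then show "C x * (f1 t z ^ a x * f2 t z ^ b x * f3 t z ^ c x) = 0" by simp
      qed
      finally show "?h t z * f3 t z ^ M = 0 * f3 t z ^ M" using rel[OF t] by simp
    qed simp
    define q where "q = (\<Sum>x\<in>?E. Polynomial.monom (C x * 2 ^ b x) (a x))"
    have "poly q (f1 t (1/2)) = 0" if t: "Im t > 0" for t
    proof -
      have "?h t (1/2) = (\<Sum>x\<in>?E. C x * 2 ^ b x * f1 t (1/2) ^ a x)"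
        unfolding generators_half[OF t]
      proof (rule sum.mono_neutral_cong_right)
        show "\<forall>x\<in>?L - ?E. C x * (f1 t (1/2) ^ a x * 2 ^ b x * 0 ^ (c x - M)) = 0"
        proof
          fix x assume "x \<in> ?L - ?E"
          then have "c x - M > 0" by auto
          then show "C x * (f1 t (1/2) ^ a x * 2 ^ b x * 0 ^ (c x - M)) = 0" by (simp only: zero_power mult_zero_right)
        qed
        fix x assume "x \<in> ?E"
        then have "c x - M = 0" by simp
        then show "C x * (f1 t (1/2) ^ a x * 2 ^ b x * 0 ^ (c x - M)) = C x * 2 ^ b x * f1 t (1/2) ^ a x"
          by (simp only: power_0 mult_1_right) (simp only: mult_ac)
      qed (use K in auto)
      then show ?thesis using h[OF t, of "1/2"] by (simp add: q_def poly_sum poly_monom)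
    qed
    then have "q = 0" by (rule f1_half_transcendental)
    have "C x = 0" if "x \<in> ?E" for x
    proof -
      have "poly.coeff q (a x) = (\<Sum>y\<in>?E. if y = x then C x * 2 ^ b x else 0)"
        unfolding q_def coeff_sum
      proof (rule sum.cong)
        fix y assume y: "y \<in> ?E"
        have "y = x" if "a y = a x"
          by (rule inj) (use y \<open>x \<in> ?E\<close> that wt[of x] wt[of y] in auto)
        then show "poly.coeff (Polynomial.monom (C y * 2 ^ b y) (a y)) (a x) = (if y = x then C x * 2 ^ b x else 0)"
          by (auto simp: coeff_monom)
      qed simp
      then show ?thesis using \<open>q = 0\<close> that K by simp
    qed
    then show ?case using Suc.IH by (auto simp: less_Suc_eq)
  qed simp
  then show ?thesis using x by blast
qed

text \<open>Comparing coefficients of the formal variable in the evaluation splits a relation into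
  homogeneous ones of fixed index.\<close>

lemma alg_independent_generators: "alg_independent JZ_ring [homog 1 (cut f1), homog 2 (cut f2), homog 3 (cut f3)]"
  unfolding alg_independent_def
proof (intro allI impI)
  let ?xs = "[homog 1 (cut f1), homog 2 (cut f2), homog 3 (cut f3)]"
  fix p :: "(nat \<Rightarrow>\<^sub>0 nat) \<Rightarrow>\<^sub>0 int"
  assume p: "(\<forall>s\<in>Poly_Mapping.keys p. Poly_Mapping.keys s \<subseteq> {..<length ?xs}) \<and> eval_mpoly JZ_ring ?xs p = \<zero>\<^bsub>JZ_ring\<^esub>"
  let ?l = "Poly_Mapping.lookup :: (nat \<Rightarrow>\<^sub>0 nat) \<Rightarrow> nat \<Rightarrow> nat"
  let ?wt = "\<lambda>s. ?l s 0 + 2 * ?l s 1 + 3 * ?l s 2"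
  have xs: "?xs ! i \<in> carrier JZ_ring" if "i < 3" for i
  proof -
    have "i = 0 \<or> i = 1 \<or> i = 2" using that by arith
    then show ?thesis
      using homog_carrier[OF gen_JZ[OF gen.f1]] homog_carrier[OF gen_JZ[OF gen.f2]] homog_carrier[OF gen_JZ[OF gen.f3]]
      by (elim disjE) (simp_all del: JZ_ring_simps(1))
  qed
  have pc: "(\<lambda>i. (?xs ! i) [^]\<^bsub>JZ_ring\<^esub> ?l s i) \<in> {..<3} \<rightarrow> carrier JZ_ring" for s
    by (intro Pi_I JZr.nat_pow_closed xs) simp
  have fc: "finprod JZ_ring (\<lambda>i. (?xs ! i) [^]\<^bsub>JZ_ring\<^esub> ?l s i) {..<3} \<in> carrier JZ_ring" for s
    by (rule JZr.finprod_closed[OF pc])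
  have sum0: "(\<Sum>s\<in>{s \<in> Poly_Mapping.keys p. ?wt s = m}. of_int (Poly_Mapping.lookup p s) * (f1 t z ^ ?l s 0 * f2 t z ^ ?l s 1 * f3 t z ^ ?l s 2)) = 0"
    if t: "Im t > 0" for t z m
  proof -
    let ?v = "\<lambda>s. f1 t z ^ ?l s 0 * f2 t z ^ ?l s 1 * f3 t z ^ ?l s 2"
    have e: "evf t z (finprod JZ_ring (\<lambda>i. (?xs ! i) [^]\<^bsub>JZ_ring\<^esub> ?l s i) {..<3}) = fps_const (?v s) * fps_X ^ ?wt s" for s
    proof -
      have "evf t z (finprod JZ_ring (\<lambda>i. (?xs ! i) [^]\<^bsub>JZ_ring\<^esub> ?l s i) {..<3}) = (\<Prod>i<3. evf t z (?xs ! i) ^ ?l s i)"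
        unfolding evf_finprod[OF finite_lessThan pc t] evf_nat_pow[OF t] ..
      also have "\<dots> = evf t z (?xs ! 0) ^ ?l s 0 * evf t z (?xs ! 1) ^ ?l s 1 * evf t z (?xs ! 2) ^ ?l s 2"
        by (simp add: numeral_3_eq_3 numeral_2_eq_2)
      also have "\<dots> = fps_const (?v s) * fps_X ^ ?wt s"
        using t by (simp add: evf_homog cut_def power_mult_distrib fps_const_power power_mult [symmetric] power_add
          fps_const_mult [symmetric] mult_ac del: fps_const_mult)
      finally show ?thesis .
    qed
    have "evf t z (eval_mpoly JZ_ring ?xs p) = (\<Sum>s\<in>Poly_Mapping.keys p. of_int (Poly_Mapping.lookup p s) * (fps_const (?v s) * fps_X ^ ?wt s))"
    proof -
      have len: "length ?xs = 3" by simp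
      have "(\<lambda>s. [Poly_Mapping.lookup p s] \<cdot>\<^bsub>JZ_ring\<^esub> finprod JZ_ring (\<lambda>i. (?xs ! i) [^]\<^bsub>JZ_ring\<^esub> ?l s i) {..<3}) \<in> Poly_Mapping.keys p \<rightarrow> carrier JZ_ring"
        using JZr.add.int_pow_closed[OF fc] by blast
      from evf_finsum[OF finite_keys this, of t z] show ?thesis
        unfolding eval_mpoly_def len evf_add_pow[OF fc] e .
    qed
    then have "(\<Sum>s\<in>Poly_Mapping.keys p. of_int (Poly_Mapping.lookup p s) * (fps_const (?v s) * fps_X ^ ?wt s)) = 0"
      using p evf_zero by metis
    from arg_cong[OF this, of "\<lambda>f. fps_nth f m"]
    have "(\<Sum>s\<in>Poly_Mapping.keys p. if ?wt s = m then of_int (Poly_Mapping.lookup p s) * ?v s else 0) = 0"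
      by (simp add: eq_commute[of m] fps_sum_nth fps_of_int [symmetric] mult.assoc [symmetric] fps_X_power_nth if_distrib del: fps_of_int cong: if_cong)
    then show ?thesis by (subst sum.inter_filter) simp_all
  qed
  show "p = 0"
  proof (rule poly_mapping_eqI)
    fix s
    show "Poly_Mapping.lookup p s = Poly_Mapping.lookup 0 s"
    proof (cases "s \<in> Poly_Mapping.keys p")
      case True
      have "(of_int (Poly_Mapping.lookup p s) :: complex) = 0"
      proof (rule homogeneous_relation_zero[where K = "{s' \<in> Poly_Mapping.keys p. ?wt s' = ?wt s}" and m = "?wt s"
            and a = "\<lambda>s. ?l s 0" and b = "\<lambda>s. ?l s 1" and c = "\<lambda>s. ?l s 2" and C = "\<lambda>s. of_int (Poly_Mapping.lookup p s)"])
        fix x y assume xy: "x \<in> {s' \<in> Poly_Mapping.keys p. ?wt s' = ?wt s}" "y \<in> {s' \<in> Poly_Mapping.keys p. ?wt s' = ?wt s}"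
          and e: "?l x 0 = ?l y 0" "?l x 1 = ?l y 1" "?l x 2 = ?l y 2"
        show "x = y"
        proof (rule poly_mapping_eqI)
          fix i :: nat
          have "\<forall>s\<in>Poly_Mapping.keys p. Poly_Mapping.keys s \<subseteq> {..<3}" using conjunct1[OF p] by (simp add: numeral_3_eq_3)
          then have k: "Poly_Mapping.keys x \<subseteq> {..<3}" "Poly_Mapping.keys y \<subseteq> {..<3}" using xy by blast+
          consider "i = 0" | "i = 1" | "i = 2" | "i \<ge> 3" by linarith
          then show "?l x i = ?l y i"
          proof cases
            case 4
            then have "i \<notin> Poly_Mapping.keys x" "i \<notin> Poly_Mapping.keys y" using k by auto
            then show ?thesis by (simp add: in_keys_iff)
          qed (simp_all only: e)
        qed
      next
        show "s \<in> {s' \<in> Poly_Mapping.keys p. ?wt s' = ?wt s}" using True by blast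
      qed (rule finite_Collect_conjI, simp, blast, rule sum0)
      then show ?thesis by simp
    qed (simp add: in_keys_iff)
  qed
qed

theorem theorem1p9:
  shows
    "(\<forall>m::nat. m > 0 \<longrightarrow>
        JZ_group m Mod JZq m \<cong> free_Abelian_group {1..m} \<and>
        (\<exists>\<psi> :: nat \<Rightarrow> jform.
           (\<forall>n \<in> {1..m}. \<psi> n \<in> JZ m) \<and>
           is_Z_basis (JZ_group m Mod JZq m) {1..m} (\<lambda>n. JZq m #>\<^bsub>JZ_group m\<^esub> \<psi> n) \<and>
           (\<forall>n. 3 \<le> n \<and> n \<le> m \<longrightarrow>
              (\<exists>P :: laurent_poly. has_q0_term (\<psi> n) P \<and>
                 (\<forall>l. Poly_Mapping.lookup P (- l) = Poly_Mapping.lookup P l) \<and>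
                 Poly_Mapping.lookup P (int n) = 1 \<and>
                 (\<forall>l > int n. Poly_Mapping.lookup P l = 0))) \<and>
           (2 \<le> m \<longrightarrow> has_q0_term (\<psi> 2)
              (Poly_Mapping.single 2 1 + Poly_Mapping.single 1 (-4) + Poly_Mapping.single 0 6
               + Poly_Mapping.single (-1) (-4) + Poly_Mapping.single (-2) 1)) \<and>
           has_q0_term (\<psi> 1)
             (Poly_Mapping.single 1 (of_nat m / of_nat (gcd 12 m))
              + Poly_Mapping.single 0 ((12 - 2 * of_nat m) / of_nat (gcd 12 m))
              + Poly_Mapping.single (-1) (of_nat m / of_nat (gcd 12 m)))))
     \<and> cring JZ_ring
     \<and> carrier JZ_ring =
         generate_ring JZ_ring {homog 1 phi01, homog 2 phi02, homog 3 phi03, homog 4 phi04}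
     \<and> alg_independent JZ_ring [homog 1 phi01, homog 2 phi02, homog 3 phi03]
     \<and> (\<forall>\<tau> z. 4 * phi04 \<tau> z = phi01 \<tau> z * phi03 \<tau> z - (phi02 \<tau> z)\<^sup>2)"
proof (intro conjI, intro allI impI, goal_cases)
  case (1 m)
  \<comment> \<open>The rows \<open>bpoly m i\<close> give both the basis property and the required
    q^0-terms: u^n for n >= 2 and the primitive linear row for n = 1.\<close>
  have "\<forall>i\<in>{1..m}. \<exists>\<phi>. gen m \<phi> \<and> JF 0 m \<phi> (\<lambda>z. poly (bpoly m i) (sy z ^ 2))"
    using has_bpoly unfolding has_def by blast
  then obtain \<psi> where "\<forall>i\<in>{1..m}. gen m (\<psi> i) \<and> JF 0 m (\<psi> i) (\<lambda>z. poly (bpoly m i) (sy z ^ 2))" by (metis (no_types))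
  then interpret index_basis m \<psi> by unfold_locales (use 1 in auto)
  have "\<exists>P :: laurent_poly. has_q0_term (\<psi> n) P \<and> (\<forall>l. Poly_Mapping.lookup P (- l) = Poly_Mapping.lookup P l) \<and>
      Poly_Mapping.lookup P (int n) = 1 \<and> (\<forall>l > int n. Poly_Mapping.lookup P l = 0)" if n: "3 \<le> n \<and> n \<le> m" for n
  proof -
    define P :: laurent_poly where "P = (\<Sum>l\<in>{- int n..int n}. Poly_Mapping.single l (of_int (uc n l)))"
    have P: "Poly_Mapping.lookup P l = of_int (uc n l)" for l
      by (auto simp: P_def lookup_sum lookup_single when_def uc_def)
    show ?thesis
      by (intro exI[of _ P] conjI psi_q0_monom) (use n P in \<open>auto simp: uc_minus\<close>, simp add: uc_def)
  qed
  moreover have "has_q0_term (\<psi> 2) (Poly_Mapping.single 2 1 + Poly_Mapping.single 1 (-4) + Poly_Mapping.single 0 6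
           + Poly_Mapping.single (-1) (-4) + Poly_Mapping.single (-2) 1)" if "2 \<le> m"
  proof (rule psi_q0_monom)
    fix l :: int
    have u: "uc 2 (-2) = 1" "uc 2 (-1) = -4" "uc 2 0 = 6" "uc 2 1 = -4" "uc 2 2 = 1"
      by (simp_all add: uc_def numeral_eq_Suc)
    consider "l = -2" | "l = -1" | "l = 0" | "l = 1" | "l = 2" | "\<bar>l\<bar> > 2" by linarith
    then show "Poly_Mapping.lookup (Poly_Mapping.single 2 (1 :: complex) + Poly_Mapping.single 1 (-4) + Poly_Mapping.single 0 6
           + Poly_Mapping.single (-1) (-4) + Poly_Mapping.single (-2) 1) l = of_int (uc 2 l)"
      by cases (auto simp: lookup_add lookup_single lookup_numeral when_def u uc_def[of 2 l])
  qed (use that in simp)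
  ultimately show ?case
    using quotient_free psi_JZ is_Z_basis_psi psi_q0_1 by blast
next
  case 2
  show ?case by (rule cring_JZ_ring)
next
  case 3
  show ?case unfolding phi01_eq phi02_eq phi03_eq phi04_eq by (rule carrier_generated)
next
  case 4
  show ?case unfolding phi01_eq phi02_eq phi03_eq by (rule alg_independent_generators)
next
  case 5
  show ?case unfolding phi01_eq phi02_eq phi03_eq phi04_eq using relation by (simp add: cut_def)
qed

end
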